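(* Let $\Omega$ be a smooth bounded domain of $\mathbb R^2$. There exists $\eta>0$ such that for every $T>0$ and every $u_0\in L^2(\Omega;\mathbb R)$ with $u_0\ge0$ and $\|u_0\|_{L^1(\Omega)}\le\eta$, the following problem admits at least one solution: find $u\in C^0([0,T];L^2(\Omega))\cap L^2(0,T;H^1(\Omega))$ with $\frac{du}{dt}\in L^2(0,T;(H^1(\Omega))')$ such that $u(0)=u_0$ and for every $w\in L^2(0,T;H^1(\Omega))$, \[ \int_0^T\Big\langle\frac{du}{d\tau}(\tau),w(\tau)\Big\rangle d\tau+\int_{(0,T)\times\Omega}(\nabla u+u\nabla\mathcal V)\cdot\nabla w\,dx\,d\tau=0, \] where $\mathcal V(t)=\Delta_D^{-1}u(t)$ for a.e. $t$.
   Context: $\langle\cdot,\cdot\rangle$ denotes the duality between $(H^1(\Omega))'$ and $H^1(\Omega)$. For $f\in L^2(\Omega)$, $\Delta_D^{-1}f$ denotes the solution $\mathcal V$ of the Poisson–Dirichlet problem $\Delta\mathcal V=f$ in $\Omega$, $\mathcal V=0$ on $\partial\Omega$. *)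

theory Defs
  imports "HOL-Analysis.Analysis"
begin

definition pd :: "2 \<Rightarrow> (real^2 \<Rightarrow> real) \<Rightarrow> real^2 \<Rightarrow> real" where
  "pd i f = (\<lambda>x. frechet_derivative f (at x) (axis i 1))"

definition grad :: "(real^2 \<Rightarrow> real) \<Rightarrow> real^2 \<Rightarrow> real^2" where
  "grad f = (\<lambda>x. \<chi> i. pd i f x)"

definition smooth_R2 :: "(real^2 \<Rightarrow> real) \<Rightarrow> bool" where
  "smooth_R2 f \<longleftrightarrow> (\<forall>ds::2 list. \<forall>x. (foldr pd ds f) differentiable (at x))"

definition smooth_R :: "(real \<Rightarrow> real) \<Rightarrow> bool" where
  "smooth_R f \<longleftrightarrow> (\<forall>n x. ((deriv ^^ n) f) differentiable (at x))"

definition test_fun :: "(real^2) set \<Rightarrow> (real^2 \<Rightarrow> real) \<Rightarrow> bool" where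
  "test_fun \<Omega> \<phi> \<longleftrightarrow> smooth_R2 \<phi> \<and> compact (closure {x. \<phi> x \<noteq> 0})
     \<and> closure {x. \<phi> x \<noteq> 0} \<subseteq> \<Omega>"

definition test_fun_R :: "real set \<Rightarrow> (real \<Rightarrow> real) \<Rightarrow> bool" where
  "test_fun_R I \<phi> \<longleftrightarrow> smooth_R \<phi> \<and> compact (closure {t. \<phi> t \<noteq> 0})
     \<and> closure {t. \<phi> t \<noteq> 0} \<subseteq> I"

definition smooth_bounded_domain :: "(real^2) set \<Rightarrow> bool" where
  "smooth_bounded_domain \<Omega> \<longleftrightarrow> open \<Omega> \<and> connected \<Omega> \<and> bounded \<Omega> \<and> \<Omega> \<noteq> {} \<and>
     (\<exists>\<rho>. smooth_R2 \<rho> \<and> \<Omega> = {x. \<rho> x < 0} \<and>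
        (\<forall>x\<in>frontier \<Omega>. \<rho> x = 0 \<and> grad \<rho> x \<noteq> 0))"

definition L2 :: "(real^2) set \<Rightarrow> (real^2 \<Rightarrow> real) \<Rightarrow> bool" where
  "L2 \<Omega> f \<longleftrightarrow> f \<in> borel_measurable (lebesgue_on \<Omega>) \<and> integrable (lebesgue_on \<Omega>) (\<lambda>x. (f x)^2)"

definition weak_grad :: "(real^2) set \<Rightarrow> (real^2 \<Rightarrow> real) \<Rightarrow> (real^2 \<Rightarrow> real^2) \<Rightarrow> bool" where
  "weak_grad \<Omega> f g \<longleftrightarrow> (\<forall>i \<phi>. test_fun \<Omega> \<phi> \<longrightarrow>
      (\<integral>x. f x * pd i \<phi> x \<partial>lebesgue_on \<Omega>) = - (\<integral>x. g x $ i * \<phi> x \<partial>lebesgue_on \<Omega>))"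

definition H1_grad :: "(real^2) set \<Rightarrow> (real^2 \<Rightarrow> real) \<Rightarrow> (real^2 \<Rightarrow> real^2) \<Rightarrow> bool" where
  "H1_grad \<Omega> f g \<longleftrightarrow> L2 \<Omega> f \<and> (\<forall>i. L2 \<Omega> (\<lambda>x. g x $ i)) \<and> weak_grad \<Omega> f g"

definition H1 :: "(real^2) set \<Rightarrow> (real^2 \<Rightarrow> real) \<Rightarrow> bool" where
  "H1 \<Omega> f \<longleftrightarrow> (\<exists>g. H1_grad \<Omega> f g)"

definition H1norm :: "(real^2) set \<Rightarrow> (real^2 \<Rightarrow> real) \<Rightarrow> real" where
  "H1norm \<Omega> f = sqrt ((\<integral>x. (f x)^2 \<partial>lebesgue_on \<Omega>)
      + (\<integral>x. (norm ((SOME g. H1_grad \<Omega> f g) x))^2 \<partial>lebesgue_on \<Omega>))"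

definition H10 :: "(real^2) set \<Rightarrow> (real^2 \<Rightarrow> real) \<Rightarrow> bool" where
  "H10 \<Omega> f \<longleftrightarrow> (\<exists>g. H1_grad \<Omega> f g \<and> (\<exists>\<phi>s. (\<forall>n. test_fun \<Omega> (\<phi>s n)) \<and>
      ((\<lambda>n. (\<integral>x. (\<phi>s n x - f x)^2 + (norm (grad (\<phi>s n) x - g x))^2 \<partial>lebesgue_on \<Omega>))
        \<longlonglongrightarrow> 0)))"

definition dirichlet_inv :: "(real^2) set \<Rightarrow> (real^2 \<Rightarrow> real) \<Rightarrow> (real^2 \<Rightarrow> real)
    \<Rightarrow> (real^2 \<Rightarrow> real^2) \<Rightarrow> bool" where
  "dirichlet_inv \<Omega> f V GV \<longleftrightarrow> H1_grad \<Omega> V GV \<and> H10 \<Omega> V \<and>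
     (\<forall>\<phi>. test_fun \<Omega> \<phi> \<longrightarrow>
        - (\<integral>x. GV x \<bullet> grad \<phi> x \<partial>lebesgue_on \<Omega>) = (\<integral>x. f x * \<phi> x \<partial>lebesgue_on \<Omega>))"

definition H1_dual :: "(real^2) set \<Rightarrow> ((real^2 \<Rightarrow> real) \<Rightarrow> real) \<Rightarrow> bool" where
  "H1_dual \<Omega> L \<longleftrightarrow>
     (\<forall>v w a b. H1 \<Omega> v \<and> H1 \<Omega> w \<longrightarrow> L (\<lambda>x. a * v x + b * w x) = a * L v + b * L w) \<and>
     (\<exists>C. \<forall>v. H1 \<Omega> v \<longrightarrow> \<bar>L v\<bar> \<le> C * H1norm \<Omega> v)"

definition dual_norm :: "(real^2) set \<Rightarrow> ((real^2 \<Rightarrow> real) \<Rightarrow> real) \<Rightarrow> real" where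
  "dual_norm \<Omega> L = Sup {\<bar>L v\<bar> | v. H1 \<Omega> v \<and> H1norm \<Omega> v \<le> 1}"

abbreviation spacetime :: "real \<Rightarrow> (real^2) set \<Rightarrow> (real \<times> (real^2)) measure" where
  "spacetime T \<Omega> \<equiv> lebesgue_on {0<..<T} \<Otimes>\<^sub>M lebesgue_on \<Omega>"

definition L2H1 :: "(real^2) set \<Rightarrow> real \<Rightarrow> (real \<Rightarrow> real^2 \<Rightarrow> real)
    \<Rightarrow> (real \<Rightarrow> real^2 \<Rightarrow> real^2) \<Rightarrow> bool" where
  "L2H1 \<Omega> T w Gw \<longleftrightarrow>
     (\<lambda>(t,x). w t x) \<in> borel_measurable (spacetime T \<Omega>) \<and>
     (\<lambda>(t,x). Gw t x) \<in> borel_measurable (spacetime T \<Omega>) \<and>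
     integrable (spacetime T \<Omega>) (\<lambda>(t,x). (w t x)^2) \<and>
     integrable (spacetime T \<Omega>) (\<lambda>(t,x). (norm (Gw t x))^2) \<and>
     (AE t in lebesgue_on {0<..<T}. H1_grad \<Omega> (w t) (Gw t))"

definition C0L2 :: "(real^2) set \<Rightarrow> real \<Rightarrow> (real \<Rightarrow> real^2 \<Rightarrow> real) \<Rightarrow> bool" where
  "C0L2 \<Omega> T U \<longleftrightarrow> (\<forall>t\<in>{0..T}. L2 \<Omega> (U t)) \<and>
     (\<forall>t\<in>{0..T}. ((\<lambda>s. \<integral>x. (U s x - U t x)^2 \<partial>lebesgue_on \<Omega>) \<longlongrightarrow> 0) (at t within {0..T}))"

definition L2dual :: "(real^2) set \<Rightarrow> real \<Rightarrow> (real \<Rightarrow> (real^2 \<Rightarrow> real) \<Rightarrow> real) \<Rightarrow> bool" where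
  "L2dual \<Omega> T \<xi> \<longleftrightarrow> (AE t in lebesgue_on {0<..<T}. H1_dual \<Omega> (\<xi> t)) \<and>
     (\<forall>v. H1 \<Omega> v \<longrightarrow> (\<lambda>t. \<xi> t v) \<in> borel_measurable (lebesgue_on {0<..<T})) \<and>
     (\<integral>\<^sup>+t. ennreal ((dual_norm \<Omega> (\<xi> t))^2) \<partial>lebesgue_on {0<..<T}) < \<infinity>"

text \<open>xi is the distributional time derivative du/dt (values in (H1)', Gelfand triple via the L2 pairing).\<close>
definition weak_time_deriv :: "(real^2) set \<Rightarrow> real \<Rightarrow> (real \<Rightarrow> real^2 \<Rightarrow> real)
    \<Rightarrow> (real \<Rightarrow> (real^2 \<Rightarrow> real) \<Rightarrow> real) \<Rightarrow> bool" where
  "weak_time_deriv \<Omega> T u \<xi> \<longleftrightarrow> (\<forall>\<phi> v. test_fun_R {0<..<T} \<phi> \<and> H1 \<Omega> v \<longrightarrow>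
     (\<integral>t. deriv \<phi> t * (\<integral>x. u t x * v x \<partial>lebesgue_on \<Omega>) \<partial>lebesgue_on {0<..<T})
       = - (\<integral>t. \<phi> t * \<xi> t v \<partial>lebesgue_on {0<..<T}))"

end

(* The solution is a limit of an implicit Euler scheme with the potential frozen at the previous
   time step. The substitution u = exp(-V) z symmetrises each step, so that the truncated problem is
   solved by Lax-Milgram and nonnegativity follows by testing with the negative part. Testing with 1
   gives conservation of mass. In the energy estimate the drift contributes a cubic term, which the
   inequality int u^3 <= C |u|_1 |u|_H1^2 absorbs when the mass is small, and a boundary term, which
   has a sign because V <= 0 inside and V = 0 on the boundary. The resulting bounds yield weak limits
   at each time; compactness of the inverse Dirichlet Laplacian makes grad V converge strongly, which
   is enough to pass to the limit in the nonlinear term. Mazur combinations transfer the energy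
   inequality to differences of the limit, whence continuity in L^2. *)
theory Submission
  imports Defs "HOL-Library.Diagonal_Subsequence"
begin

text \<open>The flux u grad V must be square integrable in space and time, although grad V itself is
  only known to be in L^2. Testing the Poisson equation with V u^2 controls it by the sup norm of V,
  the cubic integral and grad u; the sup norm comes from Stampacchia's level set iteration. The
  boundary term of the energy estimate would call for the normal derivative of V; traces are avoided
  by testing with (1 - exp (n V)) u^2 and letting n grow. The constant C of the cubic inequality
  depends on the domain alone and \<eta> = 1 / (2 C), which is why \<eta> precedes T. Regularity of
  the boundary enters through that inequality: near each boundary point two transversal directions
  point into the domain, and Gagliardo's argument runs along segments in these directions. No
  compactness in time is invoked: the equation turns weak convergence of the flux into weak
  convergence of u at every time. Sobolev functions are carried as pairs of a function and a weak
  gradient, so that Riesz and Mazur apply in L^2 spaces of tuples.\<close>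

lemmas bi_cong = Bochner_Integration.integral_cong and bi_i_bound = Bochner_Integration.integrable_bound
	and bi_add = Bochner_Integration.integral_add and bi_nonneg = Bochner_Integration.integral_nonneg
	and bi_i_add = Bochner_Integration.integrable_add and bi_i_diff = Bochner_Integration.integrable_diff
	and bi_diff = Bochner_Integration.integral_diff and bi_i_cong = Bochner_Integration.integrable_cong
	and bi_sum = Bochner_Integration.integral_sum

notation scaleR (infixr "*R" 75)
abbreviation bm where "bm \<equiv> borel_measurable"
abbreviation nni where "nni \<equiv> nn_integral"
abbreviation lims ("(_/ ----> _)" [60, 60] 60) where "X ----> l \<equiv> X \<longlonglongrightarrow> l"

section \<open>Square integrable functions with values in a Euclidean space\<close>

definition sqi :: "'a measure => ('a => 'b::euclidean_space) => bool" where
	"sqi M f \<longleftrightarrow> f : bm M & integrable M (%x. (norm (f x))^2)"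

text \<open>Defined on functions rather than on classes, so \<open>ip M f f = 0\<close> only yields
  f = 0 almost everywhere. The Euclidean codomain lets one theory serve scalars, gradients and
  tuples of both.\<close>

definition ip :: "'a measure => ('a => 'b::euclidean_space) => ('a => 'b) => real" where
	"ip M f g = (LINT x|M. f x \<bullet> g x)"

definition n2 :: "'a measure => ('a => 'b::euclidean_space) => real" where
	"n2 M f = sqrt (ip M f f)"

lemma sqi_m [measurable_dest]: "sqi M f ==> f : bm M"
	by (simp add: sqi_def)

lemma sqi_integrable: "sqi M f ==> integrable M (%x. (norm (f x))^2)"
	by (simp add: sqi_def)

lemma integrable_ip:
	assumes [measurable]: "sqi M f" "sqi M g"
	shows "integrable M (%x. f x \<bullet> g x)"
proof (rule bi_i_bound)
	show "integrable M (%x. (norm (f x))^2 + (norm (g x))^2)"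
		using assms by (intro bi_i_add) (auto simp: sqi_def)
	have "abs (f x \<bullet> g x) <= (norm (f x))^2 + (norm (g x))^2" for x
	proof -
		have "abs (f x \<bullet> g x) <= norm (f x) * norm (g x)" by (rule Cauchy_Schwarz_ineq2)
		also have "... <= (norm (f x))^2 + (norm (g x))^2"
			using sum_squares_bound[of "norm (f x)" "norm (g x)"]
				mult_nonneg_nonneg[OF norm_ge_zero norm_ge_zero, of "f x" "g x"] by linarith
		finally show ?thesis .
	qed
	thus "AE x in M. norm (f x \<bullet> g x) <= norm ((norm (f x))^2 + (norm (g x))^2)" by auto
qed measurable

lemma sqi_norm: "sqi M f ==> sqi M (%x. norm (f x))"
	by (auto simp: sqi_def)

lemma sqi_bound:
	assumes "sqi M f" and [measurable]: "g : bm M"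
		and "AE x in M. norm (g x) <= C * norm (f x)"
	shows "sqi M g"
	unfolding sqi_def
proof
	show "integrable M (%x. (norm (g x))^2)"
	proof (rule bi_i_bound)
		show "integrable M (%x. C^2 * (norm (f x))^2)" using assms by (simp add: sqi_def)
		show "AE x in M. norm ((norm (g x))^2) <= norm (C^2 * (norm (f x))^2)"
			using assms(3)
		proof eventually_elim
			case (elim x)
			hence "(norm (g x))^2 <= (C * norm (f x))^2" by (intro power_mono) auto
			thus ?case by (simp add: power_mult_distrib)
		qed
	qed measurable
qed fact

lemma sqi_zero [simp]: "sqi M (%x. 0)"
	by (simp add: sqi_def)

lemma sqi_scaleR [intro]: "sqi M f ==> sqi M (%x. c *R f x)"
	by (auto simp: sqi_def power_mult_distrib)

lemma sqi_cmult [intro]: "sqi M f ==> sqi M (%x. c * f x)" for f :: "_ => real"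
	using sqi_scaleR[of M f c] by simp

lemma sqi_uminus [intro]: "sqi M f ==> sqi M (%x. - f x)"
	by (simp add: sqi_def)

lemma sqi_add [intro]:
	assumes [measurable]: "sqi M f" "sqi M g"
	shows "sqi M (%x. f x + g x)"
	unfolding sqi_def
proof
	have "(norm (f x + g x))^2 = (norm (f x))^2 + (norm (g x))^2 + 2 * (f x \<bullet> g x)" for x
		by (simp add: dot_norm[of "f x" "g x"] field_simps)
	thus "integrable M (%x. (norm (f x + g x))^2)"
		using assms integrable_ip[OF assms] by (simp add: sqi_def)
qed measurable

lemma sqi_diff [intro]: "sqi M f ==> sqi M g ==> sqi M (%x. f x - g x)"
	using sqi_add[of M f "%x. - g x"] by auto

lemma sqi_sum [intro]: "(!!i. i : I ==> sqi M (f i)) ==> sqi M (%x. \<Sum>i\<in>I. f i x)"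
	by (induction I rule: infinite_finite_induct) auto

lemma sqi_cong_AE:
	assumes "sqi M f" "g : bm M" "AE x in M. f x = g x"
	shows "sqi M g"
	using assms(3) by (intro sqi_bound[OF assms(1,2), of 1]) auto

lemma ip_commute: "ip M f g = ip M g f"
	by (simp add: ip_def inner_commute)

lemma ip_add_left: "sqi M f ==> sqi M g ==> sqi M h ==> ip M (%x. f x + g x) h = ip M f h + ip M g h"
	by (simp add: ip_def inner_add_left integrable_ip)

lemma ip_add_right: "sqi M f ==> sqi M g ==> sqi M h ==> ip M h (%x. f x + g x) = ip M h f + ip M h g"
	by (simp add: ip_def inner_add_right integrable_ip)

lemma ip_diff_left: "sqi M f ==> sqi M g ==> sqi M h ==> ip M (%x. f x - g x) h = ip M f h - ip M g h"
	by (simp add: ip_def inner_diff_left integrable_ip)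

lemma ip_diff_right: "sqi M f ==> sqi M g ==> sqi M h ==> ip M h (%x. f x - g x) = ip M h f - ip M h g"
	by (simp add: ip_def inner_diff_right integrable_ip)

lemma ip_scale_left [simp]: "ip M (%x. c *R f x) h = c * ip M f h"
	by (simp add: ip_def)

lemma ip_scale_right [simp]: "ip M h (%x. c *R f x) = c * ip M h f"
	by (simp add: ip_def)

lemma ip_zero [simp]: "ip M (%x. 0) h = 0" "ip M h (%x. 0) = 0"
	by (simp_all add: ip_def)

lemma ip_sum_left:
	"(!!i. i : I ==> sqi M (f i)) ==> sqi M h ==> ip M (%x. \<Sum>i\<in>I. f i x) h = (\<Sum>i\<in>I. ip M (f i) h)"
	by (induction I rule: infinite_finite_induct) (auto simp: ip_add_left sqi_sum)

lemma ip_self: "ip M f f = (LINT x|M. (norm (f x))^2)"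
	by (simp add: ip_def power2_norm_eq_inner)

lemma ip_self_nonneg [simp]: "0 <= ip M f f"
	by (simp add: ip_self)

lemma n2_nonneg [simp]: "0 <= n2 M f"
	by (simp add: n2_def)

lemma n2_sq: "(n2 M f)^2 = ip M f f"
	by (simp add: n2_def)

lemma n2_norm [simp]: "n2 M (%x. norm (f x)) = n2 M f"
	by (simp add: n2_def ip_self)

text \<open>The quadratic polynomial \<open>q\<close> in t is nonnegative. The form is only
  semidefinite: if \<open>ip M g g = 0\<close>, the polynomial is affine in t and its slope must
  vanish.\<close>

lemma ip_Cauchy_Schwarz:
	assumes "sqi M f" "sqi M g"
	shows "abs (ip M f g) <= n2 M f * n2 M g"
proof -
	have q: "0 <= ip M f f - 2 * t * ip M f g + t^2 * ip M g g" for t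
	proof -
		have "ip M (%x. f x - t *R g x) (%x. f x - t *R g x)
				= ip M f f - 2 * t * ip M f g + t^2 * ip M g g"
			using assms ip_commute[of M g f]
			by (simp add: ip_diff_left ip_diff_right sqi_diff sqi_scaleR algebra_simps power2_eq_square)
		thus ?thesis using ip_self_nonneg by metis
	qed
	have "(ip M f g)^2 <= ip M f f * ip M g g"
	proof (cases "ip M g g = 0")
		case True
		have "ip M f g = 0"
		proof (rule ccontr)
			assume "ip M f g ~= 0"
			hence "ip M f f - 2 * ((ip M f f + 1) / (2 * ip M f g)) * ip M f g = -1" by (simp add: field_simps)
			with q[of "(ip M f f + 1) / (2 * ip M f g)"] True show False by simp
		qed
		thus ?thesis by simp
	next
		case False
		hence c: "ip M g g > 0" using ip_self_nonneg[of M g] by linarith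
		have "ip M f f - 2 * (ip M f g / ip M g g) * ip M f g + (ip M f g / ip M g g)^2 * ip M g g
			= ip M f f - (ip M f g)^2 / ip M g g"
			using c by (simp add: field_simps power2_eq_square)
		hence "(ip M f g)^2 / ip M g g <= ip M f f" using q[of "ip M f g / ip M g g"] by linarith
		thus ?thesis using c by (simp add: field_simps)
	qed
	hence "sqrt ((ip M f g)^2) <= sqrt (ip M f f * ip M g g)" by (rule real_sqrt_le_mono)
	thus ?thesis by (simp add: n2_def real_sqrt_mult)
qed

lemma integrable_norm_mult: "sqi M f ==> sqi M g ==> integrable M (%x. norm (f x) * norm (g x))"
	using integrable_ip[of M "%x. norm (f x)" "%x. norm (g x)"] by (simp add: sqi_norm)

lemma integral_norm_mult_le:
	assumes "sqi M f" "sqi M g"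
	shows "(LINT x|M. norm (f x) * norm (g x)) <= n2 M f * n2 M g"
	using ip_Cauchy_Schwarz[of M "%x. norm (f x)" "%x. norm (g x)"] assms
	by (simp add: sqi_norm ip_def)

lemma n2_scaleR [simp]: "n2 M (%x. c *R f x) = abs c * n2 M f"
	by (simp add: n2_def real_sqrt_mult)

lemma n2_cmult [simp]: "n2 M (%x. c * f x) = abs c * n2 M f" for f :: "_ => real"
	using n2_scaleR[of M c f] by simp

lemma n2_uminus [simp]: "n2 M (%x. - f x) = n2 M f"
	by (simp add: n2_def ip_def)

lemma n2_minus_commute: "n2 M (%x. f x - g x) = n2 M (%x. g x - f x)"
	using n2_uminus[of M "%x. f x - g x"] by simp

lemma n2_zero [simp]: "n2 M (%x. 0) = 0"
	by (simp add: n2_def)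

lemma n2_triangle:
	assumes "sqi M f" "sqi M g"
	shows "n2 M (%x. f x + g x) <= n2 M f + n2 M g"
proof (rule power2_le_imp_le)
	have "(n2 M (%x. f x + g x))^2 = ip M f f + 2 * ip M f g + ip M g g"
		using assms ip_commute[of M g f] by (simp add: n2_sq ip_add_left ip_add_right sqi_add)
	also have "... <= ip M f f + 2 * (n2 M f * n2 M g) + ip M g g"
		using ip_Cauchy_Schwarz[OF assms] by linarith
	also have "... = (n2 M f + n2 M g)^2" by (simp add: power2_sum n2_sq)
	finally show "(n2 M (%x. f x + g x))^2 <= (n2 M f + n2 M g)^2" .
qed simp

lemma n2_triangle3:
	assumes "sqi M f" "sqi M g" "sqi M h"
	shows "n2 M (%x. f x - h x) <= n2 M (%x. f x - g x) + n2 M (%x. g x - h x)"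
	using n2_triangle[of M "%x. f x - g x" "%x. g x - h x"] assms by (simp add: sqi_diff)

lemma n2_diff_le:
	assumes "sqi M f" "sqi M g"
	shows "n2 M (%x. f x - g x) <= n2 M f + n2 M g"
	using n2_triangle[of M f "%x. - g x"] assms by (simp add: sqi_uminus)

lemma n2_sum_le:
	"(!!i. i : I ==> sqi M (f i)) ==> n2 M (%x. \<Sum>i\<in>I. f i x) <= (\<Sum>i\<in>I. n2 M (f i))"
proof (induction I rule: infinite_finite_induct)
	case (insert a I)
	have "n2 M (%x. f a x + (\<Sum>i\<in>I. f i x)) <= n2 M (f a) + n2 M (%x. \<Sum>i\<in>I. f i x)"
		using insert by (intro n2_triangle) auto
	with insert show ?case by force
qed auto

lemma n2_mono:
	assumes "sqi M f" "sqi M g" "AE x in M. norm (f x) <= norm (g x)"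
	shows "n2 M f <= n2 M g"
	unfolding n2_def ip_self
proof (intro real_sqrt_le_mono integral_mono_AE)
	show "AE x in M. (norm (f x))^2 <= (norm (g x))^2"
		using assms(3) by eventually_elim (auto intro: power_mono)
qed (use assms in \<open>auto simp: sqi_def\<close>)

lemma n2_cong_AE:
	assumes "f : bm M" "g : bm M" "AE x in M. f x = g x"
	shows "n2 M f = n2 M g"
	unfolding n2_def ip_def using assms(3)
	by (intro arg_cong[of _ _ sqrt] integral_cong_AE) (use assms(1,2) in auto)

lemma ip_cong_AE:
	assumes "f : bm M" "g : bm M" "h : bm M" "AE x in M. f x = g x"
	shows "ip M f h = ip M g h"
	unfolding ip_def using assms(4)
	by (intro integral_cong_AE) (use assms(1-3) in auto)

lemma n2_eq_0:
	assumes "sqi M f" "n2 M f = 0"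
	shows "AE x in M. f x = 0"
proof -
	have "(LINT x|M. (norm (f x))^2) = 0" using assms(2) by (simp add: n2_def ip_self)
	hence "AE x in M. (norm (f x))^2 = 0"
		using assms(1) by (subst (asm) integral_nonneg_eq_0_iff_AE) (auto simp: sqi_def)
	thus ?thesis by simp
qed

lemma n2_tendsto_AE_subseq:
	assumes "!!n. sqi M (f n)" "sqi M g" "(%n. n2 M (%x. f n x - g x)) ----> 0"
	shows "EX r::nat=>nat. strict_mono r & (AE x in M. (%n. f (r n) x) ----> g x)"
proof -
	have "(%n. (n2 M (%x. f n x - g x))^2) ----> 0^2" by (intro tendsto_power assms)
	hence "(%n. \<integral>x. norm ((norm (f n x - g x))^2) \<partial>M) ----> 0" by (simp add: n2_sq ip_self)
	from tendsto_L1_AE_subseq[OF sqi_integrable[OF sqi_diff[OF assms(1,2)]] this]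
	obtain r :: "nat => nat" where
		r: "strict_mono r" "AE x in M. (%n. (norm (f (r n) x - g x))^2) ----> 0"
		by blast
	from r(2) have "AE x in M. (%n. f (r n) x) ----> g x"
	proof eventually_elim
		case (elim x)
		hence "(%n. sqrt ((norm (f (r n) x - g x))^2)) ----> sqrt 0" by (rule tendsto_real_sqrt)
		thus ?case by (simp add: tendsto_norm_zero_iff LIM_zero_iff)
	qed
	with r(1) show ?thesis by blast
qed

lemma tendsto_ip_left:
	assumes "!!n. sqi M (f n)" "sqi M g" "sqi M h" "(%n. n2 M (%x. f n x - g x)) ----> 0"
	shows "(%n. ip M (f n) h) ----> ip M g h"
proof (rule Lim_transform_bound[THEN LIM_zero_cancel])
	show "(%n. n2 M (%x. f n x - g x) * n2 M h) ----> 0"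
		using tendsto_mult_left_zero[OF assms(4)] .
	show "\<forall>\<^sub>F n in sequentially. norm (ip M (f n) h - ip M g h) <= norm (n2 M (%x. f n x - g x) * n2 M h)"
		using ip_Cauchy_Schwarz[OF sqi_diff[OF assms(1,2)] assms(3)] assms by (auto simp: ip_diff_left)
qed

lemma tendsto_n2:
	assumes "!!n. sqi M (f n)" "sqi M g" "(%n. n2 M (%x. f n x - g x)) ----> 0"
	shows "(%n. n2 M (f n)) ----> n2 M g"
proof (rule Lim_transform_bound[THEN LIM_zero_cancel, OF _ assms(3)])
	have "abs (n2 M (f n) - n2 M g) <= n2 M (%x. f n x - g x)" for n
		using n2_triangle[of M "%x. f n x - g x" g] n2_triangle[of M "%x. g x - f n x" "f n"] assms
			n2_minus_commute[of M g "f n"]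
		by (simp add: sqi_diff abs_le_iff)
	thus "\<forall>\<^sub>F n in sequentially. norm (n2 M (f n) - n2 M g) <= norm (n2 M (%x. f n x - g x))"
		by simp
qed

definition n2_Cauchy :: "'a measure => (nat => 'a => 'b::euclidean_space) => bool" where
	"n2_Cauchy M f \<longleftrightarrow> (ALL e>0. EX N. ALL m>=N. ALL n>=N. n2 M (%x. f m x - f n x) < e)"

text \<open>Riesz-Fischer. Along a subsequence whose increments are below \<open>(1/2)^k\<close> the
  sum of the norms of the increments is bounded in L^2, hence finite almost everywhere; Fatou then
  turns the pointwise limit into an L^2 limit.\<close>

lemma n2_complete:
	assumes sq: "!!n. sqi M (f n)" and C: "n2_Cauchy M f"
	obtains g where "sqi M g" "(%n. n2 M (%x. f n x - g x)) ----> 0"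
proof -
	note [measurable] = sq
	have "EX r. ALL k. (ALL m>=r k. ALL n>=r k. n2 M (%x. f m x - f n x) < (1/2)^k) & r (Suc k) > r k"
	proof (rule dependent_nat_choice)
		show "EX x. ALL m>=x. ALL n>=x. n2 M (%xa. f m xa - f n xa) < (1/2)^0"
			using C unfolding n2_Cauchy_def by simp
		fix x k
		obtain N where N: "ALL m>=N. ALL n>=N. n2 M (%x. f m x - f n x) < (1/2)^Suc k"
			using C unfolding n2_Cauchy_def by (meson zero_less_power half_gt_zero zero_less_one)
		show "EX y. (ALL m>=y. ALL n>=y. n2 M (%xa. f m xa - f n xa) < (1/2)^Suc k) & x < y"
			using N by (intro exI[of _ "max N (Suc x)"]) auto
	qed
	then obtain r where r: "!!k m n. m >= r k ==> n >= r k ==> n2 M (%x. f m x - f n x) < (1/2)^k"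
		and rm: "!!k. r (Suc k) > r k" by metis
	hence sm: "strict_mono r" by (simp add: strict_mono_Suc_iff)
	define d where "d k x = norm (f (r (Suc k)) x - f (r k) x)" for k x
	have dm[measurable]: "d k : bm M" for k unfolding d_def by measurable
	have dsq: "sqi M (d k)" for k unfolding d_def by (intro sqi_norm sqi_diff sq)
	have dn: "n2 M (d k) <= (1/2)^k" for k
		unfolding d_def using r[of k "r (Suc k)" "r k"] rm[of k] by (simp add: less_imp_le)
	have S: "(nni M (%x. ennreal ((\<Sum>k<n. d k x)^2))) <= 4" for n
	proof -
		\<comment> \<open>The norms of the increments add up to at most 2, which explains the bound 4 for
		  the squared sum.\<close>
		have sqs: "sqi M (%x. \<Sum>k<n. d k x)" using dsq by auto
		have "n2 M (%x. \<Sum>k<n. d k x) <= (\<Sum>k<n. n2 M (d k))" using dsq by (intro n2_sum_le)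
		also have "... <= (\<Sum>k<n. (1/2)^k)" using dn by (intro sum_mono)
		also have "... <= 2" by (subst geometric_sum) (auto simp: field_simps)
		finally have "(n2 M (%x. \<Sum>k<n. d k x))^2 <= 2^2" by (intro power_mono) auto
		hence *: "(LINT x|M. (\<Sum>k<n. d k x)^2) <= 4" by (simp add: n2_sq ip_self)
		have "integrable M (%x. (\<Sum>k<n. d k x)^2)" using sqi_integrable[OF sqs] by simp
		thus ?thesis using * using ennreal_leI[OF *] by (subst nn_integral_eq_integral) auto
	qed
	have "AE x in M. (SUP n. ennreal ((\<Sum>k<n. d k x)^2)) ~= \<infinity>"
	proof (rule nn_integral_PInf_AE)
		have "(nni M (%x. (SUP n. ennreal ((\<Sum>k<n. d k x)^2)))) = (SUP n. \<integral>\<^sup>+x. ennreal ((\<Sum>k<n. d k x)^2) \<partial>M)"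
		proof (rule nn_integral_monotone_convergence_SUP)
			show "incseq (%n x. ennreal ((\<Sum>k<n. d k x)^2))"
				by (auto simp: incseq_Suc_iff le_fun_def d_def intro!: ennreal_leI power_mono sum_nonneg)
		qed measurable
		also have "... <= 4" using S by (auto intro: SUP_least)
		finally show "(nni M (%x. (SUP n. ennreal ((\<Sum>k<n. d k x)^2)))) ~= \<infinity>"
			by (auto simp: top_unique)
	qed measurable
	hence conv: "AE x in M. convergent (%k. f (r k) x)"
	proof eventually_elim
		case (elim x)
		then obtain B where B: "(SUP n. ennreal ((\<Sum>k<n. d k x)^2)) = ennreal B" "B >= 0"
			by (metis ennreal_cases infinity_ennreal_def)
		have "(\<Sum>k<n. d k x) <= sqrt B" for n
		proof -
			have "ennreal ((\<Sum>k<n. d k x)^2) <= ennreal B" unfolding B(1)[symmetric] by (rule SUP_upper) simp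
			thus ?thesis using B(2) by (simp add: real_le_rsqrt)
		qed
		hence "summable (%k. d k x)" by (intro summableI_nonneg_bounded[of _ "sqrt B"]) (auto simp: d_def)
		hence "summable (%k. f (r (Suc k)) x - f (r k) x)" unfolding d_def by (rule summable_norm_cancel)
		hence "convergent (%n. \<Sum>k<n. f (r (Suc k)) x - f (r k) x)" by (simp add: summable_iff_convergent)
		hence "convergent (%n. f (r n) x - f (r 0) x)"
			unfolding sum_lessThan_telescope[of "%k. f (r k) x"] .
		thus ?case using convergent_diff_const_right_iff[of "%n. f (r n) x"] by simp
	qed
	\<comment> \<open>Where the subsequence diverges, \<open>lim\<close> is an irrelevant default
	  value; it keeps \<open>g\<close> measurable.\<close>
	define g where "g x = lim (%k. f (r k) x)" for x
	have gm [measurable]: "g : bm M" unfolding g_def by measurable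
	have bd: "(nni M (%x. ennreal ((norm (f m x - g x))^2))) <= ennreal (((1/2)^k)^2)" if "m >= r k" for m k
	proof -
		have "(nni M (%x. ennreal ((norm (f m x - g x))^2)))
			= (nni M (%x. liminf (%j. ennreal ((norm (f m x - f (r j) x))^2))))"
		proof (rule nn_integral_cong_AE, use conv in eventually_elim)
			case (elim x)
			hence "(%k. f (r k) x) ----> g x" by (simp add: g_def convergent_LIMSEQ_iff)
			hence "(%j. ennreal ((norm (f m x - f (r j) x))^2)) ----> ennreal ((norm (f m x - g x))^2)"
				by (intro tendsto_intros)
			thus ?case using lim_imp_Liminf[OF sequentially_bot] by metis
		qed
		also have "... <= liminf (%j. \<integral>\<^sup>+x. ennreal ((norm (f m x - f (r j) x))^2) \<partial>M)"
			by (rule nn_integral_liminf) measurable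
		also have "... <= ennreal (((1/2)^k)^2)"
		proof (rule Liminf_le, simp, rule eventually_sequentiallyI[of k])
			fix j assume "k <= j"
			hence "r k <= r j" using sm by (simp add: strict_mono_less_eq)
			hence "(n2 M (%x. f m x - f (r j) x))^2 <= ((1/2)^k)^2"
				using r[OF that] by (intro power_mono) (auto simp: less_imp_le)
			moreover have "(nni M (%x. ennreal ((norm (f m x - f (r j) x))^2))) = ennreal ((n2 M (%x. f m x - f (r j) x))^2)"
				unfolding n2_sq ip_self by (intro nn_integral_eq_integral sqi_integrable sqi_diff sq) auto
			ultimately show "(nni M (%x. ennreal ((norm (f m x - f (r j) x))^2))) <= ennreal (((1/2)^k)^2)"
				by (simp add: ennreal_leI)
		qed
		finally show ?thesis .
	qed
	have dsqi: "sqi M (%x. f m x - g x)" if "m >= r k" for m k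
		unfolding sqi_def
	proof
		show "integrable M (%x. (norm (f m x - g x))^2)"
			using bd[OF that] by (intro integrableI_bounded) (auto simp: le_less_trans)
	qed measurable
	have g: "sqi M g"
		using sqi_diff[OF sq[of "r 0"] dsqi[of 0 "r 0"]] by simp
	have "(%n. n2 M (%x. f n x - g x)) ----> 0"
	proof (rule LIMSEQ_I)
		fix e :: real assume "e > 0"
		then obtain k where k: "(1/2)^k < e" using real_arch_pow_inv[of e "1/2"] by auto
		have "n2 M (%x. f n x - g x) <= (1/2)^k" if "n >= r k" for n
		proof -
			have "ennreal ((n2 M (%x. f n x - g x))^2) = (nni M (%x. ennreal ((norm (f n x - g x))^2)))"
				unfolding n2_sq ip_self by (intro nn_integral_eq_integral[symmetric] sqi_integrable sqi_diff sq g) auto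
			also have "... <= ennreal (((1/2)^k)^2)" by (rule bd[OF that])
			finally show ?thesis by (simp add: abs_le_square_iff[symmetric])
		qed
		with k show "EX no. ALL n>=no. norm (n2 M (%x. f n x - g x) - 0) < e"
			by (intro exI[of _ "r k"]) (auto intro: le_less_trans)
	qed
	with g show thesis by (rule that)
qed

section \<open>Closed subspaces, the Riesz representation and weak compactness\<close>

definition l2closed :: "'a measure => ('a => 'b::euclidean_space) set => bool" where
	"l2closed M E \<longleftrightarrow> (ALL f:E. sqi M f) & (%x. 0) : E &
		 (ALL f:E. ALL g:E. ALL a b. (%x. a *R f x + b *R g x) : E) &
		 (ALL f g. (ALL n::nat. f n : E) --> sqi M g --> (%n. n2 M (%x. f n x - g x)) ----> 0 --> g : E)"

lemma parallelogram:
	assumes "sqi M f" "sqi M g"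
	shows "(n2 M (%x. f x - g x))^2
		= 2 * (n2 M f)^2 + 2 * (n2 M g)^2 - 4 * (n2 M (%x. (1/2) *R f x + (1/2) *R g x))^2"
	using assms ip_commute[of M g f] unfolding n2_sq
	by (simp add: ip_diff_left ip_diff_right ip_add_left ip_add_right sqi_diff sqi_add sqi_scaleR algebra_simps)

text \<open>The representer minimises \<open>J\<close>: the parallelogram law makes a minimising
  sequence Cauchy, completeness provides \<open>p\<close>, and the first variation of
  \<open>J\<close> at \<open>p\<close> is the claim. Closedness of E holds for every representative
  of a limit, so the choice made by \<open>n2_complete\<close> does not matter.\<close>

lemma riesz_representation:
	fixes E :: "('a => 'b::euclidean_space) set"
	assumes E: "l2closed M E"
		and lin: "!!f g a b. f : E ==> g : E ==> l (%x. a *R f x + b *R g x) = a * l f + b * l g"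
		and bdd: "!!f. f : E ==> abs (l f) <= C * n2 M f"
	obtains p where "p : E" "!!f. f : E ==> ip M p f = l f"
proof -
	have sq: "!!f. f : E ==> sqi M f" and Ez: "(%x. 0) : E"
		and Elin: "!!f g a b. f : E ==> g : E ==> (%x. a *R f x + b *R g x) : E"
		and Ecl: "!!f g. (!!n::nat. f n : E) ==> sqi M g ==> (%n. n2 M (%x. f n x - g x)) ----> 0 ==> g : E"
		using E unfolding l2closed_def by blast+
	define J where "J f = (n2 M f)^2 - 2 * l f" for f
	define d where "d = Inf (J ` E)"
	have lb: "- (C^2) <= J f" if "f : E" for f
	proof -
		have "0 <= (n2 M f - C)^2" by simp
		thus ?thesis using bdd[OF that] by (simp add: J_def power2_diff algebra_simps)
	qed
	have bb: "bdd_below (J ` E)" using lb by (intro bdd_belowI2)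
	have dle: "d <= J f" if "f : E" for f unfolding d_def using bb that by (rule cINF_lower)
	have "EX f:E. J f < d + 1 / Suc n" for n
		using cINF_less_iff[of E J "d + 1 / Suc n"] bb Ez unfolding d_def by auto
	then obtain f where f: "!!n. f n : E" "!!n. J (f n) < d + 1 / Suc n" by metis
	have par: "(n2 M (%x. f m x - f n x))^2 <= 2 / Suc m + 2 / Suc n" for m n
	proof -
		have "(n2 M (%x. f m x - f n x))^2 = 2 * J (f m) + 2 * J (f n) - 4 * J (%x. (1/2) *R f m x + (1/2) *R f n x)"
			unfolding J_def parallelogram[OF sq[OF f(1)] sq[OF f(1)]]
			using lin[OF f(1)[of m] f(1)[of n], of "1/2" "1/2"] by simp
		also have "... <= 2 * (d + 1 / Suc m) + 2 * (d + 1 / Suc n) - 4 * d"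
			using f(2)[of m] f(2)[of n] dle[OF Elin[OF f(1)[of m] f(1)[of n], of "1/2" "1/2"]] by argo

		finally show ?thesis by simp
	qed
	have "n2_Cauchy M f"
		unfolding n2_Cauchy_def
	proof (intro allI impI)
		fix e :: real assume "e > 0"
		then obtain N where N: "inverse (real (Suc N)) < e^2 / 4"
			by (metis reals_Archimedean zero_less_power divide_pos_pos zero_less_numeral)
		have "n2 M (%x. f m x - f n x) < e" if "m >= N" "n >= N" for m n
		proof (rule power2_less_imp_less)
			have "2 / real (Suc m) <= 2 * inverse (real (Suc N))" "2 / real (Suc n) <= 2 * inverse (real (Suc N))"
				using that by (auto simp: divide_simps)
			thus "(n2 M (%x. f m x - f n x))^2 < e^2" using par[of m n] N by linarith
		qed (use \<open>e > 0\<close> in simp)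
		thus "EX N. ALL m>=N. ALL n>=N. n2 M (%x. f m x - f n x) < e" by blast
	qed
	then obtain p where p: "sqi M p" "(%n. n2 M (%x. f n x - p x)) ----> 0"
		by (rule n2_complete[OF sq[OF f(1)]])
	have pE: "p : E" using Ecl f(1) p by blast
	have lc: "(%n. l (f n)) ----> l p"
	proof (rule Lim_transform_bound[THEN LIM_zero_cancel])
		show "(%n. C * n2 M (%x. f n x - p x)) ----> 0" using tendsto_mult_right_zero[OF p(2)] .
		have "norm (l (f n) - l p) <= norm (C * n2 M (%x. f n x - p x))" for n
		proof -
			have "l (f n) - l p = l (%x. f n x - p x)" and "(%x. f n x - p x) : E"
				using lin[OF f(1)[of n] pE, of 1 "-1"] Elin[OF f(1)[of n] pE, of 1 "-1"] by auto
			thus ?thesis using bdd[of "%x. f n x - p x"] by simp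
		qed
		thus "\<forall>\<^sub>F n in sequentially. norm (l (f n) - l p) <= norm (C * n2 M (%x. f n x - p x))"
			by simp
	qed
	have "(%n. J (f n)) ----> J p"
		unfolding J_def using lc tendsto_n2[OF sq[OF f(1)] p] by (intro tendsto_intros)
	moreover have "(%n. d + 1 / Suc n) ----> d + 0"
		using LIMSEQ_inverse_real_of_nat by (intro tendsto_intros) (simp add: inverse_eq_divide)
	ultimately have "J p <= d + 0"
		using f(2) by (intro LIMSEQ_le[of "%n. J (f n)" "J p"]) (auto simp: less_imp_le)
	hence Jp: "J p <= J g" if "g : E" for g using dle[OF that] by simp
	have "ip M p g = l g" if g: "g : E" for g
	proof -
		have q: "0 <= 2 * t * (ip M p g - l g) + t^2 * ip M g g" for t
		proof -
			have "J (%x. 1 *R p x + t *R g x) = J p + 2 * t * (ip M p g - l g) + t^2 * ip M g g"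
				unfolding J_def lin[OF pE g] n2_sq using p(1) sq[OF g] ip_commute[of M g p]
				by (simp add: ip_add_left ip_add_right sqi_add sqi_scaleR algebra_simps power2_eq_square)
			thus ?thesis using Jp[OF Elin[OF pE g, of 1 t]] by simp
		qed
		show ?thesis
		proof (rule ccontr)
			define a where "a = ip M p g - l g"
			assume "ip M p g ~= l g"
			hence a: "a ~= 0" by (simp add: a_def)
			\<comment> \<open>Adding 1 avoids a case distinction on \<open>ip M g g = 0\<close>. At t = - a /
			  c the quadratic is at most - a^2 / c, which is negative.\<close>
			define c where "c = ip M g g + 1"
			have c: "c > 0" "c > ip M g g" by (simp_all add: c_def add_nonneg_pos)
			have "0 <= 2 * (- a / c) * a + (- a / c)^2 * ip M g g" using q[of "- a / c"] by (simp add: a_def)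
			also have "... <= 2 * (- a / c) * a + (- a / c)^2 * c" using c by (intro add_left_mono mult_left_mono) auto
			also have "... = - (a^2 / c)" using c by (simp add: field_simps power2_eq_square)
			finally show False using a c by (simp add: field_simps)
		qed
	qed
	with pE show thesis by (rule that)
qed

text \<open>The diagonal sequence is taken against the members of the sequence itself, which
  replaces a countable dense set. The good test functions form a closed subspace E containing all
  \<open>f j\<close>, and an arbitrary y acts on E like its projection. Only convergence of the
  products is asserted; the limits are identified where needed.\<close>

lemma weakly_convergent_subseq:
	fixes f :: "nat => 'a => 'b::euclidean_space"
	assumes sq: "!!n. sqi M (f n)" and B: "!!n. n2 M (f n) <= B"
	obtains r :: "nat => nat" where "strict_mono r" "!!y. sqi M y ==> convergent (%n. ip M (f (r n)) y)"
proof -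
	have B0: "B >= 0" using n2_nonneg[of M "f 0"] B[of 0] by linarith
	have bnd: "abs (ip M (f n) y) <= B * n2 M y" if "sqi M y" for n y
		using ip_Cauchy_Schwarz[OF sq that, of n] mult_right_mono[OF B[of n] n2_nonneg[of M y]] by linarith
	interpret subseqs "%j s. convergent (%n. ip M (f (s n)) (f j))"
	proof
		fix j and s :: "nat => nat"
		have "bounded (range (%n. ip M (f (s n)) (f j)))"
			using bnd[OF sq] by (auto simp: bounded_iff)
		from bounded_imp_convergent_subsequence[OF this]
		show "EX r'. strict_mono r' & convergent (%n. ip M (f ((s \<circ> r') n)) (f j))"
			by (auto simp: convergent_def o_def)
	qed
	define r where "r = diagseq"
	have r: "strict_mono r" unfolding r_def by (rule subseq_diagseq)
	have cj: "convergent (%n. ip M (f (r n)) (f j))" for j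
	proof -
		have "convergent (%n. ip M (f ((diagseq \<circ> (+) (Suc j)) n)) (f j))"
		proof (rule diagseq_holds)
			fix r' s :: "nat => nat" and n
			assume "strict_mono r'" "convergent (%k. ip M (f (s k)) (f n))"
			from convergent_subseq_convergent[OF this(2,1)]
			show "convergent (%k. ip M (f ((s \<circ> r') k)) (f n))" by (simp add: o_def)
		qed
		hence "convergent (%n. ip M (f (r (n + Suc j))) (f j))" by (simp add: r_def o_def add.commute)
		thus ?thesis by (rule convergent_ignore_initial_segment[THEN iffD1])
	qed
	define E where "E = {y. sqi M y & convergent (%n. ip M (f (r n)) y)}"
	have "l2closed M E"
		unfolding l2closed_def
	proof (intro conjI ballI allI impI)
		show "(%x. 0) : E" by (simp add: E_def convergent_const)
		fix g h and a b :: real assume "g : E" "h : E"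
		thus "(%x. a *R g x + b *R h x) : E"
			using sq by (auto simp: E_def ip_add_right sqi_scaleR intro!: convergent_add convergent_mult convergent_const)
	next
		fix g :: "nat => 'a => 'b" and y
		assume g: "ALL n. g n : E" and y: "sqi M y" and lim: "(%n. n2 M (%x. g n x - y x)) ----> 0"
		have "Cauchy (%n. ip M (f (r n)) y)"
		proof (rule metric_CauchyI)
			fix e :: real assume e: "e > 0"
			hence "e / (3 * (B + 1)) > 0" using B0 by simp
			then obtain k where k: "n2 M (%x. g k x - y x) < e / (3 * (B + 1))"
				using LIMSEQ_D[OF lim, of "e / (3 * (B + 1))"] by fastforce
			have gk: "sqi M (g k)" "Cauchy (%n. ip M (f (r n)) (g k))"
				using g by (auto simp: E_def Cauchy_convergent_iff)
			obtain N where N: "!!m n. m >= N ==> n >= N ==> abs (ip M (f (r m)) (g k) - ip M (f (r n)) (g k)) < e / 3"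
				using metric_CauchyD[OF gk(2), of "e/3"] e by (auto simp: dist_real_def)
			have d: "abs (ip M (f (r n)) (g k) - ip M (f (r n)) y) < e / 3" for n
			proof -
				have "abs (ip M (f (r n)) (g k) - ip M (f (r n)) y) <= B * n2 M (%x. g k x - y x)"
					using bnd[OF sqi_diff[OF gk(1) y], of "r n"] sq gk y by (simp add: ip_diff_right)
				also have "... <= (B + 1) * n2 M (%x. g k x - y x)" by (intro mult_right_mono) auto
				also have "... < (B + 1) * (e / (3 * (B + 1)))" using k B0 by (intro mult_strict_left_mono) auto
				also have "... = e / 3" using B0 by (simp add: field_simps)
				finally show ?thesis .
			qed
			have "dist (ip M (f (r m)) y) (ip M (f (r n)) y) < e" if "m >= N" "n >= N" for m n
				using N[OF that] d[of m] d[of n] unfolding dist_real_def by linarith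
			thus "EX N. ALL m>=N. ALL n>=N. dist (ip M (f (r m)) y) (ip M (f (r n)) y) < e" by blast
		qed
		with y show "y : E" by (simp add: E_def Cauchy_convergent_iff)
	qed (simp add: E_def)
	have "convergent (%n. ip M (f (r n)) y)" if y: "sqi M y" for y
	proof -
		\<comment> \<open>\<open>p\<close> is the orthogonal projection of \<open>y\<close> onto E,
		  obtained by representing the functional \<open>ip M _ y\<close> on E.\<close>
		obtain p where p: "p : E" "!!g. g : E ==> ip M p g = ip M g y"
		proof (rule riesz_representation[OF \<open>l2closed M E\<close>, of "%g. ip M g y" "n2 M y"])
			show "ip M (%x. a *R g x + b *R h x) y = a * ip M g y + b * ip M h y" if "g : E" "h : E" for g h a b
				using that y by (simp add: E_def ip_add_left sqi_scaleR)
			show "abs (ip M g y) <= n2 M y * n2 M g" if "g : E" for g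
				using that y ip_Cauchy_Schwarz[of M g y] by (simp add: E_def mult.commute)
		qed auto
		have "f (r n) : E" for n using sq cj by (simp add: E_def)
		hence "ip M (f (r n)) y = ip M (f (r n)) p" for n
			using p(2)[of "f (r n)"] ip_commute[of M p] by simp
		with p(1) show ?thesis by (simp add: E_def)
	qed
	with r show thesis by (rule that)
qed

section \<open>Convex combinations of tails and Mazur's lemma\<close>

definition tail_weights :: "nat => nat => (nat => real) => bool" where
	"tail_weights n N c \<longleftrightarrow> (ALL k. 0 <= c k) & (ALL k. k < n \<or> N <= k --> c k = 0) & (\<Sum>k<N. c k) = 1"

definition combo :: "nat => (nat => real) => (nat => 'a => 'b::real_vector) => 'a => 'b" where
	"combo N c f = (%x. \<Sum>k<N. c k *R f k x)"

text \<open>Padding with zeros lets two combinations share one upper index before they are averaged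
  or subtracted.\<close>

lemma tail_weights_mono:
	assumes "tail_weights n N c" "N <= N'"
	shows "tail_weights n N' c" "combo N' c f = combo N c f"
proof -
	have "(\<Sum>k<N'. c k) = (\<Sum>k<N. c k)"
		using assms by (intro sum.mono_neutral_right) (auto simp: tail_weights_def)
	with assms show "tail_weights n N' c" by (auto simp: tail_weights_def)
	have "(\<Sum>k<N'. c k *R f k x) = (\<Sum>k<N. c k *R f k x)" for x
		using assms by (intro sum.mono_neutral_right) (auto simp: tail_weights_def)
	thus "combo N' c f = combo N c f" by (simp add: combo_def)
qed

lemma sqi_combo: "(!!k. sqi M (f k)) ==> sqi M (combo N c f)"
	unfolding combo_def by (intro sqi_sum sqi_scaleR)

lemma combo_bound:
	assumes w: "tail_weights n N c" and q: "!!k. k >= n ==> q k <= (B::real)"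
	shows "(\<Sum>k<N. c k * q k) <= B"
proof -
	have "(\<Sum>k<N. c k * q k) <= (\<Sum>k<N. c k * B)"
		using w q by (intro sum_mono) (metis le_less_linear mult_left_mono mult_zero_left order_refl tail_weights_def)
	also have "... = B" using w by (simp add: sum_distrib_right[symmetric] tail_weights_def)
	finally show ?thesis .
qed

lemma n2_combo_le:
	assumes w: "tail_weights n N c" and sq: "!!k. sqi M (f k)" and B: "!!k. k >= n ==> n2 M (f k) <= B"
	shows "n2 M (combo N c f) <= B"
proof -
	have "n2 M (combo N c f) <= (\<Sum>k<N. n2 M (%x. c k *R f k x))"
		unfolding combo_def using sq by (intro n2_sum_le sqi_scaleR)
	also have "... = (\<Sum>k<N. c k * n2 M (f k))" using w by (simp add: tail_weights_def)
	also have "... <= B" using w B by (rule combo_bound)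
	finally show ?thesis .
qed

text \<open>The n-th weights live on indices k >= n, so every limit of the original sequence is also
  the limit of the combinations.\<close>

lemma combo_tendsto:
	assumes w: "!!n. tail_weights n (N n) (c n)" and q: "q ----> (a::real)"
	shows "(%n. \<Sum>k<N n. c n k * q k) ----> a"
proof (rule LIMSEQ_I)
	fix e :: real assume e: "e > 0"
	then obtain m where m: "!!k. k >= m ==> abs (q k - a) < e / 2"
		using LIMSEQ_D[OF q, of "e/2"] by auto
	have "norm ((\<Sum>k<N n. c n k * q k) - a) < e" if n: "n >= m" for n
	proof -
		have "q k <= a + e/2" "- q k <= - a + e/2" if "k >= n" for k
			using m[of k] that n by linarith+
		hence "(\<Sum>k<N n. c n k * q k) <= a + e/2" "(\<Sum>k<N n. c n k * - q k) <= - a + e/2"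
			using combo_bound[OF w[of n], of q "a + e/2"] combo_bound[OF w[of n], of "%k. - q k" "- a + e/2"] by auto
		thus ?thesis using e by (simp add: sum_negf abs_le_iff abs_less_iff)
	qed
	thus "EX no. ALL n>=no. norm ((\<Sum>k<N n. c n k * q k) - a) < e" by blast
qed

lemma combo_diff_const:
	assumes "tail_weights n N c"
	shows "combo N c f x - g x = combo N c (%k x. f k x - g x) x"
proof -
	have "(\<Sum>k<N. c k *R g x) = g x"
		using assms by (simp add: scaleR_left.sum[symmetric] tail_weights_def)
	thus ?thesis by (simp add: combo_def scaleR_diff_right sum_subtractf)
qed

lemma combo_tendsto_n2:
	assumes w: "!!n. tail_weights n (N n) (c n)" and sq: "!!k. sqi M (f k)" "sqi M g"
		and q: "(%k. n2 M (%x. f k x - g x)) ----> 0"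
	shows "(%n. n2 M (%x. combo (N n) (c n) f x - g x)) ----> 0"
proof (rule tendsto_sandwich[OF _ _ tendsto_const combo_tendsto[OF w q]])
	have "n2 M (%x. combo (N n) (c n) f x - g x) <= (\<Sum>k<N n. c n k * n2 M (%x. f k x - g x))" for n
	proof -
		have "n2 M (%x. combo (N n) (c n) f x - g x) = n2 M (%x. \<Sum>k<N n. c n k *R (f k x - g x))"
			unfolding combo_diff_const[OF w] by (simp add: combo_def)
		also have "... <= (\<Sum>k<N n. n2 M (%x. c n k *R (f k x - g x)))"
			using sq by (intro n2_sum_le sqi_scaleR sqi_diff)
		also have "... = (\<Sum>k<N n. c n k * n2 M (%x. f k x - g x))" using w[of n] by (simp add: tail_weights_def)
		finally show ?thesis .
	qed
	thus "\<forall>\<^sub>F n in sequentially. n2 M (%x. combo (N n) (c n) f x - g x) <= (\<Sum>k<N n. c n k * n2 M (%x. f k x - g x))"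
		by simp
qed simp

text \<open>\<open>d n\<close> is the least squared norm over convex combinations of the tail from
  n. It increases and is bounded by \<open>B^2\<close>, and the parallelogram law makes near
  minimisers a Cauchy sequence. No weak limit has to be known beforehand.\<close>

lemma mazur:
	fixes f :: "nat => 'a => 'b::euclidean_space"
	assumes sq: "!!n. sqi M (f n)" and B: "!!n. n2 M (f n) <= B"
	obtains N c g where "!!n. tail_weights n (N n) (c n)" "sqi M g"
		"(%n. n2 M (%x. combo (N n) (c n) f x - g x)) ----> 0"
proof -
	define S where "S n = {(n2 M (combo N c f))^2 | N c. tail_weights n N c}" for n
	define d where "d n = Inf (S n)" for n
	have ne: "S n ~= {}" for n
	proof -
		have "tail_weights n (Suc n) (%k. if k = n then 1 else 0)" by (simp add: tail_weights_def)
		thus ?thesis unfolding S_def by blast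
	qed
	have bb: "bdd_below (S n)" for n unfolding S_def by (auto intro!: bdd_belowI[of _ 0])
	have dle: "d n <= (n2 M (combo N c f))^2" if "tail_weights n N c" for n N c
		unfolding d_def using that bb by (intro cInf_lower) (auto simp: S_def)
	have "EX N c. tail_weights n N c & (n2 M (combo N c f))^2 < d n + 1 / Suc n" for n
		using cInf_less_iff[OF ne bb, of n "d n + 1 / Suc n"] unfolding S_def d_def by auto
	then obtain N c where w: "!!n. tail_weights n (N n) (c n)"
		and y: "!!n. (n2 M (combo (N n) (c n) f))^2 < d n + 1 / Suc n" by metis
	have wd: "tail_weights n K v" if "tail_weights m K v" "n <= m" for n m K v
		using that by (auto simp: tail_weights_def)
	have "incseq d"
	proof (rule incseq_SucI)
		fix n
		have "S (Suc n) <= S n" unfolding S_def using wd[of "Suc n" _ _ n] by auto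
		thus "d n <= d (Suc n)" unfolding d_def by (intro cInf_superset_mono ne bb)
	qed
	moreover have "d n <= B^2" for n
		using dle[OF w[of n]] n2_combo_le[OF w[of n] sq B] power_mono[of "n2 M (combo (N n) (c n) f)" B 2] by force
	ultimately obtain L where "d ----> L" using incseq_convergent[of d "B^2"] by blast
	hence dC: "Cauchy d" by (rule LIMSEQ_imp_Cauchy)
	define z where "z n = combo (N n) (c n) f" for n
	have zs: "sqi M (z n)" for n unfolding z_def using sq by (rule sqi_combo)
	have par: "(n2 M (%x. z m x - z n x))^2 <= 2 / Suc m + 2 / Suc n + 2 * (d m - d n)" if "n <= m" for m n
	proof -
		define K where "K = max (N m) (N n)"
		have wm: "tail_weights m K (c m)" "combo K (c m) f = z m" and wn: "tail_weights n K (c n)" "combo K (c n) f = z n"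
			using tail_weights_mono[OF w[of m], of K] tail_weights_mono[OF w[of n], of K] by (auto simp: K_def z_def)
		\<comment> \<open>The average of two combinations with n <= m is still a combination of the tail
		  from n, so its squared norm is at least \<open>d n\<close>.\<close>
		define v where "v k = (1/2) * c m k + (1/2) * c n k" for k
		have wv: "tail_weights n K v"
			using wm(1) wn(1) that
			by (auto simp: tail_weights_def v_def sum.distrib sum_divide_distrib[symmetric])
		have "combo K v f = (%x. (1/2) *R z m x + (1/2) *R z n x)"
			unfolding wm(2)[symmetric] wn(2)[symmetric]
			by (simp add: combo_def v_def fun_eq_iff scaleR_add_left sum.distrib scaleR_sum_right)
		hence "d n <= (n2 M (%x. (1/2) *R z m x + (1/2) *R z n x))^2" using dle[OF wv] by simp
		thus ?thesis
			unfolding parallelogram[OF zs zs] using y[of m] y[of n] by (simp add: z_def)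
	qed
	have "n2_Cauchy M z"
		unfolding n2_Cauchy_def
	proof (intro allI impI)
		fix e :: real assume "e > 0"
		hence e: "e^2 / 8 > 0" by simp
		obtain N1 where N1: "inverse (real (Suc N1)) < e^2 / 8" using reals_Archimedean[OF e] by blast
		obtain N2 where N2: "!!m n. m >= N2 ==> n >= N2 ==> abs (d m - d n) < e^2 / 8"
			using metric_CauchyD[OF dC e] by (auto simp: dist_real_def)
		have *: "n2 M (%x. z m x - z n x) < e" if "m >= max N1 N2" "n >= max N1 N2" "n <= m" for m n
		proof (rule power2_less_imp_less)
			have "2 / real (Suc m) <= 2 * inverse (real (Suc N1))" "2 / real (Suc n) <= 2 * inverse (real (Suc N1))"
				using that by (auto simp: divide_simps)
			thus "(n2 M (%x. z m x - z n x))^2 < e^2" using par[OF that(3)] N1 N2[of m n] that unfolding abs_less_iff max_def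
				by (auto split: if_splits)
		qed (use \<open>e > 0\<close> in simp)
		have "n2 M (%x. z m x - z n x) < e" if "m >= max N1 N2" "n >= max N1 N2" for m n
			using *[OF that] *[OF that(2,1)] n2_minus_commute[of M "z m" "z n"] by (cases "n <= m") auto
		thus "EX N. ALL m>=N. ALL n>=N. n2 M (%x. z m x - z n x) < e" by blast
	qed
	then obtain g where "sqi M g" "(%n. n2 M (%x. z n x - g x)) ----> 0"
		by (rule n2_complete[OF zs])
	with w show thesis unfolding z_def by (rule that)
qed

section \<open>Partial derivatives and smooth functions on the plane\<close>

lemma vec2_eq: "(h::real^2) = h$1 *R axis 1 1 + h$2 *R axis 2 1"
	by (simp add: vec_eq_iff axis_def forall_2)

lemma pd_eqI: "(f has_derivative D) (at x) ==> pd i f x = D (axis i 1)"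
	unfolding pd_def by (metis frechet_derivative_at)

lemma grad_has_derivative:
	assumes "f differentiable (at x)"
	shows "(f has_derivative (%h. grad f x \<bullet> h)) (at x)"
proof -
	obtain D where D: "(f has_derivative D) (at x)" using assms by (auto simp: differentiable_def)
	interpret linear D using D by (rule has_derivative_linear)
	have "D h = grad f x \<bullet> h" for h
	proof -
		have "D h = D (h$1 *R axis 1 1 + h$2 *R axis 2 1)" using vec2_eq[of h] by simp
		also have "... = h$1 * pd 1 f x + h$2 * pd 2 f x" by (simp add: add scale pd_eqI[OF D])
		finally show ?thesis by (simp add: grad_def inner_vec_def sum_2)
	qed
	thus ?thesis using D by (metis ext)
qed

lemma pd_add: "f differentiable (at x) ==> g differentiable (at x) ==> pd i (%x. f x + g x) x = pd i f x + pd i g x"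
	using pd_eqI[OF has_derivative_add[OF grad_has_derivative grad_has_derivative], of f x g i]
	by (simp add: inner_axis grad_def)

lemma pd_mult: "f differentiable (at x) ==> g differentiable (at x)
		==> pd i (%x. f x * g x) x = f x * pd i g x + pd i f x * g x"
	using pd_eqI[OF has_derivative_mult[OF grad_has_derivative grad_has_derivative], of f x g i]
	by (simp add: inner_axis grad_def)

lemma pd_compose: "f differentiable (at x) ==> (G has_real_derivative d) (at (f x))
		==> pd i (%x. G (f x)) x = d * pd i f x"
	using pd_eqI[OF has_derivative_compose[OF grad_has_derivative has_field_derivative_imp_has_derivative], of f x G d i]
	by (simp add: inner_axis grad_def)

lemma pd_const [simp]: "pd i (%x. c) = (%x. 0)"
	by (rule ext, subst pd_eqI[OF has_derivative_const]) simp

lemma pd_coord: "pd i (%x. x $ j) = (%x. if i = j then 1 else 0)"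
	by (rule ext, subst pd_eqI[OF bounded_linear.has_derivative[OF bounded_linear_vec_nth has_derivative_ident]])
		(auto simp: axis_def)

lemma pd_cmult: "f differentiable (at x) ==> pd i (%x. c * f x) x = c * pd i f x"
	by (subst pd_mult) auto

lemma pd_reflect:
	assumes "!!x. f differentiable (at x)"
	shows "pd i (%y. f (a - y)) = (%y. - pd i f (a - y))"
proof
	fix y
	have "((%y. a - y) has_derivative (%h. - h)) (at y)" by (auto intro!: derivative_eq_intros)
	from pd_eqI[OF has_derivative_compose[OF this grad_has_derivative[OF assms]], of i]
	show "pd i (%y. f (a - y)) y = - pd i f (a - y)" by (simp add: inner_axis grad_def)
qed

lemma norm_axis1 [simp]: "norm (axis i (1::real)) = 1"
	by (simp add: norm_eq_sqrt_inner inner_axis)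

text \<open>Reduces smoothness to finding a class of differentiable functions that is stable under
  \<open>pd\<close>, so that no later argument mentions lists of derivatives.\<close>

lemma smooth_R2_coinduct:
	assumes "f : C" and d: "!!g x. g : C ==> g differentiable (at x)" and p: "!!g i. g : C ==> pd i g : C"
	shows "smooth_R2 f"
proof -
	have "foldr pd ds f : C" for ds by (induction ds) (auto intro: assms)
	thus ?thesis using d by (auto simp: smooth_R2_def)
qed

lemma smooth_differentiable: "smooth_R2 f ==> f differentiable (at x)"
	unfolding smooth_R2_def by (metis foldr_Nil id_apply)

lemma smooth_pd: "smooth_R2 f ==> smooth_R2 (pd i f)"
	unfolding smooth_R2_def
proof (intro allI)
	fix ds x assume "ALL ds x. foldr pd ds f differentiable at x"
	hence "foldr pd (ds @ [i]) f differentiable at x" by blast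
	thus "foldr pd ds (pd i f) differentiable at x" by simp
qed

lemma smooth_continuous_on: "smooth_R2 f ==> continuous_on A f"
	by (meson continuous_at_imp_continuous_on differentiable_imp_continuous_within smooth_differentiable)

lemma smooth_borel [measurable_dest]: "smooth_R2 f ==> f : bm borel"
	by (intro borel_measurable_continuous_onI smooth_continuous_on)

text \<open>The algebra generated by B. By the Leibniz rule it is stable under \<open>pd\<close> as
  soon as the derivatives of its generators lie in it.\<close>

inductive salg :: "((real^2 => real) => bool) => (real^2 => real) => bool" for B where
	salg_base: "B f ==> salg B f"
| salg_add: "salg B f ==> salg B g ==> salg B (%x. f x + g x)"
| salg_mult: "salg B f ==> salg B g ==> salg B (%x. f x * g x)"

lemma salg_smooth:
	assumes d: "!!g x. B g ==> g differentiable (at x)" and p: "!!g i. B g ==> salg B (pd i g)"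
		and f: "salg B f"
	shows "smooth_R2 f"
proof -
	have D: "g differentiable (at x)" if "salg B g" for g x
		using that by induction (auto intro: d)
	have P: "salg B (pd i g)" if "salg B g" for g i
		using that
	proof induction
		case (salg_add f g)
		have "pd i (%x. f x + g x) = (%x. pd i f x + pd i g x)"
			using salg_add D by (intro ext pd_add) auto
		thus ?case using salg_add by (auto intro: salg.salg_add)
	next
		case (salg_mult f g)
		have "pd i (%x. f x * g x) = (%x. f x * pd i g x + pd i f x * g x)"
			using salg_mult D by (intro ext pd_mult) auto
		thus ?case using salg_mult by (auto intro: salg.intros)
	qed (rule p)
	show ?thesis using f D P by (intro smooth_R2_coinduct[of f "Collect (salg B)"]) auto
qed

lemma smooth_const [simp]: "smooth_R2 (%x. c)"
	by (rule smooth_R2_coinduct[of _ "{f. EX c. f = (%x. c)}"]) auto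

lemma smooth_mult: "smooth_R2 f ==> smooth_R2 g ==> smooth_R2 (%x. f x * g x)"
	by (rule salg_smooth[of smooth_R2]) (auto intro: salg.intros smooth_pd smooth_differentiable)

lemma smooth_add: "smooth_R2 f ==> smooth_R2 g ==> smooth_R2 (%x. f x + g x)"
	by (rule salg_smooth[of smooth_R2]) (auto intro: salg.intros smooth_pd smooth_differentiable)

lemma smooth_cmult: "smooth_R2 f ==> smooth_R2 (%x. c * f x)"
	by (intro smooth_mult smooth_const)

lemma smooth_reflect:
	assumes "smooth_R2 f" shows "smooth_R2 (%y. f (a - y))"
proof (rule smooth_R2_coinduct[of _ "{g. EX c h. smooth_R2 h & g = (%y. c * h (a - y))}"])
	show "(%y. f (a - y)) : {g. EX c h. smooth_R2 h & g = (%y. c * h (a - y))}"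
		using assms by (auto intro!: exI[of _ 1] exI[of _ f])
	have d: "(%y. h (a - y)) differentiable (at x)" if "smooth_R2 h" for h x
		using differentiable_chain_at[of "%y. a - y" x h] smooth_differentiable[OF that] by (auto simp: o_def)
	fix g assume "g : {g. EX c h. smooth_R2 h & g = (%y. c * h (a - y))}"
	then obtain c h where h: "smooth_R2 h" and g: "g = (%y. c * h (a - y))" by blast
	show "g differentiable (at x)" for x unfolding g using d[OF h] by auto
	fix i
	have "pd i g = (%y. (- c) * pd i h (a - y))"
		unfolding g using pd_reflect[of h i a] h
		by (intro ext) (simp add: pd_cmult[OF d[OF h]] smooth_differentiable)
	thus "pd i g : {g. EX c h. smooth_R2 h & g = (%y. c * h (a - y))}" using smooth_pd[OF h, of i] by blast
qed

section \<open>A smooth bump and the mollifier kernel\<close>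

definition flat :: "nat => real => real" where
	"flat k t = (if t > 0 then exp (- 1 / t) / t ^ k else 0)"

lemma flat_right: "(flat k \<longlongrightarrow> 0) (at_right 0)"
proof -
	have "((%s::real. s ^ k / exp s) \<longlongrightarrow> 0) at_top" by (rule tendsto_power_div_exp_0)
	hence "((%t::real. inverse t ^ k / exp (inverse t)) \<longlongrightarrow> 0) (at_right 0)"
		by (rule filterlim_compose[OF _ filterlim_inverse_at_top_right])
	moreover have "\<forall>\<^sub>F t in at_right 0. inverse t ^ k / exp (inverse t) = flat k t"
		unfolding eventually_at_filter
		by (auto intro!: always_eventually simp: flat_def exp_minus field_simps)
	ultimately show ?thesis by (rule Lim_transform_eventually)
qed

text \<open>The family exp (-1/t) / t^k, extended by zero, is closed under differentiation up to
  linear combinations. This gives smoothness of the case k = 0 without a formula for higher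
  derivatives. At 0 the right difference quotient of \<open>flat k\<close> is
  \<open>flat (k + 1)\<close>.\<close>

lemma flat_deriv: "(flat k has_real_derivative (flat (k + 2) t - k * flat (k + 1) t)) (at t)"
proof -
	consider "t > 0" | "t < 0" | "t = 0" by linarith
	thus ?thesis
	proof cases
		case 1
		have "((%t. exp (- 1 / t) / t ^ k) has_real_derivative
			(exp (- 1 / t) * (1 / t^2) * t ^ k - exp (- 1 / t) * (k * t ^ (k - 1))) / (t ^ k * t ^ k)) (at t)"
			using 1 by (auto intro!: derivative_eq_intros simp: power2_eq_square)
		moreover have "(exp (- 1 / t) * (1 / t^2) * t ^ k - exp (- 1 / t) * (k * t ^ (k - 1))) / (t ^ k * t ^ k)
			= flat (k + 2) t - k * flat (k + 1) t"
			using 1 by (cases k) (auto simp: flat_def field_simps power2_eq_square)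
		moreover have "\<forall>\<^sub>F s in nhds t. exp (- 1 / s) / s ^ k = flat k s"
			using eventually_nhds_in_open[of "{0<..}" t] 1 by (auto simp: flat_def elim!: eventually_mono)
		ultimately show ?thesis by (subst DERIV_cong_ev[OF refl _ refl, of _ "%t. exp (- 1 / t) / t ^ k"])
				(auto elim!: eventually_mono)
	next
		case 2
		have "\<forall>\<^sub>F s in nhds t. flat k s = 0"
			using eventually_nhds_in_open[of "{..<0}" t] 2 by (auto simp: flat_def elim!: eventually_mono)
		thus ?thesis using 2 by (subst DERIV_cong_ev[OF refl _ refl, of _ "%t. 0"]) (auto simp: flat_def)
	next
		case 3
		have "((%h. flat k h / h) \<longlongrightarrow> 0) (at 0)"
			proof (rule filterlim_split_at)
			have "\<forall>\<^sub>F h in at_left 0. flat k h / h = 0"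
				unfolding eventually_at_filter by (auto intro!: always_eventually simp: flat_def)
			thus "((%h. flat k h / h) \<longlongrightarrow> 0) (at_left 0)"
				by (intro tendsto_eventually)
			have "\<forall>\<^sub>F h in at_right 0. flat (k + 1) h = flat k h / h"
				unfolding eventually_at_filter by (auto intro!: always_eventually simp: flat_def)
			thus "((%h. flat k h / h) \<longlongrightarrow> 0) (at_right 0)"
				by (rule Lim_transform_eventually[OF flat_right])
		qed
		thus ?thesis using 3 by (simp add: DERIV_def flat_def)
	qed
qed

definition bump0 :: "real => real^2 => real" where
	"bump0 e x = flat 0 (e^2 - (norm x)^2)"

lemma smooth_bump0: "smooth_R2 (bump0 e)"
proof -
	\<comment> \<open>Differentiation raises k and produces factors x_i, so the generators are all
	  radial profiles together with constants and coordinates.\<close>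
	define B where "B g \<longleftrightarrow> (EX k. g = (%x::real^2. flat k (e^2 - (norm x)^2))) \<or> (EX c. g = (%x. c)) \<or> (EX j. g = (%x. x $ j))" for g
	have hd: "((%x::real^2. flat k (e^2 - (norm x)^2)) has_derivative
		 (%h. - (2 * (x \<bullet> h)) * (flat (k + 2) (e^2 - (norm x)^2) - k * flat (k + 1) (e^2 - (norm x)^2)))) (at x)" for k x
	proof -
		have "((%x::real^2. e^2 - x \<bullet> x) has_derivative (%h. - (2 * (x \<bullet> h)))) (at x)"
			by (auto intro!: derivative_eq_intros simp: inner_commute)
		from DERIV_compose_FDERIV[OF flat_deriv this] show ?thesis
			by (simp add: power2_norm_eq_inner mult.commute)
	qed
	show ?thesis
	proof (rule salg_smooth[of B])
		fix g x assume "B g"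
		thus "g differentiable (at x)"
			unfolding B_def using hd by (auto simp: differentiable_def
					intro: bounded_linear_imp_has_derivative bounded_linear_vec_nth has_derivative_const)
	next
		fix g i assume "B g"
		then consider k where "g = (%x::real^2. flat k (e^2 - (norm x)^2))" | "(EX c. g = (%x. c)) \<or> (EX j. g = (%x. x $ j))"
			unfolding B_def by blast
		thus "salg B (pd i g)"
		proof cases
			case 1
			have "pd i g = (%x. (-2) * x $ i * (flat (k + 2) (e^2 - (norm x)^2) + (- real k) * flat (k + 1) (e^2 - (norm x)^2)))"
				unfolding 1 by (rule ext, subst pd_eqI[OF hd]) (simp add: inner_axis)
			moreover have "salg B (%x. (-2) * x $ i * (flat (k + 2) (e^2 - (norm x)^2) + (- real k) * flat (k + 1) (e^2 - (norm x)^2)))"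
				by (intro salg_mult salg_add; rule salg_base; auto simp: B_def)
			ultimately show ?thesis by simp
		next
			case 2
			hence "EX c. pd i g = (%x. c)" by (auto simp: pd_coord)
			thus ?thesis by (intro salg_base) (auto simp: B_def)
		qed
	next
		show "salg B (bump0 e)"
			unfolding bump0_def[abs_def] by (intro salg_base) (auto simp: B_def)
	qed
qed

lemma bump0_nonneg: "0 <= bump0 e x"
	by (simp add: bump0_def flat_def)

lemma bump0_eq_0: "e > 0 ==> norm x >= e ==> bump0 e x = 0"
	using power_mono[of e "norm x" 2] by (simp add: bump0_def flat_def not_less)

definition smooth_cs :: "(real^2 => real) => bool" where
	"smooth_cs f \<longleftrightarrow> smooth_R2 f & (EX R. ALL x. norm x > R --> f x = 0)"

lemma smooth_cs_smooth: "smooth_cs f ==> smooth_R2 f"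
	by (simp add: smooth_cs_def)

lemma pd_eq_0: assumes "open A" "x : A" "!!y. y : A ==> f y = 0" shows "pd i f x = 0"
proof -
	have "(f has_derivative (%h. 0)) (at x)"
		by (rule has_derivative_transform_within_open[of "%x. 0" _ _ _ A]) (use assms in auto)
	thus ?thesis by (simp add: pd_eqI)
qed

lemma smooth_cs_pd: assumes "smooth_cs f" shows "smooth_cs (pd i f)"
proof -
	obtain R where R: "!!x. norm x > R ==> f x = 0" using assms by (auto simp: smooth_cs_def)
	have "pd i f x = 0" if "norm x > R" for x
		by (rule pd_eq_0[of "{y. norm y > R}"]) (use R that in \<open>auto intro!: open_Collect_less continuous_intros\<close>)
	thus ?thesis using assms by (auto simp: smooth_cs_def intro: smooth_pd)
qed

lemma cont_cs_bounded:
	assumes "continuous_on UNIV f" "!!x::real^2. norm x > R ==> f x = (0::real)"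
	obtains C where "C > 0" "!!x. abs (f x) <= C"
proof -
	have "compact (f ` cball 0 R)" using assms(1) by (intro compact_continuous_image) (auto intro: continuous_on_subset)
	then obtain C where C: "!!y. y : f ` cball 0 R ==> norm y <= C" using compact_imp_bounded bounded_iff by metis
	have "abs (f x) <= max C 1" for x
	proof (cases "norm x > R")
		case False
		hence "abs (f x) <= C" using C[of "f x"] by simp
		thus ?thesis by simp
	qed (use assms(2)[of x] in simp)
	thus thesis using that[of "max C 1"] by auto
qed

lemma smooth_cs_bounded: assumes "smooth_cs f" obtains C where "C > 0" "!!x. abs (f x) <= C"
	using assms cont_cs_bounded[of f] unfolding smooth_cs_def by (metis smooth_continuous_on)

lemma norm_vec2_le: "norm (v::real^2) <= abs (v $ 1) + abs (v $ 2)"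
	using norm_le_l1_cart[of v] by (simp add: sum_2)

lemma lipschitz_of_grad:
	assumes "!!x. f differentiable (at x)" "!!x. norm (grad f x) <= L"
	shows "abs (f x - f y) <= L * norm (x - y)"
proof -
	have "norm (f x - f y) <= L * norm (x - y)"
	proof (rule differentiable_bound[of UNIV f "%x h. grad f x \<bullet> h"])
		show "onorm ((\<bullet>) (grad f x)) <= L" for x
			by (rule onorm_bound) (use assms(2)[of x] order_trans[OF norm_ge_zero assms(2)] in
					\<open>auto intro!: order_trans[OF Cauchy_Schwarz_ineq2] mult_right_mono\<close>)
	qed (use assms grad_has_derivative in auto)
	thus ?thesis by simp
qed

lemma smooth_cs_lipschitz:
	assumes "smooth_cs f" obtains L where "L > 0" "!!x y. abs (f x - f y) <= L * norm (x - y)"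
proof -
	obtain C1 where C1: "C1 > 0" "!!x. abs (pd 1 f x) <= C1" using smooth_cs_bounded[OF smooth_cs_pd[OF assms]] by metis
	obtain C2 where C2: "C2 > 0" "!!x. abs (pd 2 f x) <= C2" using smooth_cs_bounded[OF smooth_cs_pd[OF assms]] by metis
	have "norm (grad f x) <= C1 + C2" for x
		using norm_vec2_le[of "grad f x"] C1(2)[of x] C2(2)[of x] by (simp add: grad_def)
	hence "abs (f x - f y) <= (C1 + C2) * norm (x - y)" for x y
		by (intro lipschitz_of_grad) (use assms in \<open>auto simp: smooth_cs_def smooth_differentiable\<close>)
	thus thesis using that[of "C1 + C2"] C1(1) C2(1) by auto
qed

text \<open>The remainder is quadratic uniformly in x, so it can be integrated against an L^1
  function when a convolution is differentiated.\<close>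

lemma smooth_cs_taylor:
	assumes "smooth_cs f"
	obtains L where "L >= 0" "!!x h. abs (f (x + h) - f x - grad f x \<bullet> h) <= L * (norm h)^2"
proof -
	obtain L1 where L1: "L1 > 0" "!!x y. abs (pd 1 f x - pd 1 f y) <= L1 * norm (x - y)"
		using smooth_cs_lipschitz[OF smooth_cs_pd[OF assms]] by metis
	obtain L2 where L2: "L2 > 0" "!!x y. abs (pd 2 f x - pd 2 f y) <= L2 * norm (x - y)"
		using smooth_cs_lipschitz[OF smooth_cs_pd[OF assms]] by metis
	define L where "L = L1 + L2"
	have gl: "norm (grad f x - grad f y) <= L * norm (x - y)" for x y
		using norm_vec2_le[of "grad f x - grad f y"] L1(2)[of x y] L2(2)[of x y]
		by (simp add: grad_def L_def algebra_simps)
	have "abs (f (x + h) - f x - grad f x \<bullet> h) <= L * (norm h)^2" for x h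
	proof -
		define g where "g y = f y - grad f x \<bullet> y" for y
		have "norm (g (x + h) - g x) <= (L * norm h) * norm ((x + h) - x)"
		proof (rule differentiable_bound[of "cball x (norm h)" g "%y k. (grad f y - grad f x) \<bullet> k"])
			fix y assume y: "y : cball x (norm h)"
			have "((%y. f y - grad f x \<bullet> y) has_derivative (%k. grad f y \<bullet> k - grad f x \<bullet> k)) (at y)"
				using assms by (intro has_derivative_diff grad_has_derivative)
					(auto simp: smooth_cs_def smooth_differentiable intro!: derivative_eq_intros)
			thus "(g has_derivative (%k. (grad f y - grad f x) \<bullet> k)) (at y within cball x (norm h))"
				unfolding g_def by (auto simp: inner_diff_left intro: has_derivative_at_withinI)
			have "norm (grad f y - grad f x) <= L * norm (y - x)" by (rule gl)
			also have "... <= L * norm h" using y L1 L2 by (intro mult_left_mono) (auto simp: L_def dist_norm norm_minus_commute)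
			finally have *: "norm (grad f y - grad f x) <= L * norm h" .
			show "onorm ((\<bullet>) (grad f y - grad f x)) <= L * norm h"
				by (rule onorm_bound) (use * order_trans[OF norm_ge_zero *] in
						\<open>auto intro!: order_trans[OF Cauchy_Schwarz_ineq2] mult_right_mono\<close>)
		qed (auto simp: dist_norm)
		thus ?thesis by (simp add: g_def inner_add_right power2_eq_square algebra_simps)
	qed
	thus thesis using that[of L] L1(1) L2(1) by (auto simp: L_def)
qed

lemma lborel_integral_shift: "(LINT x|lborel. f (x + a)) = (LINT x|lborel. f x)"
	if [measurable]: "f : bm borel" for f :: "real^2 => real"
proof -
	have "(LINT x|lborel. f x) = (\<integral>x. f x \<partial>distr lborel borel ((+) a))" by (simp add: lborel_distr_plus)
	also have "... = (LINT x|lborel. f (a + x))" by (subst integral_distr) auto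
	finally show ?thesis by (simp add: add.commute)
qed

lemma integrable_bounded_support:
	fixes f :: "real^2 => real"
	assumes [measurable]: "f : bm borel" and "!!x. abs (f x) <= C" "!!x. norm x > R ==> f x = 0"
	shows "integrable lborel f"
proof (rule bi_i_bound)
	show "integrable lborel (%x. C * indicator (cball 0 R) x :: real)"
		by (intro integrable_mult_right integrable_real_indicator) (auto simp: emeasure_lborel_cball_finite[unfolded infinity_ennreal_def])
	show "AE x in lborel. norm (f x) <= norm (C * indicator (cball 0 R) x)"
	proof (intro AE_I2)
		fix x show "norm (f x) <= norm (C * indicator (cball 0 R) x)"
			using assms(2)[of x] assms(3)[of x] by (auto simp: indicator_def intro: order_trans[OF _ abs_ge_self])
	qed
qed auto

text \<open>Difference quotients have integral zero by translation invariance; the Lipschitz bound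
  on a fixed ball dominates them in the limit.\<close>

lemma integral_pd_eq_0:
	assumes d: "!!x. f differentiable (at x)" and L: "!!x y. abs (f x - f y) <= L * norm (x - y)"
		and R: "!!x. norm x > R ==> f x = 0"
	shows "(LINT x|lborel. pd i f x) = 0" "integrable lborel (pd i f)"
proof -
	have L0: "L >= 0" using order_trans[OF abs_ge_zero L[of "axis 1 1" 0]] by simp
	have c: "continuous_on UNIV f" using d by (simp add: continuous_at_imp_continuous_on differentiable_imp_continuous_within)
	have [measurable]: "f : bm borel" using c by (rule borel_measurable_continuous_onI)
	obtain C where C: "!!x. abs (f x) <= C" using cont_cs_bounded[OF c R] by metis
	define h where "h n = 1 / real (Suc n)" for n
	have h: "0 < h n" "h n <= 1" for n by (auto simp: h_def)
	have h0: "h ----> 0" unfolding h_def using LIMSEQ_inverse_real_of_nat by (simp add: inverse_eq_divide)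
	define q where "q n x = (f (x + h n *R axis i 1) - f x) / h n" for n x
	have [measurable]: "q n : bm borel" for n unfolding q_def by measurable
	have lim: "(%n. q n x) ----> pd i f x" for x
	proof -
		have "((%t. f (x + t *R axis i 1)) has_derivative (%t. grad f x \<bullet> (t *R axis i 1))) (at 0)"
			by (rule has_derivative_compose[of "%t. x + t *R axis i 1" "%t. t *R axis i 1" 0 UNIV f])
				(auto intro!: derivative_eq_intros grad_has_derivative d)
		hence "((%t. f (x + t *R axis i 1)) has_real_derivative pd i f x) (at 0)"
			by (simp add: has_field_derivative_def inner_axis grad_def mult_commute_abs)
		hence "((%t. (f (x + t *R axis i 1) - f x) / t) \<longlongrightarrow> pd i f x) (at 0)"
			by (simp add: DERIV_def)
		moreover have "filterlim h (at 0) sequentially"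
			using h0 h by (auto simp: filterlim_at intro!: always_eventually) (metis less_irrefl)
		ultimately show ?thesis unfolding q_def by (rule filterlim_compose)
	qed
	have bq: "abs (q n x) <= L" for n x
		using L[of "x + h n *R axis i 1" x] h[of n] by (simp add: q_def field_simps)
	have q0: "q n x = 0" if "norm x > R + 1" for n x
	proof -
		have "norm x - norm (h n *R axis i (1::real)) <= norm (x + h n *R axis i 1)" by (rule norm_diff_ineq)
		hence "norm (x + h n *R axis i 1) > R" using that h[of n] by simp
		thus ?thesis using R[of x] R that by (simp add: q_def)
	qed
	have qi: "(LINT x|lborel. q n x) = 0" for n
	proof -
		have i1: "integrable lborel f" by (rule integrable_bounded_support[OF _ C R]) auto
		have i2: "integrable lborel (%x. f (x + h n *R axis i 1))"
		proof (rule integrable_bounded_support[OF _ C])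
			fix x :: "real^2" assume "R + 1 < norm x"
			thus "f (x + h n *R axis i 1) = 0"
				using norm_diff_ineq[of x "h n *R axis i (1::real)"] h[of n] R by simp
		qed measurable
		show ?thesis unfolding q_def using i1 i2 lborel_integral_shift[of f] by simp
	qed
	have dom: "integrable lborel (%x. L * indicator (cball 0 (R + 1)) x :: real)"
		by (intro integrable_mult_right integrable_real_indicator) (auto simp: emeasure_lborel_cball_finite[unfolded infinity_ennreal_def])
	have bnd: "AE x in lborel. norm (q n x) <= L * indicator (cball 0 (R + 1)) x" for n
	proof (intro AE_I2)
		fix x show "norm (q n x) <= L * indicator (cball 0 (R + 1)) x"
			using bq[of n x] q0[of x n] by (cases "norm x > R + 1") auto
	qed
	have pm: "pd i f : bm lborel"
		by (rule borel_measurable_LIMSEQ_metric[of q]) (auto intro: lim)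
	have "(%n. \<integral>x. q n x \<partial>lborel) ----> (LINT x|lborel. pd i f x)"
		by (rule integral_dominated_convergence[OF pm _ dom]) (use bnd lim in auto)
	thus "(LINT x|lborel. pd i f x) = 0" unfolding qi by (simp add: LIMSEQ_const_iff)
	show "integrable lborel (pd i f)"
	proof (rule integrable_bounded_support[where C = L and R = "R + 1"])
		show "pd i f : bm borel" using pm by simp
		show "abs (pd i f x) <= L" for x
			using bq by (intro LIMSEQ_le_const2[OF tendsto_rabs[OF lim]]) auto
		show "pd i f x = 0" if "R + 1 < norm x" for x
			using lim[of x] q0[OF that] by (simp add: LIMSEQ_const_iff)
	qed
qed

definition kern :: "real => real^2 => real" where
	"kern e x = bump0 e x / (LINT x|lborel. bump0 e x)"

lemma kern_props:
	assumes e: "e > 0"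
	shows "smooth_R2 (kern e)" "0 <= kern e x" "norm x >= e ==> kern e x = 0"
		"(LINT x|lborel. kern e x) = 1" "integrable lborel (kern e)" "kern e (- x) = kern e x" "smooth_cs (kern e)"
proof -
	have cs: "smooth_cs (bump0 e)" using smooth_bump0 bump0_eq_0[OF e] by (auto simp: smooth_cs_def intro!: exI[of _ e])
	have [measurable]: "bump0 e : bm borel" using smooth_bump0 by (rule smooth_borel)
	obtain C where C: "!!x. abs (bump0 e x) <= C" using smooth_cs_bounded[OF cs] by metis
	have int: "integrable lborel (bump0 e)"
		by (rule integrable_bounded_support[OF _ C, where R = e]) (use bump0_eq_0[OF e] in auto)
	have pos: "(LINT x|lborel. bump0 e x) > 0"
	proof (rule ccontr)
		assume "\<not> ?thesis"
		hence "(LINT x|lborel. bump0 e x) = 0" using bi_nonneg[of lborel "bump0 e"] bump0_nonneg by (simp add: antisym)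
		hence "AE x in lborel. bump0 e x = 0"
			using int by (subst (asm) integral_nonneg_eq_0_iff_AE) (auto simp: bump0_nonneg)
		hence "AE x in lborel. x \<notin> ball (0::real^2) e"
		proof (rule AE_mp, intro AE_I2 impI)
			fix x assume "bump0 e x = 0"
			moreover have "bump0 e x > 0" if "norm x < e" using power_strict_mono[OF that, of 2] by (simp add: bump0_def flat_def)
			ultimately show "x \<notin> ball 0 e" by auto
		qed
		hence "emeasure lborel (ball (0::real^2) e) = 0"
			by (subst (asm) AE_iff_measurable[OF _ refl]) (auto simp: ball_def)
		hence "(ball (0::real^2) e) : null_sets lborel" by (auto simp: null_sets_def)
		hence "negligible (ball (0::real^2) e)" using negligible_iff_null_sets null_sets_completion_iff2 by blast
		thus False using e open_not_negligible[of "ball (0::real^2) e"] by auto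
	qed
	show "smooth_R2 (kern e)"
		unfolding kern_def[abs_def] using smooth_cmult[OF smooth_bump0, of "1 / (LINT x|lborel. bump0 e x)"] by simp
	show "0 <= kern e x" using pos by (simp add: kern_def bump0_nonneg)
	show z: "norm x >= e ==> kern e x = 0" for x using bump0_eq_0[OF e] by (simp add: kern_def)
	show "(LINT x|lborel. kern e x) = 1" using pos by (simp add: kern_def)
	show "integrable lborel (kern e)" unfolding kern_def[abs_def] using int by simp
	show "kern e (- x) = kern e x" by (simp add: kern_def bump0_def)
	show "smooth_cs (kern e)" using \<open>smooth_R2 (kern e)\<close> z by (auto simp: smooth_cs_def intro!: exI[of _ e])
qed

lemma kern_borel [measurable]: "e > 0 ==> kern e : bm borel"
	using kern_props(1) smooth_borel by blast

lemma inv_Suc_le: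
	assumes "inverse (real (Suc N)) < e" "n >= N"
	shows "1 / real (Suc n) <= e"
proof -
	have "1 / real (Suc n) <= 1 / real (Suc N)" using assms(2) by (intro divide_left_mono) auto
	thus ?thesis using assms(1) by (simp add: inverse_eq_divide)
qed

section \<open>Mollification on a bounded open set\<close>

locale bdom =
	fixes Om :: "(real^2) set"
	assumes open_dom: "open Om" and bounded_dom: "bounded Om" and nonempty_dom: "Om ~= {}"
begin

abbreviation Hg where "Hg == H1_grad Om"
abbreviation tf where "tf == test_fun Om"
abbreviation M :: "(real^2) measure" where "M \<equiv> lebesgue_on Om"

lemma dom_lmeasurable: "Om : lmeasurable"
	by (rule lmeasurable_open[OF bounded_dom open_dom])

lemma dom_sets [simp]: "Om : sets lebesgue"
	using dom_lmeasurable by (simp add: fmeasurableD)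

sublocale fm: finite_measure M
	by (rule finite_measure_lebesgue_on[OF dom_lmeasurable])

sublocale pm: pair_sigma_finite M M ..

lemma borel_M [intro]: "f : bm borel ==> f : bm M"
	by (intro measurable_restrict_space1 measurable_completion) auto

lemma id_M [measurable]: "(%x. x) : bm M"
	by (rule borel_M) auto

lemma smooth_M [measurable_dest]: "smooth_R2 f ==> f : bm M"
	using smooth_borel by blast

lemma nn_integral_M_le:
	assumes [measurable]: "f : bm borel"
	shows "(nni M (%x. f x)) <= (nni lborel (%x. f x))"
proof -
	have "(nni M (%x. f x)) = (nni lebesgue (%x. f x * indicator Om x))"
		by (rule nn_integral_restrict_space) simp
	also have "... <= (nni lebesgue (%x. f x))" by (intro nn_integral_mono) (auto simp: indicator_def)
	also have "... = (nni lborel (%x. f x))" by (rule nn_integral_completion) 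
	finally show ?thesis .
qed

lemma integral_M_lborel:
	fixes f :: "real^2 => real"
	assumes [measurable]: "f : bm borel" and z: "!!x. x \<notin> Om ==> f x = 0"
	shows "(LINT x|M. f x) = (LINT x|lborel. f x)"
proof -
	have "(LINT x|M. f x) = (LINT x|lebesgue. indicator Om x *R f x)"
		by (rule integral_restrict_space) simp
	also have "(%x. indicator Om x *R f x) = f" using z by (intro ext) (auto split: split_indicator)
	also have "(LINT x|lebesgue. f x) = (LINT x|lborel. f x)" by (rule integral_completion) auto
	finally show ?thesis .
qed

lemma bounded_integrable_M:
	fixes f :: "real^2 => 'a::{banach, second_countable_topology}"
	shows "f : bm M ==> (!!x. norm (f x) <= C) ==> integrable M f"
	by (rule fm.integrable_const_bound[of _ C]) auto

lemma bounded_sqi: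
	fixes f :: "real^2 => 'a::euclidean_space"
	assumes "f : bm M" "!!x. norm (f x) <= C" shows "sqi M f"
proof -
	have "norm ((norm (f x))^2) <= C^2" for x using assms(2)[of x] by (simp add: power_mono)
	thus ?thesis using assms(1) by (auto simp: sqi_def intro!: bounded_integrable_M)
qed

lemma sqi_const [simp]: "sqi M (%x. c)"
	by (rule bounded_sqi[of _ "norm c"]) auto

lemma sqi_imp_integrable:
	fixes f :: "real^2 => real"
	assumes "sqi M f" shows "integrable M f"
	using integrable_ip[OF assms sqi_const[of 1]] by simp

lemma sqi_integrable_norm: "sqi M f ==> integrable M (%x. norm (f x))"
	by (rule sqi_imp_integrable[OF sqi_norm])

lemma sqi_mult_bounded:
	fixes f :: "real^2 => 'a::euclidean_space"
	assumes f: "sqi M f" and [measurable]: "g : bm M" and C: "!!x. x : Om ==> abs (g x) <= C"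
	shows "sqi M (%x. g x *R f x)"
proof (rule sqi_bound[OF f, of _ C])
	show "(%x. g x *R f x) : bm M" using sqi_m[OF f] by measurable
qed (use C in \<open>auto intro!: mult_right_mono\<close>)

text \<open>Convolution of \<open>k\<close> with the extension of \<open>f\<close> by zero: the
  integral runs over the domain, while \<open>x\<close> ranges over the plane.\<close>

definition conv :: "(real^2 => real) => (real^2 => real) => real^2 => real" where
	"conv k f x = (LINT y|M. f y * k (x - y))"

lemma conv_integrable:
	assumes f: "integrable M f" and k: "smooth_cs k"
	shows "integrable M (%y. f y * k (x - y))"
proof -
	obtain C where C: "!!x. abs (k x) <= C" using smooth_cs_bounded[OF k] by metis
	have [measurable]: "k : bm borel" using k by (auto simp: smooth_cs_def)
	show ?thesis
	proof (rule bi_i_bound[OF integrable_mult_right[OF integrable_norm[OF f], of C]])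
		show "AE y in M. norm (f y * k (x - y)) <= norm (C * norm (f y))"
			using C order_trans[OF abs_ge_zero C] by (auto simp: abs_mult mult.commute[of C] intro!: AE_I2 mult_left_mono)
	qed (use borel_measurable_integrable[OF f] in measurable)
qed

lemma conv_has_derivative:
	assumes f: "integrable M f" and k: "smooth_cs k"
	shows "(conv k f has_derivative (%h. \<Sum>i\<in>UNIV. h $ i * conv (pd i k) f x)) (at x)"
proof -
	obtain L where L: "L >= 0" "!!x h. abs (k (x + h) - k x - grad k x \<bullet> h) <= L * (norm h)^2"
		using smooth_cs_taylor[OF k] by metis
	define A where "A = L * (LINT y|M. abs (f y))"
	have A0: "A >= 0" using L by (simp add: A_def)
	note ki = conv_integrable[OF f k] and kpi = conv_integrable[OF f smooth_cs_pd[OF k]]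
	have bl: "bounded_linear (%h::real^2. \<Sum>i\<in>UNIV. h $ i * conv (pd i k) f x)"
		by (intro bounded_linear_sum bounded_linear_mult_const bounded_linear_vec_nth)
	have est: "abs (conv k f y - conv k f x - (\<Sum>i\<in>UNIV. (y - x) $ i * conv (pd i k) f x)) <= A * (norm (y - x))^2" for y
	proof -
		define h where "h = y - x"
		have "conv k f y - conv k f x - (\<Sum>i\<in>UNIV. h $ i * conv (pd i k) f x)
			= (LINT z|M. f z * k (y - z) - f z * k (x - z) - (\<Sum>i\<in>UNIV. h $ i * (f z * pd i k (x - z))))"
			unfolding conv_def using ki kpi by simp
		hence "abs (conv k f y - conv k f x - (\<Sum>i\<in>UNIV. h $ i * conv (pd i k) f x))
			<= (LINT z|M. abs (f z * k (y - z) - f z * k (x - z) - (\<Sum>i\<in>UNIV. h $ i * (f z * pd i k (x - z)))))"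
			by (simp only: integral_abs_bound)
		also have "... <= (LINT z|M. abs (f z) * (L * (norm h)^2))"
		proof (rule integral_mono)
			fix z
			have "f z * k (y - z) - f z * k (x - z) - (\<Sum>i\<in>UNIV. h $ i * (f z * pd i k (x - z)))
				= f z * (k ((x - z) + h) - k (x - z) - grad k (x - z) \<bullet> h)"
				by (simp add: h_def grad_def inner_vec_def sum_2 algebra_simps)
			thus "abs (f z * k (y - z) - f z * k (x - z) - (\<Sum>i\<in>UNIV. h $ i * (f z * pd i k (x - z)))) <= abs (f z) * (L * (norm h)^2)"
				using L(2)[of "x - z" h] by (simp add: abs_mult mult_left_mono)
		qed (use ki kpi f in auto)
		also have "... = A * (norm h)^2" by (simp add: A_def)
		finally show ?thesis by (simp add: h_def)
	qed
	show ?thesis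
	proof (rule has_derivativeI_sandwich[of 1])
		show "((%y. A * norm (y - x)) \<longlongrightarrow> 0) (at x)" by (auto intro!: tendsto_eq_intros)
		show "norm (conv k f y - conv k f x - (\<Sum>i\<in>UNIV. (y - x) $ i * conv (pd i k) f x)) / norm (y - x) <= A * norm (y - x)"
			if "y ~= x" for y
			using est[of y] that by (simp add: field_simps power2_eq_square)
	qed (use bl in auto)
qed

lemma pd_conv: "integrable M f ==> smooth_cs k ==> pd i (conv k f) = conv (pd i k) f"
	by (rule ext, subst pd_eqI[OF conv_has_derivative]) (auto simp: axis_def if_distrib if_distribR cong: if_cong)

lemma conv_smooth:
	assumes f: "integrable M f" and k: "smooth_cs k" shows "smooth_R2 (conv k f)"
proof (rule smooth_R2_coinduct[of _ "{conv k f | k. smooth_cs k}"])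
	show "g differentiable (at x)" if "g : {conv k f | k. smooth_cs k}" for g x
		using that conv_has_derivative[OF f] by (auto simp: differentiable_def)
	show "pd i g : {conv k f | k. smooth_cs k}" if "g : {conv k f | k. smooth_cs k}" for g i
		using that pd_conv[OF f] smooth_cs_pd by auto
qed (use k in auto)

lemma conv_bounded:
	assumes f: "integrable M f" and k: "smooth_cs k"
	obtains C where "!!x. abs (conv k f x) <= C"
proof -
	obtain C where C: "!!x. abs (k x) <= C" using smooth_cs_bounded[OF k] by metis
	have "abs (conv k f x) <= (LINT y|M. abs (f y) * C)" for x
	proof -
		have "abs (conv k f x) <= (LINT y|M. abs (f y * k (x - y)))" unfolding conv_def by (rule integral_abs_bound)
		also have "... <= (LINT y|M. abs (f y) * C)"
			using integrable_abs[OF conv_integrable[OF f k]] f C by (intro integral_mono) (auto simp: abs_mult mult_left_mono)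
		finally show ?thesis .
	qed
	thus thesis by (rule that)
qed

definition mo :: "nat => (real^2 => real) => real^2 => real" where
	"mo n = conv (kern (1 / Suc n))"

lemma kern_n: "smooth_cs (kern (1 / Suc n))" "0 <= kern (1 / Suc n) x"
	"norm x >= 1 / Suc n ==> kern (1 / Suc n) x = 0" "kern (1 / Suc n) (- x) = kern (1 / Suc n) x"
	using kern_props[of "1 / Suc n"] by auto

lemma kern_meas [measurable]: "kern (1 / Suc n) : bm borel"
	by (rule kern_borel) simp

lemma mo_smooth: "integrable M f ==> smooth_R2 (mo n f)"
	unfolding mo_def by (intro conv_smooth kern_n)

lemma mo_integrable: "integrable M f ==> integrable M (mo n f)"
	using conv_bounded[of f "kern (1 / Suc n)"] mo_smooth[of f n] bounded_integrable_M
	by (metis kern_n(1) mo_def real_norm_def smooth_M)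

lemma mo_sqi: "integrable M f ==> sqi M (mo n f)"
	using conv_bounded[of f "kern (1 / Suc n)"] mo_smooth[of f n] bounded_sqi
	by (metis kern_n(1) mo_def real_norm_def smooth_M)

lemma mo_diff: "integrable M f ==> integrable M g ==> mo n (%x. f x - g x) x = mo n f x - mo n g x"
	unfolding mo_def conv_def using conv_integrable[OF _ kern_n(1)]
	by (simp add: left_diff_distrib)

lemma kern_mass_lborel: "(nni lborel (%y. ennreal (kern (1 / Suc n) (x - y)))) = 1"
proof -
	have "(nni lborel (%y. ennreal (kern (1 / Suc n) (x - y)))) = (nni lborel (%y. ennreal (kern (1 / Suc n) (- x + y))))"
		using kern_n(4)[of n "x - _"] by (simp add: algebra_simps)
	also have "... = (\<integral>\<^sup>+y. ennreal (kern (1 / Suc n) y) \<partial>distr lborel borel ((+) (- x)))"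
		by (subst nn_integral_distr) auto
	also have "... = (nni lborel (%y. ennreal (kern (1 / Suc n) y)))" by (simp add: lborel_distr_plus)
	also have "... = ennreal (LINT y|lborel. kern (1 / Suc n) y)"
		using kern_props[of "1 / Suc n"] by (intro nn_integral_eq_integral) auto
	finally show ?thesis using kern_props(4)[of "1 / Suc n"] by simp
qed

lemma kern_mass_le: "(nni M (%y. ennreal (kern (1 / Suc n) (x - y)))) <= 1"
	using nn_integral_M_le[of "%y. ennreal (kern (1 / Suc n) (x - y))"] kern_mass_lborel[of n x] by simp

lemma kern_integrable_M: "integrable M (%y. kern (1 / Suc n) (x - y))"
	using conv_integrable[OF _ kern_n(1), of "%y. 1"] by simp

lemma kern_integral_le: "(LINT y|M. kern (1 / Suc n) (x - y)) <= 1"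
proof -
	have "ennreal (LINT y|M. kern (1 / Suc n) (x - y)) = (nni M (%y. ennreal (kern (1 / Suc n) (x - y))))"
		using kern_integrable_M kern_n(2) by (intro nn_integral_eq_integral[symmetric]) auto
	hence "ennreal (LINT y|M. kern (1 / Suc n) (x - y)) <= ennreal 1" using kern_mass_le[of n x] by simp
	thus ?thesis by (subst (asm) ennreal_le_iff) auto
qed

lemma mo_one:
	assumes "ball x (1 / Suc n) <= A" "A <= Om"
	shows "mo n (indicator A) x = 1"
proof -
	have z: "kern (1 / Suc n) (x - y) = 0" if "y \<notin> A" for y
	proof -
		have "dist x y >= 1 / Suc n" using that assms(1) by (metis mem_ball not_less subsetD)
		thus ?thesis by (intro kern_n) (simp add: dist_norm)
	qed
	have "mo n (indicator A) x = (LINT y|M. kern (1 / Suc n) (x - y))"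
		unfolding mo_def conv_def using z by (intro bi_cong) (auto simp: indicator_def)
	also have "... = (LINT y|lborel. kern (1 / Suc n) (x - y))"
		using z assms(2) by (intro integral_M_lborel) auto
	also have "... = 1"
		using kern_mass_lborel[of n x] kern_n(2) by (intro integral_eq_nn_integral[THEN trans]) auto
	finally show ?thesis .
qed

lemma mo_mono:
	assumes "integrable M f" "integrable M g" "!!y. y : Om ==> f y <= g y" shows "mo n f x <= mo n g x"
	unfolding mo_def conv_def
	using assms kern_n(2) by (intro integral_mono conv_integrable kern_n(1)) (auto intro!: mult_right_mono)

text \<open>Young's inequality by Tonelli. The kernel is symmetric and its mass inside the domain is
  at most 1, hence constant 1.\<close>

lemma mo_L1:
	assumes f: "integrable M f"
	shows "(LINT x|M. abs (mo n f x)) <= (LINT x|M. abs (f x))"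
proof -
	have [measurable]: "f : bm M" using f by simp
	have "ennreal (LINT x|M. abs (mo n f x)) = (nni M (%x. ennreal (abs (mo n f x))))"
		using mo_integrable[OF f] by (intro nn_integral_eq_integral[symmetric]) auto
	also have "... <= (nni M (%x. \<integral>\<^sup>+y. ennreal (abs (f y) * kern (1 / Suc n) (x - y)) \<partial>M))"
	proof (rule nn_integral_mono)
		fix x
		have 1: "abs (mo n f x) <= (LINT y|M. abs (f y) * kern (1 / Suc n) (x - y))"
			unfolding mo_def conv_def using integral_abs_bound[of M "%y. f y * kern (1 / Suc n) (x - y)"] kern_n(2)
			by (simp add: abs_mult)
		have "ennreal (LINT y|M. abs (f y) * kern (1 / Suc n) (x - y)) = (nni M (%y. ennreal (abs (f y) * kern (1 / Suc n) (x - y))))"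
			using conv_integrable[OF integrable_abs[OF f] kern_n(1)] kern_n(2) by (intro nn_integral_eq_integral[symmetric]) auto
		with ennreal_leI[OF 1] show "ennreal (abs (mo n f x)) <= (nni M (%y. ennreal (abs (f y) * kern (1 / Suc n) (x - y))))"
			by simp
	qed
	also have "... = (nni M (%y. \<integral>\<^sup>+x. ennreal (abs (f y) * kern (1 / Suc n) (x - y)) \<partial>M))"
		by (rule pm.Fubini'[symmetric]) measurable
	also have "... <= (nni M (%y. ennreal (abs (f y))))"
	proof (rule nn_integral_mono)
		fix y
		have "(nni M (%x. ennreal (abs (f y) * kern (1 / Suc n) (x - y)))) = ennreal (abs (f y)) * (nni M (%x. ennreal (kern (1 / Suc n) (y - x))))"
			using kern_n(4)[of n "y - _"] kern_n(2) by (subst nn_integral_cmult[symmetric]) (auto simp: ennreal_mult)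
		also have "... <= ennreal (abs (f y)) * 1" by (intro mult_left_mono kern_mass_le) auto
		finally show "(nni M (%x. ennreal (abs (f y) * kern (1 / Suc n) (x - y)))) <= ennreal (abs (f y))" by simp
	qed
	also have "... = ennreal (LINT x|M. abs (f x))" using f by (intro nn_integral_eq_integral) auto
	finally show ?thesis by (subst (asm) ennreal_le_iff) auto
qed

text \<open>Density step: since mollification contracts L^1, convergence passes from approximants
  \<open>g\<close> to \<open>f\<close>.\<close>

lemma mo_approx:
	assumes f: "integrable M f"
		and g: "!!e. e > 0 ==> EX g. integrable M g & (%n. \<integral>x. abs (mo n g x - g x) \<partial>M) ----> 0 & (LINT x|M. abs (f x - g x)) < e"
	shows "(%n. \<integral>x. abs (mo n f x - f x) \<partial>M) ----> 0"
proof (rule LIMSEQ_I)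
	fix e :: real assume "e > 0"
	then obtain g where gi: "integrable M g" and gl: "(%n. \<integral>x. abs (mo n g x - g x) \<partial>M) ----> 0"
		and fg: "(LINT x|M. abs (f x - g x)) < e / 3" using g[of "e / 3"] by auto
	obtain N where N: "!!n. n >= N ==> (LINT x|M. abs (mo n g x - g x)) < e / 3"
		using LIMSEQ_D[OF gl, of "e/3"] \<open>e > 0\<close> by auto
	have "norm ((LINT x|M. abs (mo n f x - f x)) - 0) < e" if "n >= N" for n
	proof -
		have "(LINT x|M. abs (mo n f x - f x)) <= (LINT x|M. abs (mo n (%x. f x - g x) x) + abs (mo n g x - g x) + abs (f x - g x))"
			using f gi mo_integrable[OF f, of n] mo_integrable[OF gi, of n] mo_integrable[of "%x. f x - g x" n]
			by (intro integral_mono) (auto simp: mo_diff)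
		also have "... = (LINT x|M. abs (mo n (%x. f x - g x) x)) + (LINT x|M. abs (mo n g x - g x)) + (LINT x|M. abs (f x - g x))"
			using f gi mo_integrable[OF gi, of n] mo_integrable[of "%x. f x - g x" n] by simp
		also have "... < e"
			using mo_L1[of "%x. f x - g x" n] f gi fg N[OF that] by simp
		finally show ?thesis by simp
	qed
	thus "EX no. ALL n>=no. norm ((LINT x|M. abs (mo n f x - f x)) - 0) < e" by blast
qed

text \<open>With h the mollified indicator, |h - 1_A| = (h - 1_A) + 2 1_A (1 - h), and the integral
  of h does not exceed that of 1_A. Hence only points of A matter, and there h equals 1 as soon as
  the kernel ball fits into A.\<close>

lemma mo_tendsto_open:
	assumes A: "open A" "A <= Om"
	shows "(%n. \<integral>x. abs (mo n (indicator A) x - indicator A x) \<partial>M) ----> 0"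
proof -
	have Am: "indicator A : bm M" using A by (intro borel_M) auto
	have Ai: "integrable M (indicator A :: _ => real)"
		by (rule bounded_integrable_M[OF Am, of 1]) (auto simp: indicator_def)
	define h where "h n = mo n (indicator A)" for n
	have hi: "integrable M (h n)" for n unfolding h_def by (rule mo_integrable[OF Ai])
	have h0: "0 <= h n x" for n x unfolding h_def mo_def conv_def using kern_n(2)
		by (intro bi_nonneg) (auto simp: indicator_def)
	have h1: "h n x <= 1" for n x
	proof -
		have "h n x <= mo n (%x. 1) x" unfolding h_def by (rule mo_mono[OF Ai]) (auto simp: indicator_def)
		also have "... <= 1" unfolding mo_def conv_def using kern_integral_le by simp
		finally show ?thesis .
	qed
	have lim: "(%n. indicator A x * (1 - h n x)) ----> 0" for x
	proof (cases "x : A")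
		case True
		then obtain e where e: "e > 0" "ball x e <= A" using A open_contains_ball by metis
		obtain N where "inverse (real (Suc N)) < e" using reals_Archimedean[OF e(1)] by blast
		hence "1 / real (Suc n) <= e" if "n >= N" for n
			by (rule inv_Suc_le[OF _ that])
		hence "h n x = 1" if "n >= N" for n
			unfolding h_def using that e(2) A by (intro mo_one) (auto dest!: subsetD[OF subset_ball])
		hence "\<forall>\<^sub>F n in sequentially. indicator A x * (1 - h n x) = 0" by (auto intro!: eventually_sequentiallyI)
		thus ?thesis by (rule tendsto_eventually)
	qed simp
	have im: "(%x. indicator A x * (1 - h n x)) : bm M" for n
		using Am hi[of n] by (intro borel_measurable_times borel_measurable_diff) auto
	have ib: "norm (indicator A x * (1 - h n x)) <= 1" for n x
		using h0[of n x] h1[of n x] by (cases "x : A") auto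
	have "(%n. \<integral>x. indicator A x * (1 - h n x) \<partial>M) ----> (LINT x|M. 0)"
	proof (rule integral_dominated_convergence[of _ _ _ "%x. 1"])
		show "AE x in M. norm (indicator A x * (1 - h n x)) <= 1" for n
			using ib by (intro AE_I2)
		show "(%x. indicator A x * (1 - h n x)) : bm M" for n by (rule im)
		show "AE x in M. (%n. indicator A x * (1 - h n x)) ----> 0" using lim by (intro AE_I2)
	qed simp_all
	hence "(%n. 2 * (LINT x|M. indicator A x * (1 - h n x))) ----> 2 * 0" by (intro tendsto_mult_left) simp
	hence t: "(%n. 2 * (LINT x|M. indicator A x * (1 - h n x))) ----> 0" by simp
	show ?thesis
	proof (rule tendsto_sandwich[OF _ _ tendsto_const t])
		have "(LINT x|M. abs (h n x - indicator A x)) <= 2 * (LINT x|M. indicator A x * (1 - h n x))" for n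
		proof -
			have i2: "integrable M (%x. indicator A x * (1 - h n x))"
				by (rule bounded_integrable_M[OF im ib])
			have "(LINT x|M. abs (h n x - indicator A x)) = (LINT x|M. (h n x - indicator A x) + 2 * (indicator A x * (1 - h n x)))"
			proof (intro bi_cong refl)
				fix x show "abs (h n x - indicator A x) = (h n x - indicator A x) + 2 * (indicator A x * (1 - h n x))"
					using h0[of n x] h1[of n x] by (cases "x : A") auto
			qed
			also have "... = (LINT x|M. h n x) - (LINT x|M. indicator A x) + 2 * (LINT x|M. indicator A x * (1 - h n x))"
				using hi Ai i2 by simp
			finally show ?thesis
				using mo_L1[OF Ai, of n] h0 unfolding h_def by (simp add: abs_of_nonneg)
		qed
		thus "\<forall>\<^sub>F n in sequentially. (LINT x|M. abs (mo n (indicator A) x - indicator A x)) <= 2 * (LINT x|M. indicator A x * (1 - h n x))"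
			by (simp add: h_def)
	qed simp
qed

text \<open>Open sets are settled by \<open>mo_tendsto_open\<close>; outer regularity reaches
  measurable sets, and induction over integrable functions does the rest.\<close>

lemma mo_tendsto_L1:
	assumes "integrable M f"
	shows "(%n. \<integral>x. abs (mo n f x - f x) \<partial>M) ----> 0"
	using assms
proof (induction rule: integrable_induct)
	case (base A c)
	have A: "A <= Om" "A : sets lebesgue"
		using base(1) by (auto simp: sets_restrict_space)
	have Ai: "integrable M (indicator A :: _ => real)" using base by auto
	have *: "(%n. \<integral>x. abs (mo n (indicator A) x - indicator A x) \<partial>M) ----> 0"
	proof (rule mo_approx[OF Ai])
		fix e :: real assume "e > 0"
		then obtain T where T: "open T" "A <= T" "(T - A) : lmeasurable" "emeasure lebesgue (T - A) < ennreal e"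
			using sets_lebesgue_outer_open[OF A(2)] by metis
		define U where "U = T \<inter> Om"
		have U: "open U" "U <= Om" "A <= U" using T open_dom A by (auto simp: U_def)
		have Ui: "integrable M (indicator U :: _ => real)"
			by (rule bounded_integrable_M[of _ 1]) (use U in \<open>auto simp: indicator_def intro!: borel_M\<close>)
		have UA: "U - A : sets M" using U A open_dom by (auto simp: sets_restrict_space intro!: image_eqI[of _ _ "U - A"])
		have UO: "(U - A) \<inter> Om = U - A" using U by auto
		have "(LINT x|M. abs (indicator A x - indicator U x)) = (LINT x|M. (indicator (U - A) x :: real))"
			using U by (intro bi_cong) (auto simp: indicator_def)
		also have "... = measure M (U - A)" using UA UO by simp
		also have "... = measure lebesgue (U - A)"
			using UA U A by (intro measure_restrict_space) (auto simp: sets_restrict_space)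
		also have "... < e"
		proof -
			have "emeasure lebesgue (U - A) <= emeasure lebesgue (T - A)"
				using T(3) by (intro emeasure_mono) (auto simp: U_def fmeasurableD)
			hence "emeasure lebesgue (U - A) < ennreal e" using T(4) by simp
			thus ?thesis unfolding measure_def using \<open>e > 0\<close>
				by (metis enn2real_less_iff ennreal_enn2real_if ennreal_less_iff ennreal_less_top enn2real_nonneg order_less_trans infinity_ennreal_def top.not_eq_extremum)
		qed
		finally show "EX g. integrable M g & (%n. \<integral>x. abs (mo n g x - g x) \<partial>M) ----> 0 & (LINT x|M. abs (indicator A x - g x)) < e"
			using Ui mo_tendsto_open[OF U(1,2)] by blast
	qed
	have "(%n. abs c * (LINT x|M. abs (mo n (indicator A) x - indicator A x))) ----> abs c * 0"
		by (intro tendsto_mult_left *)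
	moreover have "abs (mo n (%x. indicator A x *R c) x - indicator A x *R c) = abs c * abs (mo n (indicator A) x - indicator A x)" for n x
	proof -
		have "mo n (%x. indicator A x *R c) x = c * mo n (indicator A) x"
			unfolding mo_def conv_def by (simp add: mult.commute[of _ c] mult.assoc)
		thus ?thesis by (simp add: abs_mult[symmetric] algebra_simps)
	qed
	ultimately show ?case by simp
next
	case (add f g)
	show ?case
	proof (rule tendsto_sandwich[OF _ _ tendsto_const])
		show "(%n. (LINT x|M. abs (mo n f x - f x)) + (LINT x|M. abs (mo n g x - g x))) ----> 0"
			using tendsto_add[OF add(3) add(4)] by simp
		have "(LINT x|M. abs (mo n (%x. f x + g x) x - (f x + g x))) <= (LINT x|M. abs (mo n f x - f x)) + (LINT x|M. abs (mo n g x - g x))" for n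
		proof -
			have e: "mo n (%x. f x + g x) x = mo n f x + mo n g x" for x
				unfolding mo_def conv_def using conv_integrable[OF _ kern_n(1)] add(1,2) by (simp add: distrib_right)
			have "(LINT x|M. abs (mo n (%x. f x + g x) x - (f x + g x))) <= (LINT x|M. abs (mo n f x - f x) + abs (mo n g x - g x))"
				unfolding e using add(1,2) mo_integrable[OF add(1), of n] mo_integrable[OF add(2), of n] by (intro integral_mono) auto
			also have "... = (LINT x|M. abs (mo n f x - f x)) + (LINT x|M. abs (mo n g x - g x))"
				using add(1,2) mo_integrable[OF add(1), of n] mo_integrable[OF add(2), of n] by simp
			finally show ?thesis .
		qed
		thus "\<forall>\<^sub>F n in sequentially. (LINT x|M. abs (mo n (%x. f x + g x) x - (f x + g x)))
			<= (LINT x|M. abs (mo n f x - f x)) + (LINT x|M. abs (mo n g x - g x))" by simp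
	qed simp
next
	case (lim f s)
	show ?case
	proof (rule mo_approx[OF lim(4)])
		fix e :: real assume "e > 0"
		have "(%i. \<integral>x. abs (f x - s i x) \<partial>M) ----> (LINT x|M. 0)"
		proof (rule integral_dominated_convergence[of _ _ _ "%x. 3 * abs (f x)"])
			have "abs (f x - s i x) <= 3 * abs (f x)" if "x : Om" for i x using lim(3)[of x i] that by simp
			thus "AE x in M. norm (abs (f x - s i x)) <= 3 * abs (f x)" for i by (intro AE_I2) simp
			show "AE x in M. (%i. abs (f x - s i x)) ----> 0"
				proof (intro AE_I2 tendsto_rabs_zero)
				fix x assume "x : space M"
				from tendsto_diff[OF tendsto_const lim(2)[OF this], of "f x"] show "(%i. f x - s i x) ----> 0" by simp
			qed
		qed (use lim(1,4) in auto)
		from LIMSEQ_D[OF this \<open>e > 0\<close>] obtain i where "(LINT x|M. abs (f x - s i x)) < e" by force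
		thus "EX g. integrable M g & (%n. \<integral>x. abs (mo n g x - g x) \<partial>M) ----> 0 & (LINT x|M. abs (f x - g x)) < e"
			using lim(1,5) by blast
	qed
qed

lemma mo_L2:
	assumes f: "sqi M f"
	shows "n2 M (mo n f) <= n2 M f"
proof -
	have [measurable]: "f : bm M" using f by (rule sqi_m)
	have fi: "integrable M f" and f2: "integrable M (%x. (f x)^2)" using sqi_imp_integrable[OF f] sqi_integrable[OF f] by auto
	obtain C where C: "!!x. abs (kern (1 / Suc n) x) <= C" using smooth_cs_bounded[OF kern_n(1)] by metis
	have pw: "(mo n f x)^2 <= mo n (%x. (f x)^2) x" for x
	proof -
		\<comment> \<open>Splitting the kernel as k * k and applying Cauchy-Schwarz is Jensen's inequality
		  for a kernel of mass at most 1.\<close>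
		define k where "k y = sqrt (kern (1 / Suc n) (x - y))" for y
		have [measurable]: "k : bm M" unfolding k_def by measurable
		have kb: "abs (k y) <= sqrt C" for y
			using C[of "x - y"] kern_n(2)[of n "x - y"] by (simp add: k_def)
		have ks: "sqi M k" using kb by (intro bounded_sqi[of _ "sqrt C"]) auto
		have fk: "sqi M (%y. k y *R f y)" using kb by (intro sqi_mult_bounded[OF f]) auto
		have kk: "k y * k y = kern (1 / Suc n) (x - y)" for y using kern_n(2) by (simp add: k_def)
		have "mo n f x = ip M (%y. k y *R f y) k"
			unfolding mo_def conv_def ip_def kk[symmetric] by (simp add: mult_ac)
		hence "abs (mo n f x) <= abs (n2 M (%y. k y *R f y) * n2 M k)"
			using ip_Cauchy_Schwarz[OF fk ks] by simp
		hence "(mo n f x)^2 <= (n2 M (%y. k y *R f y) * n2 M k)^2"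
			by (simp only: abs_le_square_iff)
		also have "... = mo n (%x. (f x)^2) x * (LINT y|M. kern (1 / Suc n) (x - y))"
			unfolding power_mult_distrib n2_sq ip_def mo_def conv_def kk[symmetric]
			by (simp add: power2_eq_square mult_ac)
		also have "... <= mo n (%x. (f x)^2) x * 1"
			unfolding mo_def conv_def using kern_integral_le kern_n(2)
			by (intro mult_left_mono bi_nonneg) auto
		finally show ?thesis by simp
	qed
	have "ip M (mo n f) (mo n f) <= (LINT x|M. mo n (%x. (f x)^2) x)"
		unfolding ip_self using pw sqi_integrable[OF mo_sqi[OF fi]] mo_integrable[OF f2] by (intro integral_mono) auto
	also have "... <= (LINT x|M. abs (mo n (%x. (f x)^2) x))" using mo_integrable[OF f2] by (intro integral_mono) auto
	also have "... <= ip M f f" unfolding ip_self using mo_L1[OF f2] by simp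
	finally show ?thesis unfolding n2_def by (rule real_sqrt_le_mono)
qed

text \<open>For the truncation \<open>c k\<close> the mollification error is at most 2k pointwise,
  so its square is at most 2k times its modulus and L^1 convergence suffices. The truncation error
  is contracted by \<open>mo_L2\<close>.\<close>

lemma mo_tendsto_L2:
	assumes f: "sqi M f"
	shows "(%n. n2 M (%x. mo n f x - f x)) ----> 0"
proof (rule LIMSEQ_I)
	fix e :: real assume e: "e > 0"
	have [measurable]: "f : bm M" using f by (rule sqi_m)
	define c where "c k x = max (- real k) (min (real k) (f x))" for k x
	have cm [measurable]: "c k : bm M" for k unfolding c_def by measurable
	have cb: "abs (c k x) <= real k" for k x by (auto simp: c_def)
	have cs: "sqi M (c k)" for k using cb by (intro bounded_sqi[of _ "real k"]) auto
	have "(%k. \<integral>x. (norm (f x - c k x))^2 \<partial>M) ----> (LINT x|M. 0)"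
	proof (rule integral_dominated_convergence[of _ _ _ "%x. (norm (f x))^2"])
		have "(norm (f x - c k x))^2 <= (norm (f x))^2" for k x
			by (intro power_mono) (auto simp: c_def max_def min_def abs_real_def)
		thus "AE x in M. norm ((norm (f x - c k x))^2) <= (norm (f x))^2" for k by simp
		have "\<forall>\<^sub>F k in sequentially. (norm (f x - c k x))^2 = 0" for x
		proof -
			obtain N where N: "abs (f x) <= real N" using real_arch_simple by blast
			show ?thesis by (rule eventually_sequentiallyI[of N]) (use N in \<open>auto simp: c_def max_def min_def\<close>)
		qed
		thus "AE x in M. (%k. (norm (f x - c k x))^2) ----> 0" by (intro AE_I2 tendsto_eventually)
	qed (use sqi_integrable[OF f] in auto)
	hence "(%k. sqrt (LINT x|M. (norm (f x - c k x))^2)) ----> sqrt 0" by (intro tendsto_real_sqrt) simp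
	hence "(%k. n2 M (%x. f x - c k x)) ----> 0" by (simp add: n2_def ip_self)
	then obtain k where k: "n2 M (%x. f x - c k x) < e / 3"
		using LIMSEQ_D[of _ 0 "e/3"] e by fastforce
	have ci: "integrable M (c k)" and fi: "integrable M f" by (rule sqi_imp_integrable[OF cs]) (rule sqi_imp_integrable[OF f])
	have "(%n. sqrt (2 * real k * (LINT x|M. abs (mo n (c k) x - c k x)))) ----> sqrt (2 * real k * 0)"
		by (intro tendsto_real_sqrt tendsto_mult_left mo_tendsto_L1 ci)
	then obtain N where N: "!!n. n >= N ==> sqrt (2 * real k * (LINT x|M. abs (mo n (c k) x - c k x))) < e / 3"
		using LIMSEQ_D[of _ 0 "e/3"] e by fastforce
	have "norm (n2 M (%x. mo n f x - f x) - 0) < e" if n: "n >= N" for n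
	proof -
		have s: "sqi M (mo n f)" "sqi M (mo n (c k))" "sqi M (%x. mo n (c k) x - c k x)"
			using mo_sqi[OF fi] mo_sqi[OF ci] cs by auto
		have mb: "abs (mo n (c k) x) <= real k" for x
		proof -
			have *: "mo n (%x. real k) x <= real k"
				unfolding mo_def conv_def using mult_left_mono[OF kern_integral_le, of "real k" n x] by simp
			have "mo n (c k) x <= mo n (%x. real k) x" "mo n (%x. - c k x) x <= mo n (%x. real k) x"
				using ci cb[of k] by (auto intro!: mo_mono simp: abs_le_iff)
			moreover have "mo n (%x. - c k x) x = - mo n (c k) x" by (simp add: mo_def conv_def)
			ultimately show ?thesis using * by linarith
		qed
		have "ip M (%x. mo n (c k) x - c k x) (%x. mo n (c k) x - c k x) <= (LINT x|M. 2 * real k * abs (mo n (c k) x - c k x))"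
			unfolding ip_self
		proof (rule integral_mono)
			show "(norm (mo n (c k) x - c k x))^2 <= 2 * real k * abs (mo n (c k) x - c k x)" for x
			proof -
				have "abs (mo n (c k) x - c k x) <= 2 * real k" using mb[of x] cb[of k x] by linarith
				from mult_right_mono[OF this abs_ge_zero[of "mo n (c k) x - c k x"]]
				show ?thesis by (simp add: power2_eq_square)
			qed
		qed (use sqi_integrable[OF s(3)] ci mo_integrable[OF ci] in auto)
		hence "n2 M (%x. mo n (c k) x - c k x) <= sqrt (2 * real k * (LINT x|M. abs (mo n (c k) x - c k x)))"
			unfolding n2_def by (intro real_sqrt_le_mono) simp
		hence 1: "n2 M (%x. mo n (c k) x - c k x) < e / 3" using N[OF n] by linarith
		have "n2 M (mo n (%x. f x - c k x)) < e / 3" using mo_L2[OF sqi_diff[OF f cs], of n k] k by linarith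
		moreover have "mo n (%x. f x - c k x) = (%x. mo n f x - mo n (c k) x)"
			by (rule ext) (rule mo_diff[OF fi ci])
		ultimately have 2: "n2 M (%x. mo n f x - mo n (c k) x) < e / 3" by simp
		have "n2 M (%x. mo n f x - f x) <= n2 M (%x. mo n f x - mo n (c k) x) + (n2 M (%x. mo n (c k) x - c k x) + n2 M (%x. c k x - f x))"
			using n2_triangle3[OF s(1) s(2) f] n2_triangle3[OF s(2) cs[of k] f] by linarith
		thus ?thesis using 1 2 k n2_minus_commute[of M "c k" f] by simp
	qed
	thus "EX no. ALL n>=no. norm (n2 M (%x. mo n f x - f x) - 0) < e" by blast
qed

lemma kern_test_fun:
	assumes "cball x (1 / Suc n) <= Om"
	shows "tf (%y. kern (1 / Suc n) (x - y))"
proof -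
	have "{y. kern (1 / Suc n) (x - y) ~= 0} <= cball x (1 / Suc n)"
		using kern_n(3)[of n "x - _"] by (force simp: dist_norm)
	hence "closure {y. kern (1 / Suc n) (x - y) ~= 0} <= cball x (1 / Suc n)" by (simp add: closure_minimal)
	moreover hence "compact (closure {y. kern (1 / Suc n) (x - y) ~= 0})"
		by (meson bounded_cball bounded_subset closed_closure compact_eq_bounded_closed)
	ultimately show ?thesis
		unfolding test_fun_def using smooth_reflect[OF smooth_cs_smooth[OF kern_n(1)]] assms by auto
qed

lemma dom_ball:
	assumes "x : Om" obtains N where "!!n. n >= N ==> cball x (1 / Suc n) <= Om"
proof -
	obtain e where e: "e > 0" "cball x e <= Om" using assms open_dom open_contains_cball by metis
	obtain N where "inverse (real (Suc N)) < e" using reals_Archimedean[OF e(1)] by blast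
	hence "1 / real (Suc n) <= e" if "n >= N" for n
		by (rule inv_Suc_le[OF _ that])
	hence "cball x (1 / Suc n) <= Om" if "n >= N" for n using that e(2) subset_cball by blast
	thus thesis by (rule that)
qed

text \<open>At a point of the domain the mollification is an integral of f against a test function
  once the kernel ball fits, hence zero; a subsequence of the mollifications tends to f almost
  everywhere.\<close>

lemma fundamental_lemma:
	assumes f: "integrable M f" and z: "!!ph. tf ph ==> (LINT x|M. f x * ph x) = 0"
	shows "AE x in M. f x = 0"
proof -
	have "(%n. \<integral>x. norm (mo n f x - f x) \<partial>M) ----> 0" using mo_tendsto_L1[OF f] by simp
	from tendsto_L1_AE_subseq[OF bi_i_diff[OF mo_integrable[OF f] f] this]
	obtain r :: "nat => nat" where r: "strict_mono r" "AE x in M. (%n. mo (r n) f x - f x) ----> 0" by blast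
	from r(2) show ?thesis
	proof (rule AE_mp, intro AE_I2 impI)
		fix x assume x: "x : space M" and l: "(%n. mo (r n) f x - f x) ----> 0"
		obtain N where N: "!!n. n >= N ==> cball x (1 / Suc n) <= Om" using dom_ball x by auto
		have "mo (r n) f x - f x = - f x" if "n >= N" for n
		proof -
			have "r n >= N" using seq_suble[OF r(1), of n] that by linarith
			thus ?thesis using z[OF kern_test_fun[OF N]] by (simp add: mo_def conv_def)
		qed
		hence "(%n. mo (r n) f x - f x) ----> - f x"
			by (intro tendsto_eventually eventually_sequentiallyI[of N])
		with l show "f x = 0" using LIMSEQ_unique by force
	qed
qed

end

section \<open>Pairs of functions and weakly closed subspaces\<close>

lemma sqi_Pair_iff: "sqi M (%x. (f x, g x)) \<longleftrightarrow> sqi M f & sqi M g"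
proof
	assume a: "sqi M (%x. (f x, g x))"
	have m: "f : bm M" "g : bm M"
		using borel_measurable_continuous_on[OF continuous_on_fst[OF continuous_on_id] sqi_m[OF a]]
			borel_measurable_continuous_on[OF continuous_on_snd[OF continuous_on_id] sqi_m[OF a]] by simp_all
	have "norm (f x) <= 1 * norm (f x, g x)" "norm (g x) <= 1 * norm (f x, g x)" for x
		using norm_fst_le[of "f x" "g x"] norm_snd_le[of "g x" "f x"] by auto
	thus "sqi M f & sqi M g" using sqi_bound[OF a m(1), of 1] sqi_bound[OF a m(2), of 1] by auto
next
	assume a: "sqi M f & sqi M g"
	thus "sqi M (%x. (f x, g x))"
		by (auto simp: sqi_def norm_Pair intro: borel_measurable_Pair)
qed

lemma n2_Pair_sq: "sqi M f ==> sqi M g ==> (n2 M (%x. (f x, g x)))^2 = (n2 M f)^2 + (n2 M g)^2"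
	by (simp add: n2_sq ip_def integrable_ip)

lemma n2_Pair_le: assumes "sqi M f" "sqi M g" shows "n2 M (%x. (f x, g x)) <= n2 M f + n2 M g"
	by (rule power2_le_imp_le) (use assms in \<open>auto simp: n2_Pair_sq power2_sum\<close>)

lemma n2_fst_le: assumes "sqi M f" "sqi M g" shows "n2 M f <= n2 M (%x. (f x, g x))"
	by (rule power2_le_imp_le) (use assms in \<open>auto simp: n2_Pair_sq\<close>)

lemma n2_snd_le: assumes "sqi M f" "sqi M g" shows "n2 M g <= n2 M (%x. (f x, g x))"
	by (rule power2_le_imp_le) (use assms in \<open>auto simp: n2_Pair_sq\<close>)

lemma tendsto0_le:
	fixes a b :: "nat => real"
	assumes "b ----> 0" "!!n. 0 <= a n" "!!n. a n <= b n" shows "a ----> 0"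
	by (rule tendsto_sandwich[OF _ _ tendsto_const assms(1)]) (use assms in auto)

lemma n2_Pair_tendsto:
	assumes "!!n. sqi M (f n)" "!!n. sqi M (g n)"
	shows "(%n. n2 M (%x. (f n x, g n x))) ----> 0 \<longleftrightarrow> (%n. n2 M (f n)) ----> 0 & (%n. n2 M (g n)) ----> 0"
proof
	assume a: "(%n. n2 M (%x. (f n x, g n x))) ----> 0"
	show "(%n. n2 M (f n)) ----> 0 & (%n. n2 M (g n)) ----> 0"
		by (intro conjI tendsto0_le[OF a] n2_nonneg n2_fst_le n2_snd_le assms)
next
	assume a: "(%n. n2 M (f n)) ----> 0 & (%n. n2 M (g n)) ----> 0"
	hence "(%n. n2 M (f n) + n2 M (g n)) ----> 0 + 0" by (intro tendsto_add) auto
	thus "(%n. n2 M (%x. (f n x, g n x))) ----> 0"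
		unfolding add_0_left by (rule tendsto0_le) (auto intro: n2_Pair_le assms)
qed

lemma n2_lim_unique:
	assumes "!!n. sqi M (f n)" "sqi M g" "sqi M h"
		"(%n. n2 M (%x. f n x - g x)) ----> 0" "(%n. n2 M (%x. f n x - h x)) ----> 0"
	shows "AE x in M. g x = h x"
proof -
	have "(%n. n2 M (%x. f n x - g x) + n2 M (%x. f n x - h x)) ----> 0 + 0" by (intro tendsto_add assms)
	moreover have "n2 M (%x. g x - h x) <= n2 M (%x. f n x - g x) + n2 M (%x. f n x - h x)" for n
		using n2_triangle3[OF assms(2) assms(1)[of n] assms(3)] n2_minus_commute[of M g "f n"] by simp
	ultimately have "n2 M (%x. g x - h x) <= 0" by (intro LIMSEQ_le_const[of _ "0 + 0" "n2 M (%x. g x - h x)", simplified]) auto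
	hence "n2 M (%x. g x - h x) = 0" using n2_nonneg[of M "%x. g x - h x"] by linarith
	from n2_eq_0[OF sqi_diff[OF assms(2,3)] this] show ?thesis by simp
qed

lemma l2closed_lin: "l2closed M E ==> f : E ==> g : E ==> (%x. a *R f x + b *R g x) : E"
	unfolding l2closed_def by blast

lemma l2closed_lim:
	assumes "l2closed M E" "!!n::nat. f n : E" "sqi M g" "(%n. n2 M (%x. f n x - g x)) ----> 0"
	shows "g : E"
	by (rule assms(1)[unfolded l2closed_def, THEN conjunct2, THEN conjunct2, THEN conjunct2, rule_format, OF assms(2-4)])

lemma l2closed_combo:
	assumes E: "l2closed M E" and f: "!!k. f k : E" shows "combo N c f : E"
proof -
	have "(%x. \<Sum>k<N. c k *R f k x) : E"
	proof (induction N)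
		case (Suc N)
		have "(%x. 1 *R (\<Sum>k<N. c k *R f k x) + c N *R f N x) : E"
			by (intro l2closed_lin[OF E] Suc f)
		thus ?case by simp
	qed (use E in \<open>simp add: l2closed_def\<close>)
	thus ?thesis by (simp add: combo_def)
qed

text \<open>By Mazur's lemma closed subspaces are weakly closed; this is how membership survives limits in
  which only the gradients stay bounded.\<close>
lemma l2closed_weak:
	fixes f :: "nat => 'a => 'b::euclidean_space" and g :: "nat => 'a => 'c::euclidean_space"
	assumes E: "l2closed M E" and f: "!!n. (%x. (f n x, g n x)) : E"
		and l: "sqi M f'" "(%n. n2 M (%x. f n x - f' x)) ----> 0" and B: "!!n. n2 M (g n) <= B"
	obtains h where "h : E" "AE x in M. fst (h x) = f' x"
proof -
	have sq: "sqi M (%x. (f n x, g n x))" for n using E f by (auto simp: l2closed_def)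
	hence s: "sqi M (f n)" "sqi M (g n)" for n by (auto simp: sqi_Pair_iff)
	obtain C where C: "!!n. n2 M (f n) <= C"
	proof -
		have "convergent (%n. n2 M (f n))" using tendsto_n2[OF s(1) l] by (auto simp: convergent_def)
		hence "Bseq (%n. n2 M (f n))" by (rule convergent_imp_Bseq)
		thus thesis using that by (auto simp: Bseq_def)
	qed
	have "n2 M (%x. (f n x, g n x)) <= C + B" for n using n2_Pair_le[OF s(1)[of n] s(2)[of n]] C[of n] B[of n] by linarith
	then obtain N c h where w: "!!n. tail_weights n (N n) (c n)" and h: "sqi M h"
		"(%n. n2 M (%x. combo (N n) (c n) (%n x. (f n x, g n x)) x - h x)) ----> 0" by (rule mazur[where f = "%n x. (f n x, g n x)", OF sq]) (rule that)
	have hE: "h : E" by (rule l2closed_lim[OF E l2closed_combo[OF E f] h])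
	define a b where "a x = fst (h x)" and "b x = snd (h x)" for x
	have ab: "sqi M a" "sqi M b" using h(1) sqi_Pair_iff[of M a b] by (auto simp: a_def b_def)
	have c: "combo (N n) (c n) (%n x. (f n x, g n x)) x - h x
		= (combo (N n) (c n) f x - a x, combo (N n) (c n) g x - b x)" for n x
		by (simp add: combo_def a_def b_def prod_eq_iff fst_sum snd_sum)
	have "(%n. n2 M (%x. combo (N n) (c n) f x - a x)) ----> 0"
		using h(2) n2_Pair_tendsto[of M "%n x. combo (N n) (c n) f x - a x" "%n x. combo (N n) (c n) g x - b x"]
			sqi_combo[of M f] sqi_combo[of M g] s ab by (simp add: c sqi_diff)
	moreover have "(%n. n2 M (%x. combo (N n) (c n) f x - f' x)) ----> 0"
		by (rule combo_tendsto_n2[OF w s(1) l])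
	ultimately have "AE x in M. a x = f' x"
		by (rule n2_lim_unique[OF sqi_combo[of M f, OF s(1)] ab(1) l(1)])
	with hE show thesis using that by (simp add: a_def)
qed

section \<open>Weak gradients, H^1 and H^1_0\<close>

context bdom
begin

lemma L2_iff: "L2 Om f \<longleftrightarrow> sqi M f"
	by (simp add: L2_def sqi_def)

lemma sqi_vec_iff: "sqi M (g :: _ => real^2) \<longleftrightarrow> (ALL i. sqi M (%x. g x $ i))"
proof
	assume g: "sqi M g"
	show "ALL i. sqi M (%x. g x $ i)"
	proof
		fix i
		have "(%x. g x \<bullet> axis i 1) : bm M" using sqi_m[OF g] by measurable
		hence "(%x. g x $ i) : bm M" by (simp add: inner_axis)
		thus "sqi M (%x. g x $ i)" using component_le_norm_cart by (intro sqi_bound[OF g, of _ 1]) auto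
	qed
next
	assume g: "ALL i. sqi M (%x. g x $ i)"
	have "sqi M (%x. g x $ 1 *R axis 1 1 + g x $ 2 *R (axis 2 1 :: real^2))"
	proof (rule sqi_add)
		have "sqi M (%x. g x $ i *R axis i (1::real))" for i
		proof (rule sqi_bound[of M "%x. g x $ i" _ 1])
			show "sqi M (%x. g x $ i)" using g by blast
			thus "(%x. g x $ i *R axis i (1::real)) : bm M"
				using sqi_m by (intro borel_measurable_scaleR borel_measurable_const) blast
		qed simp
		thus "sqi M (%x. g x $ 1 *R (axis 1 1 :: real^2))" "sqi M (%x. g x $ 2 *R (axis 2 1 :: real^2))" by blast+
	qed
	thus "sqi M g" using vec2_eq by (metis (no_types, lifting) ext)
qed

lemma Hg_iff: "Hg f g \<longleftrightarrow> sqi M f & sqi M g & weak_grad Om f g"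
	by (auto simp: H1_grad_def L2_iff sqi_vec_iff)

lemma HgD: assumes "Hg f g"
	shows "sqi M f" "sqi M g" "sqi M (%x. g x $ i)" "integrable M f" "integrable M (%x. g x $ i)"
		"tf ph ==> (LINT x|M. f x * pd i ph x) = - (LINT x|M. g x $ i * ph x)"
	using assms by (auto simp: Hg_iff weak_grad_def sqi_vec_iff intro: sqi_imp_integrable)

lemma test_fun_outside:
	assumes "tf ph" "x \<notin> Om" shows "ph x = 0"
proof (rule ccontr)
	assume "ph x ~= 0"
	hence "x : closure {x. ph x ~= 0}" by (intro subsetD[OF closure_subset]) simp
	thus False using assms by (auto simp: test_fun_def)
qed

lemma test_fun_smooth: "tf ph ==> smooth_R2 ph"
	by (simp add: test_fun_def)

lemma test_fun_cs: assumes "tf ph" shows "smooth_cs ph"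
proof -
	obtain R where R: "!!x. x : closure {x. ph x ~= 0} ==> norm x <= R"
		using assms unfolding test_fun_def by (meson bounded_iff compact_imp_bounded)
	have "ph x = 0" if "norm x > R" for x
		using R[of x] that closure_subset[of "{x. ph x ~= 0}"] by force
	thus ?thesis using assms by (auto simp: smooth_cs_def test_fun_def)
qed

lemma test_fun_sub:
	assumes "tf ph" "smooth_R2 ps" "{x. ps x ~= 0} <= closure {x. ph x ~= 0}" shows "tf ps"
proof -
	have c: "closure {x. ps x ~= 0} <= closure {x. ph x ~= 0}" using assms(3) by (simp add: closure_minimal)
	hence "compact (closure {x. ps x ~= 0})"
		using assms(1) unfolding test_fun_def by (meson bounded_subset closed_closure compact_eq_bounded_closed)
	thus ?thesis using c assms unfolding test_fun_def by blast
qed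

lemma test_fun_pd: assumes "tf ph" shows "tf (pd i ph)"
proof (rule test_fun_sub[OF assms smooth_pd[OF test_fun_smooth[OF assms]]])
	have "pd i ph x = 0" if "x \<notin> closure {x. ph x ~= 0}" for x
		by (rule pd_eq_0[of "- closure {x. ph x ~= 0}"]) (use that closure_subset[of "{x. ph x ~= 0}"] in auto)
	thus "{x. pd i ph x ~= 0} <= closure {x. ph x ~= 0}" by blast
qed

lemma test_fun_zero: "tf (%x. 0)"
	by (simp add: test_fun_def)

lemma test_fun_lin:
	assumes "tf ph" "tf ps" shows "tf (%x. a * ph x + b * ps x)"
proof -
	have "{x. a * ph x + b * ps x ~= 0} <= {x. ph x ~= 0} \<union> {x. ps x ~= 0}" by auto
	hence c: "closure {x. a * ph x + b * ps x ~= 0} <= closure {x. ph x ~= 0} \<union> closure {x. ps x ~= 0}"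
		unfolding closure_Un[symmetric] by (rule closure_mono)
	hence "compact (closure {x. a * ph x + b * ps x ~= 0})"
		using assms unfolding test_fun_def
		by (meson bounded_Un bounded_subset closed_closure compact_eq_bounded_closed)
	thus ?thesis using c assms unfolding test_fun_def
		by (auto intro!: smooth_add smooth_cmult)
qed

lemma grad_test_lin:
	"tf ph ==> tf ps ==> grad (%x. a * ph x + b * ps x) x = a *R grad ph x + b *R grad ps x"
	using smooth_differentiable[OF test_fun_smooth] smooth_differentiable[OF smooth_cmult[OF test_fun_smooth]]
	by (simp add: grad_def vec_eq_iff pd_add pd_cmult)

lemma test_fun_bounded: "tf ph ==> EX C>0. ALL x. abs (ph x) <= C"
	using smooth_cs_bounded[OF test_fun_cs] by metis

lemma test_fun_sqi: "tf ph ==> sqi M ph"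
	using test_fun_bounded[of ph] test_fun_smooth[of ph] by (auto intro!: bounded_sqi)

lemma test_grad_sqi: "tf ph ==> sqi M (grad ph)"
	unfolding sqi_vec_iff using test_fun_sqi[OF test_fun_pd] by (simp add: grad_def)

text \<open>The product \<open>ps * ph\<close> is C^1 with compact support. Asking no more than C^1
  of \<open>ps\<close> admits compositions G (u_n) with u_n smooth, as in the chain rule
  below.\<close>

lemma ibp_C1:
	assumes d: "!!x. ps differentiable (at x)" and c: "!!i. continuous_on UNIV (pd i ps)" and ph: "tf ph"
	shows "(LINT x|M. ps x * pd i ph x) = - (LINT x|M. pd i ps x * ph x)"
proof -
	define f where "f x = ps x * ph x" for x
	note ds = smooth_differentiable[OF test_fun_smooth[OF ph]]
	have df: "f differentiable (at x)" for x unfolding f_def using d ds by auto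
	have pf: "pd j f = (%x. ps x * pd j ph x + pd j ps x * ph x)" for j
		unfolding f_def using d ds by (intro ext pd_mult)
	have c0: "continuous_on UNIV ps" using d by (simp add: continuous_at_imp_continuous_on differentiable_imp_continuous_within)
	have cf: "continuous_on UNIV (%x. ps x * pd j ph x)" "continuous_on UNIV (%x. pd j ps x * ph x)" for j
		using c0 c smooth_continuous_on[OF test_fun_smooth[OF ph]] smooth_continuous_on[OF smooth_pd[OF test_fun_smooth[OF ph]]]
		by (auto intro!: continuous_intros)
	obtain R where R: "!!x. norm x > R ==> ph x = 0" using test_fun_cs[OF ph] by (auto simp: smooth_cs_def)
	obtain R' where R': "!!x j. norm x > R' ==> pd j ph x = 0"
	proof -
		obtain R1 where "!!x. norm x > R1 ==> pd 1 ph x = 0" using test_fun_cs[OF test_fun_pd[OF ph]] by (auto simp: smooth_cs_def)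
		moreover obtain R2 where "!!x. norm x > R2 ==> pd 2 ph x = 0" using test_fun_cs[OF test_fun_pd[OF ph]] by (auto simp: smooth_cs_def)
		ultimately show thesis using that[of "max R1 R2"] by (metis exhaust_2 max_less_iff_conj)
	qed
	define S where "S = max R R'"
	have z: "pd j f x = 0" if "norm x > S" for x j using R R' that by (simp add: pf S_def)
	have cpf: "continuous_on UNIV (pd j f)" for j unfolding pf using cf by (intro continuous_on_add)
	obtain C1 where C1: "!!x. abs (pd 1 f x) <= C1" using cont_cs_bounded[OF cpf z] by metis
	obtain C2 where C2: "!!x. abs (pd 2 f x) <= C2" using cont_cs_bounded[OF cpf z] by metis
	have "norm (grad f x) <= C1 + C2" for x
		using norm_vec2_le[of "grad f x"] C1[of x] C2[of x] by (simp add: grad_def)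
	hence L: "abs (f x - f y) <= (C1 + C2) * norm (x - y)" for x y by (rule lipschitz_of_grad[OF df])
	have "(LINT x|lborel. pd i f x) = 0"
		by (rule integral_pd_eq_0[OF df L, of R]) (use R in \<open>simp add: f_def\<close>)
	moreover have "(LINT x|M. pd i f x) = (LINT x|lborel. pd i f x)"
		using test_fun_outside[OF ph] test_fun_outside[OF test_fun_pd[OF ph]] cpf
		by (intro integral_M_lborel borel_measurable_continuous_onI) (auto simp: pf)
	moreover have "(LINT x|M. pd i f x) = (LINT x|M. ps x * pd i ph x) + (LINT x|M. pd i ps x * ph x)"
	proof -
		have "integrable M (%x. ps x * pd i ph x)"
		proof -
			obtain K where "!!x. abs (ps x * pd i ph x) <= K" using cont_cs_bounded[OF cf(1)[of i], of R'] R' by (metis mult_zero_right)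
			thus ?thesis using cf(1)[of i] by (intro bounded_integrable_M[of _ K] borel_M borel_measurable_continuous_onI) auto
		qed
		moreover have "integrable M (%x. pd i ps x * ph x)"
		proof -
			obtain K where "!!x. abs (pd i ps x * ph x) <= K" using cont_cs_bounded[OF cf(2)[of i], of R] R by (metis mult_zero_right)
			thus ?thesis using cf(2)[of i] by (intro bounded_integrable_M[of _ K] borel_M borel_measurable_continuous_onI) auto
		qed
		ultimately show ?thesis unfolding pf by simp
	qed
	ultimately show ?thesis by simp
qed

lemma weak_gradI:
	assumes "!!i ph. tf ph ==> (LINT x|M. f x * pd i ph x) = - (LINT x|M. g x $ i * ph x)"
	shows "weak_grad Om f g"
	using assms by (simp add: weak_grad_def)

lemma Hg_test: assumes "tf ph" shows "Hg ph (grad ph)"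
	unfolding Hg_iff
proof (intro conjI weak_gradI)
	fix i ps assume "tf ps"
	thus "(LINT x|M. ph x * pd i ps x) = - (LINT x|M. grad ph x $ i * ps x)"
		using ibp_C1[of ph ps i] assms smooth_differentiable[OF test_fun_smooth[OF assms]]
			smooth_continuous_on[OF smooth_pd[OF test_fun_smooth[OF assms]]] by (simp add: grad_def)
qed (use assms test_fun_sqi test_grad_sqi in auto)

lemma Hg_const: "Hg (%x. c) (%x. 0)"
	unfolding Hg_iff using ibp_C1[of "%x. c"] by (auto intro!: weak_gradI)

lemma Hg_lin:
	assumes f: "Hg f g" and f': "Hg f' g'"
	shows "Hg (%x. a * f x + b * f' x) (%x. a *R g x + b *R g' x)"
	unfolding Hg_iff
proof (intro conjI weak_gradI)
	note s = HgD(1,2)[OF f] HgD(1,2)[OF f']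
	show "sqi M (%x. a * f x + b * f' x)" "sqi M (%x. a *R g x + b *R g' x)" using s by auto
	fix i :: 2 and ph assume ph: "tf ph"
	note int = integrable_ip[OF HgD(1)[OF f] test_fun_sqi[OF test_fun_pd[OF ph]]]
		integrable_ip[OF HgD(1)[OF f'] test_fun_sqi[OF test_fun_pd[OF ph]]]
		integrable_ip[OF HgD(3)[OF f] test_fun_sqi[OF ph]] integrable_ip[OF HgD(3)[OF f'] test_fun_sqi[OF ph]]
	show "(LINT x|M. (a * f x + b * f' x) * pd i ph x) = - (LINT x|M. (a *R g x + b *R g' x) $ i * ph x)"
		using int[of i] HgD(6)[OF f ph, of i] HgD(6)[OF f' ph, of i]
		by (simp add: distrib_right mult.assoc)
qed

lemma Hg_add: "Hg f g ==> Hg f' g' ==> Hg (%x. f x + f' x) (%x. g x + g' x)"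
	using Hg_lin[of f g f' g' 1 1] by simp

lemma Hg_diff: "Hg f g ==> Hg f' g' ==> Hg (%x. f x - f' x) (%x. g x - g' x)"
	using Hg_lin[of f g f' g' 1 "-1"] by simp

lemma Hg_cmult: "Hg f g ==> Hg (%x. a * f x) (%x. a *R g x)"
	using Hg_lin[of f g f g a 0] by simp

lemma Hg_cong:
	assumes f: "Hg f g" and m: "f' : bm M" "g' : bm M"
		and e: "AE x in M. f x = f' x" "AE x in M. g x = g' x"
	shows "Hg f' g'"
	unfolding Hg_iff
proof (intro conjI weak_gradI)
	show s: "sqi M f'" "sqi M g'" using sqi_cong_AE HgD(1,2)[OF f] m e by blast+
	fix i :: 2 and ph assume ph: "tf ph"
	have [measurable]: "ph : bm M" "pd i ph : bm M"
		using test_fun_sqi[OF ph] test_fun_sqi[OF test_fun_pd[OF ph]] sqi_m by blast+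
	have [measurable]: "(%x. g x $ i) : bm M" "(%x. g' x $ i) : bm M" "f : bm M"
		using HgD[OF f] s sqi_vec_iff sqi_m by blast+
	have "(LINT x|M. f' x * pd i ph x) = (LINT x|M. f x * pd i ph x)" using e(1) m by (intro integral_cong_AE) auto
	moreover have "(LINT x|M. g' x $ i * ph x) = (LINT x|M. g x $ i * ph x)" using e(2) by (intro integral_cong_AE) auto
	ultimately show "(LINT x|M. f' x * pd i ph x) = - (LINT x|M. g' x $ i * ph x)"
		using HgD(6)[OF f ph] by simp
qed

lemma Hg_unique:
	assumes "Hg f g" "Hg f g'" shows "AE x in M. g x = g' x"
proof -
	have "AE x in M. g x $ i - g' x $ i = 0" for i
	proof (rule fundamental_lemma)
		show "integrable M (%x. g x $ i - g' x $ i)" using assms HgD(5) by auto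
		fix ph assume ph: "tf ph"
		show "(LINT x|M. (g x $ i - g' x $ i) * ph x) = 0"
			using HgD(6)[OF assms(1) ph, of i] HgD(6)[OF assms(2) ph, of i]
				integrable_ip[OF HgD(3)[OF assms(1)] test_fun_sqi[OF ph], of i]
				integrable_ip[OF HgD(3)[OF assms(2)] test_fun_sqi[OF ph], of i]
			by (simp add: left_diff_distrib)
	qed
	from this[of 1] this[of 2] show ?thesis by eventually_elim (simp add: vec_eq_iff forall_2)
qed

lemma Hg_limit:
	assumes h: "!!n. Hg (f n) (g n)" and s: "sqi M f'" "sqi M g'"
		and l: "(%n. n2 M (%x. f n x - f' x)) ----> 0" "(%n. n2 M (%x. g n x - g' x)) ----> 0"
	shows "Hg f' g'"
	unfolding Hg_iff
proof (intro conjI weak_gradI s)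
	fix i :: 2 and ph assume ph: "tf ph"
	have "sqi M (%x. ph x *R axis i (1::real))"
		by (rule sqi_bound[OF test_fun_sqi[OF ph], of _ 1])
			(use sqi_m[OF test_fun_sqi[OF ph]] in \<open>auto intro!: borel_measurable_scaleR\<close>)
	from tendsto_ip_left[where f = g, OF HgD(2)[OF h] s(2) this l(2)]
	have "(%n. - (LINT x|M. g n x $ i * ph x)) ----> - (LINT x|M. g' x $ i * ph x)"
		by (intro tendsto_minus) (simp add: ip_def inner_axis mult.commute)
	moreover have "(%n. \<integral>x. f n x * pd i ph x \<partial>M) ----> (LINT x|M. f' x * pd i ph x)"
		using tendsto_ip_left[where f = f, OF HgD(1)[OF h] s(1) test_fun_sqi[OF test_fun_pd[OF ph]] l(1)] by (simp add: ip_def)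
	ultimately show "(LINT x|M. f' x * pd i ph x) = - (LINT x|M. g' x $ i * ph x)"
		using HgD(6)[OF h ph] by (intro LIMSEQ_unique[of "%n. - (LINT x|M. g n x $ i * ph x)"]) auto
qed

text \<open>H^1_0 with the gradient made explicit. In this form it is a subset of the L^2 functions
  with values in R x R^2, to which \<open>l2closed\<close> and Mazur's lemma apply.\<close>

definition Z :: "(real^2 => real) => (real^2 => real^2) => bool" where
	"Z f g \<longleftrightarrow> Hg f g & (EX phs. (ALL n. tf (phs n)) &
		 (%n. n2 M (%x. (phs n x - f x, grad (phs n) x - g x))) ----> 0)"

lemma Z_H1: "Z f g ==> Hg f g"
	by (simp add: Z_def)

lemma Z_test: "tf ph ==> Z ph (grad ph)"
	unfolding Z_def using Hg_test by (auto intro!: exI[of _ "%_. ph"] simp: zero_prod_def[symmetric])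

lemma Z_imp_H10: assumes "Z f g" shows "H10 Om f"
proof -
	obtain phs where t: "!!n. tf (phs n)" and l: "(%n. n2 M (%x. (phs n x - f x, grad (phs n) x - g x))) ----> 0"
		using assms by (auto simp: Z_def)
	have "(%n. (n2 M (%x. (phs n x - f x, grad (phs n) x - g x)))^2) ----> 0^2" by (intro tendsto_power l)
	hence "(%n. \<integral>x. (phs n x - f x)^2 + (norm (grad (phs n) x - g x))^2 \<partial>M) ----> 0"
		by (simp add: n2_sq ip_self norm_Pair)
	with t assms show ?thesis unfolding H10_def Z_def by blast
qed

lemma Z_approx:
	assumes Z: "Z f g" and e: "e > 0"
	obtains ph where "tf ph" "n2 M (%x. (ph x - f x, grad ph x - g x)) < e"
proof -
	obtain phs where "!!n. tf (phs n)" "(%n. n2 M (%x. (phs n x - f x, grad (phs n) x - g x))) ----> 0"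
		using Z by (auto simp: Z_def)
	with LIMSEQ_D[of _ 0 e] e that show thesis by fastforce
qed

lemma Z_limit:
	assumes h: "!!n. Z (f n) (g n)" and s: "sqi M f'" "sqi M g'"
		and l: "(%n. n2 M (%x. (f n x - f' x, g n x - g' x))) ----> 0"
	shows "Z f' g'"
proof -
	note sn = HgD(1,2)[OF Z_H1[OF h]]
	have ls: "(%n. n2 M (%x. f n x - f' x)) ----> 0" "(%n. n2 M (%x. g n x - g' x)) ----> 0"
		using l n2_Pair_tendsto[of M "%n x. f n x - f' x" "%n x. g n x - g' x"] sn s by (auto simp: sqi_diff)
	have "ALL n. EX ph. tf ph & n2 M (%x. (ph x - f n x, grad ph x - g n x)) < 1 / Suc n"
	proof
		fix n
		obtain ph where "tf ph" "n2 M (%x. (ph x - f n x, grad ph x - g n x)) < 1 / Suc n"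
			by (rule Z_approx[OF h[of n], of "1 / Suc n"]) simp
		thus "EX ph. tf ph & n2 M (%x. (ph x - f n x, grad ph x - g n x)) < 1 / Suc n" by blast
	qed
	from choice[OF this] obtain phs where t: "!!n. tf (phs n)"
		and d: "!!n. n2 M (%x. (phs n x - f n x, grad (phs n) x - g n x)) < 1 / Suc n" by blast
	have "(%n. 1 / Suc n + n2 M (%x. (f n x - f' x, g n x - g' x))) ----> 0 + 0"
		using LIMSEQ_inverse_real_of_nat by (intro tendsto_add l) (simp add: inverse_eq_divide)
	hence l0: "(%n. 1 / Suc n + n2 M (%x. (f n x - f' x, g n x - g' x))) ----> 0" by simp
	have "(%n. n2 M (%x. (phs n x - f' x, grad (phs n) x - g' x))) ----> 0"
	proof (rule tendsto0_le[OF l0])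
		fix n
		have "n2 M (%x. (phs n x, grad (phs n) x) - (f' x, g' x)) <=
			n2 M (%x. (phs n x, grad (phs n) x) - (f n x, g n x)) + n2 M (%x. (f n x, g n x) - (f' x, g' x))"
			using test_fun_sqi[OF t] test_grad_sqi[OF t] sn s by (intro n2_triangle3) (auto simp: sqi_Pair_iff)
		thus "n2 M (%x. (phs n x - f' x, grad (phs n) x - g' x)) <= 1 / Suc n + n2 M (%x. (f n x - f' x, g n x - g' x))"
			using d[of n] by simp
	qed simp_all
	with t show ?thesis unfolding Z_def using Hg_limit[OF Z_H1[OF h] s ls] by blast
qed

lemma Z_lin:
	assumes f: "Z f g" and f': "Z f' g'"
	shows "Z (%x. a * f x + b * f' x) (%x. a *R g x + b *R g' x)"
proof -
	obtain ph where p: "!!n. tf (ph n)" "(%n. n2 M (%x. (ph n x - f x, grad (ph n) x - g x))) ----> 0"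
		using f by (auto simp: Z_def)
	obtain ps where q: "!!n. tf (ps n)" "(%n. n2 M (%x. (ps n x - f' x, grad (ps n) x - g' x))) ----> 0"
		using f' by (auto simp: Z_def)
	note sn = HgD(1,2)[OF Z_H1[OF f]] HgD(1,2)[OF Z_H1[OF f']]
	have "(%n. abs a * n2 M (%x. (ph n x - f x, grad (ph n) x - g x)) + abs b * n2 M (%x. (ps n x - f' x, grad (ps n) x - g' x))) ----> abs a * 0 + abs b * 0"
		by (intro tendsto_add tendsto_mult_left p q)
	hence l0: "(%n. abs a * n2 M (%x. (ph n x - f x, grad (ph n) x - g x)) + abs b * n2 M (%x. (ps n x - f' x, grad (ps n) x - g' x))) ----> 0"
		by simp
	have "(%n. n2 M (%x. ((a * ph n x + b * ps n x) - (a * f x + b * f' x),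
			grad (%x. a * ph n x + b * ps n x) x - (a *R g x + b *R g' x)))) ----> 0"
	proof (rule tendsto0_le[OF l0])
		fix n
		have "n2 M (%x. a *R (ph n x - f x, grad (ph n) x - g x) + b *R (ps n x - f' x, grad (ps n) x - g' x))
			<= n2 M (%x. a *R (ph n x - f x, grad (ph n) x - g x)) + n2 M (%x. b *R (ps n x - f' x, grad (ps n) x - g' x))"
			using test_fun_sqi test_grad_sqi p q sn by (intro n2_triangle sqi_scaleR) (auto simp: sqi_Pair_iff)
		moreover have "a *R (ph n x - f x, grad (ph n) x - g x) + b *R (ps n x - f' x, grad (ps n) x - g' x)
			= ((a * ph n x + b * ps n x) - (a * f x + b * f' x), grad (%x. a * ph n x + b * ps n x) x - (a *R g x + b *R g' x))" for x
			using grad_test_lin[OF p(1) q(1)] by (simp add: algebra_simps)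
		ultimately show "n2 M (%x. ((a * ph n x + b * ps n x) - (a * f x + b * f' x),
			grad (%x. a * ph n x + b * ps n x) x - (a *R g x + b *R g' x)))
			<= abs a * n2 M (%x. (ph n x - f x, grad (ph n) x - g x)) + abs b * n2 M (%x. (ps n x - f' x, grad (ps n) x - g' x))"
			by (simp only: n2_scaleR)
	qed simp_all
	thus ?thesis unfolding Z_def
		by (intro conjI exI[of _ "%n x. a * ph n x + b * ps n x"] allI Hg_lin Z_H1 f f' test_fun_lin p(1) q(1))
qed

lemma Z_cong:
	assumes f: "Z f g" and m: "f' : bm M" "g' : bm M"
		and e: "AE x in M. f x = f' x" "AE x in M. g x = g' x"
	shows "Z f' g'"
proof (rule Z_limit[of "%_. f" "%_. g"])
	note h = HgD(1,2)[OF Hg_cong[OF Z_H1[OF f] m e]]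
	show "sqi M f'" "sqi M g'" by (rule h)+
	have "n2 M (%x. (f x - f' x, g x - g' x)) = n2 M (%x. 0 :: real \<times> (real^2))"
	proof (rule n2_cong_AE)
		show "(%x. (f x - f' x, g x - g' x)) : bm M"
			using HgD(1,2)[OF Z_H1[OF f]] h by (intro sqi_m) (auto simp: sqi_Pair_iff sqi_diff)
		show "AE x in M. (f x - f' x, g x - g' x) = 0" using e by eventually_elim (simp add: zero_prod_def)
	qed simp
	thus "(%n. n2 M (%x. (f x - f' x, g x - g' x))) ----> 0" by simp
qed fact

lemma l2closed_H1: "l2closed M {h. Hg (%x. fst (h x)) (%x. snd (h x))}"
	unfolding l2closed_def
proof (intro conjI ballI allI impI)
	fix f assume "f : {h. Hg (%x. fst (h x)) (%x. snd (h x))}"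
	thus "sqi M f" using sqi_Pair_iff[of M "%x. fst (f x)" "%x. snd (f x)"] HgD(1,2) by auto
next
	fix f :: "nat => real^2 => real \<times> (real^2)" and g
	assume a: "ALL n. f n : {h. Hg (%x. fst (h x)) (%x. snd (h x))}" and g: "sqi M g"
		and l: "(%n. n2 M (%x. f n x - g x)) ----> 0"
	have h: "Hg (%x. fst (f n x)) (%x. snd (f n x))" for n using a by simp
	have sg: "sqi M (%x. fst (g x))" "sqi M (%x. snd (g x))" using g sqi_Pair_iff[of M "%x. fst (g x)" "%x. snd (g x)"] by auto
	have "(%n. n2 M (%x. (fst (f n x) - fst (g x), snd (f n x) - snd (g x)))) ----> 0"
		using l by (simp add: fst_diff[symmetric] snd_diff[symmetric] del: fst_diff snd_diff)
	hence "(%n. n2 M (%x. fst (f n x) - fst (g x))) ----> 0 & (%n. n2 M (%x. snd (f n x) - snd (g x))) ----> 0"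
		using HgD(1,2)[OF h] sg by (subst (asm) n2_Pair_tendsto) (auto simp: sqi_diff)
	thus "g : {h. Hg (%x. fst (h x)) (%x. snd (h x))}"
		using Hg_limit[where f = "%n x. fst (f n x)" and g = "%n x. snd (f n x)", OF h sg] by simp
qed (use Hg_const[of 0] Hg_lin in auto)

lemma l2closed_Z: "l2closed M {h. Z (%x. fst (h x)) (%x. snd (h x))}"
	unfolding l2closed_def
proof (intro conjI ballI allI impI)
	fix f assume "f : {h. Z (%x. fst (h x)) (%x. snd (h x))}"
	thus "sqi M f" using sqi_Pair_iff[of M "%x. fst (f x)" "%x. snd (f x)"] HgD(1,2)[OF Z_H1] by auto
next
	fix f :: "nat => real^2 => real \<times> (real^2)" and g
	assume a: "ALL n. f n : {h. Z (%x. fst (h x)) (%x. snd (h x))}" and g: "sqi M g"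
		and l: "(%n. n2 M (%x. f n x - g x)) ----> 0"
	have sg: "sqi M (%x. fst (g x))" "sqi M (%x. snd (g x))" using g sqi_Pair_iff[of M "%x. fst (g x)" "%x. snd (g x)"] by auto
	have "(%n. n2 M (%x. (fst (f n x) - fst (g x), snd (f n x) - snd (g x)))) ----> 0"
		using l by (simp add: fst_diff[symmetric] snd_diff[symmetric] del: fst_diff snd_diff)
	thus "g : {h. Z (%x. fst (h x)) (%x. snd (h x))}"
		using Z_limit[OF _ sg, of "%n x. fst (f n x)" "%n x. snd (f n x)"] a by simp
next
	have "Z (%x. 0) (%x. 0)" using Z_test[OF test_fun_zero] by (simp add: grad_def zero_vec_def)
	thus "(%x. 0) : {h. Z (%x. fst (h x)) (%x. snd (h x))}" by simp
qed (use Z_lin in auto)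

text \<open>Strong convergence of truncated or composed gradients would be laborious; bounded
  gradients are enough because H^1_0 is weakly closed, and \<open>Hg_unique\<close> then pins the
  gradient of the limit to \<open>g'\<close>.\<close>

lemma Z_weak:
	assumes Z: "!!n. Z (f n) (g n)" and l: "(%n. n2 M (%x. f n x - f' x)) ----> 0"
		and B: "!!n. n2 M (g n) <= B" and h: "Hg f' g'"
	shows "Z f' g'"
proof -
	obtain u where u: "Z (%x. fst (u x)) (%x. snd (u x))" "AE x in M. fst (u x) = f' x"
		using l2closed_weak[OF l2closed_Z, of f g f' B] Z l B HgD(1)[OF h] by auto
	note m = HgD(1,2)[OF Z_H1[OF u(1)], THEN sqi_m] HgD(1,2)[OF h, THEN sqi_m]
	have "Hg f' (%x. snd (u x))" by (rule Hg_cong[OF Z_H1[OF u(1)] m(3,2) u(2)]) simp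
	from Z_cong[OF u(1) m(3,4) u(2) Hg_unique[OF this h]] show ?thesis .
qed

end

section \<open>The chain rule for weak gradients\<close>

lemma mean_value_bound:
	fixes G :: "real => real"
	assumes d: "!!y. (G has_real_derivative G' y) (at y)" and I: "is_interval I" and C: "!!y. y : I ==> abs (G' y) <= C"
		and xy: "x : I" "y : I"
	shows "abs (G x - G y) <= C * abs (x - y)"
	using field_differentiable_bound[of I G G' C x y] is_interval_convex[OF I] d C xy
	by (auto intro: has_field_derivative_at_within simp: norm_minus_commute)

context bdom
begin

text \<open>If the kernel ball lies in the domain, the reflected kernel is a test function and the
  derivative can be moved from it to \<open>f\<close>.\<close>

lemma conv_pd_interior:
	assumes f: "Hg f g" and x: "cball x (1 / Suc n) <= Om"
	shows "pd i (mo n f) x = mo n (%y. g y $ i) x"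
proof -
	have "pd i (mo n f) x = (LINT y|M. f y * pd i (kern (1 / Suc n)) (x - y))"
		unfolding mo_def pd_conv[OF HgD(4)[OF f] kern_n(1)] by (simp add: conv_def)
	also have "... = - (LINT y|M. f y * pd i (%y. kern (1 / Suc n) (x - y)) y)"
		using pd_reflect[OF smooth_differentiable[OF smooth_cs_smooth[OF kern_n(1)]]] by simp
	also have "... = mo n (%y. g y $ i) x"
		using HgD(6)[OF f kern_test_fun[OF x]] by (simp add: mo_def conv_def)
	finally show ?thesis .
qed

lemma compact_margin:
	assumes "compact K" "K <= Om"
	obtains N where "!!n x. n >= N ==> x : K ==> cball x (2 / Suc n) <= Om"
proof -
	obtain e where e: "e > 0" "(\<Union>x\<in>K. ball x e) <= Om"
		using compact_subset_open_imp_ball_epsilon_subset[OF assms(1) open_dom assms(2)] by metis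
	obtain N where N: "inverse (real (Suc N)) < e / 3" using reals_Archimedean[of "e / 3"] e by auto
	have "cball x (2 / Suc n) <= Om" if "n >= N" "x : K" for n x
	proof -
		have "2 / real (Suc n) < e" using inv_Suc_le[OF N that(1)] e(1) by (simp add: field_simps)
		hence "cball x (2 / Suc n) <= ball x e" by auto
		thus ?thesis using e(2) that(2) by blast
	qed
	thus thesis by (rule that)
qed

text \<open>Where the kernel ball lies in the domain the weights have mass exactly 1 and the
  mollification is a genuine average; closer to the boundary the zero extension would pull it
  towards 0.\<close>

lemma mo_in_interval:
	assumes f: "integrable M f" and I: "I = UNIV \<or> I = {a..b}" and fI: "!!y. y : Om ==> f y : I"
		and x: "cball x (1 / Suc n) <= Om"
	shows "mo n f x : I"
proof (cases "I = UNIV")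
	case False
	hence ab: "I = {a..b}" using I by simp
	have one: "mo n (%y. c) x = c" for c
	proof -
		have "mo n (indicator Om) x = 1" using x ball_subset_cball by (intro mo_one) blast+
		hence "(LINT y|M. kern (1 / Suc n) (x - y)) = 1"
			unfolding mo_def conv_def by (subst (asm) bi_cong[OF refl, of _ _ "%y. kern (1 / Suc n) (x - y)"]) auto
		thus ?thesis by (simp add: mo_def conv_def)
	qed
	have "mo n (%y. a) x <= mo n f x" "mo n f x <= mo n (%y. b) x"
		using f fI by (auto intro!: mo_mono simp: ab)
	thus ?thesis by (simp add: one ab)
qed simp

text \<open>Chain rule by local mollification. The range condition is only needed on an interval, so that
  functions such as \<open>exp\<close> can be applied to bounded arguments.\<close>
lemma Hg_chain:
	assumes f: "Hg f g" and I: "I = UNIV \<or> I = {a..b}" and fI: "!!y. y : Om ==> f y : I"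
		and d: "!!y. (G has_real_derivative G' y) (at y)" and c: "continuous_on UNIV G'"
		and C: "!!y. y : I ==> abs (G' y) <= C"
	shows "Hg (%x. G (f x)) (%x. G' (f x) *R g x)"
proof -
	obtain x0 where x0: "x0 : Om" using nonempty_dom by blast
	have iI: "is_interval I" using I by (auto simp: is_interval_univ is_interval_cc)
	have C0: "C >= 0" using C[OF fI[OF x0]] by linarith
	have cG: "continuous_on UNIV G" using d by (meson DERIV_continuous_on has_field_derivative_at_within)
	have [measurable]: "G : bm borel" "G' : bm borel"
		using c cG by (auto intro: borel_measurable_continuous_onI)
	have fm [measurable]: "f : bm M" and gm [measurable]: "g : bm M"
		using HgD(1,2)[OF f] sqi_m by blast+
	have lip: "abs (G s - G t) <= C * abs (s - t)" if "s : I" "t : I" for s t by (rule mean_value_bound[OF d iI C that])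
	have sG: "sqi M (%x. G (f x))"
	proof -
		have "sqi M (%x. G (f x) - G (f x0))"
		proof (rule sqi_bound[of M "%x. f x - f x0" _ C])
			show "AE x in M. norm (G (f x) - G (f x0)) <= C * norm (f x - f x0)"
				using lip[OF fI fI[OF x0]] by (intro AE_I2) auto
		qed (use HgD(1)[OF f] in \<open>auto intro: sqi_diff\<close>)
		from sqi_add[OF this sqi_const[of "G (f x0)"]] show ?thesis by simp
	qed
	have sG': "sqi M (%x. G' (f x) *R g x)"
		using C fI by (intro sqi_mult_bounded[OF HgD(2)[OF f], of _ C]) auto
	show ?thesis
		unfolding Hg_iff
	proof (intro conjI weak_gradI sG sG')
		fix i :: 2 and ph assume ph: "tf ph"
		define K where "K = closure {x. ph x ~= 0}"
		have K: "compact K" "K <= Om" using ph by (auto simp: test_fun_def K_def)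
		have ph0: "ph x = 0" "pd i ph x = 0" if "x \<notin> K" for x
		proof -
			show "ph x = 0" using that closure_subset[of "{x. ph x ~= 0}"] by (auto simp: K_def)
			show "pd i ph x = 0"
				by (rule pd_eq_0[of "- K"]) (use that closure_subset[of "{x. ph x ~= 0}"] in \<open>auto simp: K_def\<close>)
		qed
		obtain B where B: "B > 0" "!!x. abs (ph x) <= B" using test_fun_bounded[OF ph] by blast
		have [measurable]: "ph : bm M" "pd i ph : bm M"
			using test_fun_smooth[OF ph] smooth_pd smooth_M by blast+
		obtain N where N: "!!n x. n >= N ==> x : K ==> cball x (2 / Suc n) <= Om" using compact_margin[OF K] by blast
		define u where "u n = mo (n + N) f" for n
		define v where "v n = mo (n + N) (%y. g y $ i)" for n
		have cb: "cball x (1 / Suc (n + N)) <= Om" if "x : K" for x n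
			using N[of "n + N" x] that by (meson divide_right_mono le_add2 of_nat_0_le_iff one_le_numeral order_trans subset_cball)
		have pu: "pd i (u n) x = v n x" if "x : K" for x n
			unfolding u_def v_def by (rule conv_pd_interior[OF f cb[OF that]])
		have uI: "u n x : I" if "x : K" for x n
			unfolding u_def by (rule mo_in_interval[OF HgD(4)[OF f] I fI cb[OF that]])
		have us: "smooth_R2 (u n)" for n unfolding u_def by (rule mo_smooth[OF HgD(4)[OF f]])
		have usq: "sqi M (u n)" "sqi M (v n)" for n
			unfolding u_def v_def by (rule mo_sqi[OF HgD(4)[OF f]], rule mo_sqi[OF HgD(5)[OF f]])
		have [measurable]: "u n : bm M" "v n : bm M" for n using usq sqi_m by blast+
		have [measurable]: "(%x. g x $ i) : bm M" using HgD(3)[OF f] sqi_m by blast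
		have ul: "(%n. n2 M (%x. u n x - f x)) ----> 0"
			unfolding u_def using LIMSEQ_ignore_initial_segment[OF mo_tendsto_L2[OF HgD(1)[OF f]], of N] by simp
		have vl: "(%n. n2 M (%x. v n x - g x $ i)) ----> 0"
			unfolding v_def using LIMSEQ_ignore_initial_segment[OF mo_tendsto_L2[OF HgD(3)[OF f, of i]], of N] by simp
		from n2_tendsto_AE_subseq[where f = u, OF usq(1) HgD(1)[OF f] ul]
		obtain r :: "nat => nat" where r: "strict_mono r" "AE x in M. (%n. u (r n) x) ----> f x" by blast
		have ulr: "(%n. n2 M (%x. u (r n) x - f x)) ----> 0" "(%n. n2 M (%x. v (r n) x - g x $ i)) ----> 0"
			using LIMSEQ_subseq_LIMSEQ[OF ul r(1)] LIMSEQ_subseq_LIMSEQ[OF vl r(1)] by (simp_all add: o_def)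
		have ibp: "(LINT x|M. G (u n x) * pd i ph x) = - (LINT x|M. G' (u n x) * v n x * ph x)" for n
		proof -
			have "(LINT x|M. G (u n x) * pd i ph x) = - (LINT x|M. pd i (%x. G (u n x)) x * ph x)"
			proof (rule ibp_C1[OF _ _ ph])
				show "(%x. G (u n x)) differentiable (at x)" for x
					using DERIV_compose_FDERIV[OF d grad_has_derivative[OF smooth_differentiable[OF us]]] by (auto simp: differentiable_def)
				have "pd j (%x. G (u n x)) = (%x. G' (u n x) * pd j (u n) x)" for j
					using pd_compose[OF smooth_differentiable[OF us] d] by blast
				thus "continuous_on UNIV (pd j (%x. G (u n x)))" for j
					using smooth_continuous_on[OF us] smooth_continuous_on[OF smooth_pd[OF us]]
					by (auto intro!: continuous_intros continuous_on_compose2[OF c])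
			qed
			also have "(LINT x|M. pd i (%x. G (u n x)) x * ph x) = (LINT x|M. G' (u n x) * v n x * ph x)"
			proof (intro bi_cong refl)
				fix x show "pd i (%x. G (u n x)) x * ph x = G' (u n x) * v n x * ph x"
					using pd_compose[OF smooth_differentiable[OF us] d, of i n x] pu[of x n] ph0[of x] by (cases "x : K") auto
			qed
			finally show ?thesis .
		qed
		note sp = test_fun_sqi[OF test_fun_pd[OF ph], of i] and su = sqi_diff[OF usq(1) HgD(1)[OF f]]
		have [measurable]: "K : sets borel" using K(1) by (simp add: borel_compact)
		\<comment> \<open>Outside K the mollifications may leave I, where no Lipschitz bound for G is
		  available. The cut-off costs nothing because \<open>pd i ph\<close> vanishes there.\<close>
		define p where "p n x = (if x : K then G (u (r n) x) else 0)" for n x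
		define p0 where "p0 x = (if x : K then G (f x) else 0)" for x
		have p0: "sqi M p0" by (rule sqi_bound[OF sG, of _ 1]) (auto simp: p0_def[abs_def])
		have pb: "AE x in M. norm (p n x - p0 x) <= C * norm (u (r n) x - f x)" for n
			using C0 lip[OF uI fI] by (intro AE_I2) (auto simp: p_def p0_def)
		have pd: "sqi M (%x. p n x - p0 x)" for n
			by (rule sqi_bound[OF su _ pb]) (simp add: p_def[abs_def] p0_def[abs_def])
		have pn: "sqi M (p n)" for n using sqi_add[OF pd p0, of n] by simp
		have "n2 M (%x. p n x - p0 x) <= C * n2 M (%x. u (r n) x - f x)" for n
			using n2_mono[OF pd[of n] sqi_cmult[OF su[of "r n"], of C]] pb[of n] C0 by (simp add: abs_mult)
		moreover have "(%n. C * n2 M (%x. u (r n) x - f x)) ----> 0" using tendsto_mult_left[OF ulr(1), of C] by simp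
		ultimately have "(%n. n2 M (%x. p n x - p0 x)) ----> 0" by (intro tendsto0_le[OF _ n2_nonneg])
		from tendsto_ip_left[OF pn p0 sp this]
		have L: "(%n. \<integral>x. G (u (r n) x) * pd i ph x \<partial>M) ----> (LINT x|M. G (f x) * pd i ph x)"
		proof -
			have "ip M (p n) (pd i ph) = (LINT x|M. G (u (r n) x) * pd i ph x)" "ip M p0 (pd i ph) = (LINT x|M. G (f x) * pd i ph x)" for n
				unfolding ip_def by (intro bi_cong; simp add: p_def p0_def ph0)+
			thus ?thesis using \<open>(%n. ip M (p n) (pd i ph)) ----> ip M p0 (pd i ph)\<close> by simp
		qed
		define q where "q n x = G' (u (r n) x) * ph x" for n x
		have qb: "abs (q n x) <= C * B" for n x
		proof (cases "x : K")
			case True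
			have "abs (G' (u (r n) x)) * abs (ph x) <= C * B" using C[OF uI[OF True]] B C0 by (intro mult_mono) auto
			thus ?thesis by (simp add: abs_mult q_def)
		qed (use ph0 B C0 in \<open>auto simp: q_def\<close>)
		have sq: "sqi M (q n)" for n by (rule bounded_sqi[of _ "C * B"]) (use qb in \<open>auto simp: q_def[abs_def]\<close>)
		note sg = HgD(3)[OF f, of i]
		note sv = sqi_diff[OF usq(2) sg]
		\<comment> \<open>The derivative term is split as (v - g) q + g q: the first part tends to zero in
		  L^2 against the bounded q, the second by dominated convergence along the almost everywhere
		  convergent subsequence.\<close>
		have R1: "(%n. ip M (%x. v (r n) x - g x $ i) (q n)) ----> 0"
		proof (rule tendsto_rabs_zero_cancel, rule tendsto0_le[OF _ abs_ge_zero])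
			show "(%n. n2 M (%x. v (r n) x - g x $ i) * n2 M (%x. C * B)) ----> 0" using tendsto_mult_right[OF ulr(2)] by simp
			have "n2 M (q n) <= n2 M (%x. C * B)" for n using qb C0 B(1) by (intro n2_mono sq sqi_const AE_I2) auto
			thus "abs (ip M (%x. v (r n) x - g x $ i) (q n)) <= n2 M (%x. v (r n) x - g x $ i) * n2 M (%x. C * B)" for n
				using order_trans[OF ip_Cauchy_Schwarz[OF sv sq] mult_left_mono] n2_nonneg by blast
		qed
		have dm: "integrable M (%x. C * B * abs (g x $ i))" using HgD(5)[OF f] by auto
		have R2: "(%n. ip M (%x. g x $ i) (q n)) ----> (LINT x|M. g x $ i * (G' (f x) * ph x))"
			unfolding ip_def inner_real_def
		proof (rule integral_dominated_convergence[OF _ _ dm])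
			show "AE x in M. norm (g x $ i * q n x) <= C * B * abs (g x $ i)" for n
				using qb by (intro AE_I2) (simp add: abs_mult mult_right_mono mult.commute[of "abs (g _ $ i)"])
			show "AE x in M. (%n. g x $ i * q n x) ----> g x $ i * (G' (f x) * ph x)"
				using r(2)
			proof eventually_elim
				case (elim x)
				have "isCont G' (f x)" using c by (simp add: continuous_on_eq_continuous_at)
				from isCont_tendsto_compose[OF this elim] show ?case unfolding q_def by (intro tendsto_intros)
			qed
		qed (simp_all add: q_def[abs_def])
		have "(LINT x|M. G' (u (r n) x) * v (r n) x * ph x) = ip M (%x. v (r n) x - g x $ i) (q n) + ip M (%x. g x $ i) (q n)" for n
			unfolding ip_diff_left[OF usq(2) sg sq] by (simp add: ip_def q_def mult_ac)
		hence "(%n. \<integral>x. G (u (r n) x) * pd i ph x \<partial>M) ----> - (LINT x|M. g x $ i * (G' (f x) * ph x))"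
			unfolding ibp using tendsto_minus[OF tendsto_add[OF R1 R2]] by simp
		from LIMSEQ_unique[OF L this]
		show "(LINT x|M. G (f x) * pd i ph x) = - (LINT x|M. (G' (f x) *R g x) $ i * ph x)"
			by (simp add: mult_ac)
	qed
qed

end

lemma n2_dominated:
	fixes h :: "nat => 'a => 'b::euclidean_space" and g :: "'a => 'c::euclidean_space"
	assumes [measurable]: "!!n. h n : bm M" and g: "sqi M g"
		and b: "!!n. AE x in M. norm (h n x) <= C * norm (g x)" and l: "AE x in M. (%n. h n x) ----> 0"
	shows "(%n. n2 M (h n)) ----> 0"
proof -
	have "(%n. \<integral>x. (norm (h n x))^2 \<partial>M) ----> (LINT x|M. 0)"
	proof (rule integral_dominated_convergence[of _ _ _ "%x. C^2 * (norm (g x))^2"])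
		show "AE x in M. (%n. (norm (h n x))^2) ----> 0"
			using l
		proof eventually_elim
			case (elim x)
			from tendsto_power[OF tendsto_norm_zero[OF elim], of 2] show ?case by simp
		qed
		show "AE x in M. norm ((norm (h n x))^2) <= C^2 * (norm (g x))^2" for n
			using b[of n]
		proof eventually_elim
			case (elim x)
			from power_mono[OF elim norm_ge_zero, of 2] show ?case by (simp add: power_mult_distrib)
		qed
	qed (use sqi_integrable[OF g] in auto)
	hence "(%n. sqrt (LINT x|M. (norm (h n x))^2)) ----> sqrt 0" by (intro tendsto_real_sqrt) simp
	thus ?thesis by (simp add: n2_def ip_self)
qed

section \<open>Products and truncations, also under zero boundary values\<close>

context bdom
begin

lemma n2_vec_le:
	fixes g :: "real^2 => real^2"
	assumes "sqi M g" shows "n2 M g <= n2 M (%x. g x $ 1) + n2 M (%x. g x $ 2)"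
proof -
	have s: "sqi M (%x. g x $ i)" for i using assms sqi_vec_iff by blast
	have "n2 M g <= n2 M (%x. norm (g x $ 1) + norm (g x $ 2))"
		using norm_vec2_le by (intro n2_mono assms sqi_add sqi_norm s) auto
	also have "... <= n2 M (%x. norm (g x $ 1)) + n2 M (%x. norm (g x $ 2))"
		by (intro n2_triangle sqi_norm s)
	finally show ?thesis by (simp only: n2_norm)
qed

lemma Hg_square:
	assumes f: "Hg f g" and b: "!!x. x : Om ==> abs (f x) <= c"
	shows "Hg (%x. (f x)^2) (%x. (2 * f x) *R g x)"
proof (rule Hg_chain[OF f, of "{-c..c}" "-c" c "%y. y^2" "%y. 2 * y" "2 * c"])
	show "f y : {-c..c}" if "y : Om" for y using b[OF that] by auto
qed (auto intro!: derivative_eq_intros continuous_intros)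

text \<open>Polarisation, 4 f f' = (f + f')^2 - (f - f')^2, reduces products to squares.\<close>

lemma Hg_mult:
	assumes f: "Hg f g" "!!x. x : Om ==> abs (f x) <= c" and f': "Hg f' g'" "!!x. x : Om ==> abs (f' x) <= c'"
	shows "Hg (%x. f x * f' x) (%x. f x *R g' x + f' x *R g x)"
proof -
	have "abs (f x + f' x) <= c + c'" "abs (f x - f' x) <= c + c'" if "x : Om" for x using f(2)[OF that] f'(2)[OF that] by linarith+
	note Hg_lin[OF Hg_square[OF Hg_add[OF f(1) f'(1)] this(1)] Hg_square[OF Hg_diff[OF f(1) f'(1)] this(2)],
			of "1/4" "-1/4"]
	moreover have "1/4 * (f x + f' x)^2 + (-1/4) * (f x - f' x)^2 = f x * f' x" for x
		by (simp add: power2_sum power2_diff field_simps)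
	moreover have "(1/4) *R (2 * (f x + f' x)) *R (g x + g' x) + (-1/4) *R (2 * (f x - f' x)) *R (g x - g' x)
		= f x *R g' x + f' x *R g x" for x
		by (simp add: vec_eq_iff algebra_simps)
	ultimately show ?thesis by simp
qed

text \<open>A smooth approximation of the positive part, shifted so that its derivative vanishes in the
  limit at the kink.\<close>
definition sp :: "real => real => real" where
	"sp e y = ((y - e) + sqrt ((y - e)^2 + e^4)) / 2"

definition sp' :: "real => real => real" where
	"sp' e y = (1 + (y - e) / sqrt ((y - e)^2 + e^4)) / 2"

lemma sp_deriv: assumes "e > 0" shows "(sp e has_real_derivative sp' e y) (at y)"
proof -
	have "(y - e)^2 + e^4 > 0" using assms by (simp add: add_nonneg_pos)
	thus ?thesis unfolding sp_def[abs_def] sp'_def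
		by (auto intro!: derivative_eq_intros simp: field_simps)
qed

lemma sp'_cont: assumes "e > 0" shows "continuous_on UNIV (sp' e)"
proof -
	have "sqrt ((y - e)^2 + e^4) ~= 0" for y using assms by (simp add: add_nonneg_eq_0_iff)
	thus ?thesis unfolding sp'_def[abs_def] by (intro continuous_intros) auto
qed

lemma sp'_bounds: assumes "e > 0" shows "0 <= sp' e y" "sp' e y <= 1"
proof -
	have "abs (y - e) = sqrt ((y - e)^2)" by simp
	also have "... <= sqrt ((y - e)^2 + e^4)" by (intro real_sqrt_le_mono) simp
	finally have 1: "abs (y - e) <= sqrt ((y - e)^2 + e^4)" .
	have "sqrt ((y - e)^2 + e^4) > 0" using assms by (simp add: add_nonneg_pos)
	hence "abs ((y - e) / sqrt ((y - e)^2 + e^4)) <= 1" using 1 by (simp add: field_simps)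
	hence "-1 <= (y - e) / sqrt ((y - e)^2 + e^4)" "(y - e) / sqrt ((y - e)^2 + e^4) <= 1"
		unfolding abs_le_iff by linarith+
	moreover have "0 <= (1 + q) / 2" "(1 + q) / 2 <= 1" if "-1 <= q" "q <= 1" for q :: real using that by auto
	ultimately show "0 <= sp' e y" "sp' e y <= 1" unfolding sp'_def by blast+
qed

lemma sp_approx: assumes "0 < e" "e <= 1" shows "abs (sp e y - max y 0) <= 2 * e"
proof -
	define s where "s = y - e"
	have "abs s = sqrt (s^2)" by simp
	also have "... <= sqrt (s^2 + e^4)" by (intro real_sqrt_le_mono) simp
	finally have 1: "abs s <= sqrt (s^2 + e^4)" .
	have "s^2 + e^4 <= (abs s + e^2)^2" by (simp add: power2_sum flip: power_mult)
	hence 2: "sqrt (s^2 + e^4) <= abs s + e^2" by (intro real_le_lsqrt) auto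
	have "e^2 <= e" using assms by (simp add: power2_eq_square mult_left_le)
	moreover have "s + abs s = 2 * max s 0" by (simp add: max_def)
	moreover have "max s 0 <= max y 0" "max y 0 <= max s 0 + e" using assms by (auto simp: s_def max_def)
	ultimately show ?thesis using 1 2 assms unfolding sp_def s_def[symmetric] abs_le_iff by (auto simp: field_simps)
qed

lemma sp'_lim: "(%n. sp' (1 / Suc n) y) ----> (if y > 0 then 1 else 0)"
proof -
	have e: "(%n. 1 / real (Suc n)) ----> 0" using LIMSEQ_inverse_real_of_nat by (simp add: inverse_eq_divide)
	show ?thesis
	proof (cases "y = 0")
		case False
		have "(%n. (1 + (y - 1 / Suc n) / sqrt ((y - 1 / Suc n)^2 + (1 / Suc n)^4)) / 2) ----> (1 + (y - 0) / sqrt ((y - 0)^2 + 0^4)) / 2"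
			by (intro tendsto_intros e) (use False in auto)
		moreover have "(1 + (y - 0) / sqrt ((y - 0)^2 + 0^4)) / 2 = (if y > 0 then 1 else 0)" using False by (auto simp: abs_if)
		ultimately show ?thesis by (simp add: sp'_def)
	next
		case True
		\<comment> \<open>At the kink the shift e dominates the regularisation, since e^4 is of lower
		  order than e^2. The quotient in \<open>sp'\<close> therefore tends to -1 and the limit is
		  0.\<close>
		have "sp' (1 / Suc n) 0 = (1 - 1 / sqrt (1 + (1 / Suc n)^2)) / 2" for n
		proof -
			define t where "t = 1 / real (Suc n)"
			have t: "t > 0" by (simp add: t_def)
			have "(0 - t)^2 + t^4 = t^2 * (1 + t^2)" by (simp add: algebra_simps power2_eq_square power4_eq_xxxx)
			hence "sqrt ((0 - t)^2 + t^4) = t * sqrt (1 + t^2)" using t by (simp add: real_sqrt_mult)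
			thus ?thesis unfolding t_def[symmetric] sp'_def using t by (simp add: field_simps)
		qed
		moreover have "(%n. (1 - 1 / sqrt (1 + (1 / Suc n)^2)) / 2) ----> (1 - 1 / sqrt (1 + 0^2)) / 2"
			by (intro tendsto_intros e) auto
		ultimately have "(%n. sp' (1 / Suc n) 0) ----> (1 - 1 / sqrt (1 + 0^2)) / 2" by (simp only:)
		thus ?thesis using True by simp
	qed
qed

lemma Hg_pos:
	assumes f: "Hg f g"
	shows "Hg (%x. max (f x) 0) (%x. if f x > 0 then g x else 0)"
proof (rule Hg_limit)
	have [measurable]: "f : bm M" "g : bm M" using HgD(1,2)[OF f] sqi_m by blast+
	define e where "e n = 1 / real (Suc n)" for n
	have e: "0 < e n" "e n <= 1" for n by (auto simp: e_def)
	have e0: "e ----> 0" unfolding e_def using LIMSEQ_inverse_real_of_nat by (simp add: inverse_eq_divide)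
	show h: "Hg (%x. sp (e n) (f x)) (%x. sp' (e n) (f x) *R g x)" for n
		by (rule Hg_chain[OF f, of UNIV 0 0 "sp (e n)" "sp' (e n)" 1])
			(use sp_deriv sp'_cont sp'_bounds e in \<open>auto simp: abs_le_iff intro: order_trans[OF _ sp'_bounds(1)]\<close>)
	show s: "sqi M (%x. max (f x) 0)" by (rule sqi_bound[OF HgD(1)[OF f], of _ 1]) auto
	show s': "sqi M (%x. if f x > 0 then g x else 0)" by (rule sqi_bound[OF HgD(2)[OF f], of _ 1]) auto
	have l: "(%n. 2 * e n * n2 M (%x. 1 :: real)) ----> 0"
		using tendsto_mult_left[OF tendsto_mult_right[OF e0], of 2 "n2 M (%x. 1 :: real)"] by (simp add: mult.assoc)
	show "(%n. n2 M (%x. sp (e n) (f x) - max (f x) 0)) ----> 0"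
	proof (rule tendsto0_le[OF l])
		fix n
		have "n2 M (%x. sp (e n) (f x) - max (f x) 0) <= n2 M (%x. 2 * e n * (1::real))"
			using sp_approx[OF e, of n] e[of n] by (intro n2_mono sqi_diff HgD(1)[OF h] s) auto
		also have "... = 2 * e n * n2 M (%x. 1 :: real)" unfolding n2_cmult using e[of n] by simp
		finally show "n2 M (%x. sp (e n) (f x) - max (f x) 0) <= 2 * e n * n2 M (%x. 1 :: real)" .
	qed simp
	show "(%n. n2 M (%x. sp' (e n) (f x) *R g x - (if f x > 0 then g x else 0))) ----> 0"
	proof (rule n2_dominated[OF _ HgD(2)[OF f]])
		show "(%x. sp' (e n) (f x) *R g x - (if f x > 0 then g x else 0)) : bm M" for n
			using sqi_diff[OF HgD(2)[OF h] s'] by (rule sqi_m)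
		have "norm (sp' (e n) (f x) *R g x - (if f x > 0 then g x else 0)) <= 1 * norm (g x)" for n x
		proof -
			have "sp' (e n) (f x) *R g x - (if f x > 0 then g x else 0) = (sp' (e n) (f x) - (if f x > 0 then 1 else 0)) *R g x"
				by (simp add: scaleR_diff_left)
			moreover have "abs (sp' (e n) (f x) - (if f x > 0 then 1 else 0)) <= 1" using sp'_bounds[OF e(1)[of n], of "f x"] by auto
			ultimately show ?thesis by (metis norm_scaleR mult_right_mono norm_ge_zero)
		qed
		thus "AE x in M. norm (sp' (e n) (f x) *R g x - (if f x > 0 then g x else 0)) <= 1 * norm (g x)" for n by simp
		have "(%n. sp' (e n) (f x) *R g x - (if f x > 0 then g x else 0)) ----> (if f x > 0 then 1 else 0) *R g x - (if f x > 0 then g x else 0)" for x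
			unfolding e_def by (intro tendsto_intros sp'_lim)
		moreover have "(if f x > 0 then 1 else 0) *R g x - (if f x > 0 then g x else 0) = 0" for x by simp
		ultimately show "AE x in M. (%n. sp' (e n) (f x) *R g x - (if f x > 0 then g x else 0)) ----> 0" by (intro AE_I2) metis
	qed
qed

text \<open>f is the difference of its positive and negative parts, whose gradients both vanish on
  {f = 0}; weak gradients are unique.\<close>

lemma Hg_level:
	assumes f: "Hg f g" shows "AE x in M. f x = 0 --> g x = 0"
proof -
	note Hg_diff[OF Hg_pos[OF f] Hg_pos[OF Hg_cmult[OF f, of "-1"]]]
	moreover have "(%x. max (f x) 0 - max (-1 * f x) 0) = f" by (auto simp: max_def)
	ultimately have "Hg f (%x. (if f x > 0 then g x else 0) - (if -1 * f x > 0 then -1 *R g x else 0))" by simp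
	from Hg_unique[OF f this] show ?thesis by eventually_elim auto
qed

lemma Hg_pos_above:
	assumes "Hg f g" shows "Hg (%x. max (f x - k) 0) (%x. if f x > k then g x else 0)"
	using Hg_pos[OF Hg_diff[OF assms Hg_const[of k]]] unfolding diff_zero diff_gt_0_iff_gt .

lemma Hg_clip:
	assumes f: "Hg f g" and m: "m >= 0"
	shows "Hg (%x. max (-m) (min m (f x))) (%x. if - m <= f x & f x <= m then g x else 0)"
proof -
	define f1 g1 where "f1 x = f x - max (f x - m) 0" and "g1 x = g x - (if f x > m then g x else 0)" for x
	have h1: "Hg f1 g1" unfolding f1_def g1_def by (intro Hg_diff f Hg_pos_above)
	have "Hg (%x. f1 x + max (-1 * f1 x - m) 0) (%x. g1 x + (if -1 * f1 x > m then -1 *R g1 x else 0))"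
		by (intro Hg_add h1 Hg_pos_above Hg_cmult)
	moreover have "f1 x + max (-1 * f1 x - m) 0 = max (-m) (min m (f x))" for x by (auto simp: f1_def max_def min_def)
	moreover have "g1 x + (if -1 * f1 x > m then -1 *R g1 x else 0) = (if - m <= f x & f x <= m then g x else 0)" for x
		using m by (auto simp: f1_def g1_def max_def)
	ultimately show ?thesis by simp
qed

text \<open>For small radius the mollifications of f are test functions. Replacing g by its
  restriction to K, allowed by \<open>Hg_level\<close>, makes the mollified gradient vanish off a
  neighbourhood of K as well, so that it equals the gradient of the mollification
  everywhere.\<close>

lemma Z_compact_support:
	assumes f: "Hg f g" and K: "compact K" "K <= Om" and z: "!!x. x : Om ==> x \<notin> K ==> f x = 0"
	shows "Z f g"
proof -
	have Kb: "K : sets borel" using K(1) by (simp add: borel_compact)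
	have [measurable]: "g : bm M" "f : bm M" using HgD(1,2)[OF f] sqi_m by blast+
	define g' where "g' x = indicator K x *R g x" for x
	have [measurable]: "(%x. indicator K x :: real) : bm M" using Kb by (intro borel_M) auto
	have g'm: "g' : bm M" unfolding g'_def by measurable
	have "AE x in M. g x = g' x"
		using Hg_level[OF f]
	proof (rule AE_mp, intro AE_I2 impI)
		fix x assume "x : space M" "f x = 0 --> g x = 0"
		thus "g x = g' x" using z[of x] by (auto simp: g'_def indicator_def)
	qed
	hence f': "Hg f g'" and gg: "AE x in M. g' x = g x" using Hg_cong[OF f _ g'm] by auto
	obtain N where N: "!!n x. n >= N ==> x : K ==> cball x (2 / Suc n) <= Om" using compact_margin[OF K] by blast
	\<comment> \<open>The closed neighbourhood K + cball 0 (1 / Suc n), which contains the support of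
	  the mollification.\<close>
	define S where "S n = {x + y | x y. x : K & y : cball 0 (1 / real (Suc n))}" for n
	have SK: "compact (S n)" for n unfolding S_def by (intro compact_sums K compact_cball)
	have SOm: "cball x (1 / Suc n) <= Om" if "x : S n" "n >= N" for x n
	proof -
		have "EX k y. x = k + y & k : K & norm y <= 1 / Suc n" using that(1) by (force simp: S_def)
		then obtain k y where ky: "x = k + y" "k : K" "norm y <= 1 / Suc n" by blast
		have "cball x (1 / Suc n) <= cball k (2 / Suc n)"
		proof
			fix z assume "z : cball x (1 / Suc n)"
			hence "dist x z <= 1 / Suc n" by simp
			moreover have "dist k z <= dist k x + dist x z" by (rule dist_triangle)
			moreover have "dist k x = norm y" using ky(1) by (simp add: dist_norm)
			moreover have "2 / real (Suc n) = 1 / Suc n + 1 / Suc n" by simp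
			ultimately have "dist k z <= 2 / Suc n" using ky(3) by linarith
			thus "z : cball k (2 / Suc n)" by simp
		qed
		thus ?thesis using N[OF that(2) ky(2)] by blast
	qed
	have z0: "mo n h x = 0" if "x \<notin> S n" "!!y. y : Om ==> y \<notin> K ==> h y = 0" for n h x
	proof -
		have "h y * kern (1 / Suc n) (x - y) = 0" if "y : Om" for y
		proof (cases "y : K")
			case True
			have "norm (x - y) >= 1 / Suc n"
			proof (rule ccontr)
				assume "\<not> ?thesis"
				hence "x : S n" unfolding S_def using True by (intro CollectI, rule_tac exI[of _ y], rule_tac exI[of _ "x - y"]) auto
				thus False using \<open>x \<notin> S n\<close> by simp
			qed
			thus ?thesis using kern_n(3) by simp
		qed (use that \<open>!!y. y : Om ==> y \<notin> K ==> h y = 0\<close> in simp)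
		thus ?thesis unfolding mo_def conv_def
			by (subst bi_cong[OF refl, of _ _ "%y. 0"]) auto
	qed
	have fz: "mo n f x = 0" if "x \<notin> S n" for n x by (rule z0[OF that z])
	have t: "tf (mo n f)" if "n >= N" for n
	proof -
		have "{x. mo n f x ~= 0} <= S n" using fz by blast
		hence c: "closure {x. mo n f x ~= 0} <= S n" using SK by (simp add: closure_minimal compact_imp_closed)
		hence "compact (closure {x. mo n f x ~= 0})"
			using SK by (meson bounded_subset closed_closure compact_eq_bounded_closed)
		moreover have "S n <= Om"
		proof
			fix x assume "x : S n"
			from SOm[OF this that] show "x : Om" by auto
		qed
		ultimately show ?thesis using c mo_smooth[OF HgD(4)[OF f]] unfolding test_fun_def by blast
	qed
	have p: "pd i (mo n f) x = mo n (%y. g' y $ i) x" if "n >= N" for n x i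
	proof (cases "x : S n")
		case True
		thus ?thesis by (intro conv_pd_interior[OF f' SOm[OF _ that]])
	next
		case False
		have "pd i (mo n f) x = 0"
			by (rule pd_eq_0[of "- S n"]) (use False fz open_Compl[OF compact_imp_closed[OF SK]] in auto)
		moreover have "mo n (%y. g' y $ i) x = 0" by (rule z0[OF False]) (simp add: g'_def)
		ultimately show ?thesis by simp
	qed
	have gl: "(%n. n2 M (%x. grad (mo (n + N) f) x - g' x)) ----> 0"
	proof (rule tendsto0_le)
		have "(%n. n2 M (%x. mo (n + N) (%y. g' y $ i) x - g' x $ i)) ----> 0" for i
			using LIMSEQ_ignore_initial_segment[OF mo_tendsto_L2[OF HgD(3)[OF f', of i]], of N] by simp
		from tendsto_add[OF this[of 1] this[of 2]]
		show "(%n. n2 M (%x. mo (n + N) (%y. g' y $ 1) x - g' x $ 1) + n2 M (%x. mo (n + N) (%y. g' y $ 2) x - g' x $ 2)) ----> 0"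
			by simp
		fix n
		show "n2 M (%x. grad (mo (n + N) f) x - g' x)
			<= n2 M (%x. mo (n + N) (%y. g' y $ 1) x - g' x $ 1) + n2 M (%x. mo (n + N) (%y. g' y $ 2) x - g' x $ 2)"
			using n2_vec_le[OF sqi_diff[OF test_grad_sqi[OF t[of "n + N"]] HgD(2)[OF f']]] p[of "n + N"] by (simp add: grad_def)
	qed simp
	have fl: "(%n. n2 M (%x. mo (n + N) f x - f x)) ----> 0"
		using LIMSEQ_ignore_initial_segment[OF mo_tendsto_L2[OF HgD(1)[OF f]], of N] by simp
	have "Z f g'"
	proof (rule Z_limit)
		show "Z (mo (n + N) f) (grad (mo (n + N) f))" for n by (rule Z_test[OF t]) simp
		show "(%n. n2 M (%x. (mo (n + N) f x - f x, grad (mo (n + N) f) x - g' x))) ----> 0"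
			using fl gl test_fun_sqi[OF t] test_grad_sqi[OF t] HgD(1,2)[OF f']
			by (subst n2_Pair_tendsto) (auto intro!: sqi_diff)
	qed (use HgD(1,2)[OF f'] in auto)
	thus ?thesis using gg by (intro Z_cong[of f g' f g]) auto
qed

text \<open>Clipping the approximating test functions at m preserves compact support and brings them
  no farther from V. Smoothness is lost and the gradients are merely bounded, which is what
  \<open>Z_compact_support\<close> and \<open>Z_weak\<close> tolerate.\<close>

lemma Z_bounded_approx:
	assumes Z: "Z V GV" and m: "!!x. x : Om ==> abs (V x) <= m"
	obtains ps gam K B where "!!n. Hg (ps n) (gam n)" "!!n x. abs (ps n x) <= m" "!!n. compact (K n)" "!!n. K n <= Om"
		"!!n x. x \<notin> K n ==> ps n x = 0" "(%n. n2 M (%x. ps n x - V x)) ----> 0" "!!n. n2 M (gam n) <= B"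
proof -
	obtain x0 where "x0 : Om" using nonempty_dom by blast
	hence m0: "m >= 0" using m[of x0] by linarith
	note sV = HgD(1,2)[OF Z_H1[OF Z]]
	obtain ph where t: "!!n. tf (ph n)" and l: "(%n. n2 M (%x. (ph n x - V x, grad (ph n) x - GV x))) ----> 0"
		using Z by (auto simp: Z_def)
	have ls: "(%n. n2 M (%x. ph n x - V x)) ----> 0" "(%n. n2 M (%x. grad (ph n) x - GV x)) ----> 0"
		using l n2_Pair_tendsto[of M "%n x. ph n x - V x" "%n x. grad (ph n) x - GV x"] test_fun_sqi[OF t] test_grad_sqi[OF t] sV
		by (auto simp: sqi_diff)
	have "convergent (%n. n2 M (grad (ph n)))"
		using tendsto_n2[where f = "%n. grad (ph n)", OF test_grad_sqi[OF t] sV(2) ls(2)] by (auto simp: convergent_def)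
	then obtain B where B: "!!n. n2 M (grad (ph n)) <= B"
		using Bseq_def convergent_imp_Bseq by (metis abs_le_D1 real_norm_def)
	define ps where "ps n x = max (-m) (min m (ph n x))" for n x
	define gam where "gam n x = (if - m <= ph n x & ph n x <= m then grad (ph n) x else 0)" for n x
	have h: "Hg (ps n) (gam n)" for n unfolding ps_def gam_def by (rule Hg_clip[OF Hg_test[OF t] m0])
	show thesis
	proof (rule that[of ps gam "%n. closure {x. ph n x ~= 0}" B])
		show "abs (ps n x) <= m" for n x using m0 by (auto simp: ps_def)
		show "compact (closure {x. ph n x ~= 0})" "closure {x. ph n x ~= 0} <= Om" for n using t by (auto simp: test_fun_def)
		show "ps n x = 0" if "x \<notin> closure {x. ph n x ~= 0}" for n x
		proof -
			have "ph n x = 0" using that closure_subset[of "{x. ph n x ~= 0}"] by auto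
			thus ?thesis using m0 by (simp add: ps_def)
		qed
		show "(%n. n2 M (%x. ps n x - V x)) ----> 0"
		proof (rule tendsto0_le[OF ls(1)])
			fix n
			have "abs (ps n x - V x) <= abs (ph n x - V x)" if "x : Om" for x
			proof -
				have "-m <= V x" "V x <= m" using m[OF that] by linarith+
				thus ?thesis using m0 by (auto simp: ps_def max_def min_def abs_if)
			qed
			thus "n2 M (%x. ps n x - V x) <= n2 M (%x. ph n x - V x)"
				by (intro n2_mono sqi_diff HgD(1)[OF h] sV test_fun_sqi[OF t] AE_I2) auto
		qed simp
		show "n2 M (gam n) <= B" for n
			using B[of n] by (intro order_trans[OF n2_mono[OF HgD(2)[OF h] test_grad_sqi[OF t]] B]) (auto simp: gam_def)
	qed (rule h)
qed

text \<open>A factor of compact support makes the product compactly supported, whatever the boundary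
  behaviour of w; the limit is taken with bounded gradients only.\<close>

lemma Z_mult:
	assumes Z: "Z V GV" and m: "!!x. x : Om ==> abs (V x) <= m" and w: "Hg w gw" "!!x. x : Om ==> abs (w x) <= c"
	shows "Z (%x. V x * w x) (%x. V x *R gw x + w x *R GV x)"
proof -
	obtain x0 where x0: "x0 : Om" using nonempty_dom by blast
	have m0: "m >= 0" "c >= 0" using m[OF x0] w(2)[OF x0] by linarith+
	obtain ps gam K B where a: "!!n. Hg (ps n) (gam n)" "!!n x. abs (ps n x) <= m" "!!n. compact (K n)" "!!n. K n <= Om"
		"!!n x. x \<notin> K n ==> ps n x = 0" "(%n. n2 M (%x. ps n x - V x)) ----> 0" "!!n. n2 M (gam n) <= B"
		by (rule Z_bounded_approx[OF Z m]) (assumption | rule that)+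
	have h: "Hg (%x. ps n x * w x) (%x. ps n x *R gw x + w x *R gam n x)" for n
		by (rule Hg_mult[OF a(1) _ w]) (use a(2) in auto)
	have wm: "w : bm M" "ps n : bm M" for n using HgD(1)[OF w(1)] HgD(1)[OF a(1)] sqi_m by blast+
	show ?thesis
	proof (rule Z_weak)
		show "Z (%x. ps n x * w x) (%x. ps n x *R gw x + w x *R gam n x)" for n
			by (rule Z_compact_support[OF h a(3)[of n] a(4)[of n]]) (use a(5) in auto)
		show H: "Hg (%x. V x * w x) (%x. V x *R gw x + w x *R GV x)"
			by (rule Hg_mult[OF Z_H1[OF Z] m w])
		show "(%n. n2 M (%x. ps n x * w x - V x * w x)) ----> 0"
		proof (rule tendsto0_le)
			show "(%n. c * n2 M (%x. ps n x - V x)) ----> 0" using tendsto_mult_left[OF a(6), of c] by simp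
			fix n
			have "n2 M (%x. ps n x * w x - V x * w x) <= n2 M (%x. c * (ps n x - V x))"
			proof (intro n2_mono sqi_diff sqi_cmult HgD(1)[OF h] HgD(1)[OF H] HgD(1)[OF a(1)] HgD(1)[OF Z_H1[OF Z]] AE_I2)
				fix x assume "x : space M"
				hence "abs (w x) * abs (ps n x - V x) <= c * abs (ps n x - V x)" using w(2) by (intro mult_right_mono) auto
				moreover have "ps n x * w x - V x * w x = w x * (ps n x - V x)" by (simp add: algebra_simps)
				ultimately show "norm (ps n x * w x - V x * w x) <= norm (c * (ps n x - V x))"
					using m0 by (simp add: abs_mult)
			qed
			thus "n2 M (%x. ps n x * w x - V x * w x) <= c * n2 M (%x. ps n x - V x)" using m0 by simp
		qed simp
		show "n2 M (%x. ps n x *R gw x + w x *R gam n x) <= m * n2 M gw + c * B" for n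
		proof -
			have s: "sqi M (%x. ps n x *R gw x)" "sqi M (%x. w x *R gam n x)"
				using a(2) w(2) by (auto intro!: sqi_mult_bounded[OF HgD(2)[OF w(1)], of _ m] sqi_mult_bounded[OF HgD(2)[OF a(1)], of _ c] wm)
			have "n2 M (%x. ps n x *R gw x + w x *R gam n x) <= n2 M (%x. ps n x *R gw x) + n2 M (%x. w x *R gam n x)"
				by (rule n2_triangle[OF s])
			also have "... <= n2 M (%x. m *R gw x) + n2 M (%x. c *R gam n x)"
				using a(2) w(2) m0 by (intro add_mono n2_mono s sqi_scaleR HgD(2)[OF w(1)] HgD(2)[OF a(1)] AE_I2) (auto intro!: mult_right_mono)
			also have "... = m * n2 M gw + c * n2 M (gam n)" using m0 by (simp only: n2_scaleR abs_of_nonneg)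
			also have "... <= m * n2 M gw + c * B" using a(7)[of n] m0 by (intro add_mono mult_left_mono) auto
			finally show ?thesis .
		qed
	qed
qed

lemma Z_chain:
	assumes Z: "Z V GV" and m: "!!x. x : Om ==> abs (V x) <= m"
		and d: "!!y. (G has_real_derivative G' y) (at y)" and c: "continuous_on UNIV G'" and G0: "G 0 = 0"
		and C: "!!y. y : {-m..m} ==> abs (G' y) <= C"
	shows "Z (%x. G (V x)) (%x. G' (V x) *R GV x)"
proof -
	obtain x0 where x0: "x0 : Om" using nonempty_dom by blast
	have m0: "m >= 0" using m[OF x0] by linarith
	have C0: "C >= 0" using C[of 0] m0 by auto
	obtain ps gam K B where a: "!!n. Hg (ps n) (gam n)" "!!n x. abs (ps n x) <= m" "!!n. compact (K n)" "!!n. K n <= Om"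
		"!!n x. x \<notin> K n ==> ps n x = 0" "(%n. n2 M (%x. ps n x - V x)) ----> 0" "!!n. n2 M (gam n) <= B"
		by (rule Z_bounded_approx[OF Z m]) (assumption | rule that)+
	have h: "Hg (%x. G (ps n x)) (%x. G' (ps n x) *R gam n x)" for n
		by (rule Hg_chain[OF a(1) _ _ d c C, where I = "{-m..m}" and a = "-m" and b = m]) (use a(2) in \<open>auto simp: abs_le_iff minus_le_iff\<close>)
	have H: "Hg (%x. G (V x)) (%x. G' (V x) *R GV x)"
		by (rule Hg_chain[OF Z_H1[OF Z] _ _ d c C, where I = "{-m..m}" and a = "-m" and b = m]) (use m in \<open>auto simp: abs_le_iff minus_le_iff\<close>)
	show ?thesis
	proof (rule Z_weak[OF _ _ _ H])
		show "Z (%x. G (ps n x)) (%x. G' (ps n x) *R gam n x)" for n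
			by (rule Z_compact_support[OF h a(3)[of n] a(4)[of n]]) (use a(5) G0 in auto)
		show "(%n. n2 M (%x. G (ps n x) - G (V x))) ----> 0"
		proof (rule tendsto0_le)
			show "(%n. C * n2 M (%x. ps n x - V x)) ----> 0" using tendsto_mult_left[OF a(6), of C] by simp
			fix n
			have "n2 M (%x. G (ps n x) - G (V x)) <= n2 M (%x. C * (ps n x - V x))"
			proof (intro n2_mono sqi_diff sqi_cmult HgD(1)[OF h] HgD(1)[OF H] HgD(1)[OF a(1)] HgD(1)[OF Z_H1[OF Z]] AE_I2)
				fix x assume "x : space M"
				hence "ps n x : {-m..m}" "V x : {-m..m}" using a(2)[of n x] m[of x] by (auto simp: abs_le_iff)
				from mean_value_bound[OF d is_interval_cc C this]
				show "norm (G (ps n x) - G (V x)) <= norm (C * (ps n x - V x))" using C0 by (simp add: abs_mult)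
			qed
			thus "n2 M (%x. G (ps n x) - G (V x)) <= C * n2 M (%x. ps n x - V x)" using C0 by simp
		qed simp
		show "n2 M (%x. G' (ps n x) *R gam n x) <= C * B" for n
		proof -
			have "n2 M (%x. G' (ps n x) *R gam n x) <= n2 M (%x. C *R gam n x)"
				using a(2) C C0 by (intro n2_mono HgD(2)[OF h] sqi_scaleR HgD(2)[OF a(1)] AE_I2)
					(auto intro!: mult_right_mono simp: abs_le_iff minus_le_iff)
			also have "... <= C * B" unfolding n2_scaleR using a(7)[of n] C0 by (simp add: mult_left_mono)
			finally show ?thesis .
		qed
	qed
qed

text \<open>The sign of k makes the truncation vanish where the approximating test function
  does.\<close>

lemma Z_pos:
	assumes Z: "Z V GV" and k: "k >= 0"
	shows "Z (%x. max (V x - k) 0) (%x. if V x > k then GV x else 0)"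
proof -
	note sV = HgD(1,2)[OF Z_H1[OF Z]]
	obtain ph where t: "!!n. tf (ph n)" and l: "(%n. n2 M (%x. (ph n x - V x, grad (ph n) x - GV x))) ----> 0"
		using Z by (auto simp: Z_def)
	have ls: "(%n. n2 M (%x. ph n x - V x)) ----> 0" "(%n. n2 M (%x. grad (ph n) x - GV x)) ----> 0"
		using l n2_Pair_tendsto[of M "%n x. ph n x - V x" "%n x. grad (ph n) x - GV x"] test_fun_sqi[OF t] test_grad_sqi[OF t] sV
		by (auto simp: sqi_diff)
	have "convergent (%n. n2 M (grad (ph n)))"
		using tendsto_n2[where f = "%n. grad (ph n)", OF test_grad_sqi[OF t] sV(2) ls(2)] by (auto simp: convergent_def)
	then obtain B where B: "!!n. n2 M (grad (ph n)) <= B"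
		using Bseq_def convergent_imp_Bseq by (metis abs_le_D1 real_norm_def)
	note h = Hg_pos_above[OF Hg_test[OF t], of _ k]
	note H = Hg_pos_above[OF Z_H1[OF Z], of k]
	show ?thesis
	proof (rule Z_weak[OF _ _ _ H])
		show "Z (%x. max (ph n x - k) 0) (%x. if ph n x > k then grad (ph n) x else 0)" for n
		proof (rule Z_compact_support[OF h, of "closure {x. ph n x ~= 0}"])
			show "compact (closure {x. ph n x ~= 0})" "closure {x. ph n x ~= 0} <= Om" using t by (auto simp: test_fun_def)
			show "max (ph n x - k) 0 = 0" if "x \<notin> closure {x. ph n x ~= 0}" for x
			proof -
				have "ph n x = 0" using that closure_subset[of "{x. ph n x ~= 0}"] by auto
				thus ?thesis using k by simp
			qed
		qed
		show "(%n. n2 M (%x. max (ph n x - k) 0 - max (V x - k) 0)) ----> 0"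
		proof (rule tendsto0_le[OF ls(1)])
			show "n2 M (%x. max (ph n x - k) 0 - max (V x - k) 0) <= n2 M (%x. ph n x - V x)" for n
				by (intro n2_mono sqi_diff HgD(1)[OF h] HgD(1)[OF H] sV test_fun_sqi[OF t] AE_I2) (auto simp: max_def)
		qed simp
		show "n2 M (%x. if ph n x > k then grad (ph n) x else 0) <= B" for n
			by (intro order_trans[OF n2_mono[OF HgD(2)[OF h] test_grad_sqi[OF t]] B]) auto
	qed
qed

end

section \<open>Integrals along lines and Gagliardo's inequality in the plane\<close>

definition vec2 :: "real => real => real^2" where
	"vec2 s t = s *R axis 1 1 + t *R axis 2 1"

lemma vec2_nth [simp]: "vec2 s t $ 1 = s" "vec2 s t $ 2 = t"
	by (simp_all add: vec2_def axis_def)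

lemma vec2_collapse [simp]: "vec2 (x $ 1) (x $ 2) = x"
	by (simp add: vec_eq_iff forall_2)

lemma vec2_measurable [measurable]: "(%(s, t). vec2 s t) : bm (borel \<Otimes>\<^sub>M borel)"
	unfolding vec2_def by measurable

lemma vec2_borel: "(%(s, t). vec2 s t) : (lborel \<Otimes>\<^sub>M lborel) \<rightarrow>\<^sub>M borel"
	using vec2_measurable by (simp add: measurable_cong_sets[OF sets_pair_measure_cong[OF sets_lborel sets_lborel] refl])

lemma Basis_2: "(Basis :: (real^2) set) = {axis 1 1, axis 2 1}"
	by (auto simp: Basis_vec_def) (metis exhaust_2)

lemma lborel_vec2: "(lborel :: (real^2) measure) = distr (lborel \<Otimes>\<^sub>M lborel) borel (%(s, t). vec2 s t)"
proof (rule lborel_eqI)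
	fix l u :: "real^2" assume A: "!!b. b : Basis ==> l \<bullet> b <= u \<bullet> b"
	have lu: "l $ 1 <= u $ 1" "l $ 2 <= u $ 2"
		using A[of "axis 1 1"] A[of "axis 2 1"] by (auto simp: Basis_2 inner_axis)
	have "(%(s, t). vec2 s t) -` box l u \<inter> space (lborel \<Otimes>\<^sub>M lborel) = box (l $ 1) (u $ 1) \<times> box (l $ 2) (u $ 2)"
		by (auto simp: box_def Basis_2 inner_axis space_pair_measure)
	hence "emeasure (distr (lborel \<Otimes>\<^sub>M lborel) borel (%(s, t). vec2 s t)) (box l u)
		= emeasure (lborel \<Otimes>\<^sub>M lborel) (box (l $ 1) (u $ 1) \<times> box (l $ 2) (u $ 2))"
		by (simp add: emeasure_distr[OF vec2_borel])
	also have "... = ennreal (u $ 1 - l $ 1) * ennreal (u $ 2 - l $ 2)"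
		using lu by (subst lborel.emeasure_pair_measure_Times) auto
	also have "... = (\<Prod>b\<in>Basis. (u - l) \<bullet> b)"
		using lu by (simp add: Basis_2 axis_eq_axis inner_axis ennreal_mult)
	finally show "emeasure (distr (lborel \<Otimes>\<^sub>M lborel) borel (%(s, t). vec2 s t)) (box l u) = (\<Prod>b\<in>Basis. (u - l) \<bullet> b)" .
qed simp

lemma nn_integral_vec2:
	assumes [measurable]: "f : bm borel"
	shows "(nni lborel (%x. f x)) = (nni lborel (%t. \<integral>\<^sup>+s. f (vec2 s t) \<partial>lborel))"
proof -
	have m: "(%p. f (vec2 (fst p) (snd p))) : bm (lborel \<Otimes>\<^sub>M lborel)"
		using measurable_compose[OF vec2_borel assms] by (simp add: case_prod_beta)
	have "(nni lborel (%x. f x)) = (nni (lborel \<Otimes>\<^sub>M lborel) (%p. f (vec2 (fst p) (snd p))))"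
		by (subst lborel_vec2, subst nn_integral_distr[OF vec2_borel]) (auto simp: case_prod_beta)
	also have "... = (nni lborel (%t. \<integral>\<^sup>+s. f (vec2 s t) \<partial>lborel))"
		using lborel_pair.nn_integral_snd[of "%p. f (vec2 (fst p) (snd p))"] m by simp
	finally show ?thesis .
qed

lemma nn_integral_shift: "f : bm borel ==> (nni lborel (%s. f (t + s))) = (nni lborel (%s. f s))" for t :: real
	using nn_integral_real_affine[of f 1 t] by simp

text \<open>The line x1 - a x2 = c, with direction (a, 1), is parametrised by its second coordinate.
  In the label c no Jacobian appears, so integrating over c returns the plane integral.\<close>

definition line_int :: "(real^2 => ennreal) => real => real => ennreal" where
	"line_int g a c = (nni lborel (%s. g (vec2 (c + a * s) s)))"

lemma vec2_comp_measurable [measurable (raw)]: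
	assumes [measurable]: "f : bm N" "h : bm N" shows "(%x. vec2 (f x) (h x)) : bm N"
	unfolding vec2_def by measurable

lemma line_int_measurable [measurable]:
	assumes [measurable]: "g : bm borel" shows "line_int g a : bm borel"
	unfolding line_int_def[abs_def] by measurable

lemma nn_integral_line_int:
	assumes [measurable]: "g : bm borel"
	shows "(nni lborel (%c. line_int g a c)) = (nni lborel (%x. g x))"
proof -
	have "(nni lborel (%c. line_int g a c)) = (nni lborel (%s. \<integral>\<^sup>+c. g (vec2 (c + a * s) s) \<partial>lborel))"
		unfolding line_int_def by (rule lborel_pair.Fubini') measurable
	also have "... = (nni lborel (%s. \<integral>\<^sup>+c. g (vec2 c s) \<partial>lborel))"
	proof (rule nn_integral_cong)
		fix s show "(nni lborel (%c. g (vec2 (c + a * s) s))) = (nni lborel (%c. g (vec2 c s)))"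
			using nn_integral_shift[of "%c. g (vec2 c s)" "a * s"] by (simp add: add.commute)
	qed
	also have "... = (nni lborel (%x. g x))" by (rule nn_integral_vec2[symmetric]) fact
	finally show ?thesis .
qed

text \<open>x1 - a x2 and x1 - b x2 are linear coordinates with Jacobian |a - b|, in which the
  integrand separates.\<close>

lemma nn_integral_two_lines:
	assumes [measurable]: "F : bm borel" "G : bm borel" and ab: "a ~= b"
	shows "(\<integral>\<^sup>+x. F (x $ 1 - a * x $ 2) * G (x $ 1 - b * x $ 2) \<partial>(lborel :: (real^2) measure))
		= ennreal (1 / abs (a - b)) * ((nni lborel (%c. F c)) * (nni lborel (%c. G c)))"
proof -
	have nth: "(%x::real^2. x $ i) : bm borel" for i by (intro borel_measurable_continuous_onI continuous_intros)
	note [measurable] = nth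
	have G: "(nni lborel (%t. G (y + (a - b) * t))) = ennreal (1 / abs (a - b)) * (nni lborel (%c. G c))" for y
	proof -
		have "(nni lborel (%c. G c)) = ennreal (abs (a - b)) * (nni lborel (%t. G (y + (a - b) * t)))"
			using nn_integral_real_affine[of G "a - b" y] ab by simp
		hence "ennreal (1 / abs (a - b)) * (nni lborel (%c. G c)) = (ennreal (1 / abs (a - b)) * ennreal (abs (a - b))) * (nni lborel (%t. G (y + (a - b) * t)))"
			by (simp add: mult.assoc)
		moreover have "ennreal (1 / abs (a - b)) * ennreal (abs (a - b)) = 1" using ab by (subst ennreal_mult[symmetric]) auto
		ultimately show ?thesis by simp
	qed
	have "(\<integral>\<^sup>+x. F (x $ 1 - a * x $ 2) * G (x $ 1 - b * x $ 2) \<partial>(lborel :: (real^2) measure))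
		= (nni lborel (%t. \<integral>\<^sup>+s. F (s - a * t) * G (s - b * t) \<partial>lborel))"
		by (subst nn_integral_vec2) auto
	also have "... = (nni lborel (%t. \<integral>\<^sup>+y. F y * G (y + (a - b) * t) \<partial>lborel))"
	proof (rule nn_integral_cong)
		fix t show "(nni lborel (%s. F (s - a * t) * G (s - b * t))) = (nni lborel (%y. F y * G (y + (a - b) * t)))"
			using nn_integral_shift[of "%s. F (s - a * t) * G (s - b * t)" "a * t"] by (simp add: algebra_simps)
	qed
	also have "... = (nni lborel (%y. \<integral>\<^sup>+t. F y * G (y + (a - b) * t) \<partial>lborel))"
		by (rule lborel_pair.Fubini') measurable
	also have "... = (nni lborel (%y. F y * (ennreal (1 / abs (a - b)) * (nni lborel (%c. G c)))))"
		by (intro nn_integral_cong) (simp add: nn_integral_cmult G)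
	also have "... = ennreal (1 / abs (a - b)) * ((nni lborel (%c. F c)) * (nni lborel (%c. G c)))"
		by (simp add: nn_integral_multc mult_ac)
	finally show ?thesis .
qed

text \<open>Gagliardo's argument with two transversal directions in place of the coordinate axes.
  The freedom to tilt them is what keeps one-sided segments inside the domain near its
  boundary.\<close>

lemma gagliardo:
	fixes g h :: "real^2 => ennreal"
	assumes [measurable]: "g : bm borel" "h : bm borel" and ab: "a ~= b"
		and h: "!!x. h x <= line_int g a (x $ 1 - a * x $ 2)" "!!x. h x <= line_int g b (x $ 1 - b * x $ 2)"
	shows "(nni lborel (%x. h x * h x)) <= ennreal (1 / abs (a - b)) * ((nni lborel (%x. g x)) * (nni lborel (%x. g x)))"
proof -
	have "(nni lborel (%x. h x * h x)) <= (\<integral>\<^sup>+x. line_int g a (x $ 1 - a * x $ 2) * line_int g b (x $ 1 - b * x $ 2) \<partial>(lborel :: (real^2) measure))"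
		using h by (intro nn_integral_mono mult_mono) auto
	also have "... = ennreal (1 / abs (a - b)) * ((nni lborel (%x. g x)) * (nni lborel (%x. g x)))"
		using nn_integral_two_lines[of "line_int g a" "line_int g b" a b] by (simp add: ab nn_integral_line_int)
	finally show ?thesis .
qed

lemma ftc_nn_bound:
	fixes p p' :: "real => real"
	assumes d: "!!r. (p has_real_derivative p' r) (at r)" and c: "continuous_on UNIV p'" and r: "0 <= r"
	shows "ennreal (abs (p 0)) <= ennreal (abs (p r)) + (nni lborel (%s. ennreal (abs (p' s)) * indicator {0..r} s))"
proof -
	have cc: "isCont p' s" for s using c by (simp add: continuous_on_eq_continuous_at)
	have F: "(LINT s|lborel. indicator {0..r} s *R p' s) = p r - p 0"
		using integral_FTC_Icc[of 0 r p p'] r d c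
		by (metis continuous_on_subset has_field_derivative_at_within has_real_derivative_iff_has_vector_derivative subset_UNIV)
	have i: "integrable lborel (%s. indicator {0..r} s *R p' s)"
		using borel_integrable_atLeastAtMost[of 0 r p'] cc by (simp add: mult.commute)
	have "ennreal (abs (p r - p 0)) <= (nni lborel (%s. ennreal (abs (p' s)) * indicator {0..r} s))"
		using integral_norm_bound_ennreal[OF i] unfolding F
		by (simp add: abs_mult ennreal_mult ennreal_indicator[symmetric] mult.commute)
	hence "ennreal (abs (p r)) + ennreal (abs (p r - p 0)) <= ennreal (abs (p r)) + (nni lborel (%s. ennreal (abs (p' s)) * indicator {0..r} s))"
		by (intro add_left_mono)
	moreover have "ennreal (abs (p 0)) <= ennreal (abs (p r)) + ennreal (abs (p r - p 0))"
		by (subst ennreal_plus[symmetric]) (auto intro!: ennreal_leI simp del: ennreal_plus)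
	ultimately show ?thesis by (rule order_trans[rotated])
qed

text \<open>Averaging the fundamental theorem over the end point r in [0, h] replaces the unknown
  end value by a mean, at the price of the zero-order term |p| / h.\<close>

lemma avg_nn_bound:
	fixes p p' :: "real => real"
	assumes d: "!!r. (p has_real_derivative p' r) (at r)" and c: "continuous_on UNIV p'" and h: "h > 0"
	shows "ennreal (abs (p 0)) <= (nni lborel (%s. ennreal (abs (p s) / h + abs (p' s)) * indicator {0..h} s))"
proof -
	have cp: "continuous_on UNIV p" using d by (meson DERIV_continuous_on has_field_derivative_at_within)
	have [measurable]: "p : bm borel" "p' : bm borel"
		using c cp by (auto intro: borel_measurable_continuous_onI)
	define J where "J = (nni lborel (%s. ennreal (abs (p' s)) * indicator {0..h} s))"
	have b: "ennreal (abs (p 0)) <= ennreal (abs (p r)) + J" if "r : {0..h}" for r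
	proof -
		have "(nni lborel (%s. ennreal (abs (p' s)) * indicator {0..r} s)) <= J"
			unfolding J_def using that by (intro nn_integral_mono mult_left_mono) (auto simp: indicator_def)
		thus ?thesis using ftc_nn_bound[OF d c, of r] that by (meson add_left_mono atLeastAtMost_iff order_trans)
	qed
	have e: "emeasure lborel {0..h} = ennreal h" using h by simp
	have "ennreal h * ennreal (abs (p 0)) = (nni lborel (%r. ennreal (abs (p 0)) * indicator {0..h} r))"
		using e by (subst nn_integral_cmult_indicator) (auto simp: mult.commute)
	also have "... <= (nni lborel (%r. ennreal (abs (p r)) * indicator {0..h} r + J * indicator {0..h} r))"
		using b by (intro nn_integral_mono) (auto simp: indicator_def)
	also have "... = (nni lborel (%r. ennreal (abs (p r)) * indicator {0..h} r)) + J * ennreal h"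
		using e by (subst nn_integral_add) (auto simp: nn_integral_cmult_indicator)
	finally have A: "ennreal h * ennreal (abs (p 0)) <= (nni lborel (%r. ennreal (abs (p r)) * indicator {0..h} r)) + J * ennreal h" .
	have hh: "ennreal (1 / h) * ennreal h = 1" using h by (subst ennreal_mult[symmetric]) auto
	have "ennreal (abs (p 0)) = ennreal (1 / h) * (ennreal h * ennreal (abs (p 0)))" using hh by (simp add: mult.assoc[symmetric])
	also have "... <= ennreal (1 / h) * ((nni lborel (%r. ennreal (abs (p r)) * indicator {0..h} r)) + J * ennreal h)"
		by (intro mult_left_mono A) simp
	also have "... = ennreal (1 / h) * (nni lborel (%r. ennreal (abs (p r)) * indicator {0..h} r)) + J"
		using hh by (simp add: distrib_left mult.left_commute[of "ennreal (1/h)" J])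
	also have "... = (nni lborel (%s. ennreal (1 / h) * (ennreal (abs (p s)) * indicator {0..h} s) + ennreal (abs (p' s)) * indicator {0..h} s))"
		unfolding J_def by (subst nn_integral_add) (auto simp: nn_integral_cmult)
	also have "... = (nni lborel (%s. ennreal (abs (p s) / h + abs (p' s)) * indicator {0..h} s))"
		using h by (intro nn_integral_cong) (auto simp: indicator_def ennreal_mult[symmetric] ennreal_plus[symmetric] simp del: ennreal_plus)
	finally show ?thesis .
qed

lemma smooth_line_deriv:
	assumes "smooth_R2 w"
	shows "((%r. w (x + r *R d)) has_real_derivative (grad w (x + r *R d) \<bullet> d)) (at r)"
		"continuous_on UNIV (%r. grad w (x + r *R d) \<bullet> d)"
proof -
	have "((%r. x + r *R d) has_derivative (%r. r *R d)) (at r)" by (auto intro!: derivative_eq_intros)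
	from has_derivative_compose[OF this grad_has_derivative[OF smooth_differentiable[OF assms]]]
	show "((%r. w (x + r *R d)) has_real_derivative (grad w (x + r *R d) \<bullet> d)) (at r)"
		by (simp add: has_field_derivative_def mult_commute_abs)
	have "continuous_on UNIV (%r. \<Sum>i\<in>UNIV. pd i w (x + r *R d) * d $ i)"
		by (intro continuous_intros continuous_on_compose2[OF smooth_continuous_on[OF smooth_pd[OF assms]]]) auto
	thus "continuous_on UNIV (%r. grad w (x + r *R d) \<bullet> d)" by (simp add: inner_vec_def grad_def)
qed

text \<open>The direction of the line integral is \<open>(a, 1)\<close>; the sign \<open>\<sigma>\<close> selects the half line.\<close>
lemma nn_integral_ray:
	fixes x :: "real^2"
	assumes [measurable]: "g : bm borel" and si: "si = 1 \<or> si = (-1::real)"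
	shows "(nni lborel (%r. g (x + r *R (si *R vec2 a 1)))) = line_int g a (x $ 1 - a * x $ 2)"
proof -
	have "line_int g a (x $ 1 - a * x $ 2) = ennreal (abs (si)) * (nni lborel (%r. g (vec2 (x $ 1 - a * x $ 2 + a * (x $ 2 + si * r)) (x $ 2 + si * r))))"
		unfolding line_int_def using si by (subst nn_integral_real_affine[of _ si "x $ 2"]) auto
	moreover have "vec2 (x $ 1 - a * x $ 2 + a * (x $ 2 + si * r)) (x $ 2 + si * r) = x + r *R (si *R vec2 a 1)" for r
		by (simp add: vec_eq_iff forall_2 algebra_simps)
	ultimately show ?thesis using si by auto
qed

lemma norm_vec2_1: "norm (vec2 a 1) <= abs a + 1"
	using norm_vec2_le[of "vec2 a 1"] by simp

definition seg :: "real => real => real => real^2 => (real^2) set" where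
	"seg si a h x = (%r. x + r *R (si *R vec2 a 1)) ` {0..h}"

lemma seg_bound:
	assumes w: "smooth_R2 w" and K: "K : sets borel" "seg si a h x <= K" and si: "si = 1 \<or> si = (-1::real)" and h: "h > 0"
		and D: "abs a + 1 <= D"
	shows "ennreal (abs (w x)) <= line_int (%y. ennreal (abs (w y) / h + D * norm (grad w y)) * indicator K y) a (x $ 1 - a * x $ 2)"
proof -
	define d where "d = si *R vec2 a 1"
	have [measurable]: "w : bm borel" using w by (rule smooth_borel)
	have [measurable]: "pd i w : bm borel" for i using smooth_pd[OF w] by (rule smooth_borel)
	have gm: "grad w = (%x. pd 1 w x *R axis 1 1 + pd 2 w x *R axis 2 1)"
		by (rule ext, subst vec2_eq[of "grad w _"]) (simp add: grad_def)
	have [measurable]: "grad w : bm borel" unfolding gm by measurable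
	note [measurable] = K(1)
	have dn: "norm d <= D" using si norm_vec2_1[of a] D by (auto simp: d_def)
	have "ennreal (abs (w x)) <= (nni lborel (%s. ennreal (abs (w (x + s *R d)) / h + abs (grad w (x + s *R d) \<bullet> d)) * indicator {0..h} s))"
		using avg_nn_bound[OF smooth_line_deriv[OF w] h, of x d] by simp
	also have "... <= (nni lborel (%s. ennreal (abs (w (x + s *R d)) / h + D * norm (grad w (x + s *R d))) * indicator K (x + s *R d)))"
	proof (rule nn_integral_mono)
		fix s
		have "abs (grad w (x + s *R d) \<bullet> d) <= norm (grad w (x + s *R d)) * norm d" by (rule Cauchy_Schwarz_ineq2)
		also have "... <= D * norm (grad w (x + s *R d))" using dn by (simp add: mult.commute mult_right_mono)
		finally have "abs (w (x + s *R d)) / h + abs (grad w (x + s *R d) \<bullet> d) <= abs (w (x + s *R d)) / h + D * norm (grad w (x + s *R d))" by simp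
		moreover have "x + s *R d : K" if "s : {0..h}" using K(2) that unfolding seg_def d_def by blast
		ultimately show "ennreal (abs (w (x + s *R d)) / h + abs (grad w (x + s *R d) \<bullet> d)) * indicator {0..h} s
			<= ennreal (abs (w (x + s *R d)) / h + D * norm (grad w (x + s *R d))) * indicator K (x + s *R d)"
			by (auto simp: indicator_def intro!: ennreal_leI)
	qed
	also have "... = line_int (%y. ennreal (abs (w y) / h + D * norm (grad w y)) * indicator K y) a (x $ 1 - a * x $ 2)"
		unfolding d_def using K(1) by (intro nn_integral_ray si) measurable
	finally show ?thesis .
qed

lemma grad_borel: "smooth_R2 w ==> grad w : bm borel"
proof -
	assume w: "smooth_R2 w"
	have [measurable]: "pd i w : bm borel" for i using smooth_pd[OF w] by (rule smooth_borel)
	have gm: "grad w = (%x. pd 1 w x *R axis 1 1 + pd 2 w x *R axis 2 1)"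
		by (rule ext, subst vec2_eq[of "grad w _"]) (simp add: grad_def)
	show ?thesis unfolding gm by measurable
qed

text \<open>The local version for functions without compact support: only segments that start in S
  and stay in K are integrated, so only values of w and grad w in K enter the right side.\<close>

lemma gagliardo_segments:
	assumes w: "smooth_R2 w" and K: "K : sets borel" and S: "S : sets borel"
		and sg: "!!x. x : S ==> seg si a h x <= K" "!!x. x : S ==> seg si b h x <= K"
		and si: "si = 1 \<or> si = (-1::real)" and h: "h > 0" and ab: "a ~= b"
	defines "D \<equiv> abs a + abs b + 1"
	shows "(nni lborel (%x. ennreal ((w x)^2) * indicator S x))
		<= ennreal (1 / abs (a - b)) * (nni lborel (%x. ennreal (abs (w x) / h + D * norm (grad w x)) * indicator K x))^2"
proof -
	define g where "g y = ennreal (abs (w y) / h + D * norm (grad w y)) * indicator K y" for y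
	define f where "f y = ennreal (abs (w y)) * indicator S y" for y
	have [measurable]: "w : bm borel" "grad w : bm borel" using w smooth_borel grad_borel by auto
	have gm: "g : bm borel" unfolding g_def[abs_def] using K by measurable
	have fm: "f : bm borel" unfolding f_def[abs_def] using S by measurable
	have "(nni lborel (%x. f x * f x)) <= ennreal (1 / abs (a - b)) * ((nni lborel (%x. g x)) * (nni lborel (%x. g x)))"
	proof (rule gagliardo[OF gm fm ab])
		fix x
		show "f x <= line_int g a (x $ 1 - a * x $ 2)"
			using seg_bound[OF w K sg(1) si h, of x D] by (cases "x : S") (auto simp: f_def g_def[abs_def] D_def)
		show "f x <= line_int g b (x $ 1 - b * x $ 2)"
			using seg_bound[OF w K sg(2) si h, of x D] by (cases "x : S") (auto simp: f_def g_def[abs_def] D_def)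
	qed
	moreover have "f x * f x = ennreal ((w x)^2) * indicator S x" for x
		by (auto simp: f_def indicator_def ennreal_mult[symmetric] power2_eq_square)
	ultimately show ?thesis by (simp add: g_def power2_eq_square)
qed

text \<open>The directions are (0, 1) and (1, 1), so |a - b| = 1, and 2 bounds their lengths.
  Following them far enough leaves the support.\<close>

lemma gagliardo_compact_support:
	assumes w: "smooth_cs w"
	shows "(nni lborel (%x. ennreal ((w x)^2))) <= (nni lborel (%x. ennreal (2 * norm (grad w x))))^2"
proof -
	have sm: "smooth_R2 w" using w by (rule smooth_cs_smooth)
	obtain R where R: "!!x. norm x > R ==> w x = 0" using w by (auto simp: smooth_cs_def)
	define g where "g y = ennreal (2 * norm (grad w y))" for y
	have [measurable]: "w : bm borel" "grad w : bm borel" using sm smooth_borel grad_borel by auto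
	have gm: "g : bm borel" unfolding g_def[abs_def] by measurable
	have *: "ennreal (abs (w x)) <= line_int g a (x $ 1 - a * x $ 2)" if a: "0 <= a" "a <= 1" for a x
	proof -
		define d where "d = (1::real) *R vec2 a 1"
		define r where "r = abs R + norm x + 1"
		have dn: "norm d <= 2" using norm_vec2_1[of a] a by (simp add: d_def)
		have d1: "norm d >= 1" using component_le_norm_cart[of d 2] by (simp add: d_def)
		have "norm (r *R d) >= r" using d1 mult_left_mono[of 1 "norm d" r] by (simp add: r_def)
		moreover have "norm (r *R d) - norm x <= norm (x + r *R d)" using norm_diff_ineq[of "r *R d" x] by (simp add: add.commute)
		ultimately have z: "w (x + r *R d) = 0" by (intro R) (simp add: r_def)
		have "ennreal (abs (w x)) <= (nni lborel (%s. ennreal (abs (grad w (x + s *R d) \<bullet> d)) * indicator {0..r} s))"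
			using ftc_nn_bound[OF smooth_line_deriv[OF sm], of r x d] z by (simp add: r_def)
		also have "... <= (nni lborel (%s. g (x + s *R d)))"
		proof (rule nn_integral_mono)
			fix s
			have "abs (grad w (x + s *R d) \<bullet> d) <= norm (grad w (x + s *R d)) * norm d" by (rule Cauchy_Schwarz_ineq2)
			also have "... <= 2 * norm (grad w (x + s *R d))" using dn by (simp add: mult.commute mult_right_mono)
			finally show "ennreal (abs (grad w (x + s *R d) \<bullet> d)) * indicator {0..r} s <= g (x + s *R d)"
				by (auto simp: indicator_def g_def intro!: ennreal_leI)
		qed
		also have "... = line_int g a (x $ 1 - a * x $ 2)" unfolding d_def by (intro nn_integral_ray gm) simp
		finally show ?thesis .
	qed
	have "(nni lborel (%x. ennreal (abs (w x)) * ennreal (abs (w x)))) <= ennreal (1 / abs (0 - 1)) * ((nni lborel (%x. g x)) * (nni lborel (%x. g x)))"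
		by (rule gagliardo[OF gm]) (use *[of 0] *[of 1] in auto)
	thus ?thesis by (simp add: ennreal_mult[symmetric] power2_eq_square g_def)
qed

lemma (in bdom) nn_integral_M_eq:
	assumes [measurable]: "f : bm borel" and z: "!!x. x \<notin> Om ==> f x = 0"
	shows "(nni M (%x. f x)) = (nni lborel (%x. f x))"
proof -
	have "(nni M (%x. f x)) = (nni lebesgue (%x. f x * indicator Om x))"
		by (rule nn_integral_restrict_space) simp
	also have "(%x. f x * indicator Om x) = f" using z by (intro ext) (auto split: split_indicator)
	also have "(nni lebesgue (%x. f x)) = (nni lborel (%x. f x))" by (rule nn_integral_completion)
	finally show ?thesis .
qed

text \<open>The planar embedding of W^{1,1}_0 into L^2, by density of test functions. The L^1 norm
  of the gradient on the right is what lets the measure of level sets enter Stampacchia's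
  iteration.\<close>

lemma (in bdom) Z_sobolev:
	assumes Z: "Z V GV"
	shows "n2 M V <= 2 * (LINT x|M. norm (GV x))"
proof -
	have T: "n2 M ph <= 2 * (LINT x|M. norm (grad ph x))" if t: "tf ph" for ph
	proof -
		have sm: "smooth_R2 ph" by (rule test_fun_smooth[OF t])
		have [measurable]: "ph : bm borel" "grad ph : bm borel" using sm smooth_borel grad_borel by auto
		have gz: "grad ph x = 0" if "x \<notin> Om" for x
			using test_fun_outside[OF test_fun_pd[OF t] that] by (simp add: grad_def vec_eq_iff)
		have "(nni M (%x. ennreal ((ph x)^2))) <= (nni M (%x. ennreal (2 * norm (grad ph x))))^2"
			using gagliardo_compact_support[OF test_fun_cs[OF t]] test_fun_outside[OF t] gz
			by (subst (1 2) nn_integral_M_eq) auto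
		moreover have "(nni M (%x. ennreal ((ph x)^2))) = ennreal ((n2 M ph)^2)"
			unfolding n2_sq ip_self using sqi_integrable[OF test_fun_sqi[OF t]] by (subst nn_integral_eq_integral) auto
		moreover have "(nni M (%x. ennreal (2 * norm (grad ph x)))) = ennreal (2 * (LINT x|M. norm (grad ph x)))"
			using sqi_integrable_norm[OF test_grad_sqi[OF t]] by (subst nn_integral_eq_integral) auto
		ultimately have "ennreal ((n2 M ph)^2) <= ennreal ((2 * (LINT x|M. norm (grad ph x)))^2)"
			by (simp add: power2_eq_square ennreal_mult[symmetric])
		hence "(n2 M ph)^2 <= (2 * (LINT x|M. norm (grad ph x)))^2" by (subst (asm) ennreal_le_iff) auto
		thus ?thesis by (rule power2_le_imp_le) simp
	qed
	obtain ph where t: "!!n. tf (ph n)" and l: "(%n. n2 M (%x. (ph n x - V x, grad (ph n) x - GV x))) ----> 0"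
		using Z by (auto simp: Z_def)
	note sV = HgD(1,2)[OF Z_H1[OF Z]]
	have ls: "(%n. n2 M (%x. ph n x - V x)) ----> 0" "(%n. n2 M (%x. grad (ph n) x - GV x)) ----> 0"
		using l n2_Pair_tendsto[of M "%n x. ph n x - V x" "%n x. grad (ph n) x - GV x"] test_fun_sqi[OF t] test_grad_sqi[OF t] sV
		by (auto simp: sqi_diff)
	have l1: "(%n. n2 M (ph n)) ----> n2 M V" by (rule tendsto_n2[where f = ph, OF test_fun_sqi[OF t] sV(1) ls(1)])
	have l2: "(%n. 2 * ((LINT x|M. norm (GV x)) + n2 M (%x. grad (ph n) x - GV x) * n2 M (%x. 1::real))) ----> 2 * ((LINT x|M. norm (GV x)) + 0 * n2 M (%x. 1::real))"
		by (intro tendsto_intros ls)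
	have "n2 M V <= 2 * ((LINT x|M. norm (GV x)) + 0 * n2 M (%x. 1::real))"
	proof (rule LIMSEQ_le[OF l1 l2], intro exI allI impI)
		fix n
		have sd: "sqi M (%x. grad (ph n) x - GV x)" by (intro sqi_diff test_grad_sqi t sV)
		have "(LINT x|M. norm (grad (ph n) x)) <= (LINT x|M. norm (GV x) + norm (grad (ph n) x - GV x) * norm (1::real))"
			using test_grad_sqi[OF t] sV sd by (intro integral_mono) (auto simp: norm_triangle_sub intro: sqi_integrable_norm)
		also have "... = (LINT x|M. norm (GV x)) + (LINT x|M. norm (grad (ph n) x - GV x) * norm (1::real))"
			using sqi_integrable_norm sV sd by (intro bi_add) auto
		also have "... <= (LINT x|M. norm (GV x)) + n2 M (%x. grad (ph n) x - GV x) * n2 M (%x. 1::real)"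
			using integral_norm_mult_le[OF sd sqi_const[of "1::real"]] by simp
		finally show "n2 M (ph n) <= 2 * ((LINT x|M. norm (GV x)) + n2 M (%x. grad (ph n) x - GV x) * n2 M (%x. 1::real))"
			using T[OF t, of n] by argo
	qed
	thus ?thesis by simp
qed

section \<open>An interior cone condition with two directions\<close>

definition cone_at :: "(real^2) set => real^2 => real => real => real => real => real => bool" where
	"cone_at Om p r si a b h \<longleftrightarrow> r > 0 & h > 0 & a ~= b & (si = 1 \<or> si = -1) &
		 (ALL x:ball p r \<inter> Om. seg si a h x <= Om & seg si b h x <= Om)"

lemma seg_in_ball:
	assumes x: "x : ball p (e / 2)" and si: "si = 1 \<or> si = (-1::real)" and s: "0 <= s" "s <= e / (2 * (abs a + abs b + 2))" and e: "e > 0"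
	shows "x + s *R (si *R vec2 a 1) : ball p e"
proof -
	have "norm (s *R (si *R vec2 a 1)) <= s * (abs a + abs b + 2)"
		using si s norm_vec2_1[of a] by (auto intro!: mult_left_mono)
	also have "... <= e / (2 * (abs a + abs b + 2)) * (abs a + abs b + 2)" using s by (intro mult_right_mono) auto
	also have "... = e / 2"
	proof -
		have "e / (2 * k) * k = e / 2" if "k > 0" for k :: real using that by simp
		note this[of "abs a + abs b + 2"]
		moreover have "abs a + abs b + 2 > 0" by linarith
		ultimately show ?thesis by blast
	qed
	finally have n: "norm (s *R (si *R vec2 a 1)) <= e / 2" .
	have "dist p (x + s *R (si *R vec2 a 1)) <= dist p x + dist x (x + s *R (si *R vec2 a 1))" by (rule dist_triangle)
	thus ?thesis using x n by (simp add: dist_norm)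
qed

text \<open>At a boundary point choose two directions along which the defining function strictly
  decreases. By continuity of its gradient they serve in a whole ball, and a segment starting where
  the function is negative stays there.\<close>

lemma cone_exists:
	assumes Om: "open Om" and rh: "smooth_R2 rh" "Om = {x. rh x < 0}" "!!x. x : frontier Om ==> grad rh x ~= 0"
		and p: "p : closure Om"
	shows "EX r si a b h. cone_at Om p r si a b h"
proof (cases "p : Om")
	case True
	then obtain e where e: "e > 0" "ball p e <= Om" using Om open_contains_ball by metis
	have "cone_at Om p (e / 2) 1 0 1 (e / (2 * (abs 0 + abs 1 + 2)))"
		unfolding cone_at_def
	proof (intro conjI ballI)
		fix x assume "x : ball p (e / 2) \<inter> Om"
		hence x: "x : ball p (e / 2)" by simp
		show "seg 1 0 (e / (2 * (abs 0 + abs 1 + 2))) x <= Om"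
			using seg_in_ball[OF x _ _ _ e(1), of 1 _ 0 1] e(2) by (auto simp: seg_def subset_iff)
		show "seg 1 1 (e / (2 * (abs 0 + abs 1 + 2))) x <= Om"
			using seg_in_ball[OF x _ _ _ e(1), of 1 _ 1 0] e(2) by (auto simp: seg_def subset_iff)
	qed (use e in auto)
	thus ?thesis by blast
next
	case False
	hence "p : frontier Om" using p Om by (simp add: frontier_def interior_open)
	hence g0: "grad rh p ~= 0" by (rule rh(3))
	have "EX si a b. (si = 1 \<or> si = (-1::real)) & a ~= b & grad rh p \<bullet> (si *R vec2 a 1) < 0 & grad rh p \<bullet> (si *R vec2 b 1) < 0"
	proof (cases "grad rh p $ 1 = 0")
		case True
		hence "grad rh p $ 2 ~= 0" using g0 by (simp add: vec_eq_iff forall_2)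
		thus ?thesis using True
			\<comment> \<open>If the first component vanishes, every slope gives the same product, so 0 and 1
			  serve and only the sign has to be chosen.\<close>
			by (rule_tac exI[of _ "if grad rh p $ 2 > 0 then -1 else 1"], rule_tac exI[of _ 0], rule_tac exI[of _ 1])
				(auto simp: inner_vec_def sum_2)
	next
		case False
		thus ?thesis
			\<comment> \<open>The two slopes make the inner products with the gradient equal to -1 and
			  -2.\<close>
			by (rule_tac exI[of _ 1], rule_tac exI[of _ "- (grad rh p $ 2 + 1) / grad rh p $ 1"],
					rule_tac exI[of _ "- (grad rh p $ 2 + 2) / grad rh p $ 1"])
				(auto simp: inner_vec_def sum_2 field_simps)
	qed
	then obtain si a b where si: "si = 1 \<or> si = (-1::real)" and ab: "a ~= b"
		and neg: "grad rh p \<bullet> (si *R vec2 a 1) < 0" "grad rh p \<bullet> (si *R vec2 b 1) < 0" by blast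
	have "EX e>0. ALL x:ball p e. grad rh x \<bullet> d < 0" if "grad rh p \<bullet> d < 0" for d
	proof -
		have "continuous_on UNIV (%x. \<Sum>i\<in>UNIV. pd i rh x * d $ i)"
			by (intro continuous_intros smooth_continuous_on smooth_pd rh)
		hence "continuous_on UNIV (%x. grad rh x \<bullet> d)" by (simp add: inner_vec_def grad_def)
		hence "open {x. grad rh x \<bullet> d < 0}" by (intro open_Collect_less continuous_on_const)
		thus ?thesis using that unfolding open_contains_ball by blast
	qed
	from this[OF neg(1)] this[OF neg(2)] obtain e1 e2 where e1: "e1 > 0" "!!x. x : ball p e1 ==> grad rh x \<bullet> (si *R vec2 a 1) < 0"
		and e2: "e2 > 0" "!!x. x : ball p e2 ==> grad rh x \<bullet> (si *R vec2 b 1) < 0" by blast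
	define e where "e = min e1 e2"
	have e: "e > 0" "e <= e1" "e <= e2" using e1 e2 by (auto simp: e_def)
	define h where "h = e / (2 * (abs a + abs b + 2))"
	have h: "h > 0" using e by (simp add: h_def add_nonneg_pos)
	have dec: "x + s *R d : Om" if x: "x : Om" and s: "0 <= s" and d: "!!t. 0 <= t ==> t <= s ==> grad rh (x + t *R d) \<bullet> d < 0" for x s d
	proof -
		have "rh (x + s *R d) <= rh (x + 0 *R d)"
		proof (rule DERIV_nonpos_imp_nonincreasing[of 0 s "%t. rh (x + t *R d)"])
			fix t assume "0 <= t" "t <= s"
			thus "EX y. ((%t. rh (x + t *R d)) has_real_derivative y) (at t) & y <= 0"
				using smooth_line_deriv(1)[OF rh(1)] d[of t] by (intro exI[of _ "grad rh (x + t *R d) \<bullet> d"]) auto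
		qed (rule s)
		thus ?thesis using x rh(2) by auto
	qed
	have "cone_at Om p (e / 2) si a b h"
		unfolding cone_at_def
	proof (intro conjI ballI)
		fix x assume "x : ball p (e / 2) \<inter> Om"
		hence x: "x : ball p (e / 2)" "x : Om" by auto
		have A: "x + t *R (si *R vec2 a 1) : ball p e" "x + t *R (si *R vec2 b 1) : ball p e" if "0 <= t" "t <= h" for t
			using seg_in_ball[OF x(1) si that(1) _ e(1), of a b] seg_in_ball[OF x(1) si that(1) _ e(1), of b a] that(2)
			by (auto simp: h_def add.commute)
		have G1: "grad rh (x + t *R (si *R vec2 a 1)) \<bullet> (si *R vec2 a 1) < 0" if "0 <= t" "t <= h" for t
			by (rule e1(2), rule subsetD[OF subset_ball[OF e(2)] A(1)[OF that]])
		have G2: "grad rh (x + t *R (si *R vec2 b 1)) \<bullet> (si *R vec2 b 1) < 0" if "0 <= t" "t <= h" for t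
			by (rule e2(2), rule subsetD[OF subset_ball[OF e(3)] A(2)[OF that]])
		have "x + s *R (si *R vec2 a 1) : Om" if "s : {0..h}" for s
			by (rule dec[OF x(2) _ G1]) (use that in auto)
		thus "seg si a h x <= Om" by (auto simp: seg_def)
		have "x + s *R (si *R vec2 b 1) : Om" if "s : {0..h}" for s
			by (rule dec[OF x(2) _ G2]) (use that in auto)
		thus "seg si b h x <= Om" by (auto simp: seg_def)
	qed (use e h si ab in auto)
	thus ?thesis by blast
qed

locale sbdom =
	fixes Om :: "(real^2) set"
	assumes dom: "smooth_bounded_domain Om"

sublocale sbdom \<subseteq> bdom
	using dom by unfold_locales (auto simp: smooth_bounded_domain_def)

section \<open>The fourth and third power inequalities in H^1\<close>

context bdom
begin

text \<open>A closed exhaustion of the domain. The factor 2 leaves room for kernel balls of radius 1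
  / Suc n with n >= m, where mollification and gradient commute.\<close>

definition inn :: "nat => (real^2) set" where
	"inn m = {x. 2 / Suc m <= infdist x (- Om)}"

lemma compl_dom: "closed (- Om)" "- Om ~= {}"
proof -
	show "closed (- Om)" using open_dom by (simp add: closed_def)
	show "- Om ~= {}"
	proof
		assume "- Om = {}"
		hence "Om = UNIV" by blast
		thus False using bounded_dom not_bounded_UNIV by simp
	qed
qed

lemma inn_closed: "closed (inn m)"
	unfolding inn_def by (intro closed_Collect_le continuous_intros)

lemma inn_cball:
	assumes "x : inn m" "n >= m" shows "cball x (1 / Suc n) <= Om"
proof (rule ccontr)
	assume "\<not> ?thesis"
	then obtain y where "y : cball x (1 / Suc n)" "y : - Om" by blast
	hence y: "dist x y <= 1 / Suc n" "y : - Om" by simp_all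
	have "2 / Suc m <= dist x y" using assms(1) infdist_le[OF y(2), of x] by (simp add: inn_def)
	moreover have "1 / real (Suc n) <= 1 / Suc m" using assms(2) by (intro divide_left_mono) auto
	moreover have "1 / real (Suc m) < 2 / Suc m" by (simp add: divide_strict_right_mono)
	ultimately show False using y(1) by linarith
qed

lemma inn_sub: "inn m <= Om"
	using inn_cball[of _ m m] by force

lemma inn_mono: assumes "m <= n" shows "inn m <= inn n"
proof -
	have "2 / real (Suc n) <= 2 / Suc m" using assms by (intro divide_left_mono) auto
	thus ?thesis by (auto simp: inn_def)
qed

lemma compact_inn: assumes "compact K" "K <= Om" obtains m where "K <= inn m"
proof (cases "K = {}")
	case False
	have "K \<inter> - Om = {}" using assms(2) by blast
	from separate_compact_closed[OF assms(1) compl_dom(1) this]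
	obtain d where d: "d > 0" "!!x y. x : K ==> y : - Om ==> d <= dist x y" by blast
	have i: "d <= infdist x (- Om)" if "x : K" for x
		unfolding infdist_notempty[OF compl_dom(2)] using compl_dom(2) d(2)[OF that] by (intro cINF_greatest) auto
	obtain m where "inverse (real (Suc m)) < d / 2" using reals_Archimedean[of "d / 2"] d by auto
	hence "2 / real (Suc m) <= d" by (simp add: inverse_eq_divide field_simps)
	hence "K <= inn m" using i by (force simp: inn_def)
	thus thesis by (rule that)
qed (use that in auto)

definition mov :: "nat => (real^2 => real^2) => real^2 => real^2" where
	"mov n g x = vec2 (mo n (%y. g y $ 1) x) (mo n (%y. g y $ 2) x)"

lemma mov_nth [simp]: "mov n g x $ i = mo n (%y. g y $ i) x"
	using exhaust_2[of i] by (auto simp: mov_def)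

lemma mov_sqi: "sqi M g ==> sqi M (mov n g)"
	unfolding sqi_vec_iff by (auto intro!: mo_sqi sqi_imp_integrable)

lemma mov_tendsto:
	assumes g: "sqi M g" shows "(%n. n2 M (%x. mov n g x - g x)) ----> 0"
proof (rule tendsto0_le)
	have c: "sqi M (%x. g x $ i)" for i using g sqi_vec_iff by blast
	show "(%n. n2 M (%x. mo n (%y. g y $ 1) x - g x $ 1) + n2 M (%x. mo n (%y. g y $ 2) x - g x $ 2)) ----> 0"
		using tendsto_add[OF mo_tendsto_L2[OF c[of 1]] mo_tendsto_L2[OF c[of 2]]] by simp
	show "n2 M (%x. mov n g x - g x) <= n2 M (%x. mo n (%y. g y $ 1) x - g x $ 1) + n2 M (%x. mo n (%y. g y $ 2) x - g x $ 2)" for n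
		using n2_vec_le[OF sqi_diff[OF mov_sqi[OF g] g], of n] by simp
qed simp

text \<open>Gagliardo's inequality is applied to the square of a mollification v. Since grad (v^2) =
  2 v grad v, Cauchy-Schwarz leaves the L^2 norms of v and of the mollified gradient. Restricting to
  segments inside \<open>inn m\<close> identifies grad v with that mollified gradient; Fatou removes
  the mollification.\<close>

lemma L4_local_inn:
	assumes u: "Hg u g" and ab: "a ~= b" and h: "h > 0" and si: "si = 1 \<or> si = (-1::real)"
		and S: "S : sets borel" "S <= Om" "!!x. x : S ==> seg si a h x <= inn m" "!!x. x : S ==> seg si b h x <= inn m"
	defines "D \<equiv> abs a + abs b + 1"
	shows "(nni M (%x. ennreal ((u x)^4) * indicator S x)) <= ennreal (1 / abs (a - b) * ((n2 M u)^2 / h + 2 * D * (n2 M u * n2 M g))^2)"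
proof -
	note H = HgD[OF u]
	have [measurable]: "u : bm M" using H(1) sqi_m by blast
	have innM: "inn m : sets borel" using inn_closed by (rule borel_closed)
	have D0: "D >= 0" by (simp add: D_def)
	define B where "B n = 1 / abs (a - b) * ((n2 M (mo n u))^2 / h + 2 * D * (n2 M (mo n u) * n2 M (mov n g)))^2" for n
	have st: "(nni M (%x. ennreal ((mo n u x)^4) * indicator S x)) <= ennreal (B n)" if n: "n >= m" for n
	proof -
		define v where "v = mo n u"
		have vs: "smooth_R2 v" unfolding v_def by (rule mo_smooth[OF H(4)])
		have vsq: "sqi M v" unfolding v_def by (rule mo_sqi[OF H(4)])
		have w: "smooth_R2 (%x. v x * v x)" by (intro smooth_mult vs)
		have [measurable]: "v : bm borel" "grad v : bm borel" "grad (%x. v x * v x) : bm borel"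
			using vs w smooth_borel grad_borel by auto
		have [measurable]: "mov n g : bm M" "v : bm M"
			using mov_sqi[OF H(2)] vsq sqi_m by blast+
		note [measurable] = S(1) innM
		have gw: "norm (grad (%x. v x * v x) x) = 2 * (abs (v x) * norm (grad v x))" for x
		proof -
			have "grad (%x. v x * v x) x = (2 * v x) *R grad v x"
				using smooth_differentiable[OF vs] by (simp add: grad_def vec_eq_iff pd_mult)
			thus ?thesis by (simp add: abs_mult)
		qed
		have gv: "grad v x = mov n g x" if "x : inn m" for x
			using conv_pd_interior[OF u inn_cball[OF that n]] by (simp add: vec_eq_iff grad_def v_def)
		have "(nni M (%x. ennreal ((v x)^4) * indicator S x)) = (nni lborel (%x. ennreal ((v x * v x)^2) * indicator S x))"
			using S(2) by (subst nn_integral_M_eq) (auto simp: power2_eq_square power4_eq_xxxx indicator_def mult.assoc)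
		also have "... <= ennreal (1 / abs (a - b)) * (nni lborel (%x. ennreal (abs (v x * v x) / h + D * norm (grad (%x. v x * v x) x)) * indicator (inn m) x))^2"
			unfolding D_def using gagliardo_segments[OF w innM S(1,3,4) si h ab] by simp
		also have "(nni lborel (%x. ennreal (abs (v x * v x) / h + D * norm (grad (%x. v x * v x) x)) * indicator (inn m) x))
			= (nni M (%x. ennreal (abs (v x * v x) / h + D * norm (grad (%x. v x * v x) x)) * indicator (inn m) x))"
			using inn_sub by (intro nn_integral_M_eq[symmetric]) (auto simp: indicator_def)
		also have "... <= (nni M (%x. ennreal ((v x)^2 / h + 2 * D * (norm (v x) * norm (mov n g x)))))"
			using gv by (intro nn_integral_mono) (auto simp: gw indicator_def power2_eq_square mult_ac)
		also have "... = ennreal (LINT x|M. (v x)^2 / h + 2 * D * (norm (v x) * norm (mov n g x)))"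
		proof (rule nn_integral_eq_integral)
			show "integrable M (%x. (v x)^2 / h + 2 * D * (norm (v x) * norm (mov n g x)))"
				using sqi_integrable[OF vsq] integrable_norm_mult[OF vsq mov_sqi[OF H(2)]] by auto
		qed (use h D0 in auto)
		also have "... <= ennreal ((n2 M v)^2 / h + 2 * D * (n2 M v * n2 M (mov n g)))"
		proof (rule ennreal_leI)
			have "(LINT x|M. (v x)^2 / h + 2 * D * (norm (v x) * norm (mov n g x)))
				= (LINT x|M. (norm (v x))^2) / h + 2 * D * (LINT x|M. norm (v x) * norm (mov n g x))"
				using sqi_integrable[OF vsq] integrable_norm_mult[OF vsq mov_sqi[OF H(2)]] by simp
			also have "... <= (n2 M v)^2 / h + 2 * D * (n2 M v * n2 M (mov n g))"
				unfolding n2_sq ip_self using integral_norm_mult_le[OF vsq mov_sqi[OF H(2)]] D0 by (intro add_mono mult_left_mono) auto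
			finally show "(LINT x|M. (v x)^2 / h + 2 * D * (norm (v x) * norm (mov n g x))) <= (n2 M v)^2 / h + 2 * D * (n2 M v * n2 M (mov n g))" .
		qed
		finally have "(nni M (%x. ennreal ((v x)^4) * indicator S x))
			<= ennreal (1 / abs (a - b)) * (ennreal ((n2 M v)^2 / h + 2 * D * (n2 M v * n2 M (mov n g))))^2"
			by (simp add: power_mono mult_left_mono)
		also have "... = ennreal (B n)"
		proof -
			have *: "ennreal k * (ennreal c)^2 = ennreal (k * c^2)" if "0 <= k" "0 <= c" for k c
				using that by (simp add: ennreal_power ennreal_mult)
			show ?thesis unfolding B_def v_def[symmetric] by (rule *) (use h D0 in auto)
		qed
		finally show ?thesis by (simp add: v_def)
	qed
	have ul: "(%n. n2 M (%x. mo n u x - u x)) ----> 0" by (rule mo_tendsto_L2[OF H(1)])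
	from n2_tendsto_AE_subseq[where f = "%n. mo n u", OF mo_sqi[OF H(4)] H(1) ul]
	obtain r :: "nat => nat" where r: "strict_mono r" "AE x in M. (%n. mo (r n) u x) ----> u x" by blast
	have "(%n. n2 M (mo n u)) ----> n2 M u" "(%n. n2 M (mov n g)) ----> n2 M g"
		using tendsto_n2[where f = "%n. mo n u", OF mo_sqi[OF H(4)] H(1) ul]
			tendsto_n2[where f = "%n. mov n g", OF mov_sqi[OF H(2)] H(2) mov_tendsto[OF H(2)]] by auto
	hence "B ----> 1 / abs (a - b) * ((n2 M u)^2 / h + 2 * D * (n2 M u * n2 M g))^2"
		unfolding B_def[abs_def] using h by (intro tendsto_intros) auto
	from LIMSEQ_subseq_LIMSEQ[OF this r(1)]
	have Bl: "(%n. ennreal (B (r n))) ----> ennreal (1 / abs (a - b) * ((n2 M u)^2 / h + 2 * D * (n2 M u * n2 M g))^2)"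
		by (intro tendsto_ennrealI) (simp add: o_def)
	have [measurable]: "mo n u : bm M" for n using mo_sqi[OF H(4)] sqi_m by blast
	have SM: "S : sets M" using S(1,2) by (auto simp: sets_restrict_space intro!: image_eqI[of _ _ S])
	note [measurable] = SM
	have "(nni M (%x. ennreal ((u x)^4) * indicator S x)) = (nni M (%x. liminf (%n. ennreal ((mo (r n) u x)^4) * indicator S x)))"
	proof (rule nn_integral_cong_AE, use r(2) in eventually_elim)
		case (elim x)
		hence "(%n. ennreal ((mo (r n) u x)^4)) ----> ennreal ((u x)^4)" by (intro tendsto_ennrealI tendsto_power)
		hence "(%n. ennreal ((mo (r n) u x)^4) * indicator S x) ----> ennreal ((u x)^4) * indicator S x"
			by (cases "x : S") auto
		thus ?case using lim_imp_Liminf[OF sequentially_bot] by metis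
	qed
	also have "... <= liminf (%n. \<integral>\<^sup>+x. ennreal ((mo (r n) u x)^4) * indicator S x \<partial>M)" by (rule nn_integral_liminf) measurable
	also have "... <= liminf (%n. ennreal (B (r n)))"
	proof (rule Liminf_mono, rule eventually_sequentiallyI[of m])
		fix n assume "m <= n"
		hence "m <= r n" using seq_suble[OF r(1), of n] by linarith
		thus "(nni M (%x. ennreal ((mo (r n) u x)^4) * indicator S x)) <= ennreal (B (r n))" by (rule st)
	qed
	also have "... = ennreal (1 / abs (a - b) * ((n2 M u)^2 / h + 2 * D * (n2 M u * n2 M g))^2)"
		by (rule lim_imp_Liminf[OF sequentially_bot Bl])
	finally show ?thesis .
qed

text \<open>Each segment is compact and so lies in some \<open>inn m\<close>; the sets
  \<open>S m\<close> therefore exhaust the part of the ball inside the domain, with a bound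
  independent of m.\<close>

lemma L4_local:
	assumes u: "Hg u g" and cone: "cone_at Om p r si a b h"
	shows "(nni M (%x. ennreal ((u x)^4) * indicator (ball p r) x))
		<= ennreal (1 / abs (a - b) * ((n2 M u)^2 / h + 2 * (abs a + abs b + 1) * (n2 M u * n2 M g))^2)" (is "_ <= ?B")
proof -
	have c: "h > 0" "a ~= b" "si = 1 \<or> si = -1" "!!x. x : ball p r ==> x : Om ==> seg si a h x <= Om & seg si b h x <= Om"
		using cone by (auto simp: cone_at_def)
	have [measurable]: "u : bm M" using HgD(1)[OF u] sqi_m by blast
	define S where "S m = {x : ball p r \<inter> Om. seg si a h x <= inn m & seg si b h x <= inn m}" for m
	have Sb: "S m : sets borel" for m
	proof -
		\<comment> \<open>Measurability of \<open>S m\<close>: having a segment inside a closed set is an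
		  intersection of closed conditions on its starting point.\<close>
		have cl: "closed {x. seg si d h x <= inn m}" for d
		proof -
			have "{x. seg si d h x <= inn m} = (\<Inter>s\<in>{0..h}. (%x. x + s *R (si *R vec2 d 1)) -` inn m)" by (auto simp: seg_def)
			moreover have "closed ((%x. x + s *R (si *R vec2 d 1)) -` inn m)" for s
				by (intro continuous_closed_vimage inn_closed continuous_intros)
			ultimately show ?thesis by (simp add: closed_INT)
		qed
		have "S m = ball p r \<inter> Om \<inter> {x. seg si a h x <= inn m} \<inter> {x. seg si b h x <= inn m}" by (auto simp: S_def)
		thus ?thesis using cl[of a] cl[of b] open_dom by (auto intro!: sets.Int)
	qed
	have SM: "S m : sets M" for m
		using Sb[of m] by (auto simp: sets_restrict_space S_def intro!: image_eqI[of _ _ "S m"])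
	note [measurable] = SM
	have "S m <= S n" if "m <= n" for m n using inn_mono[OF that] unfolding S_def by blast
	hence inc: "incseq S" by (simp add: incseq_def)
	have U: "(\<Union>m. S m) = ball p r \<inter> Om"
	proof
		show "ball p r \<inter> Om <= (\<Union>m. S m)"
		proof
			fix x assume x: "x : ball p r \<inter> Om"
			have cp: "compact (seg si d h x)" for d unfolding seg_def by (intro compact_continuous_image continuous_intros) auto
			obtain m1 where m1: "seg si a h x <= inn m1" using compact_inn[OF cp] c(4) x by blast
			obtain m2 where m2: "seg si b h x <= inn m2" using compact_inn[OF cp] c(4) x by blast
			have "x : S (max m1 m2)" using x m1 m2 inn_mono[of m1 "max m1 m2"] inn_mono[of m2 "max m1 m2"] by (auto simp: S_def)
			thus "x : (\<Union>m. S m)" by blast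
		qed
	qed (auto simp: S_def)
	have "(nni M (%x. ennreal ((u x)^4) * indicator (ball p r) x)) = (nni M (%x. (SUP m. ennreal ((u x)^4) * indicator (S m) x)))"
	proof (rule nn_integral_cong)
		fix x assume "x : space M"
		hence x: "x : Om" by simp
		show "ennreal ((u x)^4) * indicator (ball p r) x = (SUP m. ennreal ((u x)^4) * indicator (S m) x)"
		proof (rule antisym)
			show "ennreal ((u x)^4) * indicator (ball p r) x <= (SUP m. ennreal ((u x)^4) * indicator (S m) x)"
			proof (cases "x : ball p r")
				case True
				hence "x : (\<Union>m. S m)" unfolding U using x by blast
				then obtain m where "x : S m" by blast
				thus ?thesis using True by (intro SUP_upper2[of m]) auto
			qed simp
			show "(SUP m. ennreal ((u x)^4) * indicator (S m) x) <= ennreal ((u x)^4) * indicator (ball p r) x"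
				by (rule SUP_least) (auto simp: indicator_def S_def)
		qed
	qed
	also have "... = (SUP m. \<integral>\<^sup>+x. ennreal ((u x)^4) * indicator (S m) x \<partial>M)"
		by (rule nn_integral_monotone_convergence_SUP)
			(use inc in \<open>auto simp: incseq_def le_fun_def indicator_def\<close>)
	also have "... <= ?B"
	proof (rule SUP_least)
		fix m show "(nni M (%x. ennreal ((u x)^4) * indicator (S m) x)) <= ?B"
			by (rule L4_local_inn[OF u c(2,1,3) Sb, of m]) (auto simp: S_def)
	qed
	finally show ?thesis .
qed

end

context sbdom
begin

text \<open>Compactness of the closure leaves finitely many balls, over which the local constants
  are summed.\<close>

lemma L4_bound:
	obtains C where "C > 0" "!!u g. Hg u g ==> integrable M (%x. (u x)^4)"
		"!!u g. Hg u g ==> (LINT x|M. (u x)^4) <= C * (n2 M u)^2 * ((n2 M u)^2 + (n2 M g)^2)"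
proof -
	obtain rh where rh: "smooth_R2 rh" "Om = {x. rh x < 0}" "!!x. x : frontier Om ==> grad rh x ~= 0"
		using dom unfolding smooth_bounded_domain_def by blast
	have "ALL p:closure Om. EX q. case q of (r, si, a, b, h) => cone_at Om p r si a b h"
		using cone_exists[OF open_dom rh] by fastforce
	from bchoice[OF this] obtain q where q: "ALL p:closure Om. case q p of (r, si, a, b, h) => cone_at Om p r si a b h" by (rule exE)
	define R where "R p = fst (q p)" for p
	define A where "A p = fst (snd (snd (q p)))" for p
	define B where "B p = fst (snd (snd (snd (q p))))" for p
	define h where "h p = snd (snd (snd (snd (q p))))" for p
	have cone: "cone_at Om p (R p) (fst (snd (q p))) (A p) (B p) (h p)" if "p : closure Om" for p
		using bspec[OF q that] by (simp add: case_prod_beta R_def A_def B_def h_def)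
	have R0: "R p > 0" "h p > 0" if "p : closure Om" for p using cone[OF that] by (auto simp: cone_at_def)
	have cc: "compact (closure Om)" using bounded_dom by (simp add: compact_closure)
	obtain P where P: "P <= closure Om" "finite P" "closure Om <= (\<Union>p\<in>P. ball p (R p))"
		by (rule compactE_image[OF cc, of "closure Om" "%p. ball p (R p)"]) (use R0 in force)+
	define k where "k p = 1 / h p + 2 * (abs (A p) + abs (B p) + 1)" for p
	\<comment> \<open>The factor 2 comes from (s + t)^2 <= 2 (s^2 + t^2); the summand 1 ensures
	  positivity.\<close>
	define C where "C = (\<Sum>p\<in>P. 1 / abs (A p - B p) * (k p)^2 * 2) + 1"
	have C0: "C > 0" unfolding C_def by (intro add_nonneg_pos sum_nonneg) auto
	have key: "(nni M (%x. ennreal ((u x)^4))) <= ennreal (C * (n2 M u)^2 * ((n2 M u)^2 + (n2 M g)^2))" if u: "Hg u g" for u g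
	proof -
		have [measurable]: "u : bm M" using HgD(1)[OF u] sqi_m by blast
		define X where "X = (n2 M u)^2 * ((n2 M u)^2 + (n2 M g)^2)"
		have X0: "X >= 0" by (simp add: X_def)
		have ball [measurable]: "ball p r \<inter> Om : sets M" for p r
			using open_dom by (auto simp: sets_restrict_space intro!: image_eqI[of _ _ "ball p r"])
		have [measurable]: "(%x. indicator (ball p r) x :: ennreal) : bm M" for p r
			by (intro borel_M borel_measurable_indicator borel_open open_ball)
		have "(nni M (%x. ennreal ((u x)^4))) <= (nni M (%x. (\<Sum>p\<in>P. ennreal ((u x)^4) * indicator (ball p (R p)) x)))"
		proof (rule nn_integral_mono)
			fix x assume "x : space M"
			hence "x : closure Om" using closure_subset by auto
			from subsetD[OF P(3) this] obtain p where p: "p : P" "x : ball p (R p)" by blast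
			have "ennreal ((u x)^4) = ennreal ((u x)^4) * indicator (ball p (R p)) x" using p by simp
			also have "... <= (\<Sum>p\<in>P. ennreal ((u x)^4) * indicator (ball p (R p)) x)"
				by (rule member_le_sum[OF p(1)]) (use P in auto)
			finally show "ennreal ((u x)^4) <= (\<Sum>p\<in>P. ennreal ((u x)^4) * indicator (ball p (R p)) x)" .
		qed
		also have "... = (\<Sum>p\<in>P. \<integral>\<^sup>+x. ennreal ((u x)^4) * indicator (ball p (R p)) x \<partial>M)" by (rule nn_integral_sum) measurable
		also have "... <= (\<Sum>p\<in>P. ennreal (1 / abs (A p - B p) * (k p)^2 * 2 * X))"
		proof (rule sum_mono)
			fix p assume p: "p : P"
			hence pc: "p : closure Om" using P by blast
			define s where "s = n2 M u"
			define t where "t = n2 M g"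
			have st: "s >= 0" "t >= 0" by (auto simp: s_def t_def)
			have k: "1 / h p <= k p" "2 * (abs (A p) + abs (B p) + 1) <= k p" "0 <= k p" using R0(2)[OF pc] by (auto simp: k_def)
			have "s^2 / h p + 2 * (abs (A p) + abs (B p) + 1) * (s * t) <= k p * s^2 + k p * (s * t)"
				using k st mult_right_mono[OF k(1), of "s^2"] by (intro add_mono mult_right_mono) auto
			also have "... = k p * (s * (s + t))" by (simp add: power2_eq_square algebra_simps)
			finally have "(s^2 / h p + 2 * (abs (A p) + abs (B p) + 1) * (s * t))^2 <= (k p * (s * (s + t)))^2"
				using st R0(2)[OF pc] by (intro power_mono) auto
			also have "... = (k p)^2 * (s^2 * (s + t)^2)" by (simp add: power_mult_distrib)
			also have "... <= (k p)^2 * (s^2 * (2 * (s^2 + t^2)))"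
				using sum_squares_bound[of s t] by (intro mult_left_mono) (auto simp: power2_sum)
			finally have "1 / abs (A p - B p) * (s^2 / h p + 2 * (abs (A p) + abs (B p) + 1) * (s * t))^2 <= 1 / abs (A p - B p) * ((k p)^2 * (s^2 * (2 * (s^2 + t^2))))"
				by (intro mult_left_mono) auto
			also have "... = 1 / abs (A p - B p) * (k p)^2 * 2 * X" by (simp add: X_def s_def t_def)
			finally show "(nni M (%x. ennreal ((u x)^4) * indicator (ball p (R p)) x)) <= ennreal (1 / abs (A p - B p) * (k p)^2 * 2 * X)"
				using L4_local[OF u cone[OF pc]] unfolding s_def t_def by (meson ennreal_leI order_trans)
		qed
		also have "... = ennreal (\<Sum>p\<in>P. 1 / abs (A p - B p) * (k p)^2 * 2 * X)" using X0 by (intro sum_ennreal) auto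
		also have "(\<Sum>p\<in>P. 1 / abs (A p - B p) * (k p)^2 * 2 * X) = (C - 1) * X" by (simp add: C_def sum_distrib_right)
		also have "ennreal ((C - 1) * X) <= ennreal (C * X)" using X0 by (intro ennreal_leI mult_right_mono) auto
		finally show ?thesis by (simp add: X_def mult.assoc)
	qed
	show thesis
	proof (rule that[OF C0])
		fix u g assume u: "Hg u g"
		have [measurable]: "u : bm M" using HgD(1)[OF u] sqi_m by blast
		show i: "integrable M (%x. (u x)^4)"
			using key[OF u] by (intro integrableI_bounded) (auto simp: le_less_trans)
		have "ennreal (LINT x|M. (u x)^4) <= ennreal (C * (n2 M u)^2 * ((n2 M u)^2 + (n2 M g)^2))"
			using key[OF u] nn_integral_eq_integral[OF i] by simp
		thus "(LINT x|M. (u x)^4) <= C * (n2 M u)^2 * ((n2 M u)^2 + (n2 M g)^2)"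
			using C0 by (subst (asm) ennreal_le_iff) auto
	qed
qed

text \<open>Write a_k for the integral of u^k and H for the squared H^1 norm. Two Cauchy-Schwarz
  inequalities, a_2^2 <= a_1 a_3 and a_3^2 <= a_2 a_4, and a_4 <= C a_2 H combine to a_3^2 <= C H
  a_1 a_3, and one factor a_3 cancels. The factor a_1 is the mass, which becomes the smallness
  parameter.\<close>

lemma L3_bound:
	obtains C where "C > 0" "!!u g. Hg u g ==> integrable M (%x. (u x)^4)"
		"!!u g. Hg u g ==> (!!x. x : Om ==> 0 <= u x) ==>
			 (LINT x|M. (u x)^3) <= C * (LINT x|M. u x) * ((n2 M u)^2 + (n2 M g)^2)"
		"!!u g. Hg u g ==> (LINT x|M. (u x)^4) <= C * (n2 M u)^2 * ((n2 M u)^2 + (n2 M g)^2)"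
proof -
	obtain C where C: "C > 0" "!!u g. Hg u g ==> integrable M (%x. (u x)^4)"
		"!!u g. Hg u g ==> (LINT x|M. (u x)^4) <= C * (n2 M u)^2 * ((n2 M u)^2 + (n2 M g)^2)" using L4_bound by blast
	show thesis
	proof (rule that[OF C(1,2) _ C(3)])
		fix u g assume u: "Hg u g" and u0: "!!x. x : Om ==> 0 <= u x"
		note su = HgD(1)[OF u]
		have [measurable]: "u : bm M" using su sqi_m by blast
		define a1 where "a1 = (LINT x|M. u x)"
		define a2 where "a2 = (LINT x|M. (u x)^2)"
		define a3 where "a3 = (LINT x|M. (u x)^3)"
		define a4 where "a4 = (LINT x|M. (u x)^4)"
		define H where "H = (n2 M u)^2 + (n2 M g)^2"
		have s2: "sqi M (%x. (u x)^2)" using C(2)[OF u] by (auto simp: sqi_def simp flip: power_mult)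
		have i3: "integrable M (%x. (u x)^3)" using integrable_ip[OF su s2] by (simp add: power3_eq_cube power2_eq_square mult.assoc)
		have i1: "integrable M u" using su sqi_imp_integrable by blast
		have sq1: "sqi M (%x. sqrt (u x))"
			unfolding sqi_def
		proof
			have "integrable M (%x. (norm (sqrt (u x)))^2) \<longleftrightarrow> integrable M u"
				by (rule bi_i_cong[OF refl]) (use u0 in auto)
			thus "integrable M (%x. (norm (sqrt (u x)))^2)" using i1 by blast
		qed measurable
		have sq3: "sqi M (%x. sqrt (u x) * u x)"
			unfolding sqi_def
		proof
			have "integrable M (%x. (norm (sqrt (u x) * u x))^2) \<longleftrightarrow> integrable M (%x. (u x)^3)"
				by (rule bi_i_cong[OF refl]) (use u0 in \<open>auto simp: power_mult_distrib power3_eq_cube power2_eq_square\<close>)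
			thus "integrable M (%x. (norm (sqrt (u x) * u x))^2)" using i3 by blast
		qed measurable
		have n1: "(n2 M (%x. sqrt (u x)))^2 = a1"
			unfolding n2_sq ip_self a1_def by (intro bi_cong) (use u0 in auto)
		have n3: "(n2 M (%x. sqrt (u x) * u x))^2 = a3"
			unfolding n2_sq ip_self a3_def by (intro bi_cong)
				(use u0 in \<open>auto simp: power_mult_distrib power3_eq_cube power2_eq_square\<close>)
		have n4: "(n2 M (%x. (u x)^2))^2 = a4" unfolding n2_sq ip_self a4_def by (simp flip: power_mult)
		have nu: "(n2 M u)^2 = a2" unfolding n2_sq ip_self a2_def by simp
		have c1: "a2^2 <= a1 * a3"
		proof -
			have "ip M (%x. sqrt (u x)) (%x. sqrt (u x) * u x) = a2"
				unfolding ip_def a2_def by (intro bi_cong) (use u0 in \<open>auto simp: power2_eq_square simp flip: mult.assoc\<close>)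
			hence "abs a2 <= abs (n2 M (%x. sqrt (u x)) * n2 M (%x. sqrt (u x) * u x))" using ip_Cauchy_Schwarz[OF sq1 sq3] by simp
			thus ?thesis unfolding n1[symmetric] n3[symmetric] by (simp only: abs_le_square_iff power_mult_distrib)
		qed
		have c2: "a3^2 <= a2 * a4"
		proof -
			have "ip M u (%x. (u x)^2) = a3" unfolding ip_def a3_def by (simp add: power3_eq_cube power2_eq_square mult.assoc)
			hence "abs a3 <= abs (n2 M u * n2 M (%x. (u x)^2))" using ip_Cauchy_Schwarz[OF su s2] by simp
			thus ?thesis unfolding nu[symmetric] n4[symmetric] by (simp only: abs_le_square_iff power_mult_distrib)
		qed
		have p: "0 <= a1" "0 <= a2" "0 <= a3" "0 <= H" unfolding n1[symmetric] n3[symmetric] nu[symmetric] H_def by simp_all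
		have c4: "a4 <= C * a2 * H" using C(3)[OF u] unfolding a4_def H_def nu by (simp add: mult.assoc)
		have "a3^2 <= a2 * (C * a2 * H)" using c2 mult_left_mono[OF c4 p(2)] by linarith
		also have "... = C * H * a2^2" by (simp add: power2_eq_square)
		also have "... <= C * H * (a1 * a3)" using c1 C(1) p by (intro mult_left_mono) auto
		finally have "a3 * a3 <= (C * a1 * H) * a3" by (simp add: power2_eq_square mult_ac)
		hence "a3 <= C * a1 * H"
			using p C(1) by (cases "a3 = 0") (auto simp: mult_le_cancel_right)
		thus "(LINT x|M. (u x)^3) <= C * (LINT x|M. u x) * ((n2 M u)^2 + (n2 M g)^2)"
			by (simp add: a3_def a1_def H_def)
	qed
qed

end

section \<open>The Dirichlet problem: existence, sup bound and drift estimates\<close>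

context bdom
begin

text \<open>The square root of the area of the domain, through which the Poincare and Stampacchia
  constants depend on it.\<close>

definition dsize :: real where "dsize = n2 M (%x. 1 :: real)"

lemma dsize_nonneg [simp]: "0 <= dsize"
	by (simp add: dsize_def)

lemma integral_norm_le_n2: "sqi M f ==> (LINT x|M. norm (f x)) <= n2 M f * dsize"
	using integral_norm_mult_le[of M f "%x. 1 :: real"] by (simp add: dsize_def)

lemma Z_poincare:
	assumes Z: "Z V GV" shows "n2 M V <= 2 * dsize * n2 M GV"
	using Z_sobolev[OF Z] integral_norm_le_n2[OF HgD(2)[OF Z_H1[OF Z]]] by (simp add: mult_ac)

text \<open>Weak form of \<open>\<Delta>V = f\<close> in \<open>\<Omega>\<close>, \<open>V = 0\<close> on the boundary.\<close>
definition sol :: "(real^2 => real) => (real^2 => real) => (real^2 => real^2) => bool" where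
	"sol f V GV \<longleftrightarrow> Z V GV & (ALL W GW. Z W GW --> ip M GV GW = - ip M f W)"

lemma solD: assumes "sol f V GV" shows "Z V GV" "Hg V GV" "sqi M V" "sqi M GV" "Z W GW ==> ip M GV GW = - ip M f W"
	using assms Z_H1[of V GV] HgD(1,2)[OF Z_H1[of V GV]] by (auto simp: sol_def)

lemma Z_unique_fun:
	assumes "Z V g" "Z V' g" shows "AE x in M. V x = V' x"
proof -
	have d: "Z (%x. 1 * V x + (-1) * V' x) (%x. 1 *R g x + (-1) *R g x)" by (rule Z_lin[OF assms])
	have "n2 M (%x. 1 * V x + (-1) * V' x) <= 0" using Z_poincare[OF d] by simp
	hence "n2 M (%x. 1 * V x + (-1) * V' x) = 0" using n2_nonneg by (rule antisym)
	from n2_eq_0[OF HgD(1)[OF Z_H1[OF d]] this] show ?thesis by simp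
qed

text \<open>Riesz is applied in the space of gradients of H^1_0 functions. By Poincare this space is
  closed, the gradient determines the function, and the functional is bounded in the gradient
  norm.\<close>

lemma sol_exists:
	assumes f: "sqi M f" obtains V GV where "sol f V GV"
proof -
	define E where "E = {g. EX V. Z V g}"
	\<comment> \<open>The chosen potential of g is unique up to a null set, so the value does not
	  depend on the choice.\<close>
	define l where "l g = - ip M f (SOME V. Z V g)" for g
	have l: "l g = - ip M f V" if "Z V g" for V g
	proof -
		have S: "Z (SOME V. Z V g) g" using that by (rule someI[of "%V. Z V g"])
		note sm = HgD(1)[OF Z_H1[OF S], THEN sqi_m] HgD(1)[OF Z_H1[OF that], THEN sqi_m]
		show ?thesis unfolding l_def using ip_cong_AE[OF sm sqi_m[OF f] Z_unique_fun[OF S that]] ip_commute[of M f] by simp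
	qed
	have E: "l2closed M E"
		unfolding l2closed_def
	proof (intro conjI ballI allI impI)
		show "sqi M g" if "g : E" for g using that HgD(2)[OF Z_H1] by (auto simp: E_def)
		have "Z (%x. 0) (%x. 0)" using Z_test[OF test_fun_zero] by (simp add: grad_def zero_vec_def)
		thus "(%x. 0) : E" by (auto simp: E_def)
		show "(%x. a *R g x + b *R h x) : E" if "g : E" "h : E" for g h a b
			using that Z_lin by (fastforce simp: E_def)
		fix g :: "nat => real^2 => real^2" and g'
		assume g: "ALL n. g n : E" and g': "sqi M g'" and lim: "(%n. n2 M (%x. g n x - g' x)) ----> 0"
		have "ALL n. EX V. Z V (g n)" using g by (auto simp: E_def)
		from choice[OF this] obtain V where V: "!!n. Z (V n) (g n)" by blast
		note s = HgD(1,2)[OF Z_H1[OF V]]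
		have "n2_Cauchy M V"
			unfolding n2_Cauchy_def
		proof (intro allI impI)
			fix e :: real assume e: "e > 0"
			define d where "d = e / (4 * dsize + 1)"
			have d: "d > 0" using e by (simp add: d_def add_nonneg_pos)
			obtain N where N: "!!n. n >= N ==> n2 M (%x. g n x - g' x) < d" using LIMSEQ_D[OF lim d] by auto
			have "n2 M (%x. V m x - V n x) < e" if "m >= N" "n >= N" for m n
			proof -
				have "Z (%x. 1 * V m x + (-1) * V n x) (%x. 1 *R g m x + (-1) *R g n x)" by (rule Z_lin[OF V V])
				from Z_poincare[OF this] have "n2 M (%x. V m x - V n x) <= 2 * dsize * n2 M (%x. g m x - g n x)" by simp
				also have "... <= 2 * dsize * (d + d)"
					using n2_triangle3[OF s(2)[of m] g' s(2)[of n]] n2_minus_commute[of M g' "g n"] N[OF that(1)] N[OF that(2)]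
					by (intro mult_left_mono) auto
				also have "... < (4 * dsize + 1) * d" using d by (simp add: algebra_simps)
				also have "... = e" unfolding d_def using dsize_nonneg by (simp add: add_nonneg_eq_0_iff)
				finally show ?thesis .
			qed
			thus "EX N. ALL m>=N. ALL n>=N. n2 M (%x. V m x - V n x) < e" by blast
		qed
		then obtain V' where V': "sqi M V'" "(%n. n2 M (%x. V n x - V' x)) ----> 0"
			by (rule n2_complete[OF s(1)])
		have "(%n. n2 M (%x. (V n x - V' x, g n x - g' x))) ----> 0"
			using V'(2) lim s V'(1) g' by (subst n2_Pair_tendsto) (auto intro!: sqi_diff)
		hence "Z V' g'" by (rule Z_limit[OF V V'(1) g'])
		thus "g' : E" by (auto simp: E_def)
	qed
	obtain GV where GV: "GV : E" "!!g. g : E ==> ip M GV g = l g"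
	proof (rule riesz_representation[OF E, of l "n2 M f * (2 * dsize)"])
		fix g h :: "real^2 => real^2" and a b assume "g : E" "h : E"
		then obtain V W where V: "Z V g" and W: "Z W h" by (auto simp: E_def)
		have "l (%x. a *R g x + b *R h x) = - ip M f (%x. a * V x + b * W x)" by (rule l[OF Z_lin[OF V W]])
		also have "... = a * l g + b * l h"
			using f HgD(1)[OF Z_H1[OF V]] HgD(1)[OF Z_H1[OF W]] ip_scale_right[of M f a V] ip_scale_right[of M f b W]
			by (simp add: l[OF V] l[OF W] ip_add_right sqi_cmult)
		finally show "l (%x. a *R g x + b *R h x) = a * l g + b * l h" .
	next
		fix g assume "g : E"
		then obtain V where V: "Z V g" by (auto simp: E_def)
		have "abs (l g) <= n2 M f * n2 M V" using ip_Cauchy_Schwarz[OF f HgD(1)[OF Z_H1[OF V]]] by (simp add: l[OF V])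
		also have "... <= n2 M f * (2 * dsize * n2 M g)" by (rule mult_left_mono[OF Z_poincare[OF V]]) simp
		finally show "abs (l g) <= n2 M f * (2 * dsize) * n2 M g" by (simp add: mult.assoc)
	qed (rule that)
	then obtain V where V: "Z V GV" by (auto simp: E_def)
	have "sol f V GV"
		unfolding sol_def using V GV(2) l by (force simp: E_def)
	thus thesis by (rule that)
qed

lemma sol_lin:
	assumes "sol f V GV" "sol f' V' GV'" "sqi M f" "sqi M f'"
	shows "sol (%x. a * f x + b * f' x) (%x. a * V x + b * V' x) (%x. a *R GV x + b *R GV' x)"
	unfolding sol_def
proof (intro conjI allI impI)
	show "Z (%x. a * V x + b * V' x) (%x. a *R GV x + b *R GV' x)" using assms by (intro Z_lin solD)
	fix W GW assume Z: "Z W GW"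
	note s = HgD(1,2)[OF Z_H1[OF Z]] solD(4)[OF assms(1)] solD(4)[OF assms(2)]
	show "ip M (%x. a *R GV x + b *R GV' x) GW = - ip M (%x. a * f x + b * f' x) W"
		using s assms(3,4) solD(5)[OF assms(1) Z] solD(5)[OF assms(2) Z] ip_scale_left[of M a f W] ip_scale_left[of M b f' W]
		by (simp add: ip_add_left sqi_scaleR sqi_cmult)
qed

lemma sol_diff:
	"sol f V GV ==> sol f' V' GV' ==> sqi M f ==> sqi M f' ==> sol (%x. f x - f' x) (%x. V x - V' x) (%x. GV x - GV' x)"
	using sol_lin[of f V GV f' V' GV' 1 "-1"] by simp

lemma sol_estimate:
	assumes s: "sol f V GV" and f: "sqi M f" shows "n2 M GV <= 2 * dsize * n2 M f" "n2 M V <= (2 * dsize)^2 * n2 M f"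
proof -
	have "(n2 M GV)^2 <= n2 M f * n2 M V"
		using solD(5)[OF s solD(1)[OF s]] ip_Cauchy_Schwarz[OF f solD(3)[OF s]] by (simp add: n2_sq)
	also have "... <= n2 M f * (2 * dsize * n2 M GV)" by (rule mult_left_mono[OF Z_poincare[OF solD(1)[OF s]]]) simp
	finally have "n2 M GV * n2 M GV <= (2 * dsize * n2 M f) * n2 M GV" by (simp add: power2_eq_square mult_ac)
	thus 1: "n2 M GV <= 2 * dsize * n2 M f"
		using n2_nonneg[of M GV] by (cases "n2 M GV = 0") (auto simp: mult_le_cancel_right)
	have "n2 M V <= 2 * dsize * n2 M GV" by (rule Z_poincare[OF solD(1)[OF s]])
	also have "... <= 2 * dsize * (2 * dsize * n2 M f)" by (intro mult_left_mono 1) auto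
	finally show "n2 M V <= (2 * dsize)^2 * n2 M f" by (simp add: power2_eq_square mult_ac)
qed

lemma sol_cong:
	assumes s: "sol f V GV" and V': "V' : bm M" "AE x in M. V x = V' x" shows "sol f V' GV"
	using s Z_cong[OF solD(1)[OF s] V'(1) sqi_m[OF solD(4)[OF s]] V'(2)] unfolding sol_def by simp

lemma sol_dirichlet_inv: assumes s: "sol f V GV" shows "dirichlet_inv Om f V GV"
	unfolding dirichlet_inv_def
	using solD[OF s] Z_imp_H10[OF solD(1)[OF s]] solD(5)[OF s Z_test] by (auto simp: ip_def)

text \<open>Weak maximum principle: the positive part of V is an admissible test function and makes
  its own Dirichlet energy nonpositive.\<close>

lemma sol_nonpos:
	assumes s: "sol f V GV" and f: "AE x in M. 0 <= f x" and fs: "sqi M f" shows "AE x in M. V x <= 0"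
proof -
	have Z: "Z (%x. max (V x) 0) (%x. if V x > 0 then GV x else 0)" using Z_pos[OF solD(1)[OF s], of 0] by simp
	have "ip M GV (%x. if V x > 0 then GV x else 0) = ip M (%x. if V x > 0 then GV x else 0) (%x. if V x > 0 then GV x else 0)"
		unfolding ip_def by (intro bi_cong) auto
	also have "... = (n2 M (%x. if V x > 0 then GV x else 0))^2" by (simp add: n2_sq)
	finally have "(n2 M (%x. if V x > 0 then GV x else 0))^2 = - (LINT x|M. f x * max (V x) 0)"
		using solD(5)[OF s Z] by (simp add: ip_def)
	moreover have "0 <= (LINT x|M. f x * max (V x) 0)" using f by (intro integral_nonneg_AE) (auto elim: eventually_mono)
	ultimately have "(n2 M (%x. if V x > 0 then GV x else 0))^2 <= 0" by linarith
	hence "n2 M (%x. if V x > 0 then GV x else 0) = 0" by simp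
	hence "n2 M (%x. max (V x) 0) <= 0" using Z_poincare[OF Z] by simp
	hence "n2 M (%x. max (V x) 0) = 0" using n2_nonneg by (rule antisym)
	from n2_eq_0[OF HgD(1)[OF Z_H1[OF Z]] this] show ?thesis by eventually_elim (simp add: max_def split: if_splits)
qed

text \<open>Test with W, the positive part of V - k. The Sobolev inequality with Cauchy-Schwarz on
  {V > k} and the energy identity give |W|_2 <= 4 A |f|_2 with A the measure of {V > k}; then
  Chebyshev at height h - k. The quadratic dependence on A drives the iteration.\<close>

lemma stampacchia_step:
	assumes s: "sol f V GV" and f: "sqi M f" and k: "0 <= k" "k < h"
	shows "(h - k)^2 * measure M {x : space M. V x > h} <= (4 * measure M {x : space M. V x > k} * n2 M f)^2"
proof -
	have Vm [measurable]: "V : bm M" using solD(3)[OF s] sqi_m by blast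
	have S [measurable]: "{x : space M. V x > a} : sets M" for a by measurable
	define W where "W x = max (V x - k) 0" for x
	define GW where "GW x = (if V x > k then GV x else 0)" for x
	define A where "A = measure M {x : space M. V x > k}"
	have Z: "Z W GW" unfolding W_def GW_def by (rule Z_pos[OF solD(1)[OF s] k(1)])
	note sW = HgD(1,2)[OF Z_H1[OF Z]]
	have A0: "A >= 0" by (simp add: A_def)
	have "ip M GV GW = ip M GW GW" unfolding ip_def by (intro bi_cong) (auto simp: GW_def)
	hence "(n2 M GW)^2 = - ip M f W" using solD(5)[OF s Z] by (simp add: n2_sq)
	hence G: "(n2 M GW)^2 <= n2 M f * n2 M W" using ip_Cauchy_Schwarz[OF f sW(1)] by simp
	define c where "c x = (indicator {x : space M. V x > k} x :: real)" for x
	have cs: "sqi M c" unfolding c_def by (rule bounded_sqi[of _ 1]) (auto intro!: borel_measurable_indicator S[unfolded space_lebesgue_on] simp: indicator_le_1)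
	have "ip M c c = (LINT x|M. indicator {x : space M. V x > k} x)"
		unfolding ip_def c_def by (intro bi_cong) (auto simp: indicator_def)
	hence cn: "(n2 M c)^2 = A" using S by (simp add: n2_sq A_def Int_absorb2 subset_iff)
	have "(LINT x|M. norm (GW x)) = (LINT x|M. norm (GW x) * norm (c x))"
		by (intro bi_cong) (auto simp: GW_def c_def)
	hence "n2 M W <= 2 * (n2 M GW * n2 M c)" using Z_sobolev[OF Z] integral_norm_mult_le[OF sW(2) cs] by linarith
	hence "(n2 M W)^2 <= (2 * (n2 M GW * n2 M c))^2" by (intro power_mono) auto
	also have "... = 4 * A * (n2 M GW)^2" by (simp add: power_mult_distrib cn)
	also have "... <= 4 * A * (n2 M f * n2 M W)" using A0 by (intro mult_left_mono G) auto
	finally have "n2 M W * n2 M W <= (4 * A * n2 M f) * n2 M W" by (simp add: power2_eq_square mult_ac)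
	hence WB: "n2 M W <= 4 * A * n2 M f"
		using A0 n2_nonneg[of M W] by (cases "n2 M W = 0") (auto simp: mult_le_cancel_right)
	have "(h - k)^2 * measure M {x : space M. V x > h} = (LINT x|M. (h - k)^2 * indicator {x : space M. V x > h} x)"
		using S by (simp add: Int_absorb2 subset_iff)
	also have "... <= (LINT x|M. (norm (W x))^2)"
	proof (rule integral_mono)
		show "integrable M (%x. (h - k)^2 * indicator {x : space M. V x > h} x)" by (intro integrable_mult_right integrable_real_indicator S) (simp add: fm.emeasure_eq_measure)
		show "integrable M (%x. (norm (W x))^2)" by (rule sqi_integrable[OF sW(1)])
		show "(h - k)^2 * indicator {x : space M. V x > h} x <= (norm (W x))^2" for x
			using k power_mono[of "h - k" "V x - k" 2] by (auto simp: indicator_def W_def max_def)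
	qed
	also have "... = (n2 M W)^2" by (simp add: n2_sq ip_self)
	also have "... <= (4 * A * n2 M f)^2" using WB by (intro power_mono) auto
	finally show ?thesis by (simp add: A_def)
qed

text \<open>Along the levels d (1 - 2^-n) the measure of the superlevel set decays like 4^-n, so {V
  > d} is null.\<close>

lemma stampacchia_upper:
	assumes s: "sol f V GV" and f: "sqi M f" shows "AE x in M. V x <= 16 * dsize * n2 M f"
proof (cases "dsize * n2 M f = 0")
	case True
	hence "n2 M GV = 0" using sol_estimate(1)[OF s f] by (intro antisym n2_nonneg) auto
	hence "n2 M V <= 0" using Z_poincare[OF solD(1)[OF s]] by simp
	hence "n2 M V = 0" using n2_nonneg by (rule antisym)
	from n2_eq_0[OF solD(3)[OF s] this] show ?thesis by eventually_elim simp
next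
	case False
	define F where "F = n2 M f"
	\<comment> \<open>Exactly the height for which the recursion reproduces the decay 4^-n: the
	  induction step requires d^2 = 256 dsize^2 F^2.\<close>
	define d where "d = 16 * dsize * F"
	have F0: "F > 0" "dsize > 0" using False n2_nonneg[of M f] dsize_nonneg by (auto simp: F_def order_less_le)
	have d0: "d > 0" using F0 by (simp add: d_def)
	have [measurable]: "V : bm M" using solD(3)[OF s] sqi_m by blast
	have S [measurable]: "{x : space M. V x > a} : sets M" for a by measurable
	define A where "A k = measure M {x : space M. V x > k}" for k
	have Anti: "A k <= A j" if "j <= k" for j k unfolding A_def using that by (intro fm.finite_measure_mono S) auto
	have ds: "dsize^2 = measure M (space M)" by (simp add: dsize_def n2_sq ip_def)
	define k where "k n = d * (1 - (1/2)^n)" for n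
	have step: "A (k n) <= dsize^2 * (1/4)^n" for n
	proof (induction n)
		case 0
		show ?case unfolding ds A_def using fm.bounded_measure[of "{x : space M. V x > k 0}"] by simp
	next
		case (Suc n)
		have kk: "0 <= k n" "k n < k (Suc n)" using d0 by (auto simp: k_def power_le_one)
		have df: "k (Suc n) - k n = d * (1/2)^Suc n" by (simp add: k_def algebra_simps)
		have "(d * (1/2)^Suc n)^2 * A (k (Suc n)) <= (4 * A (k n) * F)^2"
			using stampacchia_step[OF s f kk] unfolding df A_def F_def .
		also have "... <= (4 * (dsize^2 * (1/4)^n) * F)^2"
			using Suc F0 by (intro power_mono mult_right_mono mult_left_mono) (auto simp: A_def)
		finally have "d^2 * ((1/4) * (1/4)^n * A (k (Suc n))) <= 16 * F^2 * (dsize^2 * dsize^2) * ((1/4)^n * (1/4)^n)"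
			by (simp add: power_mult_distrib power2_eq_square power_divide mult_ac power_mult[symmetric])
				(simp add: power_mult_distrib[symmetric] mult_ac)
		hence "256 * (dsize^2 * F^2) * ((1/4) * (1/4)^n * A (k (Suc n))) <= 16 * F^2 * (dsize^2 * dsize^2) * ((1/4)^n * (1/4)^n)"
			by (simp add: d_def power_mult_distrib mult_ac)
		hence "(16 * dsize^2 * F^2 * (1/4)^n) * (4 * A (k (Suc n))) <= (16 * dsize^2 * F^2 * (1/4)^n) * (dsize^2 * (1/4)^n)"
			by (simp add: mult_ac)
		hence "4 * A (k (Suc n)) <= dsize^2 * (1/4)^n" using F0 by (subst (asm) mult_le_cancel_left_pos) auto
		thus ?case by simp
	qed
	have "A d <= dsize^2 * (1/4)^n" for n
		using step[of n] Anti[of "k n" d] d0 by (auto simp: k_def mult_left_le)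
	moreover have "(%n. dsize^2 * (1/4)^n) ----> dsize^2 * 0" by (intro tendsto_intros) auto
	ultimately have "A d <= dsize^2 * 0" by (intro LIMSEQ_le_const) auto
	hence "measure M {x : space M. \<not> V x <= d} = 0" unfolding A_def by (simp add: not_le antisym)
	hence "emeasure M {x : space M. \<not> V x <= d} = 0" by (simp add: fm.emeasure_eq_measure)
	thus ?thesis unfolding d_def F_def using S[of "16 * dsize * n2 M f"] by (subst AE_iff_measurable[OF _ refl]) (simp_all add: not_le)
qed

text \<open>The almost everywhere bounds are made pointwise by clipping, since the chain and product
  rules ask for pointwise ranges. The lower bound comes from Stampacchia applied to the solution
  with datum -f.\<close>

lemma potential_exists:
	assumes f: "sqi M f" "AE x in M. 0 <= f x"
	obtains V GV where "sol f V GV" "!!x. V x <= 0" "!!x. - (16 * dsize * n2 M f) <= V x"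
proof -
	obtain V GV where s: "sol f V GV" using sol_exists[OF f(1)] by blast
	have "sol (%x. 0 * f x + (-1) * f x) (%x. 0 * V x + (-1) * V x) (%x. 0 *R GV x + (-1) *R GV x)"
		by (rule sol_lin[OF s s f(1) f(1)])
	hence sm: "sol (%x. - f x) (%x. - V x) (%x. - GV x)" by simp
	define K where "K = 16 * dsize * n2 M f"
	have K0: "K >= 0" by (simp add: K_def)
	define V' where "V' x = max (- K) (min 0 (V x))" for x
	have [measurable]: "V : bm M" using solD(3)[OF s] sqi_m by blast
	have "AE x in M. V x = V' x"
		using sol_nonpos[OF s f(2,1)] stampacchia_upper[OF sm sqi_uminus[OF f(1)]]
		by eventually_elim (auto simp: V'_def K_def max_def min_def)
	hence "sol f V' GV" by (intro sol_cong[OF s]) (auto simp: V'_def[abs_def])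
	thus thesis using K0 by (intro that[of V' GV]) (auto simp: V'_def K_def)
qed

text \<open>Test with V u^2: the integral of u^2 |GV|^2 equals minus that of f V u^2 minus that of 2
  V u GV . g. Young's inequality absorbs half of the left side. Boundedness of V is thus traded for
  integrability of the drift.\<close>

lemma drift_bound:
	assumes s: "sol f V GV" and f: "sqi M f" and m: "!!x. x : Om ==> abs (V x) <= m"
		and u: "Hg u g" and c: "!!x. x : Om ==> abs (u x) <= c"
	shows "(n2 M (%x. u x *R GV x))^2 <= 2 * m * (LINT x|M. (u x)^2 * abs (f x)) + 4 * m^2 * (n2 M g)^2"
proof -
	obtain x0 where x0: "x0 : Om" using nonempty_dom by blast
	have m0: "m >= 0" using m[OF x0] by linarith
	note su = HgD(1,2)[OF u] and sV = solD(3,4)[OF s]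
	have [measurable]: "u : bm M" "V : bm M" "f : bm M"
		using su sV f sqi_m by blast+
	have "abs ((u x)^2) <= c^2" if "x : Om" for x using power_mono[OF c[OF that], of 2] by simp
	from Z_mult[OF solD(1)[OF s] m Hg_square[OF u c] this]
	have Z: "Z (%x. V x * (u x)^2) (%x. V x *R (2 * u x) *R g x + (u x)^2 *R GV x)" by simp
	have uG: "sqi M (%x. u x *R GV x)" using c by (intro sqi_mult_bounded[OF sV(2), of _ c]) auto
	have Vg: "sqi M (%x. (2 * V x) *R g x)" by (rule sqi_mult_bounded[OF su(2), of _ "2 * m"]) (use m in \<open>auto simp: abs_mult\<close>)
	have u2f: "integrable M (%x. (u x)^2 * abs (f x))"
		using integrable_norm_mult[OF sqi_mult_bounded[OF su(1), of u c] f] c by (simp add: power2_eq_square abs_mult[symmetric] mult.commute)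
	define X where "X = (n2 M (%x. u x *R GV x))^2"
	have "ip M GV (%x. V x *R (2 * u x) *R g x + (u x)^2 *R GV x)
		= (LINT x|M. (u x *R GV x) \<bullet> ((2 * V x) *R g x) + (u x *R GV x) \<bullet> (u x *R GV x))"
		unfolding ip_def by (intro bi_cong) (auto simp: inner_add_right power2_eq_square)
	also have "... = ip M (%x. u x *R GV x) (%x. (2 * V x) *R g x) + X"
		unfolding X_def n2_sq ip_def by (rule bi_add[OF integrable_ip[OF uG Vg] integrable_ip[OF uG uG]])
	finally have eq: "X = - ip M f (%x. V x * (u x)^2) - ip M (%x. u x *R GV x) (%x. (2 * V x) *R g x)"
		using solD(5)[OF s Z] by simp
	have 1: "- ip M f (%x. V x * (u x)^2) <= m * (LINT x|M. (u x)^2 * abs (f x))"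
	proof -
		have "- ip M f (%x. V x * (u x)^2) <= abs (ip M f (%x. V x * (u x)^2))" by linarith
		also have "... <= (LINT x|M. abs (f x * (V x * (u x)^2)))" unfolding ip_def by simp
		also have "... <= (LINT x|M. m * ((u x)^2 * abs (f x)))"
		proof (rule integral_mono)
			show i: "integrable M (%x. m * ((u x)^2 * abs (f x)))" using u2f by simp
			have b: "abs (f x * (V x * (u x)^2)) <= m * ((u x)^2 * abs (f x))" if "x : Om" for x
				using mult_right_mono[OF m[OF that], of "(u x)^2 * abs (f x)"] by (simp add: abs_mult mult_ac)
			show "integrable M (%x. abs (f x * (V x * (u x)^2)))"
				by (rule bi_i_bound[OF i]) (use b in \<open>auto intro!: AE_I2 intro: order_trans[OF _ abs_ge_self]\<close>)
			show "abs (f x * (V x * (u x)^2)) <= m * ((u x)^2 * abs (f x))" if "x : space M" for x using b that by simp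
		qed
		finally show ?thesis by simp
	qed
	have 2: "- ip M (%x. u x *R GV x) (%x. (2 * V x) *R g x) <= X / 2 + 2 * m^2 * (n2 M g)^2"
	proof -
		have "n2 M (%x. (2 * V x) *R g x) <= n2 M (%x. (2 * m) *R g x)"
			using m m0 by (intro n2_mono Vg sqi_scaleR su AE_I2) (auto intro!: mult_right_mono simp: abs_mult)
		also have "... = 2 * m * n2 M g" using m0 by simp
		finally have "n2 M (%x. u x *R GV x) * n2 M (%x. (2 * V x) *R g x) <= n2 M (%x. u x *R GV x) * (2 * m * n2 M g)"
			by (intro mult_left_mono) auto
		hence a: "- ip M (%x. u x *R GV x) (%x. (2 * V x) *R g x) <= n2 M (%x. u x *R GV x) * (2 * m * n2 M g)"
			using ip_Cauchy_Schwarz[OF uG Vg] by linarith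
		have "2 * n2 M (%x. u x *R GV x) * (2 * m * n2 M g) <= (n2 M (%x. u x *R GV x))^2 + (2 * m * n2 M g)^2"
			by (rule sum_squares_bound)
		hence "n2 M (%x. u x *R GV x) * (2 * m * n2 M g) <= X / 2 + 2 * m^2 * (n2 M g)^2"
			by (simp add: X_def power_mult_distrib)
		with a show ?thesis by linarith
	qed
	have "X <= 2 * (m * (LINT x|M. (u x)^2 * abs (f x))) + 2 * (2 * m^2 * (n2 M g)^2)" using eq 1 2 by argo
	thus ?thesis by (simp add: X_def mult_ac)
qed

text \<open>The outward normal derivative of a nonpositive potential is nonnegative. In weak form this is obtained
  by testing with \<open>(1 - exp (V / \<epsilon>)) u\<^sup>2\<close>, which vanishes on the boundary.\<close>
lemma drift_sign:
	assumes s: "sol f V GV" and f: "sqi M f" "AE x in M. 0 <= f x" and V: "!!x. V x <= 0" "!!x. - m <= V x"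
		and u: "Hg u g" and c: "!!x. x : Om ==> abs (u x) <= c"
	shows "- 2 * ip M (%x. u x *R GV x) g <= (LINT x|M. f x * (u x)^2)"
proof -
	have m0: "m >= 0" using V(1)[of 0] V(2)[of 0] by linarith
	note su = HgD(1,2)[OF u] and sV = solD(3,4)[OF s]
	have [measurable]: "u : bm M" "V : bm M" "f : bm M"
		using su sV f sqi_m by blast+
	\<comment> \<open>These factors lie in [0, 1], vanish where V does and tend to 1 where V < 0: they
	  approximate the constant 1 by functions with zero boundary values.\<close>
	define th where "th n x = 1 - exp (V x * real (Suc n))" for n x
	have th: "0 <= th n x" "th n x <= 1" for n x using V(1)[of x] by (auto simp: th_def mult_nonpos_nonneg)
	have [measurable]: "th n : bm M" for n unfolding th_def by measurable
	have uG: "sqi M (%x. u x *R GV x)" using c by (intro sqi_mult_bounded[OF sV(2), of _ c]) auto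
	have fu: "integrable M (%x. f x * (u x)^2)"
		using integrable_ip[OF f(1) sqi_mult_bounded[OF su(1), of u c]] c by (simp add: power2_eq_square)
	have est: "- 2 * ip M (%x. th n x *R u x *R GV x) g <= (LINT x|M. f x * (u x)^2)" for n
	proof -
		define e where "e = real (Suc n)"
		define G where "G y = 1 - exp (y * e)" for y
		define G' where "G' y = - (e * exp (y * e))" for y
		have ZG: "Z (%x. G (V x)) (%x. G' (V x) *R GV x)"
		proof (rule Z_chain[OF solD(1)[OF s], where m = m and C = "e * exp (m * e)"])
			show "abs (V x) <= m" for x using V(1)[of x] V(2)[of x] by linarith
			show "(G has_real_derivative G' y) (at y)" for y unfolding G_def G'_def by (auto intro!: derivative_eq_intros)
			show "continuous_on UNIV G'" unfolding G'_def by (intro continuous_intros)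
			show "abs (G' y) <= e * exp (m * e)" if "y : {-m..m}" for y using that by (auto simp: G'_def e_def)
		qed (simp add: G_def)
		have Gb: "abs (G (V x)) <= 1" for x using th[of n x] by (simp add: G_def th_def e_def)
		have ub: "abs ((u x)^2) <= c^2" if "x : Om" for x using power_mono[OF c[OF that], of 2] by simp
		have Z: "Z (%x. G (V x) * (u x)^2) (%x. G (V x) *R (2 * u x) *R g x + (u x)^2 *R G' (V x) *R GV x)"
			by (rule Z_mult[OF ZG Gb Hg_square[OF u c] ub])
		have tu: "sqi M (%x. th n x *R u x *R GV x)" using th[of n] by (intro sqi_mult_bounded[OF uG, of _ 1]) auto
		have G'b: "abs (G' (V x)) <= e" for x using V(1)[of x] by (simp add: G'_def e_def mult_nonpos_nonneg)
		have [measurable]: "(%x. G' (V x)) : bm M" unfolding G'_def by measurable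
		have gu: "sqi M (%x. G' (V x) *R u x *R GV x)" using G'b by (intro sqi_mult_bounded[OF uG, of _ e]) auto
		have "ip M GV (%x. G (V x) *R (2 * u x) *R g x + (u x)^2 *R G' (V x) *R GV x)
			= (LINT x|M. 2 * ((th n x *R u x *R GV x) \<bullet> g x) + (G' (V x) *R u x *R GV x) \<bullet> (u x *R GV x))"
			unfolding ip_def by (intro bi_cong) (auto simp: inner_add_right power2_eq_square th_def G_def e_def)
		also have "... = 2 * ip M (%x. th n x *R u x *R GV x) g + (LINT x|M. (G' (V x) *R u x *R GV x) \<bullet> (u x *R GV x))"
			unfolding ip_def using integrable_ip[OF tu su(2)] integrable_ip[OF gu uG] by (subst bi_add) auto
		finally have "- 2 * ip M (%x. th n x *R u x *R GV x) g = ip M f (%x. G (V x) * (u x)^2) + (LINT x|M. (G' (V x) *R u x *R GV x) \<bullet> (u x *R GV x))"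
			using solD(5)[OF s Z] by linarith
		\<comment> \<open>This term stands in for the boundary integral of u^2 times the normal derivative
		  of V. Only its sign is used.\<close>
		moreover have "(LINT x|M. (G' (V x) *R u x *R GV x) \<bullet> (u x *R GV x)) <= 0"
		proof -
			have "(G' (V x) *R u x *R GV x) \<bullet> (u x *R GV x) <= 0" for x
			proof -
				have "(G' (V x) *R u x *R GV x) \<bullet> (u x *R GV x) = G' (V x) * ((u x *R GV x) \<bullet> (u x *R GV x))" by simp
				thus ?thesis by (simp only:) (intro mult_nonpos_nonneg inner_ge_zero, simp add: G'_def e_def)
			qed
			hence "0 <= (LINT x|M. - ((G' (V x) *R u x *R GV x) \<bullet> (u x *R GV x)))" by (intro bi_nonneg) simp
			thus ?thesis by simp
		qed
		moreover have "ip M f (%x. G (V x) * (u x)^2) <= (LINT x|M. f x * (u x)^2)"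
			unfolding ip_def
		proof (rule integral_mono_AE[OF integrable_ip[OF f(1) HgD(1)[OF Z_H1[OF Z]]] fu])
			show "AE x in M. f x \<bullet> (G (V x) * (u x)^2) <= f x * (u x)^2"
				using f(2)
			proof eventually_elim
				case (elim x)
				have "G (V x) * (u x)^2 <= 1 * (u x)^2" using th(2)[of n x] by (intro mult_right_mono) (auto simp: G_def th_def e_def)
				thus ?case using elim by (simp add: mult_left_mono)
			qed
		qed
		ultimately show ?thesis by linarith
	qed
	have "(%n. \<integral>x. (th n x *R u x *R GV x) \<bullet> g x \<partial>M) ----> (LINT x|M. (u x *R GV x) \<bullet> g x)"
	proof (rule integral_dominated_convergence[of _ _ _ "%x. norm ((u x *R GV x) \<bullet> g x)"])
		show "integrable M (%x. norm ((u x *R GV x) \<bullet> g x))" using integrable_ip[OF uG su(2)] by (rule integrable_norm)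
		show "(%x. (u x *R GV x) \<bullet> g x) : bm M" using integrable_ip[OF uG su(2)] by simp
		show "(%x. (th n x *R u x *R GV x) \<bullet> g x) : bm M" for n
		proof -
			have "sqi M (%x. th n x *R u x *R GV x)" using th[of n] by (intro sqi_mult_bounded[OF uG, of _ 1]) auto
			from integrable_ip[OF this su(2)] show ?thesis by simp
		qed
		show "AE x in M. norm ((th n x *R u x *R GV x) \<bullet> g x) <= norm ((u x *R GV x) \<bullet> g x)" for n
		proof (intro AE_I2)
			fix x show "norm ((th n x *R u x *R GV x) \<bullet> g x) <= norm ((u x *R GV x) \<bullet> g x)"
				using mult_right_mono[OF th(2)[of n x], of "abs ((u x *R GV x) \<bullet> g x)"] th(1)[of n x] by (simp add: abs_mult)
		qed
		show "AE x in M. (%n. (th n x *R u x *R GV x) \<bullet> g x) ----> (u x *R GV x) \<bullet> g x"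
			\<comment> \<open>The factors \<open>th n\<close> do not tend to 1 on {V = 0}, but there GV
			  vanishes almost everywhere.\<close>
			using Hg_level[OF solD(2)[OF s]]
		proof eventually_elim
			case (elim x)
			show ?case
			proof (cases "V x = 0")
				case False
				hence "V x < 0" using V(1)[of x] by simp
				hence "exp (V x) < 1" by simp
				hence "(%n. (exp (V x))^Suc n) ----> 0" by (intro LIMSEQ_Suc LIMSEQ_realpow_zero) auto
				hence "(%n. exp (V x * real (Suc n))) ----> 0" by (simp add: exp_of_nat2_mult[symmetric] del: of_nat_Suc power_Suc)
				hence "(%n. th n x) ----> 1 - 0" unfolding th_def by (intro tendsto_diff tendsto_const)
				hence "(%n. (th n x *R u x *R GV x) \<bullet> g x) ----> ((1 - 0) *R u x *R GV x) \<bullet> g x" by (intro tendsto_intros)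
				thus ?thesis by simp
			qed (use elim in simp)
		qed
	qed
	hence "(%n. - 2 * ip M (%x. th n x *R u x *R GV x) g) ----> - 2 * ip M (%x. u x *R GV x) g"
		unfolding ip_def by (intro tendsto_mult_left)
	thus ?thesis by (rule LIMSEQ_le_const2) (use est in blast)
qed

end

section \<open>One implicit Euler step\<close>

lemma l2closed_preimage:
	fixes A :: "'a => 'b::euclidean_space => 'c::euclidean_space"
	assumes E: "l2closed M E" and lin: "!!x a b y z. A x (a *R y + b *R z) = a *R A x y + b *R A x z"
		and m: "!!h. h : bm M ==> (%x. A x (h x)) : bm M" and C: "!!x y. norm (A x y) <= C * norm y"
	shows "l2closed M {h. sqi M h & (%x. A x (h x)) : E}"
	unfolding l2closed_def
proof (intro conjI ballI allI impI)
	have d: "A x y - A x z = A x (y - z)" for x y z using lin[of x 1 y "-1" z] by simp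
	have A0: "A x 0 = 0" for x using d[of x 0 0] by simp
	show "(%x. 0) : {h. sqi M h & (%x. A x (h x)) : E}" using E by (simp add: A0 l2closed_def)
	show "(%x. a *R f x + b *R g x) : {h. sqi M h & (%x. A x (h x)) : E}"
		if "f : {h. sqi M h & (%x. A x (h x)) : E}" "g : {h. sqi M h & (%x. A x (h x)) : E}" for f g a b
		using that l2closed_lin[OF E, of "%x. A x (f x)" "%x. A x (g x)" a b] by (simp add: lin sqi_add sqi_scaleR)
	fix f g assume f: "ALL n::nat. f n : {h. sqi M h & (%x. A x (h x)) : E}" and g: "sqi M g"
		and l: "(%n. n2 M (%x. f n x - g x)) ----> 0"
	have s: "sqi M (%x. A x (h x))" if "sqi M h" for h
		by (rule sqi_bound[OF that m[OF sqi_m[OF that]]]) (rule AE_I2, rule C)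
	have fg: "sqi M (%x. f n x - g x)" for n using f g by auto
	have "n2 M (%x. A x (f n x) - A x (g x)) <= abs C * n2 M (%x. f n x - g x)" for n
	proof -
		have "n2 M (%x. A x (f n x - g x)) <= n2 M (%x. C *R (f n x - g x))"
		proof (rule n2_mono[OF s[OF fg] sqi_scaleR[OF fg]], rule AE_I2)
			show "norm (A x (f n x - g x)) <= norm (C *R (f n x - g x))" for x
				using C[of x "f n x - g x"] mult_right_mono[OF abs_ge_self[of C] norm_ge_zero[of "f n x - g x"]] by simp
		qed
		thus ?thesis by (simp add: d)
	qed
	note b = this
	have "(%n. abs C * n2 M (%x. f n x - g x)) ----> 0" using tendsto_mult_left[OF l, of "abs C"] by simp
	hence l': "(%n. n2 M (%x. A x (f n x) - A x (g x))) ----> 0"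
		by (rule tendsto0_le[OF _ n2_nonneg b])
	have fE: "(%x. A x (f n x)) : E" for n using f by blast
	have "(%x. A x (g x)) : E" by (rule l2closed_lim[OF E fE s[OF g] l'])
	thus "g : {h. sqi M h & (%x. A x (h x)) : E}" using g by simp
qed auto

context bdom
begin

text \<open>Multiplying z by w = exp (-V / 2) and its gradient by sqrt ta * w turns the weighted
  bilinear form into the plain L^2 product on pairs, so Riesz on the transformed subspace does the
  work of Lax-Milgram.\<close>

lemma weighted_exists:
	assumes f: "sqi M f" and V: "V : bm M" "!!x. V x <= 0" "!!x. - m <= V x" and ta: "ta > 0"
	obtains z gz where "Hg z gz" "!!ph gph. Hg ph gph ==>
		ip M (%x. exp (- V x) *R z x) ph + ta * ip M (%x. exp (- V x) *R gz x) gph = ip M f ph"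
proof -
	note [measurable] = V(1)
	define w where "w x = exp (- V x / 2)" for x
	have w1: "1 <= w x" "w x <= exp (m / 2)" "0 < w x" for x using V(2,3)[of x] by (auto simp: w_def)
	have [measurable]: "w : bm M" unfolding w_def by measurable
	have ww: "w x * w x = exp (- V x)" for x by (simp add: w_def exp_add[symmetric])
	define s where "s = sqrt ta"
	have s: "s > 0" "s * s = ta" using ta by (auto simp: s_def)
	\<comment> \<open>\<open>A\<close> undoes the rescaling; E consists of the rescaled pairs that come
	  from H^1.\<close>
	define A where "A x y = (fst y / w x, (1 / (s * w x)) *R snd y)" for x and y :: "real \<times> (real^2)"
	define E where "E = {h. sqi M h & (%x. A x (h x)) : {h. Hg (%x. fst (h x)) (%x. snd (h x))}}"
	define l where "l h = ip M f (%x. fst (h x) / w x)" for h :: "real^2 => real \<times> (real^2)"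
	have fA: "abs (fst y / w x) <= norm y" for x y
	proof -
		have "abs (fst y / w x) <= abs (fst y)" using w1[of x] by (simp add: divide_le_eq mult_le_cancel_left1)
		also have "... <= norm y" using norm_fst_le[of "fst y" "snd y"] by simp
		finally show ?thesis .
	qed
	have E: "l2closed M E"
		unfolding E_def
	proof (rule l2closed_preimage[OF l2closed_H1, where C = "1 + 1 / s"])
		show "A x (a *R y + b *R z) = a *R A x y + b *R A x z" for x a b y z
			by (simp add: A_def add_divide_distrib scaleR_add_right mult.commute)
		show "(%x. A x (h x)) : bm M" if [measurable]: "h : bm M" for h
		proof -
			have "h : M \<rightarrow>\<^sub>M borel \<Otimes>\<^sub>M borel" using that unfolding borel_prod .
			hence [measurable]: "(%x. fst (h x)) : bm M" "(%x. snd (h x)) : bm M" by measurable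
			show ?thesis unfolding A_def by measurable
		qed
		show "norm (A x y) <= (1 + 1 / s) * norm y" for x y
		proof -
			have "norm (A x y) <= abs (fst y / w x) + norm ((1 / (s * w x)) *R snd y)"
				unfolding A_def using norm_Pair_le[of "fst y / w x" "(1 / (s * w x)) *R snd y"] by simp
			moreover have "norm ((1 / (s * w x)) *R snd y) <= (1 / s) * norm y"
			proof -
				have "1 / (s * w x) <= 1 / s" using w1[of x] s by (simp add: frac_le)
				hence "1 / (s * w x) * norm (snd y) <= 1 / s * norm y"
					using norm_snd_le[of "snd y" "fst y"] w1[of x] s by (intro mult_mono) auto
				thus ?thesis using w1[of x] s by (simp add: abs_mult)
			qed
			ultimately show ?thesis using fA[of y x] by (simp add: distrib_right)
		qed
	qed
	have fw: "sqi M (%x. fst (h x) / w x)" if "h : E" for h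
		using that HgD(1) by (auto simp: E_def A_def)
	obtain p where p: "p : E" "!!h. h : E ==> ip M p h = l h"
	proof (rule riesz_representation[OF E, of l "n2 M f"])
		fix h k a b assume "h : E" "k : E"
		hence hk: "sqi M (%x. fst (h x) / w x)" "sqi M (%x. fst (k x) / w x)" by (auto intro: fw)
		have "l (%x. a *R h x + b *R k x) = ip M f (%x. a *R (fst (h x) / w x) + b *R (fst (k x) / w x))"
			unfolding l_def by (simp add: add_divide_distrib)
		thus "l (%x. a *R h x + b *R k x) = a * l h + b * l k"
			using f hk by (simp only: ip_add_right[OF sqi_scaleR[OF hk(1)] sqi_scaleR[OF hk(2)] f] ip_scale_right l_def)
	next
		fix h assume h: "h : E"
		have "abs (l h) <= n2 M f * n2 M (%x. fst (h x) / w x)" unfolding l_def by (rule ip_Cauchy_Schwarz[OF f fw[OF h]])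
		also have "... <= n2 M f * n2 M h"
		proof (intro mult_left_mono n2_mono fw h AE_I2)
			show "norm (fst (h x) / w x) <= norm (h x)" for x using fA[of "h x" x] by simp
		qed (use h in \<open>auto simp: E_def\<close>)
		finally show "abs (l h) <= n2 M f * n2 M h" .
	qed (rule that)
	define z where "z x = fst (p x) / w x" for x
	define gz where "gz x = (1 / (s * w x)) *R snd (p x)" for x
	have z: "Hg z gz" using p(1) by (simp add: E_def A_def z_def[abs_def] gz_def[abs_def])
	have pz: "p x = (w x * z x, (s * w x) *R gz x)" for x using w1(3)[of x] s(1) by (simp add: z_def gz_def prod_eq_iff)
	have ez: "sqi M (%x. exp (- V x) *R z x)" "sqi M (%x. exp (- V x) *R gz x)"
		using V by (auto intro!: sqi_mult_bounded[where C = "exp m"] HgD[OF z] simp del: real_scaleR_def) (metis neg_le_iff_le add.inverse_inverse)+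
	have "ip M (%x. exp (- V x) *R z x) ph + ta * ip M (%x. exp (- V x) *R gz x) gph = ip M f ph" if ph: "Hg ph gph" for ph gph
	proof -
		define h where "h x = (w x *R ph x, (s * w x) *R gph x)" for x
		have "sqi M (%x. w x *R ph x)" using w1 by (intro sqi_mult_bounded[where C = "exp (m / 2)"] HgD[OF ph]) (auto simp: abs_of_pos)
		moreover have "sqi M (%x. s *R w x *R gph x)" using w1
			by (intro sqi_scaleR sqi_mult_bounded[where C = "exp (m / 2)"] HgD[OF ph]) (auto simp: abs_of_pos)
		moreover have Ah: "A x (h x) = (ph x, gph x)" for x using w1(3)[of x] s(1) by (simp add: A_def h_def)
		ultimately have "h : E" using ph by (simp add: E_def Ah) (simp add: h_def[abs_def] sqi_Pair_iff)
		hence "ip M p h = l h" by (rule p(2))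
		also have "... = ip M f ph" unfolding l_def h_def using w1(3) by (intro arg_cong[where f = "ip M f"]) (auto simp: fun_eq_iff less_le)
		also have "ip M p h = (LINT x|M. (exp (- V x) *R z x) \<bullet> ph x + ta * ((exp (- V x) *R gz x) \<bullet> gph x))"
			unfolding ip_def by (intro bi_cong) (auto simp: pz h_def ww[symmetric] s(2)[symmetric] mult_ac)
		also have "... = ip M (%x. exp (- V x) *R z x) ph + ta * ip M (%x. exp (- V x) *R gz x) gph"
			unfolding ip_def using integrable_ip[OF ez(1) HgD(1)[OF ph]] integrable_ip[OF ez(2) HgD(2)[OF ph]]
			by (subst bi_add) auto
		finally show ?thesis .
	qed
	thus thesis using z by (rule that[rotated])
qed

text \<open>Since V <= 0 the weight is at least 1, so on {z > c} the weighted zero-order term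
  exceeds f by at least z - c. Testing with the positive part of z - c then forces it to
  vanish.\<close>

lemma weighted_max_principle:
	assumes z: "Hg z gz" and V: "V : bm M" "!!x. V x <= 0" "!!x. - m <= V x" and ta: "ta > 0"
		and eq: "!!ph gph. Hg ph gph ==> ip M (%x. exp (- V x) *R z x) ph + ta * ip M (%x. exp (- V x) *R gz x) gph = ip M f ph"
		and f: "sqi M f" "!!x. f x <= c" and c: "c >= 0"
	shows "AE x in M. z x <= c"
proof -
	define ph where "ph x = max (z x - c) 0" for x
	define g where "g x = (if z x > c then gz x else 0)" for x
	have ph: "Hg ph g" unfolding ph_def g_def by (rule Hg_pos_above[OF z])
	note s = HgD(1,2)[OF z] and sph = HgD(1,2)[OF ph]
	have eb: "abs (exp (- V x)) <= exp m" for x using V(3)[of x] by simp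
	have ez: "sqi M (%x. exp (- V x) *R z x)" "sqi M (%x. exp (- V x) *R gz x)"
		using V(1) eb by (auto intro!: sqi_mult_bounded[where C = "exp m"] s simp del: real_scaleR_def)
	have "0 <= ip M (%x. exp (- V x) *R gz x) g"
		unfolding ip_def by (intro bi_nonneg) (simp add: g_def)
	hence "ip M (%x. exp (- V x) *R z x) ph <= ip M f ph" using eq[OF ph] ta by (smt (verit) mult_nonneg_nonneg)
	moreover have "ip M ph ph <= ip M (%x. exp (- V x) *R z x) ph - ip M f ph"
		unfolding ip_diff_left[OF ez(1) f(1) sph(1), symmetric]
		unfolding ip_def
	proof (rule integral_mono)
		show "integrable M (%x. ph x \<bullet> ph x)" by (rule integrable_ip[OF sph(1) sph(1)])
		show "integrable M (%x. (exp (- V x) *R z x - f x) \<bullet> ph x)" by (rule integrable_ip[OF sqi_diff[OF ez(1) f(1)] sph(1)])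
		fix x
		show "ph x \<bullet> ph x <= (exp (- V x) *R z x - f x) \<bullet> ph x"
		proof (cases "z x > c")
			case True
			have "1 * z x <= exp (- V x) * z x" using V(2)[of x] True c by (intro mult_right_mono) auto
			hence "ph x <= exp (- V x) * z x - f x" using True f(2)[of x] by (simp add: ph_def)
			thus ?thesis using True by (simp add: mult_right_mono ph_def)
		qed (simp add: ph_def)
	qed
	ultimately have "(n2 M ph)^2 <= 0" unfolding n2_sq by linarith
	hence "n2 M ph = 0" by simp
	from n2_eq_0[OF sph(1) this] show ?thesis by eventually_elim (auto simp: ph_def max_def split: if_splits)
qed

text \<open>The substitution \<open>u = exp (- V) z\<close> makes the implicit Euler step symmetric.\<close>
lemma euler_step:
	assumes f: "sqi M f" "!!x. 0 <= f x" "!!x. f x <= c" and V: "sol h V GV" "!!x. V x <= 0" "!!x. - m <= V x" and ta: "ta > 0"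
	obtains u g where "Hg u g" "!!x. 0 <= u x" "!!x. u x <= exp m * c"
		"!!ph gph. Hg ph gph ==> ip M u ph + ta * ip M (%x. g x + u x *R GV x) gph = ip M f ph"
proof -
	have Vm [measurable]: "V : bm M" using solD(3)[OF V(1)] sqi_m by blast
	obtain z0 gz where z0: "Hg z0 gz" and eq: "!!ph gph. Hg ph gph ==>
		ip M (%x. exp (- V x) *R z0 x) ph + ta * ip M (%x. exp (- V x) *R gz x) gph = ip M f ph"
		using weighted_exists[OF f(1) Vm V(2,3) ta] by blast
	have [measurable]: "z0 : bm M" "gz : bm M" using HgD(1,2)[OF z0] sqi_m by blast+
	have c: "c >= 0" using f(2,3)[of 0] by linarith
	have up: "AE x in M. z0 x <= c" by (rule weighted_max_principle[OF z0 Vm V(2,3) ta eq f(1,3) c])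
	have zm: "Hg (%x. - z0 x) (%x. - gz x)" using Hg_cmult[OF z0, of "-1"] by simp
	have "AE x in M. - z0 x <= 0"
	proof (rule weighted_max_principle[OF zm Vm V(2,3) ta _ sqi_uminus[OF f(1)]])
		have n: "ip M (%x. - p x) q = - ip M p q" for p q :: "real^2 => 'z::euclidean_space" by (simp add: ip_def)
		show "ip M (%x. exp (- V x) *R - z0 x) ph + ta * ip M (%x. exp (- V x) *R - gz x) gph = ip M (%x. - f x) ph"
			if "Hg ph gph" for ph gph
			using eq[OF that] by (simp add: n scaleR_minus_right)
	qed (use f(2) in auto)
	\<comment> \<open>Clipping changes z0 on a null set only and gives pointwise bounds, which the
	  product rule for u requires.\<close>
	define z where "z x = max 0 (min c (z0 x))" for x
	have zz: "AE x in M. z0 x = z x" using up \<open>AE x in M. - z0 x <= 0\<close> by eventually_elim (auto simp: z_def max_def min_def)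
	have zb: "0 <= z x" "z x <= c" for x using c by (auto simp: z_def)
	have [measurable]: "z : bm M" unfolding z_def by measurable
	have zH: "Hg z gz" by (rule Hg_cong[OF z0]) (use zz in auto)
	have eH: "Hg (%x. exp (- V x)) (%x. (- exp (- V x)) *R GV x)"
	proof (rule Hg_chain[OF solD(2)[OF V(1)], where I = "{-m..0}" and a = "-m" and b = 0 and C = "exp m" and G = "%y. exp (- y)" and G' = "%y. - exp (- y)"])
		show "continuous_on UNIV (%y::real. - exp (- y))" by (intro continuous_intros)
	qed (use V in \<open>auto intro!: derivative_eq_intros\<close>)
	define u where "u x = exp (- V x) * z x" for x
	\<comment> \<open>With this gradient g + u GV = exp (-V) gz: the drift cancels the derivative of
	  the exponential factor.\<close>
	define g where "g x = exp (- V x) *R gz x + z x *R (- exp (- V x)) *R GV x" for x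
	have eb: "exp (- V x) <= exp m" for x using V(3)[of x] by simp
	have "Hg u g"
		unfolding u_def[abs_def] g_def[abs_def] by (rule Hg_mult[OF eH _ zH]) (use eb zb in auto)
	moreover have "u x <= exp m * c" "0 <= u x" for x unfolding u_def using zb[of x] eb by (auto intro!: mult_mono)
	moreover have "ip M u ph + ta * ip M (%x. g x + u x *R GV x) gph = ip M f ph" if ph: "Hg ph gph" for ph gph
	proof -
		have "ip M u ph = ip M (%x. exp (- V x) *R z0 x) ph"
			using zz HgD(1)[OF ph, THEN sqi_m] by (intro ip_cong_AE) (auto simp: u_def[abs_def] elim: eventually_mono)
		moreover have "(%x. g x + u x *R GV x) = (%x. exp (- V x) *R gz x)" by (simp add: g_def u_def fun_eq_iff)
		ultimately show ?thesis using eq[OF ph] by simp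
	qed
	ultimately show thesis by (intro that)
qed

end

section \<open>The discrete scheme and its uniform bounds\<close>

lemma discrete_gronwall:
	fixes S D :: "nat => real"
	assumes ta: "0 < ta" "ta <= 1" and n: "!!n. 0 <= S n" "!!n. 0 <= D n"
		and st: "!!n. S (Suc n) + 2 * ta * D (Suc n) <= S n + ta / 2 * (S (Suc n) + D (Suc n) + S n + D n)"
	defines "Y0 \<equiv> S 0 + ta / 2 * D 0"
	shows "S n <= exp (2 * ta * n) * Y0" "ta * (\<Sum>j<n. D (Suc j)) <= exp (2 * ta * n) * Y0 * (1 + ta * n)"
proof -
	\<comment> \<open>The right side of the recursion contains D at both time levels; adding ta / 2
	  times D moves the old value into the quantity that is propagated.\<close>
	define Y where "Y n = S n + ta / 2 * D n" for n
	have Yn: "0 <= Y n" for n using n ta by (simp add: Y_def)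
	have sY: "S n <= Y n" for n using n ta by (simp add: Y_def)
	have Ys: "Y (Suc n) + ta * D (Suc n) <= Y n + ta / 2 * (Y n + Y (Suc n))" for n
	proof -
		have "Y (Suc n) + ta * D (Suc n) <= Y n + ta / 2 * (S n + S (Suc n))" using st[of n] by (simp add: Y_def algebra_simps)
		also have "... <= Y n + ta / 2 * (Y n + Y (Suc n))" using ta sY by (intro add_left_mono mult_left_mono add_mono) auto
		finally show ?thesis .
	qed
	have grow: "Y (Suc n) <= exp (2 * ta) * Y n" for n
	proof -
		have "0 <= ta * D (Suc n)" using n ta by simp
		hence "(1 - ta / 2) * Y (Suc n) <= (1 + ta / 2) * Y n" using Ys[of n] by (simp add: algebra_simps)
		also have "... <= ((1 - ta / 2) * (1 + 2 * ta)) * Y n"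
		proof (intro mult_right_mono Yn)
			\<comment> \<open>For ta <= 1 the growth factor (1 + ta / 2) / (1 - ta / 2) is at most 1 + 2 ta,
			  hence at most exp (2 ta).\<close>
			have "ta * ta <= ta * 1" using ta by (intro mult_left_mono) auto
			thus "1 + ta / 2 <= (1 - ta / 2) * (1 + 2 * ta)" by (simp add: algebra_simps)
		qed
		finally have "(1 - ta / 2) * Y (Suc n) <= (1 - ta / 2) * ((1 + 2 * ta) * Y n)" by (simp add: mult.assoc)
		hence "Y (Suc n) <= (1 + 2 * ta) * Y n" using ta by (subst (asm) mult_le_cancel_left_pos) auto
		also have "... <= exp (2 * ta) * Y n" by (intro mult_right_mono Yn exp_ge_add_one_self)
		finally show ?thesis .
	qed
	have Yb: "Y n <= exp (2 * ta * n) * Y0" for n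
	proof (induction n)
		case (Suc n)
		have "Y (Suc n) <= exp (2 * ta) * (exp (2 * ta * n) * Y0)"
			by (rule order_trans[OF grow mult_left_mono[OF Suc]]) simp
		also have "... = exp (2 * ta * Suc n) * Y0" by (simp add: exp_add[symmetric] algebra_simps)
		finally show ?case .
	qed (simp add: Y_def Y0_def)
	have Y00: "0 <= Y0" using Yn[of 0] by (simp add: Y_def Y0_def)
	show "S n <= exp (2 * ta * n) * Y0" using sY[of n] Yb[of n] by linarith
	define K where "K = exp (2 * ta * n) * Y0"
	have YK: "Y j <= K" if "j <= n" for j
	proof -
		have "exp (2 * ta * j) * Y0 <= K" unfolding K_def using that ta Y00 by (intro mult_right_mono) auto
		thus ?thesis using Yb[of j] by linarith
	qed
	have "Y i + ta * (\<Sum>j<i. D (Suc j)) <= K + ta * i * K" if "i <= n" for i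
		using that
	proof (induction i)
		case 0
		thus ?case using YK[of 0] by simp
	next
		case (Suc i)
		have "ta / 2 * (Y i + Y (Suc i)) <= ta / 2 * (K + K)" using YK[of i] YK[of "Suc i"] Suc.prems ta by (intro mult_left_mono add_mono) auto
		with Ys[of i] Suc show ?case by (simp add: algebra_simps)
	qed
	from this[of n] Yn[of n] have "ta * (\<Sum>j<n. D (Suc j)) <= K + ta * n * K" by simp
	thus "ta * (\<Sum>j<n. D (Suc j)) <= exp (2 * ta * n) * Y0 * (1 + ta * n)" by (simp add: K_def algebra_simps)
qed

context bdom
begin

text \<open>The potential \<open>V n\<close> belongs to \<open>u n\<close> but drives the step to
  \<open>u (Suc n)\<close>, which keeps each step linear. The sup bound on \<open>u n\<close> is
  qualitative and may grow with n; the uniform estimates are those in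
  \<open>rothe_bd\<close>.\<close>

definition rothe :: "real => (nat => real^2 => real) => (nat => real^2 => real^2) => (nat => real^2 => real) => (nat => real^2 => real^2) => bool" where
	"rothe ta u g V GV \<longleftrightarrow> (ALL n. Hg (u n) (g n) & (EX c. ALL x. 0 <= u n x & u n x <= c) & sol (u n) (V n) (GV n) &
		 (ALL x. V n x <= 0 & - (16 * dsize * n2 M (u n)) <= V n x) &
		 (ALL ph gph. Hg ph gph -->
			 ip M (u (Suc n)) ph + ta * ip M (%x. g (Suc n) x + u (Suc n) x *R GV n x) gph = ip M (u n) ph))"

text \<open>The last condition ties the step to the gradient of the regularised initial datum, which
  has no uniform bound when the true datum is only in L^2.\<close>

definition rothe_data :: "real => real => real => nat => real => (real^2 => real) => (real^2 => real^2) => bool" where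
	"rothe_data et R T N ta a ga \<longleftrightarrow> (LINT x|M. a x) <= et & n2 M a <= R & 0 < ta & ta <= 1 & ta * real N <= T & ta * (n2 M ga)^2 <= 1"

definition rothe_bd :: "real => nat => real => (nat => real^2 => real) => (nat => real^2 => real^2) => (nat => real^2 => real) => (nat => real^2 => real^2) => bool" where
	"rothe_bd B N ta u g V GV \<longleftrightarrow> (ALL n<=N. n2 M (u n) <= B & (ALL x. abs (V n x) <= B)) & ta * (\<Sum>j<N. (n2 M (g j))^2) <= B & ta * (\<Sum>j<N. (n2 M (g (Suc j)))^2) <= B
		& ta * (\<Sum>j<N. (n2 M (%x. g (Suc j) x + u (Suc j) x *R GV j x))^2) <= B"

lemma rotheD:
	assumes "rothe ta u g V GV"
	shows "Hg (u n) (g n)" "sqi M (u n)" "sqi M (g n)" "0 <= u n x" "EX c. ALL x. abs (u n x) <= c" "sol (u n) (V n) (GV n)" "V n x <= 0" "- (16 * dsize * n2 M (u n)) <= V n x"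
		"Hg ph gph ==> ip M (u (Suc n)) ph + ta * ip M (%x. g (Suc n) x + u (Suc n) x *R GV n x) gph = ip M (u n) ph"
		"sqi M (%x. u (Suc n) x *R GV n x)"
proof -
	note r = assms[unfolded rothe_def, rule_format, of n]
	show 1: "Hg (u n) (g n)" "sol (u n) (V n) (GV n)" "0 <= u n x" "V n x <= 0" "- (16 * dsize * n2 M (u n)) <= V n x"
		"Hg ph gph ==> ip M (u (Suc n)) ph + ta * ip M (%x. g (Suc n) x + u (Suc n) x *R GV n x) gph = ip M (u n) ph"
		using r by auto
	show "sqi M (u n)" "sqi M (g n)" using HgD(1,2)[OF 1(1)] .
	have b: "EX c. ALL x. abs (u n x) <= c" for n using assms[unfolded rothe_def, rule_format, of n] by (metis abs_of_nonneg)
	thus "EX c. ALL x. abs (u n x) <= c" .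
	obtain c where c: "!!x. abs (u (Suc n) x) <= c" using b[of "Suc n"] by blast
	have "Hg (u (Suc n)) (g (Suc n))" using assms by (simp add: rothe_def)
	thus "sqi M (%x. u (Suc n) x *R GV n x)"
		using c by (intro sqi_mult_bounded[OF solD(4)[OF 1(2)], where C = c]) (auto dest: HgD(1) sqi_m)
qed

lemma rothe_exists:
	assumes a: "Hg a ga" "!!x. 0 <= a x" "!!x. a x <= c" and ta: "ta > 0"
	obtains u g V GV where "rothe ta u g V GV" "u 0 = a" "g 0 = ga"
proof -
	define P where "P n s = (case s of (u, g, V, GV) => Hg u g & (EX c. ALL x. 0 <= u x & u x <= c) & sol u V GV &
		 (ALL x. V x <= 0 & - (16 * dsize * n2 M u) <= V x) & (n = 0 --> u = a & g = ga))" for n :: nat and s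
	define Q where "Q n s s' = (case s of (u, g, V, GV) => case s' of (u', g', V', GV') =>
		 ALL ph gph. Hg ph gph --> ip M u' ph + ta * ip M (%x. g' x + u' x *R GV x) gph = ip M u ph)" for n :: nat and s s' :: "(real^2 => real) \<times> (real^2 => real^2) \<times> (real^2 => real) \<times> (real^2 => real^2)"
	have pot: "EX V GV. sol u V GV & (ALL x. V x <= 0 & - (16 * dsize * n2 M u) <= V x)" if "Hg u g" "!!x. 0 <= u x" for u g
		using potential_exists[OF HgD(1)[OF that(1)]] that(2) by (metis AE_I2)
	have "EX f. ALL n. P n (f n) & Q n (f n) (f (Suc n))"
	proof (rule dependent_nat_choice)
		obtain V GV where "sol a V GV" "ALL x. V x <= 0 & - (16 * dsize * n2 M a) <= V x" using pot[OF a(1,2)] by blast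
		hence "P 0 (a, ga, V, GV)" using a by (auto simp: P_def)
		thus "EX x. P 0 x" by blast
	next
		fix s n assume s: "P n s"
		obtain u g V GV where se: "s = (u, g, V, GV)" by (cases s)
		note s = s[unfolded se P_def prod.case]
		then obtain c where c: "!!x. 0 <= u x" "!!x. u x <= c" by blast
		have uH: "Hg u g" and so: "sol u V GV" and V: "!!x. V x <= 0" "!!x. - (16 * dsize * n2 M u) <= V x" using s by auto
		obtain u' g' where u': "Hg u' g'" "!!x. 0 <= u' x" "!!x. u' x <= exp (16 * dsize * n2 M u) * c"
			"!!ph gph. Hg ph gph ==> ip M u' ph + ta * ip M (%x. g' x + u' x *R GV x) gph = ip M u ph"
			using euler_step[OF HgD(1)[OF uH] c so V ta] by blast
		obtain V' GV' where V': "sol u' V' GV'" "ALL x. V' x <= 0 & - (16 * dsize * n2 M u') <= V' x" using pot[OF u'(1,2)] by blast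
		have "P (Suc n) (u', g', V', GV')" "Q n s (u', g', V', GV')" using u' V' by (auto simp: P_def Q_def se)
		thus "EX y. P (Suc n) y & Q n s y" by blast
	qed
	then obtain f where f: "!!n. P n (f n)" "!!n. Q n (f n) (f (Suc n))" by blast
	show thesis
	proof (rule that)
		show "rothe ta (%n. fst (f n)) (%n. fst (snd (f n))) (%n. fst (snd (snd (f n)))) (%n. snd (snd (snd (f n))))"
			using f unfolding rothe_def P_def Q_def by (simp add: case_prod_unfold)
		show "fst (f 0) = a" "fst (snd (f 0)) = ga" using f(1)[of 0] by (auto simp: P_def case_prod_unfold)
	qed
qed

lemma rothe_mass: assumes "rothe ta u g V GV" shows "(LINT x|M. u n x) = (LINT x|M. u 0 x)"
proof (induction n)
	case (Suc n)
	have "(LINT x|M. u (Suc n) x) = (LINT x|M. u n x)" using rotheD(9)[OF assms Hg_const[of 1]] by (simp add: ip_def)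
	thus ?case using Suc by simp
qed simp

text \<open>Testing with u (Suc n), \<open>drift_sign\<close> replaces the drift by the integral of
  u n * (u (Suc n))^2; the time levels are mixed because the potential is frozen. It is at most the
  sum of the two cubic integrals, each absorbed by the small conserved mass.\<close>

lemma rothe_energy:
	assumes r: "rothe ta u g V GV" and ta: "ta > 0"
		and C: "ALL u g. Hg u g --> (ALL x:Om. 0 <= u x) --> (LINT x|M. (u x)^3) <= C * (LINT x|M. u x) * ((n2 M u)^2 + (n2 M g)^2)"
		and m: "C * (LINT x|M. u 0 x) <= 1 / 2"
	defines "S \<equiv> %n. (n2 M (u n))^2" and "D \<equiv> %n. (n2 M (g n))^2"
	shows "(LINT x|M. u n x * (u (Suc n) x)^2) <= 1 / 2 * (S (Suc n) + D (Suc n) + S n + D n)"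
		"S (Suc n) + 2 * ta * D (Suc n) <= S n + ta / 2 * (S (Suc n) + D (Suc n) + S n + D n)"
proof -
	note s = rotheD(2,3)[OF r]
	have [measurable]: "u n : bm M" for n using s(1) sqi_m by blast
	have b: "EX c. ALL n':{n, Suc n}. ALL x. abs (u n' x) <= c" using rotheD(5)[OF r, of n] rotheD(5)[OF r, of "Suc n"]
		by (metis insert_iff empty_iff order_trans linear)
	then obtain c where c: "!!x. abs (u n x) <= c" "!!x. abs (u (Suc n) x) <= c" by auto
	have c0: "c >= 0" using c(1)[of 0] by linarith
	have c': "u n x <= c" "u (Suc n) x <= c" for x using c[of x] by auto
	have i3: "integrable M (%x. (u n' x)^3)" if "n' : {n, Suc n}" for n'
		using c that by (intro bounded_integrable_M[where C = "c^3"]) (auto simp: power_abs intro!: power_mono)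
	have cube: "(LINT x|M. (u n x)^3) <= 1 / 2 * (S n + D n)" for n
	proof -
		have "(LINT x|M. (u n x)^3) <= (C * (LINT x|M. u 0 x)) * (S n + D n)"
			using C[rule_format, OF rotheD(1)[OF r, of n] rotheD(4)[OF r]] rothe_mass[OF r, of n] by (simp add: S_def D_def)
		also have "... <= 1 / 2 * (S n + D n)" using m by (intro mult_right_mono) (auto simp: S_def D_def)
		finally show ?thesis .
	qed
	have "(LINT x|M. u n x * (u (Suc n) x)^2) <= (LINT x|M. (u (Suc n) x)^3 + (u n x)^3)"
	proof (rule integral_mono)
		show "integrable M (%x. u n x * (u (Suc n) x)^2)"
			using c' c0 rotheD(4)[OF r] by (intro bounded_integrable_M[where C = "c * c^2"]) (auto simp: abs_mult abs_of_nonneg intro!: mult_mono power_mono)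
		show "integrable M (%x. (u (Suc n) x)^3 + (u n x)^3)" by (intro bi_i_add i3) auto
		show "u n x * (u (Suc n) x)^2 <= (u (Suc n) x)^3 + (u n x)^3" for x
		proof -
			\<comment> \<open>The mixed cubic term is dominated by the cube of the larger factor.\<close>
			define a b where "a = u n x" and "b = u (Suc n) x"
			have ab: "0 <= a" "0 <= b" using rotheD(4)[OF r] by (auto simp: a_def b_def)
			have "a * b^2 <= b^3 + a^3"
			proof (cases "a <= b")
				case True
				hence "a * b^2 <= b * b^2" by (intro mult_right_mono) auto
				thus ?thesis using ab by (simp add: power3_eq_cube power2_eq_square mult.assoc add_increasing2)
			next
				case False
				hence "a * b^2 <= a * a^2" using ab by (intro mult_left_mono power_mono) auto
				thus ?thesis using ab by (simp add: power3_eq_cube power2_eq_square mult.assoc add_increasing)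
			qed
			thus ?thesis by (simp add: a_def b_def)
		qed
	qed
	also have "... = (LINT x|M. (u (Suc n) x)^3) + (LINT x|M. (u n x)^3)" by (intro bi_add i3) auto
	finally show 1: "(LINT x|M. u n x * (u (Suc n) x)^2) <= 1 / 2 * (S (Suc n) + D (Suc n) + S n + D n)"
		using cube[of n] cube[of "Suc n"] by argo
	have uG: "sqi M (%x. u (Suc n) x *R GV n x)" by (rule rotheD(10)[OF r])
	have e: "S (Suc n) + ta * (D (Suc n) + ip M (%x. u (Suc n) x *R GV n x) (g (Suc n))) = ip M (u n) (u (Suc n))"
		using rotheD(9)[OF r rotheD(1)[OF r, of "Suc n"], of n] s uG by (simp add: S_def D_def n2_sq ip_add_left)
	have "- 2 * ip M (%x. u (Suc n) x *R GV n x) (g (Suc n)) <= (LINT x|M. u n x * (u (Suc n) x)^2)"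
		using rotheD(4)[OF r] c(2) by (intro drift_sign[OF rotheD(6)[OF r] s(1) _ rotheD(7)[OF r] rotheD(8)[OF r] rotheD(1)[OF r]]) auto
	with 1 have "- 2 * ip M (%x. u (Suc n) x *R GV n x) (g (Suc n)) <= 1 / 2 * (S (Suc n) + D (Suc n) + S n + D n)" by linarith
	from mult_left_mono[OF this, of ta] ta
	have dr: "- 2 * (ta * ip M (%x. u (Suc n) x *R GV n x) (g (Suc n))) <= ta / 2 * (S (Suc n) + D (Suc n) + S n + D n)" by (simp add: algebra_simps)
	have "2 * ip M (u n) (u (Suc n)) <= S n + S (Suc n)"
		using ip_Cauchy_Schwarz[OF s(1)[of n] s(1)[of "Suc n"]] sum_squares_bound[of "n2 M (u n)" "n2 M (u (Suc n))"] by (simp add: S_def)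
	with e dr show "S (Suc n) + 2 * ta * D (Suc n) <= S n + ta / 2 * (S (Suc n) + D (Suc n) + S n + D n)"
		by (simp add: distrib_left)
qed

end

context sbdom
begin

text \<open>The smallness threshold uses only the cubic inequality and is fixed before T and the
  size R of the datum; these enter B through the Gronwall factor.\<close>

lemma rothe_bounds:
	obtains et where "et > 0"
		"!!T R. EX B>=0. ALL N ta u g V GV. rothe ta u g V GV --> rothe_data et R T N ta (u 0) (g 0) --> rothe_bd B N ta u g V GV"
proof -
	obtain C where C: "C > 0" "ALL u g. Hg u g --> (ALL x:Om. 0 <= u x) --> (LINT x|M. (u x)^3) <= C * (LINT x|M. u x) * ((n2 M u)^2 + (n2 M g)^2)"
		by (rule L3_bound) blast
	show thesis
	proof (rule that[of "1 / (2 * C)"])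
		show "1 / (2 * C) > 0" using C by simp
		fix T R :: real
		\<comment> \<open>K bounds the squared L^2 norms by Gronwall, m the potentials by Stampacchia, KD
		  the accumulated squared gradients at either end of the cells, and KF the accumulated squared
		  flux.\<close>
		define K where "K = exp (2 * abs T) * (R^2 + 1)"
		define m where "m = 16 * dsize * sqrt K"
		define KD where "KD = K * (1 + abs T) + 1"
		define KF where "KF = (2 + 8 * m^2) * KD + 2 * m * (2 * KD + 2 * abs T * K)"
		have K0: "K >= 0" by (simp add: K_def)
		have m0: "m >= 0" using K0 by (simp add: m_def)
		have KD0: "KD >= 0" using K0 by (simp add: KD_def)
		have KF0: "KF >= 0" using K0 m0 KD0 by (simp add: KF_def)
		define B where "B = sqrt K + m + KD + KF"
		have B: "sqrt K <= B" "m <= B" "KD <= B" "KF <= B" "B >= 0" using K0 m0 KD0 KF0 by (auto simp: B_def)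
		have "rothe_bd B N ta u g V GV" if r: "rothe ta u g V GV" and d: "rothe_data (1 / (2 * C)) R T N ta (u 0) (g 0)" for N ta u g V GV
		proof -
			have mass: "(LINT x|M. u 0 x) <= 1 / (2 * C)" and R: "n2 M (u 0) <= R" and ta: "0 < ta" "ta <= 1"
				and N: "ta * real N <= T" and g0: "ta * (n2 M (g 0))^2 <= 1" using d by (auto simp: rothe_data_def)
			note s = rotheD(2,3)[OF r]
			define S where "S n = (n2 M (u n))^2" for n
			define D where "D n = (n2 M (g n))^2" for n
			have nn: "0 <= S n" "0 <= D n" for n by (auto simp: S_def D_def)
			have "C * (LINT x|M. u 0 x) <= 1 / 2" using mass C(1) by (simp add: field_simps)
			note en = rothe_energy[OF r ta(1) C(2) this, folded S_def D_def]
			have gr: "S n <= exp (2 * ta * n) * (S 0 + ta / 2 * D 0)" "ta * (\<Sum>j<n. D (Suc j)) <= exp (2 * ta * n) * (S 0 + ta / 2 * D 0) * (1 + ta * n)" for n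
				using nn en(2) by (intro discrete_gronwall[OF ta]; blast)+
			define Y0 where "Y0 = S 0 + ta / 2 * D 0"
			have "S 0 <= R^2" using R unfolding S_def by (intro power_mono) auto
			hence Y0: "Y0 <= R^2 + 1" "0 <= Y0" using g0 nn[of 0] ta by (auto simp: Y0_def D_def)
			have T: "0 <= T" using N ta by (meson mult_nonneg_nonneg of_nat_0_le_iff order_trans less_imp_le)
			have ex: "exp (2 * ta * n) * Y0 <= K" if "n <= N" for n
			proof -
				have "ta * n <= ta * N" using that ta by simp
				hence "exp (2 * ta * n) <= exp (2 * abs T)" using N T by simp
				thus ?thesis unfolding K_def using Y0 by (intro mult_mono) auto
			qed
			have SK: "S n <= K" if "n <= N" for n using gr(1)[of n] ex[OF that] by (simp add: Y0_def)
			have uK: "n2 M (u n) <= sqrt K" if "n <= N" for n using SK[OF that] real_le_rsqrt by (simp add: S_def)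
			have Vm: "abs (V n x) <= m" if "n <= N" for n x
			proof -
				have "16 * dsize * n2 M (u n) <= m" unfolding m_def using uK[OF that] by (intro mult_left_mono) auto
				thus ?thesis using rotheD(7)[OF r, of n x] rotheD(8)[OF r, of n x] by linarith
			qed
			have D1: "ta * (\<Sum>j<N. D (Suc j)) <= K * (1 + abs T)"
			proof -
				have "ta * (\<Sum>j<N. D (Suc j)) <= exp (2 * ta * N) * Y0 * (1 + ta * N)" using gr(2)[of N] by (simp add: Y0_def)
				also have "... <= K * (1 + abs T)" using ex[of N] N T ta K0 by (intro mult_mono) auto
				finally show ?thesis .
			qed
			have D0: "ta * (\<Sum>j<N. D j) <= KD"
			proof -
				have "(\<Sum>j<N. D j) <= (\<Sum>j<Suc N. D j)" using nn by simp
				also have "... = D 0 + (\<Sum>j<N. D (Suc j))" by (rule sum.lessThan_Suc_shift)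
				finally have "ta * (\<Sum>j<N. D j) <= ta * (D 0 + (\<Sum>j<N. D (Suc j)))" using ta by (intro mult_left_mono) auto
				thus ?thesis using D1 g0 by (simp add: KD_def D_def distrib_left)
			qed
			\<comment> \<open>Drift and gradient are estimated separately. The cubic integral from
			  \<open>drift_bound\<close> is again the mixed one already controlled in the energy
			  estimate.\<close>
			have F: "(n2 M (%x. g (Suc j) x + u (Suc j) x *R GV j x))^2 <= (2 + 8 * m^2) * D (Suc j) + 2 * m * (D (Suc j) + D j + 2 * K)" if "j < N" for j
			proof -
				define X where "X = (n2 M (%x. u (Suc j) x *R GV j x))^2"
				obtain c where c: "!!x. abs (u (Suc j) x) <= c" using rotheD(5)[OF r, of "Suc j"] by blast
				have "X <= 2 * m * (LINT x|M. (u (Suc j) x)^2 * abs (u j x)) + 4 * m^2 * D (Suc j)"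
					unfolding X_def D_def using Vm[of j] that c by (intro drift_bound[OF rotheD(6)[OF r] s(1) _ rotheD(1)[OF r]]) auto
				also have "(LINT x|M. (u (Suc j) x)^2 * abs (u j x)) = (LINT x|M. u j x * (u (Suc j) x)^2)"
					using rotheD(4)[OF r] by (simp add: mult.commute)
				also have "2 * m * (LINT x|M. u j x * (u (Suc j) x)^2) <= 2 * m * (1 / 2 * (D (Suc j) + D j + 2 * K))"
					using en(1)[of j] SK[of j] SK[of "Suc j"] that m0 by (intro mult_left_mono) auto
				finally have X: "X <= m * (D (Suc j) + D j + 2 * K) + 4 * m^2 * D (Suc j)" by simp
				have "n2 M (%x. g (Suc j) x + u (Suc j) x *R GV j x) <= n2 M (g (Suc j)) + n2 M (%x. u (Suc j) x *R GV j x)"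
					by (rule n2_triangle[OF s(2) rotheD(10)[OF r]])
				hence "(n2 M (%x. g (Suc j) x + u (Suc j) x *R GV j x))^2 <= (n2 M (g (Suc j)) + n2 M (%x. u (Suc j) x *R GV j x))^2"
					by (intro power_mono) auto
				also have "... <= 2 * D (Suc j) + 2 * X"
					using sum_squares_bound[of "n2 M (g (Suc j))" "n2 M (%x. u (Suc j) x *R GV j x)"] by (simp add: power2_sum D_def X_def)
				finally show ?thesis using X by (simp add: algebra_simps)
			qed
			have "ta * (\<Sum>j<N. (n2 M (%x. g (Suc j) x + u (Suc j) x *R GV j x))^2)
				<= ta * (\<Sum>j<N. (2 + 8 * m^2) * D (Suc j) + 2 * m * (D (Suc j) + D j + 2 * K))"
				using F ta by (intro mult_left_mono sum_mono) auto
			also have "... = (2 + 8 * m^2) * (ta * (\<Sum>j<N. D (Suc j))) + 2 * m * (ta * (\<Sum>j<N. D (Suc j)) + ta * (\<Sum>j<N. D j) + 2 * (ta * N) * K)"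
				by (simp add: sum.distrib sum_distrib_left algebra_simps)
			also have "... <= (2 + 8 * m^2) * KD + 2 * m * (KD + KD + 2 * abs T * K)"
				using D1 D0 N K0 m0 by (intro add_mono mult_left_mono mult_right_mono) (auto simp: KD_def)
			also have "... = KF" by (simp add: KF_def)
			finally have Fb: "ta * (\<Sum>j<N. (n2 M (%x. g (Suc j) x + u (Suc j) x *R GV j x))^2) <= KF" .
			have "n2 M (u n) <= B & (ALL x. abs (V n x) <= B)" if "n <= N" for n using uK[OF that] Vm[OF that] B by (meson order_trans)
			moreover have "ta * (\<Sum>j<N. D j) <= B" "ta * (\<Sum>j<N. D (Suc j)) <= B" using D0 D1 B by (auto simp: KD_def)
			ultimately show ?thesis using Fb B unfolding D_def rothe_bd_def by (intro conjI allI impI) auto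
		qed
		thus "EX B>=0. ALL N ta u g V GV. rothe ta u g V GV --> rothe_data (1 / (2 * C)) R T N ta (u 0) (g 0) --> rothe_bd B N ta u g V GV"
			using B(5) by (intro exI[of _ B]) blast
	qed
qed

lemma smooth_cs_H1_conv:
	assumes f: "integrable M f" shows "Hg (mo n f) (grad (mo n f))"
proof -
	note sm = mo_smooth[OF f, of n]
	obtain C where C: "!!x. abs (mo n f x) <= C" using conv_bounded[OF f kern_n(1)] unfolding mo_def by blast
	have pdc: "pd i (mo n f) = conv (pd i (kern (1 / Suc n))) f" for i unfolding mo_def by (rule pd_conv[OF f kern_n(1)])
	have "sqi M (%x. grad (mo n f) x $ i)" for i
	proof -
		have "smooth_cs (pd i (kern (1 / Suc n)))" by (rule smooth_cs_pd[OF kern_n(1)])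
		from conv_bounded[OF f this] obtain D where "!!x. abs (pd i (mo n f) x) <= D" unfolding pdc by blast
		thus ?thesis using smooth_pd[OF sm, of i] by (intro bounded_sqi[of _ D]) (auto simp: grad_def)
	qed
	hence "sqi M (grad (mo n f))" by (simp add: sqi_vec_iff)
	moreover have "weak_grad Om (mo n f) (grad (mo n f))"
		by (intro weak_gradI) (use sm in \<open>auto simp: grad_def intro!: ibp_C1 smooth_differentiable smooth_continuous_on smooth_pd\<close>)
	ultimately show ?thesis using mo_sqi[OF f, of n] by (simp add: Hg_iff)
qed

end

section \<open>Functions of time and space, and the energy inequality for curves\<close>

locale stdom = sbdom + fixes T :: real assumes T_pos: "0 < T"
begin

abbreviation L :: "real measure" where "L \<equiv> lebesgue_on {0<..<T}"
abbreviation ind :: "real => real => real => real" where "ind a b \<equiv> indicator {a..<b}"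
abbreviation ST :: "(real \<times> (real^2)) measure" where "ST \<equiv> L \<Otimes>\<^sub>M M"

lemma measure_L: "emeasure L (space L) = ennreal T"
	using T_pos by (simp add: emeasure_restrict_space)

sublocale lf: finite_measure L
	by (rule finite_measureI) (use measure_L in simp)

sublocale st: pair_sigma_finite L M
	by unfold_locales

lemma slice_measurable [measurable]:
	assumes "f : bm ST" "t : {0<..<T}" shows "(%x. f (t, x)) : bm M"
	using measurable_compose_Pair1[of t L f M borel] assms by simp

lemma slice_measurable' [measurable]:
	assumes [measurable]: "(f :: _ => 'b::euclidean_space) : bm ST"
	shows "(%t. n2 M (%x. f (t, x))) : bm L"
	unfolding n2_def ip_def by measurable

lemma ST_ip:
	assumes f: "sqi ST f" and g: "sqi ST g"
	shows "AE t in L. sqi M (%x. f (t, x))" "integrable L (%t. ip M (%x. f (t, x)) (%x. g (t, x)))"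
		"ip ST f g = (LINT t|L. ip M (%x. f (t, x)) (%x. g (t, x)))"
proof -
	have "AE t in L. integrable M (%x. (norm (f (t, x)))^2)" using st.AE_integrable_fst'[OF sqi_integrable[OF f]] .
	moreover have "AE t in L. t : {0<..<T}" using AE_space[of L] by simp
	ultimately show "AE t in L. sqi M (%x. f (t, x))"
		by eventually_elim (simp add: sqi_def slice_measurable[OF sqi_m[OF f]])
	show "integrable L (%t. ip M (%x. f (t, x)) (%x. g (t, x)))"
		using st.integrable_fst'[OF integrable_ip[OF f g]] by (simp add: ip_def)
	show "ip ST f g = (LINT t|L. ip M (%x. f (t, x)) (%x. g (t, x)))"
		using st.integral_fst'[OF integrable_ip[OF f g]] by (simp add: ip_def)
qed

lemma ST_n2:
	assumes f: "sqi ST f" shows "sqi L (%t. n2 M (%x. f (t, x)))" "n2 L (%t. n2 M (%x. f (t, x))) = n2 ST f"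
proof -
	show "sqi L (%t. n2 M (%x. f (t, x)))"
		using ST_ip(2)[OF f f] slice_measurable'[OF sqi_m[OF f]] by (simp add: sqi_def n2_sq)
	have "ip L (%t. n2 M (%x. f (t, x))) (%t. n2 M (%x. f (t, x))) = ip ST f f"
		unfolding ST_ip(3)[OF f f] by (simp add: ip_def[of L] n2_sq power2_eq_square[symmetric])
	thus "n2 L (%t. n2 M (%x. f (t, x))) = n2 ST f" by (simp add: n2_def)
qed

lemma sqi_ST_I:
	assumes [measurable]: "(f :: _ => 'b::euclidean_space) : bm ST" and b: "sqi L b"
		and s: "AE t in L. sqi M (%x. f (t, x)) & n2 M (%x. f (t, x)) <= (b t :: real)"
	shows "sqi ST f" "n2 ST f <= n2 L b"
proof -
	have s': "AE t in L. norm (n2 M (%x. f (t, x))) <= 1 * norm (b t)" using s by eventually_elim auto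
	have sn: "sqi L (%t. n2 M (%x. f (t, x)))"
		by (rule sqi_bound[OF b _ s']) measurable
	have "integrable ST (%z. (norm (f z))^2)"
	proof (rule st.Fubini_integrable)
		show "AE t in L. integrable M (%x. (norm (f (t, x)))^2)" using s by eventually_elim (auto dest: sqi_integrable)
		show "integrable L (%t. \<integral>x. norm ((norm (f (t, x)))^2) \<partial>M)"
			using sqi_integrable[OF sn] by (simp add: n2_sq ip_self)
	qed measurable
	thus f: "sqi ST f" by (simp add: sqi_def)
	show "n2 ST f <= n2 L b"
		unfolding ST_n2(2)[OF f, symmetric] using s' by (intro n2_mono sn b) simp
qed

lemma n2_L_const: "sqi L (%t. c :: real)" "n2 L (%t. c) = abs c * sqrt T"
proof -
	show "sqi L (%t. c)" by (simp add: sqi_def lf.emeasure_finite)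
	have "measure L {0<..<T} = T" using measure_L T_pos by (simp add: measure_def)
	hence "ip L (%t. c) (%t. c) = c^2 * T" by (simp add: ip_def power2_eq_square)
	thus "n2 L (%t. c) = abs c * sqrt T" by (simp add: n2_def real_sqrt_mult)
qed

lemma ST_slices_tendsto:
	assumes f: "!!n. sqi ST (f n)" and g: "sqi ST g" and l: "(%n. n2 ST (%z. f n z - g z)) ----> 0"
	obtains r :: "nat => nat" where "strict_mono r" "AE t in L. (%n. n2 M (%x. f (r n) (t, x) - g (t, x))) ----> 0"
proof -
	have s: "sqi ST (%z. f n z - g z)" for n using f g by auto
	have "(%n. n2 L (%t. n2 M (%x. f n (t, x) - g (t, x)) - 0)) ----> 0" using l ST_n2(2)[OF s] by simp
	from n2_tendsto_AE_subseq[OF _ sqi_zero this] ST_n2(1)[OF s] show thesis using that by auto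
qed

text \<open>The tensor product of a scalar profile in time and a function in space. With an
  indicator as profile it expresses time integrals over subintervals.\<close>

definition tn :: "(real => real) => (real^2 => 'b) => real \<times> (real^2) => 'b::euclidean_space" where
	"tn a ph = (%z. a (fst z) *R ph (snd z))"

lemma tn_sqi:
	assumes a: "sqi L a" and ph: "sqi M ph" shows "sqi ST (tn a ph)" "n2 ST (tn a ph) <= n2 L a * n2 M ph"
proof -
	have [measurable]: "a : bm L" "ph : bm M" using a ph sqi_m by auto
	have m: "tn a ph : bm ST" unfolding tn_def by measurable
	have b: "sqi L (%t. n2 M ph * abs (a t))" using sqi_norm[OF a] by (auto intro!: sqi_cmult)
	have s: "AE t in L. sqi M (%x. tn a ph (t, x)) & n2 M (%x. tn a ph (t, x)) <= n2 M ph * abs (a t)"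
		using ph by (auto simp: tn_def intro!: sqi_scaleR)
	show "sqi ST (tn a ph)" by (rule sqi_ST_I(1)[OF m b s])
	have "n2 L (%t. abs (a t)) = n2 L a" using n2_norm[of L a] by simp
	hence "n2 L (%t. n2 M ph * abs (a t)) = n2 L a * n2 M ph" by (subst n2_cmult) simp
	thus "n2 ST (tn a ph) <= n2 L a * n2 M ph" using sqi_ST_I(2)[OF m b s] by (simp only:)
qed

lemma ip_tn:
	assumes f: "sqi ST f" and a: "sqi L a" and ph: "sqi M ph"
	shows "ip ST f (tn a ph) = (LINT t|L. a t * ip M (%x. f (t, x)) ph)" "integrable L (%t. a t * ip M (%x. f (t, x)) ph)"
	using ST_ip(2,3)[OF f tn_sqi(1)[OF a ph]] by (simp_all add: tn_def)

lemma indicator_L: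
	shows "sqi L (ind a b)" "0 <= a ==> a <= b ==> b <= T ==> (LINT t|L. ind a b t) = b - a"
		"0 <= a ==> a <= b ==> b <= T ==> n2 L (ind a b) = sqrt (b - a)"
proof -

	have m: "ind a b : bm L" by (intro measurable_restrict_space1 measurable_completion) auto
	show "sqi L (ind a b)"
		by (rule sqi_bound[OF n2_L_const(1)[of 1] m, where C = 1]) (auto simp: indicator_def)
	show i: "(LINT t|L. ind a b t) = b - a" if "0 <= a" "a <= b" "b <= T"
	proof -
		have "(LINT t|L. ind a b t) = measure lebesgue ({a..<b} \<inter> {0<..<T})"
			by (simp add: integral_restrict_space measure_restrict_space)
		\<comment> \<open>The time measure lives on the open interval, so the left end point is lost
		  exactly when a = 0.\<close>
		also have "{a..<b} \<inter> {0<..<T} = (if a = 0 then {a<..<b} else {a..<b})" using that by auto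
		also have "measure lebesgue ... = b - a" using that by simp
		finally show ?thesis .
	qed
	show "n2 L (ind a b) = sqrt (b - a)" if "0 <= a" "a <= b" "b <= T"
	proof -
		have "ip L (ind a b) (ind a b) = (LINT t|L. ind a b t)"
			unfolding ip_def by (intro bi_cong) (auto simp: indicator_def)
		thus ?thesis using i[OF that] by (simp add: n2_def)
	qed
qed

lemma tn_bound:
	assumes f: "sqi ST f" and ph: "sqi M ph" and ab: "0 <= a" "a <= b" "b <= T"
	shows "abs (ip ST f (tn (ind a b) ph)) <= n2 ST f * (sqrt (b - a) * n2 M ph)"
proof -
	have "abs (ip ST f (tn (ind a b) ph)) <= n2 ST f * n2 ST (tn (ind a b) ph)"
		by (rule ip_Cauchy_Schwarz[OF f tn_sqi(1)[OF indicator_L(1) ph]])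
	also have "... <= n2 ST f * (sqrt (b - a) * n2 M ph)"
		using tn_sqi(2)[OF indicator_L(1) ph, of a b] indicator_L(3)[OF ab] by (intro mult_left_mono) auto
	finally show ?thesis .
qed

lemma tn_split:
	assumes f: "sqi ST f" and ph: "sqi M ph" and ab: "0 <= a" "a <= b"
	shows "ip ST f (tn (ind 0 b) ph) = ip ST f (tn (ind 0 a) ph) + ip ST f (tn (ind a b) ph)"
proof -
	note s = tn_sqi(1)[OF indicator_L(1) ph]
	have "tn (ind 0 b) ph = (%z. tn (ind 0 a) ph z + tn (ind a b) ph z)"
		using ab by (auto simp: tn_def fun_eq_iff indicator_def)
	thus ?thesis using ip_add_right[OF s s f] by simp
qed

text \<open>Limit of telescoping sums over uniform partitions.\<close>
lemma energy_ineq: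
	fixes v :: "real => real^2 => real" and G :: "real \<times> (real^2) => real^2"
	assumes H: "!!t. 0 <= t ==> t <= T ==> Hg (v t) (%x. G (t, x))" and G: "sqi ST G" and F: "sqi ST F"
		and eq: "!!t ph gph. 0 <= t ==> t <= T ==> Hg ph gph ==> ip M (v t) ph = ip M (v 0) ph - ip ST F (tn (ind 0 t) gph)"
		and lip: "!!s t. 0 <= s ==> s <= t ==> t <= T ==> n2 M (%x. G (t, x) - G (s, x)) <= K * (t - s)"
		and t: "0 <= t" "t <= T"
	shows "(n2 M (v t))^2 <= (n2 M (v 0))^2 + 2 * n2 ST F * n2 ST G"
proof -
	have est: "(n2 M (v t))^2 <= (n2 M (v 0))^2 + n2 ST F * (2 * n2 ST G) + (n2 ST F * (2 * abs K * t * sqrt T)) * (1 / Suc n)" for n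
	proof -
		define p where "p i = t * i / Suc n" for i :: nat
		have p: "0 <= p i" "p i <= p (Suc i)" "p 0 = 0" "p (Suc n) = t" "p (Suc i) - p i = t / Suc n" for i
			using t by (simp_all add: p_def divide_right_mono mult_left_mono diff_divide_distrib[symmetric] right_diff_distrib[symmetric] del: of_nat_Suc)
				(simp add: field_simps)?
		have pT: "p i <= T" if "i <= Suc n" for i
		proof -
			have "t * i <= t * Suc n" using that t by (intro mult_left_mono) auto
			hence "p i <= t" by (simp add: p_def divide_le_eq del: of_nat_Suc)
			thus ?thesis using t by simp
		qed
		\<comment> \<open>Testing the increment over a cell with the sum of the two end values produces a
		  difference of squares, which telescopes. As the mesh shrinks this sum approximates 2 G.\<close>
		define gam where "gam i x = G (p i, x) + G (p (Suc i), x)" for i x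
		have Hi: "Hg (v (p i)) (%x. G (p i, x))" if "i <= Suc n" for i using H p(1) pT[OF that] by blast
		define R where "R z = (\<Sum>i<Suc n. tn (ind (p i) (p (Suc i))) (gam i) z)" for z
		have gam: "sqi M (gam i)" if "i < Suc n" for i
			unfolding gam_def using HgD(2)[OF Hi[of i]] HgD(2)[OF Hi[of "Suc i"]] that by (intro sqi_add) auto
		have sR: "sqi ST (tn (ind (p i) (p (Suc i))) (gam i))" if "i < Suc n" for i by (rule tn_sqi(1)[OF indicator_L(1) gam[OF that]])
		have R: "sqi ST R" unfolding R_def using sR by (intro sqi_sum) auto
		have step: "(n2 M (v (p (Suc i))))^2 - (n2 M (v (p i)))^2 = - ip ST F (tn (ind (p i) (p (Suc i))) (gam i))" if i: "i < Suc n" for i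
		proof -
			note a = Hi[of i] and b = Hi[of "Suc i"]
			have ab: "Hg (%x. v (p i) x + v (p (Suc i)) x) (gam i)" unfolding gam_def using a b i by (intro Hg_add) auto
			have sa: "sqi M (v (p i))" "sqi M (v (p (Suc i)))" using HgD(1)[OF a] HgD(1)[OF b] i by auto
			have "ip M (v (p (Suc i))) (%x. v (p i) x + v (p (Suc i)) x) - ip M (v (p i)) (%x. v (p i) x + v (p (Suc i)) x)
				= - ip ST F (tn (ind (p i) (p (Suc i))) (gam i))"
				using eq[OF p(1)[of i] pT ab] eq[OF p(1)[of "Suc i"] pT ab] tn_split[OF F gam[OF i] p(1,2)[of i]] i by simp
			thus ?thesis using ip_add_right[OF sa(1,2,1)] ip_add_right[OF sa(1,2,2)] ip_commute[of M "v (p i)" "v (p (Suc i))"] by (simp add: n2_sq)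
		qed
		have "(n2 M (v t))^2 - (n2 M (v 0))^2 = (\<Sum>i<Suc n. (n2 M (v (p (Suc i))))^2 - (n2 M (v (p i)))^2)"
			using sum_lessThan_telescope[of "%i. (n2 M (v (p i)))^2" "Suc n"] p(3,4) by simp
		also have "... = (\<Sum>i<Suc n. - ip ST F (tn (ind (p i) (p (Suc i))) (gam i)))" using step by (intro sum.cong) auto
		also have "... = - ip ST F R"
			unfolding R_def ip_commute[of ST F] using sR F by (subst ip_sum_left) (auto simp: sum_negf)
		finally have e: "(n2 M (v t))^2 - (n2 M (v 0))^2 = - ip ST F R" .
		\<comment> \<open>Bounds the slice error of replacing the sampled gradients by 2 G on [0, t); the
		  absolute value covers K of either sign.\<close>
		define c where "c = 2 * abs K * (t / Suc n)"
		have c0: "c >= 0" using t by (simp add: c_def)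
		define Gt where "Gt z = ind 0 t (fst z) *R G z" for z
		have [measurable]: "G : bm ST" "R : bm ST" "ind 0 t : bm L"
			using G R indicator_L(1)[of 0 t] sqi_m by auto
		have Gt: "sqi ST Gt" "n2 ST Gt <= n2 ST G"
		proof -
			have m: "Gt : bm ST" unfolding Gt_def by measurable
			have b: "AE z in ST. norm (Gt z) <= 1 * norm (G z)" by (auto simp: Gt_def indicator_def)
			show g: "sqi ST Gt" by (rule sqi_bound[OF G m b])
			show "n2 ST Gt <= n2 ST G" using b by (intro n2_mono g G) simp
		qed
		have RG: "n2 ST (%z. R z - 2 *R Gt z) <= c * sqrt T"
		proof -
			have sl: "sqi M (%x. R (r, x) - 2 *R Gt (r, x)) & n2 M (%x. R (r, x) - 2 *R Gt (r, x)) <= c" if r: "r : {0<..<T}" for r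
			proof (cases "r < t")
				case True
				define k where "k = nat \<lfloor>r * Suc n / t\<rfloor>"
				have tp: "t > 0" using True r by simp
				have k1: "real k <= r * Suc n / t" "r * Suc n / t < real k + 1" unfolding k_def using r tp by (auto simp: of_nat_nat)
				have k: "p k <= r" "r < p (Suc k)" using k1 tp by (auto simp: p_def field_simps)
				have "r * Suc n / t < Suc n" using True tp by (simp add: divide_less_eq mult.commute)
				hence kn: "k < Suc n" using k1 by linarith
				have ind: "ind (p i) (p (Suc i)) r = (if i = k then 1 else 0 :: real)" for i
				proof (cases i k rule: linorder_cases)
					case less
					hence "p (Suc i) <= p k" using t by (simp add: p_def divide_right_mono mult_left_mono)
					thus ?thesis using k less by simp
				next
					case greater
					hence "p (Suc k) <= p i" using t by (simp add: p_def divide_right_mono mult_left_mono)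
					thus ?thesis using k greater by simp
				qed (use k in simp)
				have Rr: "R (r, x) = gam k x" for x using kn by (simp add: R_def tn_def ind if_distrib[of "%a. a *R _"] cong: if_cong del: sum.lessThan_Suc)
				have eqR: "(%x. R (r, x) - 2 *R Gt (r, x)) = (%x. (G (p k, x) - G (r, x)) + (G (p (Suc k), x) - G (r, x)))"
					using True r by (auto simp: Rr gam_def Gt_def scaleR_2)
				have sG: "sqi M (%x. G (p k, x))" "sqi M (%x. G (p (Suc k), x))" "sqi M (%x. G (r, x))"
					using HgD(2)[OF Hi[of k]] HgD(2)[OF Hi[of "Suc k"]] HgD(2)[OF H[of r]] kn r by auto
				have "n2 M (%x. (G (p k, x) - G (r, x)) + (G (p (Suc k), x) - G (r, x))) <= n2 M (%x. G (p k, x) - G (r, x)) + n2 M (%x. G (p (Suc k), x) - G (r, x))"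
					using sG by (intro n2_triangle sqi_diff)
				also have "... <= K * (r - p k) + K * (p (Suc k) - r)"
					using lip[of "p k" r] lip[of r "p (Suc k)"] p(1) pT[of "Suc k"] kn k r n2_minus_commute[of M "%x. G (p k, x)"] by (intro add_mono) auto
				also have "... = K * (t / Suc n)" using p(5)[of k] by (simp add: algebra_simps)
				also have "... <= c" unfolding c_def using tp by (intro mult_right_mono) auto
				finally show ?thesis unfolding eqR using sG by (intro conjI sqi_add sqi_diff)
			next
				case False
				have "ind (p i) (p (Suc i)) r = (0 :: real)" if "i < Suc n" for i
				proof -
					have "p (Suc i) <= p (Suc n)" unfolding p_def using that t by (intro divide_right_mono mult_left_mono) auto
					thus ?thesis using False p(4) by (auto simp: indicator_def)
				qed
				hence "R (r, x) = 0" "Gt (r, x) = 0" for x using False by (auto simp: R_def tn_def Gt_def simp del: sum.lessThan_Suc)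
				thus ?thesis using c0 by simp
			qed
			have m: "(%z. R z - 2 *R Gt z) : bm ST" unfolding Gt_def by measurable
			have "AE r in L. sqi M (%x. R (r, x) - 2 *R Gt (r, x)) & n2 M (%x. R (r, x) - 2 *R Gt (r, x)) <= c"
				using sl by (intro AE_I2) simp
			from sqi_ST_I(2)[OF m n2_L_const(1) this] show ?thesis using c0 by (simp add: n2_L_const)
		qed
		have "n2 ST R <= n2 ST (%z. R z - 2 *R Gt z) + n2 ST (%z. 2 *R Gt z)"
			using n2_triangle[OF sqi_diff[OF R sqi_scaleR[OF Gt(1), of 2]] sqi_scaleR[OF Gt(1), of 2]] by simp
		also have "... <= c * sqrt T + 2 * n2 ST G" using RG Gt(2) by simp
		finally have "n2 ST F * n2 ST R <= n2 ST F * (c * sqrt T + 2 * n2 ST G)" by (intro mult_left_mono) auto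
		thus ?thesis using e ip_Cauchy_Schwarz[OF F R] by (simp add: c_def algebra_simps)
	qed
	have "(%n. (n2 M (v 0))^2 + n2 ST F * (2 * n2 ST G) + (n2 ST F * (2 * abs K * t * sqrt T)) * (1 / Suc n)) ---->
		(n2 M (v 0))^2 + n2 ST F * (2 * n2 ST G) + (n2 ST F * (2 * abs K * t * sqrt T)) * 0"
		by (intro tendsto_intros LIMSEQ_Suc[OF lim_1_over_n, unfolded o_def])
	hence "(n2 M (v t))^2 <= (n2 M (v 0))^2 + n2 ST F * (2 * n2 ST G) + (n2 ST F * (2 * abs K * t * sqrt T)) * 0"
		by (rule LIMSEQ_le_const) (use est in blast)
	thus ?thesis by simp
qed

end

context stdom
begin

text \<open>\<open>appr B e u0 W GW F ub gb V GV\<close>: an approximate solution with error \<open>e\<close>, consisting of a curve \<open>W\<close> that is Lipschitz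
  in \<open>H\<^sup>1\<close> and solves the equation with flux \<open>F\<close>, and of a weakly close function \<open>ub\<close> such that \<open>F = gb + ub GV\<close>.\<close>
definition appr :: "real => real => (real^2 => real) => (real \<times> (real^2) => real) => (real \<times> (real^2) => real^2) => (real \<times> (real^2) => real^2) =>
		(real \<times> (real^2) => real) => (real \<times> (real^2) => real^2) => (real \<times> (real^2) => real) => (real \<times> (real^2) => real^2) => bool" where
	"appr B e u0 W GW F ub gb V GV \<longleftrightarrow>
		(sqi ST GW & n2 ST GW <= B) & (sqi ST F & n2 ST F <= B) & (sqi ST ub & n2 ST ub <= B) & (sqi ST gb & n2 ST gb <= B) &
		(sqi ST V & n2 ST V <= B) & (sqi ST GV & n2 ST GV <= B) &
		(ALL t:{0..T}. Hg (%x. W (t, x)) (%x. GW (t, x)) & n2 M (%x. W (t, x)) <= B &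
			(ALL ph gph. Hg ph gph --> ip M (%x. W (t, x)) ph = ip M (%x. W (0, x)) ph - ip ST F (tn (ind 0 t) gph))) &
		(EX K. ALL s t. 0 <= s --> s <= t --> t <= T --> n2 M (%x. W (t, x) - W (s, x)) <= K * (t - s) & n2 M (%x. GW (t, x) - GW (s, x)) <= K * (t - s)) &
		n2 M (%x. W (0, x) - u0 x) <= e &
		(ALL t:{0<..<T}. Hg (%x. ub (t, x)) (%x. gb (t, x)) & n2 M (%x. ub (t, x)) <= B & sqi M (%x. ub (t, x) *R GV (t, x)) &
			(ALL x. F (t, x) = gb (t, x) + ub (t, x) *R GV (t, x) & abs (V (t, x)) <= B) &
			(ALL ph gph. Hg ph gph --> abs (ip M (%x. ub (t, x)) ph - ip M (%x. W (t, x)) ph) <= e * n2 M gph) &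
			(EX f. sqi M f & n2 M f <= B & sol f (%x. V (t, x)) (%x. GV (t, x)) &
				(ALL ph gph. Hg ph gph --> abs (ip M f ph - ip M (%x. W (t, x)) ph) <= e * n2 M gph)))"

end

section \<open>Interpolation of the discrete scheme in time\<close>

locale grid = stdom + fixes ta :: real and N :: nat assumes ta_pos: "0 < ta" and taN: "ta * real N = T"
begin

definition cell :: "nat => real => real" where "cell j = ind (j * ta) (Suc j * ta)"
text \<open>\<open>ta * ramp j t\<close> is the length of the part of cell j before time t. Hence
  \<open>pl\<close> is piecewise linear interpolation in telescoped form, and the primitive of a
  step function in time is a combination of ramps.\<close>

definition ramp :: "nat => real => real" where "ramp j t = max 0 (min 1 (t / ta - j))"
definition pc :: "(nat => real^2 => 'b::euclidean_space) => real \<times> (real^2) => 'b" where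
	"pc h z = (\<Sum>j<N. tn (cell j) (h j) z)"
definition pl :: "(nat => real^2 => 'b::euclidean_space) => real \<times> (real^2) => 'b" where
	"pl h z = h 0 (snd z) + (\<Sum>j<N. tn (ramp j) (%x. h (Suc j) x - h j x) z)"

lemma node_le: "j < N ==> Suc j * ta <= T"
	using mult_right_mono[of "real (Suc j)" "real N" ta] ta_pos taN by (simp add: mult.commute del: of_nat_Suc)

lemma cell_exists:
	assumes t: "0 <= t" "t < T" obtains j where "j < N" "j * ta <= t" "t < Suc j * ta"
proof -
	define j where "j = nat \<lfloor>t / ta\<rfloor>"
	have j: "real j <= t / ta" "t / ta < real j + 1" unfolding j_def using t ta_pos by (auto simp: of_nat_nat)
	have "t / ta < N" using t ta_pos taN by (simp add: divide_less_eq mult.commute)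
	hence "j < N" using j by linarith
	moreover have "j * ta <= t" "t < Suc j * ta" using j ta_pos by (auto simp: field_simps)
	ultimately show thesis by (rule that)
qed

lemma cell_eq:
	assumes "j * ta <= t" "t < Suc j * ta" shows "cell i t = (if i = j then 1 else 0)"
proof (cases i j rule: linorder_cases)
	case less
	hence "real (Suc i) * ta <= j * ta" using ta_pos by (intro mult_right_mono) auto
	thus ?thesis using assms less by (simp add: cell_def)
next
	case greater
	hence "real (Suc j) * ta <= i * ta" using ta_pos by (intro mult_right_mono) auto
	thus ?thesis using assms greater by (simp add: cell_def)
qed (use assms in \<open>simp add: cell_def\<close>)

lemma cell_sqi: "sqi L (cell j)" unfolding cell_def by (rule indicator_L(1))

lemma pc_slice: "j < N ==> j * ta <= t ==> t < Suc j * ta ==> pc h (t, x) = h j x"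
	by (simp add: pc_def tn_def cell_eq if_distrib[of "%a. a *R _"] cong: if_cong)

lemma ramp_eq:
	assumes "j * ta <= t" "t <= Suc j * ta" shows "ramp i t = (if i < j then 1 else if i = j then t / ta - j else 0)"
proof -
	have t: "j <= t / ta" "t / ta <= j + 1" using assms ta_pos by (auto simp: field_simps)
	show ?thesis
	proof (cases i j rule: linorder_cases)
		case less
		hence "real i + 1 <= j" by linarith
		thus ?thesis using t less by (simp add: ramp_def)
	next
		case greater
		hence "real j + 1 <= i" by linarith
		thus ?thesis using t greater by (simp add: ramp_def)
	qed (use t in \<open>simp add: ramp_def\<close>)
qed

lemma pl_slice:
	fixes h :: "nat => real^2 => 'b::euclidean_space"
	assumes j: "j < N" "j * ta <= t" "t <= Suc j * ta"
	shows "pl h (t, x) = (1 - (t / ta - j)) *R h j x + (t / ta - j) *R h (Suc j) x"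
proof -
	have "(\<Sum>i<N. ramp i t *R (h (Suc i) x - h i x)) = (\<Sum>i<Suc j. ramp i t *R (h (Suc i) x - h i x))"
		using j by (intro sum.mono_neutral_right) (auto simp: ramp_eq[OF j(2,3)])
	also have "... = (\<Sum>i<j. h (Suc i) x - h i x) + (t / ta - j) *R (h (Suc j) x - h j x)"
		by (simp add: ramp_eq[OF j(2,3)])
	also have "... = (h j x - h 0 x) + (t / ta - j) *R (h (Suc j) x - h j x)"
		using sum_lessThan_telescope[of "%i. h i x" j] by simp
	finally show ?thesis by (simp add: pl_def tn_def algebra_simps)
qed

lemma slice_ex:
	fixes h :: "nat => real^2 => 'b::euclidean_space"
	assumes "0 <= t" "t <= T"
	obtains j th where "j < N" "0 <= th" "th <= 1" "j * ta <= t" "t <= Suc j * ta" "t - j * ta <= ta" "Suc j * ta - t <= ta"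
		"!!h :: nat => real^2 => 'b. !!x. pl h (t, x) = (1 - th) *R h j x + th *R h (Suc j) x"
proof -
	obtain j where j: "j < N" "j * ta <= t" "t <= Suc j * ta"
	proof (cases "t < T")
		case True
		with assms obtain j where "j < N" "j * ta <= t" "t < Suc j * ta" by (auto elim: cell_exists)
		thus thesis by (intro that) auto
	next
		case False
		hence t: "t = T" using assms by simp
		obtain k where k: "N = Suc k" using taN T_pos by (cases N) auto
		show thesis using t taN ta_pos by (intro that[of k]) (auto simp: k algebra_simps)
	qed
	show thesis using j ta_pos by (intro that[of j "t / ta - j"] pl_slice) (auto simp: field_simps)
qed

lemma cells_n2:
	assumes a: "!!j. 0 <= a j"
	shows "sqi L (%t. \<Sum>j<N. a j * cell j t)" "n2 L (%t. \<Sum>j<N. a j * cell j t) = sqrt (ta * (\<Sum>j<N. (a j)^2))"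
proof -
	show s: "sqi L (%t. \<Sum>j<N. a j * cell j t)" using cell_sqi by (intro sqi_sum sqi_cmult)
	have ci: "integrable L (cell j)" for j using integrable_ip[OF cell_sqi[of j] n2_L_const(1)[of 1]] by simp
	have "ip L (%t. \<Sum>j<N. a j * cell j t) (%t. \<Sum>j<N. a j * cell j t) = (LINT t|L. (\<Sum>j<N. (a j)^2 * cell j t))"
		unfolding ip_def
	proof (intro bi_cong refl)
		fix t assume "t : space L"
		then obtain j where j: "j < N" "j * ta <= t" "t < Suc j * ta" by (auto intro: cell_exists[of t])
		thus "(\<Sum>j<N. a j * cell j t) \<bullet> (\<Sum>j<N. a j * cell j t) = (\<Sum>j<N. (a j)^2 * cell j t)"
			by (simp add: cell_eq[OF j(2,3)] if_distrib[of "%a. _ * a"] power2_eq_square cong: if_cong)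
	qed
	also have "... = (\<Sum>j<N. (a j)^2 * (LINT t|L. cell j t))"
		using ci by (subst bi_sum) auto
	also have "... = (\<Sum>j<N. (a j)^2 * ta)"
	proof (intro sum.cong refl)
		fix j assume "j : {..<N}"
		hence "(LINT t|L. cell j t) = ta"
			unfolding cell_def using ta_pos node_le[of j] by (subst indicator_L(2)) (auto simp: algebra_simps)
		thus "(a j)^2 * (LINT t|L. cell j t) = (a j)^2 * ta" by simp
	qed
	finally show "n2 L (%t. \<Sum>j<N. a j * cell j t) = sqrt (ta * (\<Sum>j<N. (a j)^2))"
		by (simp add: n2_def sum_distrib_left mult.commute)
qed

lemma pc_sqi:
	fixes h :: "nat => real^2 => 'b::euclidean_space"
	assumes h: "!!j. sqi M (h j)" shows "sqi ST (pc h)" "n2 ST (pc h) <= sqrt (ta * (\<Sum>j<N. (n2 M (h j))^2))"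
proof -
	show s: "sqi ST (pc h)" unfolding pc_def using h by (intro sqi_sum tn_sqi(1) cell_sqi)
	have "AE t in L. sqi M (%x. pc h (t, x)) & n2 M (%x. pc h (t, x)) <= (\<Sum>j<N. n2 M (h j) * cell j t)"
	proof (rule AE_I2)
		fix t assume "t : space L"
		then obtain j where j: "j < N" "j * ta <= t" "t < Suc j * ta" by (auto intro: cell_exists[of t])
		thus "sqi M (%x. pc h (t, x)) & n2 M (%x. pc h (t, x)) <= (\<Sum>j<N. n2 M (h j) * cell j t)"
			using h by (simp add: pc_slice[OF j] cell_eq[OF j(2,3)] if_distrib[of "%a. _ * a"] cong: if_cong)
	qed
	from sqi_ST_I(2)[OF sqi_m[OF s] cells_n2(1) this] cells_n2(2)[of "%j. n2 M (h j)"]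
	show "n2 ST (pc h) <= sqrt (ta * (\<Sum>j<N. (n2 M (h j))^2))" by simp
qed

lemma pl_sqi:
	fixes h :: "nat => real^2 => 'b::euclidean_space"
	assumes h: "!!j. sqi M (h j)"
	shows "sqi ST (pl h)" "n2 ST (pl h) <= sqrt (ta * (\<Sum>j<N. (n2 M (h j))^2)) + sqrt (ta * (\<Sum>j<N. (n2 M (h (Suc j)))^2))"
proof -
	have [measurable]: "h j : bm M" for j using h sqi_m by blast
	have rm [measurable]: "ramp j : bm L" for j
		unfolding ramp_def by (intro measurable_restrict_space1 measurable_completion) auto
	have m: "pl h : bm ST" unfolding pl_def tn_def by measurable
	have b: "sqi L (%t. (\<Sum>j<N. n2 M (h j) * cell j t) + (\<Sum>j<N. n2 M (h (Suc j)) * cell j t))" (is "sqi L ?b")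
		by (intro sqi_add cells_n2(1)) auto
	have s: "AE t in L. sqi M (%x. pl h (t, x)) & n2 M (%x. pl h (t, x)) <= ?b t"
	proof (rule AE_I2)
		fix t assume "t : space L"
		then obtain j where j: "j < N" "j * ta <= t" "t < Suc j * ta" by (auto intro: cell_exists[of t])
		define th where "th = t / ta - j"
		have th: "0 <= th" "th <= 1" using j ta_pos by (auto simp: th_def field_simps)
		have e: "(%x. pl h (t, x)) = (%x. (1 - th) *R h j x + th *R h (Suc j) x)" by (rule ext) (use pl_slice[OF j(1,2) less_imp_le[OF j(3)], of h] in \<open>simp add: th_def\<close>)
		have "n2 M (%x. pl h (t, x)) <= (1 - th) * n2 M (h j) + th * n2 M (h (Suc j))"
			unfolding e using n2_triangle[OF sqi_scaleR[OF h] sqi_scaleR[OF h], of "1 - th" j th "Suc j"] th by simp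
		also have "... <= n2 M (h j) + n2 M (h (Suc j))" using th by (intro add_mono mult_left_le_one_le) auto
		also have "... = ?b t" using j by (simp add: cell_eq[OF j(2,3)] if_distrib[of "%a. _ * a"] cong: if_cong)
		finally show "sqi M (%x. pl h (t, x)) & n2 M (%x. pl h (t, x)) <= ?b t"
			unfolding e using h by (auto intro!: sqi_add sqi_scaleR)
	qed
	show "sqi ST (pl h)" by (rule sqi_ST_I(1)[OF m b s])
	have "n2 ST (pl h) <= n2 L ?b" by (rule sqi_ST_I(2)[OF m b s])
	also have "... <= n2 L (%t. \<Sum>j<N. n2 M (h j) * cell j t) + n2 L (%t. \<Sum>j<N. n2 M (h (Suc j)) * cell j t)"
		by (intro n2_triangle cells_n2(1)) auto
	finally show "n2 ST (pl h) <= sqrt (ta * (\<Sum>j<N. (n2 M (h j))^2)) + sqrt (ta * (\<Sum>j<N. (n2 M (h (Suc j)))^2))"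
		by (simp add: cells_n2(2))
qed

text \<open>This makes the discrete equations equivalent to one exact equation for the linear
  interpolant, with piecewise constant flux.\<close>

lemma ip_pc:
	assumes h: "!!j. sqi M (h j)" and ph: "sqi M ph" and t: "0 <= t" "t <= T"
	shows "ip ST (pc h) (tn (ind 0 t) ph) = (\<Sum>j<N. ta * ramp j t * ip M (h j) ph)"
proof -
	have *: "ind 0 t r * cell j r = ind (j * ta) (max (j * ta) (min (Suc j * ta) t)) r" for j r
		using ta_pos by (auto simp: cell_def indicator_def max_def min_def) (meson mult_nonneg_nonneg of_nat_0_le_iff less_imp_le order_trans)+
	have node_le': "real j * ta <= T" if "j < N" for j using node_le[OF that] ta_pos by (simp add: algebra_simps)
	have i: "integrable L (ind a b)" for a b using integrable_ip[OF indicator_L(1) n2_L_const(1)[of 1]] by simp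
	have r: "max (j * ta) (min (Suc j * ta) t) - j * ta = ta * ramp j t" for j
		using ta_pos by (auto simp: ramp_def max_def min_def field_simps)
	have "ip ST (pc h) (tn (ind 0 t) ph) = (LINT r|L. ind 0 t r * ip M (%x. pc h (r, x)) ph)"
		by (rule ip_tn(1)[OF pc_sqi(1)[OF h] indicator_L(1) ph])
	also have "... = (LINT r|L. (\<Sum>j<N. ind (j * ta) (max (j * ta) (min (Suc j * ta) t)) r * ip M (h j) ph))"
	proof (intro bi_cong refl)
		fix r
		have "ip M (%x. pc h (r, x)) ph = (\<Sum>j<N. cell j r * ip M (h j) ph)"
			using h ph by (simp add: pc_def tn_def ip_sum_left sqi_scaleR)
		thus "ind 0 t r * ip M (%x. pc h (r, x)) ph = (\<Sum>j<N. ind (j * ta) (max (j * ta) (min (Suc j * ta) t)) r * ip M (h j) ph)"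
			by (simp only: *[symmetric] sum_distrib_left mult.assoc)
	qed
	also have "... = (\<Sum>j<N. (LINT r|L. ind (j * ta) (max (j * ta) (min (Suc j * ta) t)) r) * ip M (h j) ph)"
		using i by (subst bi_sum) auto
	also have "... = (\<Sum>j<N. ta * ramp j t * ip M (h j) ph)"
		using ta_pos t node_le node_le' by (intro sum.cong refl arg_cong2[where f = "(*)"]) (subst indicator_L(2), auto simp: r[symmetric])
	finally show ?thesis .
qed

lemma ramp_lip: assumes "s <= t" shows "0 <= ramp j t - ramp j s" "ramp j t - ramp j s <= (t - s) / ta"
proof -
	have "s / ta <= t / ta" using assms ta_pos by (simp add: divide_right_mono)
	thus "0 <= ramp j t - ramp j s" "ramp j t - ramp j s <= (t - s) / ta" by (auto simp: ramp_def diff_divide_distrib)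
qed

text \<open>The constant degenerates as the step shrinks. This is harmless: Lipschitz continuity
  serves only the partition limit in \<open>energy_ineq\<close>, for one approximation at a
  time.\<close>

lemma pl_lip:
	fixes h :: "nat => real^2 => 'b::euclidean_space"
	assumes h: "!!j. sqi M (h j)" and st: "s <= t"
	shows "n2 M (%x. pl h (t, x) - pl h (s, x)) <= ((\<Sum>j<N. n2 M (%x. h (Suc j) x - h j x)) / ta) * (t - s)"
proof -
	have "(%x. pl h (t, x) - pl h (s, x)) = (%x. \<Sum>j<N. (ramp j t - ramp j s) *R (h (Suc j) x - h j x))"
		by (simp add: pl_def tn_def sum_subtractf[symmetric] scaleR_diff_left)
	note e = this
	have "n2 M (%x. pl h (t, x) - pl h (s, x)) <= (\<Sum>j<N. n2 M (%x. (ramp j t - ramp j s) *R (h (Suc j) x - h j x)))"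
		unfolding e using h by (intro n2_sum_le sqi_scaleR sqi_diff)
	also have "... <= (\<Sum>j<N. (t - s) / ta * n2 M (%x. h (Suc j) x - h j x))"
	proof (intro sum_mono)
		show "n2 M (%x. (ramp j t - ramp j s) *R (h (Suc j) x - h j x)) <= (t - s) / ta * n2 M (%x. h (Suc j) x - h j x)" for j
			using mult_right_mono[OF ramp_lip(2)[OF st, of j], of "n2 M (%x. h (Suc j) x - h j x)"] ramp_lip(1)[OF st, of j] by simp
	qed
	finally show ?thesis by (simp add: sum_distrib_left sum_divide_distrib mult_ac)
qed

text \<open>Different interpolants play different roles: the linear one satisfies the equation
  exactly, while the step functions satisfy the pointwise identity for the flux. The two are close
  when tested with H^1 functions, because the equation bounds the change over one cell.\<close>

lemma rothe_appr:
	assumes r: "rothe ta u g V GV" and bd: "rothe_bd B N ta u g V GV"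
		and e: "sqrt B * sqrt ta <= e" "n2 M (%x. u 0 x - u0 x) <= e"
	defines "B1 \<equiv> B + 2 * sqrt B + sqrt T * (B + 2 * dsize * B + (2 * dsize)^2 * B)"
	shows "appr B1 e u0 (pl u) (pl g) (pc (%j x. g (Suc j) x + u (Suc j) x *R GV j x)) (pc (%j. u (Suc j))) (pc (%j. g (Suc j))) (pc V) (pc GV)"
proof -
	have B: "!!n. n <= N ==> n2 M (u n) <= B" "!!n x. n <= N ==> abs (V n x) <= B"
		"ta * (\<Sum>j<N. (n2 M (g j))^2) <= B" "ta * (\<Sum>j<N. (n2 M (g (Suc j)))^2) <= B"
		"ta * (\<Sum>j<N. (n2 M (%x. g (Suc j) x + u (Suc j) x *R GV j x))^2) <= B" using bd unfolding rothe_bd_def by blast+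
	define F where "F j x = g (Suc j) x + u (Suc j) x *R GV j x" for j x
	note su = rotheD(2)[OF r] and sg = rotheD(3)[OF r]
	have sV: "sqi M (V j)" and sGV: "sqi M (GV j)" for j using solD(3,4)[OF rotheD(6)[OF r]] by auto
	have sF: "sqi M (F j)" for j unfolding F_def using sqi_add[OF sg rotheD(10)[OF r]] .
	have B0: "B >= 0" using order_trans[OF n2_nonneg B(1)[of 0]] by simp
	have T0: "sqrt T >= 0" using T_pos by simp
	have Bs: "B <= B1" "2 * sqrt B <= B1" "sqrt B <= B1" "sqrt T * B <= B1" "sqrt T * (2 * dsize * B) <= B1" "sqrt T * ((2 * dsize)^2 * B) <= B1"
	proof -
		have "0 <= sqrt B" "0 <= sqrt T * B" "0 <= sqrt T * (2 * dsize * B)" "0 <= sqrt T * ((2 * dsize)^2 * B)" using B0 T0 by auto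
		thus "B <= B1" "2 * sqrt B <= B1" "sqrt B <= B1" "sqrt T * B <= B1" "sqrt T * (2 * dsize * B) <= B1" "sqrt T * ((2 * dsize)^2 * B) <= B1"
			using B0 unfolding B1_def distrib_left by linarith+
	qed
	have pcb: "n2 ST (pc h) <= sqrt T * c" if "!!j. sqi M (h j)" "!!j. j < N ==> n2 M (h j) <= c" for h :: "nat => real^2 => 'b::euclidean_space" and c
	proof -
		have "0 < N" using taN T_pos by (intro gr0I) auto
		hence c: "c >= 0" using order_trans[OF n2_nonneg that(2)[of 0]] by simp
		have "(\<Sum>j<N. (n2 M (h j))^2) <= (\<Sum>j<N. c^2)" using that(2) by (intro sum_mono power_mono) auto
		hence "ta * (\<Sum>j<N. (n2 M (h j))^2) <= ta * (\<Sum>j<N. c^2)" using ta_pos by (intro mult_left_mono) auto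
		also have "... = T * c^2" using taN by (simp add: mult.assoc[symmetric])
		finally have "sqrt (ta * (\<Sum>j<N. (n2 M (h j))^2)) <= sqrt T * c" using c by (metis real_sqrt_le_mono real_sqrt_mult real_sqrt_abs abs_of_nonneg)
		moreover have "n2 ST (pc h) <= sqrt (ta * (\<Sum>j<N. (n2 M (h j))^2))" by (rule pc_sqi(2)) (rule that(1))
		ultimately show ?thesis by linarith
	qed
	have ub: "n2 M (u n) <= B1" if "n <= N" for n using B(1)[OF that] Bs(1) by linarith
	have eq: "ip M (%x. pl u (t, x)) ph = ip M (%x. pl u (0, x)) ph - ip ST (pc F) (tn (ind 0 t) gph)"
		if t: "0 <= t" "t <= T" and ph: "Hg ph gph" for t ph gph
	proof -
		note s = HgD(1,2)[OF ph]
		have "ip M (%x. pl u (t, x)) ph = ip M (u 0) ph + (\<Sum>j<N. ramp j t * ip M (%x. u (Suc j) x - u j x) ph)" for t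
		proof -
			have 1: "sqi M (%x. ramp j t *R (u (Suc j) x - u j x))" for j using su by (intro sqi_scaleR sqi_diff)
			show ?thesis unfolding pl_def tn_def using su s(1) ip_sum_left[where I = "{..<N}", OF 1 s(1)] sqi_sum[where I = "{..<N}", OF 1] ip_scale_left
				by (simp add: ip_add_left del: real_scaleR_def)
		qed
		moreover have "ramp j 0 = 0" for j by (simp add: ramp_def)
		moreover have "ip M (%x. u (Suc j) x - u j x) ph = - ta * ip M (F j) gph" for j
			using rotheD(9)[OF r ph, of j] ip_diff_left[OF su su s(1), of "Suc j" j] unfolding F_def[abs_def] by linarith
		ultimately show ?thesis using ip_pc[OF sF s(2) t] by (simp add: sum_negf mult_ac)
	qed
	\<comment> \<open>Over a time span of at most ta the tested solution moves by at most |F| sqrt ta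
	  |gph|, which is where the condition sqrt B * sqrt ta <= e comes from.\<close>
	have close: "abs (ip M (u i) ph - ip M (%x. pl u (t, x)) ph) <= e * n2 M gph"
		if t: "0 <= t" "t <= T" and i: "i <= N" "i * ta - t <= ta" "t - i * ta <= ta" and ph: "Hg ph gph" for t i ph gph
	proof -
		note s = HgD(1,2)[OF ph]
		have nF: "n2 ST (pc F) <= sqrt B"
			using pc_sqi(2)[of F, OF sF] real_sqrt_le_mono[OF B(5)] unfolding F_def[abs_def] by linarith
		have iT: "0 <= i * ta" "i * ta <= T"
			using ta_pos mult_right_mono[of "real i" "real N" ta] i(1) taN by (auto simp: mult.commute)
		have "pl u (i * ta, x) = u i x" for x
		proof (cases i)
			case 0
			thus ?thesis using ta_pos T_pos taN by (subst pl_slice[of 0]) (auto intro: gr0I)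
		next
			case (Suc k)
			thus ?thesis using ta_pos i(1) by (subst pl_slice[of k]) (auto simp: field_simps)
		qed
		hence ui: "ip M (u i) ph = ip M (%x. pl u (i * ta, x)) ph" by simp
		have d: "abs (ip M (%x. pl u (b, x)) ph - ip M (%x. pl u (a, x)) ph) <= e * n2 M gph" if ab: "0 <= a" "a <= b" "b <= T" "b - a <= ta" for a b
		proof -
			have "abs (ip M (%x. pl u (b, x)) ph - ip M (%x. pl u (a, x)) ph) = abs (ip ST (pc F) (tn (ind a b) gph))"
				using eq[OF _ _ ph, of a] eq[OF _ _ ph, of b] tn_split[OF pc_sqi(1)[OF sF] s(2) ab(1,2)] ab by simp
			also have "... <= n2 ST (pc F) * (sqrt (b - a) * n2 M gph)" by (rule tn_bound[OF pc_sqi(1)[OF sF] s(2) ab(1-3)])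
			also have "... <= sqrt B * (sqrt ta * n2 M gph)" using nF ab B0 by (intro mult_mono) auto
			also have "... <= e * n2 M gph" unfolding mult.assoc[symmetric] by (intro mult_right_mono e) auto
			finally show ?thesis .
		qed
		show ?thesis
		proof (cases "i * ta <= t")
			case True
			thus ?thesis unfolding ui using d[of "i * ta" t] iT t i by (simp add: abs_minus_commute)
		next
			case False
			thus ?thesis unfolding ui using d[of t "i * ta"] iT t i by simp
		qed
	qed
	have ST: "sqi ST (pl g) & n2 ST (pl g) <= B1" "sqi ST (pc F) & n2 ST (pc F) <= B1"
		"sqi ST (pc (%j. u (Suc j))) & n2 ST (pc (%j. u (Suc j))) <= B1" "sqi ST (pc (%j. g (Suc j))) & n2 ST (pc (%j. g (Suc j))) <= B1"
		"sqi ST (pc V) & n2 ST (pc V) <= B1" "sqi ST (pc GV) & n2 ST (pc GV) <= B1"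
	proof -
		have sq: "sqrt (ta * (\<Sum>j<N. (n2 M (g j))^2)) <= sqrt B" "sqrt (ta * (\<Sum>j<N. (n2 M (g (Suc j)))^2)) <= sqrt B"
			"sqrt (ta * (\<Sum>j<N. (n2 M (F j))^2)) <= sqrt B" using B(3-5) unfolding F_def by (auto intro: real_sqrt_le_mono)
		show "sqi ST (pl g) & n2 ST (pl g) <= B1" using pl_sqi[of g, OF sg] sq(1,2) Bs(2) by linarith
		show "sqi ST (pc F) & n2 ST (pc F) <= B1" using pc_sqi[of F, OF sF] sq(3) Bs(3) by linarith
		show "sqi ST (pc (%j. g (Suc j))) & n2 ST (pc (%j. g (Suc j))) <= B1" using pc_sqi[of "%j. g (Suc j)", OF sg] sq(2) Bs(3) by linarith
		show "sqi ST (pc (%j. u (Suc j))) & n2 ST (pc (%j. u (Suc j))) <= B1"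
			using pc_sqi(1)[of "%j. u (Suc j)", OF su] pcb[of "%j. u (Suc j)" B] su B(1) Bs(4) by force
		have eV: "n2 M (V j) <= (2 * dsize)^2 * B" "n2 M (GV j) <= 2 * dsize * B" if "j < N" for j
			using sol_estimate[OF rotheD(6)[OF r] su, of j] B(1)[of j] that
				mult_left_mono[of "n2 M (u j)" B "(2 * dsize)^2"] mult_left_mono[of "n2 M (u j)" B "2 * dsize"] by auto
		show "sqi ST (pc V) & n2 ST (pc V) <= B1" using pc_sqi(1)[of V, OF sV] pcb[of V, OF sV eV(1)] Bs(6) by linarith
		show "sqi ST (pc GV) & n2 ST (pc GV) <= B1" using pc_sqi(1)[of GV, OF sGV] pcb[of GV, OF sGV eV(2)] Bs(5) by linarith
	qed
	have pt: "Hg (%x. pl u (t, x)) (%x. pl g (t, x)) & n2 M (%x. pl u (t, x)) <= B1" if t: "0 <= t" "t <= T" for t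
	proof -
		obtain j where j: "j < N" "j * ta <= t" "t <= Suc j * ta" using slice_ex[OF t] by metis
		define th where "th = t / ta - j"
		have th: "0 <= th" "th <= 1" using j ta_pos by (auto simp: th_def field_simps)
		have e: "(%x. pl u (t, x)) = (%x. (1 - th) * u j x + th * u (Suc j) x)" "(%x. pl g (t, x)) = (%x. (1 - th) *R g j x + th *R g (Suc j) x)"
			using pl_slice[OF j, of u] pl_slice[OF j, of g] by (auto simp: th_def)
		have "n2 M (%x. pl u (t, x)) <= (1 - th) * n2 M (u j) + th * n2 M (u (Suc j))"
			unfolding e using n2_triangle[OF sqi_cmult[OF su] sqi_cmult[OF su], of "1 - th" j th "Suc j"] th by simp
		also have "... <= (1 - th) * B1 + th * B1" using th ub[of j] ub[of "Suc j"] j by (intro add_mono mult_left_mono) auto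
		finally have "n2 M (%x. pl u (t, x)) <= B1" by (simp add: algebra_simps)
		thus ?thesis unfolding e using Hg_lin[OF rotheD(1)[OF r] rotheD(1)[OF r], of "1 - th" j th "Suc j"] by blast
	qed
	define K where "K = (\<Sum>j<N. n2 M (%x. u (Suc j) x - u j x)) / ta + (\<Sum>j<N. n2 M (%x. g (Suc j) x - g j x)) / ta"
	have lip: "n2 M (%x. pl u (t, x) - pl u (s, x)) <= K * (t - s) & n2 M (%x. pl g (t, x) - pl g (s, x)) <= K * (t - s)" if st: "s <= t" for s t
	proof -
		have "0 <= (\<Sum>j<N. n2 M (%x. u (Suc j) x - u j x)) / ta" "0 <= (\<Sum>j<N. n2 M (%x. g (Suc j) x - g j x)) / ta"
			using ta_pos by (auto intro!: divide_nonneg_pos sum_nonneg)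
		hence "(\<Sum>j<N. n2 M (%x. u (Suc j) x - u j x)) / ta * (t - s) <= K * (t - s)" "(\<Sum>j<N. n2 M (%x. g (Suc j) x - g j x)) / ta * (t - s) <= K * (t - s)"
			using st by (auto simp only: K_def intro!: mult_right_mono)
		thus ?thesis using pl_lip[of u, OF su st] pl_lip[of g, OF sg st] by linarith
	qed
	have "0 < N" using taN T_pos by (intro gr0I) auto
	hence W0: "n2 M (%x. pl u (0, x) - u0 x) <= e" using e(2) ta_pos by (simp add: pl_slice[of 0])
	have sl: "Hg (%x. pc (%j. u (Suc j)) (t, x)) (%x. pc (%j. g (Suc j)) (t, x)) & n2 M (%x. pc (%j. u (Suc j)) (t, x)) <= B1
			& sqi M (%x. pc (%j. u (Suc j)) (t, x) *R pc GV (t, x)) &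
			(ALL x. pc F (t, x) = pc (%j. g (Suc j)) (t, x) + pc (%j. u (Suc j)) (t, x) *R pc GV (t, x) & abs (pc V (t, x)) <= B1) &
			(ALL ph gph. Hg ph gph --> abs (ip M (%x. pc (%j. u (Suc j)) (t, x)) ph - ip M (%x. pl u (t, x)) ph) <= e * n2 M gph) &
			(EX f. sqi M f & n2 M f <= B1 & sol f (%x. pc V (t, x)) (%x. pc GV (t, x)) &
				(ALL ph gph. Hg ph gph --> abs (ip M f ph - ip M (%x. pl u (t, x)) ph) <= e * n2 M gph))" if t: "0 < t" "t < T" for t
	proof -
		obtain j where j: "j < N" "j * ta <= t" "t < Suc j * ta" using t by (auto intro: cell_exists[of t])
		have Vb: "abs (V j x) <= B1" for x using B(2)[of j x] Bs(1) j(1) by linarith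
		\<comment> \<open>On cell j the drifted function is u (Suc j), whereas the potential comes from u
		  j; both nodes are within ta of t.\<close>
		have c: "abs (ip M (u i) ph - ip M (%x. pl u (t, x)) ph) <= e * n2 M gph" if "i = j \<or> i = Suc j" "Hg ph gph" for i ph gph
			using that j t ta_pos by (intro close) (auto simp: algebra_simps)
		show ?thesis unfolding pc_slice[OF j]
			using rotheD(1)[OF r, of "Suc j"] ub[of "Suc j"] ub[of j] j(1) rotheD(10)[OF r, of j] Vb c su rotheD(6)[OF r, of j]
			by (intro conjI exI[of _ "u j"]) (auto simp: F_def)
	qed
	have 7: "ALL t:{0..T}. Hg (%x. pl u (t, x)) (%x. pl g (t, x)) & n2 M (%x. pl u (t, x)) <= B1 &
			(ALL ph gph. Hg ph gph --> ip M (%x. pl u (t, x)) ph = ip M (%x. pl u (0, x)) ph - ip ST (pc F) (tn (ind 0 t) gph))"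
	proof (rule ballI)
		fix t assume "t : {0..T}"
		hence t: "0 <= t" "t <= T" by auto
		show "Hg (%x. pl u (t, x)) (%x. pl g (t, x)) & n2 M (%x. pl u (t, x)) <= B1 &
			(ALL ph gph. Hg ph gph --> ip M (%x. pl u (t, x)) ph = ip M (%x. pl u (0, x)) ph - ip ST (pc F) (tn (ind 0 t) gph))"
			using pt[OF t] eq[OF t] by blast
	qed
	have 8: "EX K. ALL s t. 0 <= s --> s <= t --> t <= T --> n2 M (%x. pl u (t, x) - pl u (s, x)) <= K * (t - s) & n2 M (%x. pl g (t, x) - pl g (s, x)) <= K * (t - s)"
		using lip by blast
	have F: "(%j x. g (Suc j) x + u (Suc j) x *R GV j x) = F" by (simp add: F_def[abs_def])
	show ?thesis
		unfolding appr_def F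
		by (rule conjI[OF ST(1) conjI[OF ST(2) conjI[OF ST(3) conjI[OF ST(4) conjI[OF ST(5) conjI[OF ST(6) conjI[OF 7 conjI[OF 8 conjI[OF W0]]]]]]]]])
			(use sl in simp)
qed

end

section \<open>Compactness of the inverse Dirichlet Laplacian\<close>

lemma nn_integral_shift2:
	fixes a :: "real^2"
	assumes [measurable]: "f : bm borel" shows "(nni lborel (%x. f (x + a))) = (nni lborel (%x. f x))"
proof -
	have "(nni lborel (%x. f x)) = (\<integral>\<^sup>+x. f x \<partial>distr lborel borel ((+) a))" by (simp add: lborel_distr_plus)
	also have "... = (nni lborel (%x. f (a + x)))" by (subst nn_integral_distr) auto
	finally show ?thesis by (simp add: add.commute)
qed

text \<open>The fundamental theorem along the segment from x to x + z, integrated over x by Fubini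
  and translation invariance.\<close>

lemma translation_L1:
	assumes w: "smooth_R2 w"
	shows "(nni lborel (%x. ennreal (abs (w (x + z) - w x)))) <= ennreal (norm z) * (nni lborel (%x. ennreal (norm (grad w x))))"
proof -
	note [measurable] = smooth_borel[OF w] grad_borel[OF w]
	define I where "I = (nni lborel (%x. ennreal (norm (grad w x))))"
	have "(nni lborel (%x. ennreal (abs (w (x + z) - w x))))
		<= (nni lborel (%x. (nni lborel (%s. ennreal (norm z) * ennreal (norm (grad w (x + s *R z))) * indicator {0..1} s))))"
	proof (intro nn_integral_mono)
		fix x
		have d: "((%r. w (x + r *R z) - w (x + z)) has_real_derivative (grad w (x + r *R z) \<bullet> z)) (at r)" for r
			using DERIV_diff[OF smooth_line_deriv(1)[OF w] DERIV_const] by simp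
		have "ennreal (abs (w (x + z) - w x)) <= (nni lborel (%s. ennreal (abs (grad w (x + s *R z) \<bullet> z)) * indicator {0..1} s))"
			using ftc_nn_bound[OF d smooth_line_deriv(2)[OF w], of 1] by (simp add: abs_minus_commute)
		also have "... <= (nni lborel (%s. ennreal (norm z) * ennreal (norm (grad w (x + s *R z))) * indicator {0..1} s))"
		proof (intro nn_integral_mono mult_right_mono)
			show "ennreal (abs (grad w (x + s *R z) \<bullet> z)) <= ennreal (norm z) * ennreal (norm (grad w (x + s *R z)))" for s
				using Cauchy_Schwarz_ineq2[of "grad w (x + s *R z)" z] by (simp add: ennreal_mult[symmetric] mult.commute)
		qed simp
		finally show "ennreal (abs (w (x + z) - w x)) <= (nni lborel (%s. ennreal (norm z) * ennreal (norm (grad w (x + s *R z))) * indicator {0..1} s))" .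
	qed
	also have "... = (nni lborel (%s. (nni lborel (%x. ennreal (norm z) * ennreal (norm (grad w (x + s *R z))) * indicator {0..1} s))))"
		by (rule lborel_pair.Fubini'[symmetric]) measurable
	also have "... = (nni lborel (%s. ennreal (norm z) * I * indicator {0..1::real} s))"
	proof (intro nn_integral_cong)
		fix s :: real
		have "(nni lborel (%x. ennreal (norm z) * ennreal (norm (grad w (x + s *R z))) * indicator {0..1} s))
			= ennreal (norm z) * (nni lborel (%x. ennreal (norm (grad w (x + s *R z))))) * indicator {0..1} s"
			by (subst nn_integral_multc, measurable, subst nn_integral_cmult) measurable
		thus "(nni lborel (%x. ennreal (norm z) * ennreal (norm (grad w (x + s *R z))) * indicator {0..1} s)) = ennreal (norm z) * I * indicator {0..1} s"
			using nn_integral_shift2[of "%x. ennreal (norm (grad w x))" "s *R z"] by (simp add: I_def)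
	qed
	also have "... = ennreal (norm z) * I" by (simp add: nn_integral_cmult_indicator)
	finally show ?thesis by (simp add: I_def)
qed

text \<open>The mollification error is an average of translation errors with |z| < de.\<close>

lemma mollify_L1:
	assumes w: "smooth_cs w" and de: "de > 0"
	shows "(nni lborel (%x. ennreal (abs (w x - (LINT z|lborel. w (z + x) * kern de z))))) <= ennreal de * (nni lborel (%x. ennreal (norm (grad w x))))"
proof -
	define k where "k = kern de"
	note kp = kern_props[OF de, folded k_def] and sm = smooth_cs_smooth[OF w]
	note [measurable] = smooth_borel[OF sm] grad_borel[OF sm] kern_borel[OF de, folded k_def]
	obtain C where C: "!!x. abs (w x) <= C" using smooth_cs_bounded[OF w] by blast
	define I where "I = (nni lborel (%x. ennreal (norm (grad w x))))"
	have "ennreal (abs (w x - (LINT z|lborel. w (z + x) * k z))) <= (nni lborel (%z. ennreal (k z) * ennreal (abs (w (x + z) - w x))))" for x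
	proof -
		have i: "integrable lborel (%z. w (z + x) * k z)"
		proof (rule bi_i_bound[OF integrable_mult_right[OF kp(5), of C]])
			show "AE z in lborel. norm (w (z + x) * k z) <= norm (C * k z)"
			proof (rule AE_I2)
				fix z
				have "abs (w (z + x)) * k z <= abs C * k z" using C[of "z + x"] kp(2)[of z] by (intro mult_right_mono) auto
				thus "norm (w (z + x) * k z) <= norm (C * k z)" using kp(2)[of z] by (simp add: abs_mult)
			qed
		qed measurable
		have "w x - (LINT z|lborel. w (z + x) * k z) = (LINT z|lborel. w x * k z - w (z + x) * k z)"
			using i kp(4,5) by (subst bi_diff) auto
		moreover have "ennreal (norm (LINT z|lborel. w x * k z - w (z + x) * k z)) <= (nni lborel (%z. norm (w x * k z - w (z + x) * k z)))"
			using i kp(5) by (intro integral_norm_bound_ennreal) auto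
		moreover have "norm (w x * k z - w (z + x) * k z) = k z * abs (w (x + z) - w x)" for z
		proof -
			have "w x * k z - w (z + x) * k z = - (k z * (w (x + z) - w x))" by (simp add: algebra_simps)
			thus ?thesis using kp(2)[of z] by (simp only: real_norm_def abs_minus_cancel abs_mult abs_of_nonneg)
		qed
		ultimately show ?thesis using kp(2) by (simp add: ennreal_mult)
	qed
	hence "(nni lborel (%x. ennreal (abs (w x - (LINT z|lborel. w (z + x) * k z))))) <= (nni lborel (%x. (nni lborel (%z. ennreal (k z) * ennreal (abs (w (x + z) - w x))))))"
		by (intro nn_integral_mono)
	also have "... = (nni lborel (%z. (nni lborel (%x. ennreal (k z) * ennreal (abs (w (x + z) - w x))))))"
		by (rule lborel_pair.Fubini'[symmetric]) measurable
	also have "... <= (nni lborel (%z. ennreal (k z) * (ennreal de * I)))"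
	proof (intro nn_integral_mono)
		fix z
		have "(nni lborel (%x. ennreal (k z) * ennreal (abs (w (x + z) - w x)))) = ennreal (k z) * (nni lborel (%x. ennreal (abs (w (x + z) - w x))))"
			by (rule nn_integral_cmult) measurable
		also have "... <= ennreal (k z) * (ennreal (norm z) * I)"
			unfolding I_def by (intro mult_left_mono translation_L1 sm) simp
		also have "... <= ennreal (k z) * (ennreal de * I)"
		proof (cases "norm z >= de")
			case True
			thus ?thesis using kp(3)[of z] by simp
		next
			case False
			thus ?thesis by (intro mult_left_mono mult_right_mono ennreal_leI) auto
		qed
		finally show "(nni lborel (%x. ennreal (k z) * ennreal (abs (w (x + z) - w x)))) <= ennreal (k z) * (ennreal de * I)" .
	qed
	also have "... = (nni lborel (%z. ennreal (k z))) * (ennreal de * I)"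
		by (rule nn_integral_multc) measurable
	also have "(nni lborel (%z. ennreal (k z))) = 1" using nn_integral_eq_integral[OF kp(5)] kp(2,4) by simp
	finally show ?thesis by (simp add: k_def I_def)
qed

context bdom
begin

lemma test_mo_L1:
	assumes ph: "tf ph" shows "(LINT x|M. abs (ph x - mo n ph x)) <= 1 / Suc n * (LINT x|M. norm (grad ph x))"
proof -
	define de where "de = 1 / real (Suc n)"
	have de: "de > 0" by (simp add: de_def)
	note sm = test_fun_smooth[OF ph]
	have phi: "integrable M ph" by (rule sqi_imp_integrable[OF test_fun_sqi[OF ph]])
	have moi: "integrable M (mo n ph)" by (rule mo_integrable[OF phi])
	have mo: "mo n ph x = (LINT z|lborel. ph (z + x) * kern de z)" for x
	proof -
		note [measurable] = smooth_borel[OF sm] kern_borel[OF de]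
		have "mo n ph x = (LINT y|lborel. ph y * kern de (x - y))"
			unfolding mo_def conv_def de_def[symmetric] using test_fun_outside[OF ph] by (intro integral_M_lborel) auto
		also have "... = (LINT z|lborel. ph (z + x) * kern de (x - (z + x)))" by (rule lborel_integral_shift[symmetric]) measurable
		finally show ?thesis using kern_props(6)[OF de] by simp
	qed
	have b: "(%x. ennreal (abs (ph x - mo n ph x))) : bm borel"
		using smooth_borel[OF sm] smooth_borel[OF mo_smooth[OF phi, of n]] by simp
	have gb: "(%x. ennreal (norm (grad ph x))) : bm borel" using grad_borel[OF sm] by simp
	have g0: "grad ph x = 0" if "x \<notin> Om" for x using test_fun_outside[OF test_fun_pd[OF ph] that] by (simp add: grad_def vec_eq_iff)
	have "ennreal (LINT x|M. abs (ph x - mo n ph x)) = (nni M (%x. ennreal (abs (ph x - mo n ph x))))"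
		using phi moi by (intro nn_integral_eq_integral[symmetric]) auto
	also have "... <= (nni lborel (%x. ennreal (abs (ph x - mo n ph x))))" by (rule nn_integral_M_le[OF b])
	also have "... <= ennreal de * (nni lborel (%x. ennreal (norm (grad ph x))))"
		unfolding mo by (rule mollify_L1[OF test_fun_cs[OF ph] de])
	also have "(nni lborel (%x. ennreal (norm (grad ph x)))) = (nni M (%x. ennreal (norm (grad ph x))))"
		using g0 by (intro nn_integral_M_eq[symmetric] gb) simp
	also have "... = ennreal (LINT x|M. norm (grad ph x))"
		by (rule nn_integral_eq_integral[OF sqi_integrable_norm[OF test_grad_sqi[OF ph]]]) simp
	finally have "ennreal (LINT x|M. abs (ph x - mo n ph x)) <= ennreal (de * (LINT x|M. norm (grad ph x)))" using de by (simp add: ennreal_mult)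
	thus ?thesis using de by (simp add: de_def)
qed

text \<open>Rellich's theorem enters only through this estimate.\<close>
lemma Z_mo_L1:
	assumes Z: "Z V GV" shows "(LINT x|M. abs (V x - mo n V x)) <= 1 / Suc n * (dsize * n2 M GV)"
proof (rule field_le_epsilon)
	fix e :: real assume e: "e > 0"
	\<comment> \<open>Three errors of size at most ep * dsize arise: approximation by a test function,
	  its mollified counterpart, and the excess in the gradient norm.\<close>
	define ep where "ep = e / (3 * dsize + 1)"
	have ep: "ep > 0" using e by (simp add: ep_def add_nonneg_pos)
	obtain ph where ph: "tf ph" "n2 M (%x. (ph x - V x, grad ph x - GV x)) < ep" by (rule Z_approx[OF Z ep])
	note sV = HgD(1,2)[OF Z_H1[OF Z]] and sph = test_fun_sqi[OF ph(1)] test_grad_sqi[OF ph(1)]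
	note d = sqi_diff[OF sph(1) sV(1)] sqi_diff[OF sph(2) sV(2)]
	have n: "n2 M (%x. ph x - V x) <= ep" "n2 M (%x. grad ph x - GV x) <= ep" using n2_fst_le[OF d] n2_snd_le[OF d] ph(2) by linarith+
	note i = sqi_imp_integrable[OF sV(1)] sqi_imp_integrable[OF sph(1)]
	note di = sqi_imp_integrable[OF d(1)]
	have 1: "(LINT x|M. abs (ph x - V x)) <= ep * dsize"
		using integral_norm_le_n2[OF d(1)] mult_right_mono[OF n(1) dsize_nonneg] by simp
	have 2: "(LINT x|M. abs (mo n (%x. ph x - V x) x)) <= ep * dsize" using mo_L1[OF di] 1 by (rule order_trans)
	have "(LINT x|M. norm (grad ph x)) <= n2 M (grad ph) * dsize" by (rule integral_norm_le_n2[OF sph(2)])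
	also have "... <= (n2 M GV + ep) * dsize"
		using n2_triangle[OF d(2) sV(2)] n(2) by (intro mult_right_mono) auto
	finally have "1 / Suc n * (LINT x|M. norm (grad ph x)) <= 1 / Suc n * ((n2 M GV + ep) * dsize)" by (intro mult_left_mono) auto
	hence 3: "(LINT x|M. abs (ph x - mo n ph x)) <= 1 / Suc n * ((n2 M GV + ep) * dsize)" using test_mo_L1[OF ph(1), of n] by linarith
	have "1 / Suc n * (ep * dsize) <= 1 * (ep * dsize)" using ep by (intro mult_right_mono) auto
	have "(LINT x|M. abs (V x - mo n V x)) <= (LINT x|M. abs (ph x - V x) + abs (ph x - mo n ph x) + abs (mo n (%x. ph x - V x) x))"
		using i di mo_integrable[of _ n] by (intro integral_mono bi_i_add integrable_abs bi_i_diff) (auto simp: mo_diff)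
	also have "... = (LINT x|M. abs (ph x - V x)) + (LINT x|M. abs (ph x - mo n ph x)) + (LINT x|M. abs (mo n (%x. ph x - V x) x))"
		using i di mo_integrable[of _ n] by (subst bi_add; simp)+
	also have "... <= ep * dsize + 1 / Suc n * ((n2 M GV + ep) * dsize) + ep * dsize" using 1 2 3 by linarith
	also have "... = 1 / Suc n * (dsize * n2 M GV) + 1 / Suc n * (ep * dsize) + 2 * (ep * dsize)" by (simp add: algebra_simps)
	also have "... <= 1 / Suc n * (dsize * n2 M GV) + 3 * (ep * dsize)"
		using \<open>1 / Suc n * (ep * dsize) <= 1 * (ep * dsize)\<close> by linarith
	also have "3 * (ep * dsize) <= e"
	proof -
		have "3 * (ep * dsize) <= ep * (3 * dsize + 1)" using ep by (simp add: algebra_simps)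
		also have "... = e" unfolding ep_def using dsize_nonneg by (simp add: add_nonneg_eq_0_iff)
		finally show ?thesis .
	qed
	finally show "(LINT x|M. abs (V x - mo n V x)) <= 1 / Suc n * (dsize * n2 M GV) + e" by simp
qed

text \<open>Mollified functions are dense in L^2 and belong to H^1, so a bounded sequence need only
  be tested against functions for which the equation provides information.\<close>

lemma weak_limit_dense:
	assumes f: "!!k. sqi M (f k)" "!!k. n2 M (f k) <= B" and g: "sqi M g"
		and l: "!!n ps. sqi M ps ==> (%k. ip M (f k) (mo n ps)) ----> ip M g (mo n ps)" and ps: "sqi M ps"
	shows "(%k. ip M (f k) ps) ----> ip M g ps"
proof (rule LIMSEQ_I)
	fix e :: real assume e: "e > 0"
	define C where "C = abs B + n2 M g + 1"
	have C: "C > 0" "abs B + n2 M g <= C" by (auto simp: C_def add_nonneg_pos)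
	define d where "d = e / (2 * C)"
	have d: "d > 0" using e C by (simp add: d_def)
	obtain n where n: "n2 M (%x. mo n ps x - ps x) < d" using LIMSEQ_D[OF mo_tendsto_L2[OF ps] d] by auto
	have sm: "sqi M (mo n ps)" by (rule mo_sqi[OF sqi_imp_integrable[OF ps]])
	note sd = sqi_diff[OF sm ps]
	obtain K where K: "!!k. k >= K ==> abs (ip M (f k) (mo n ps) - ip M g (mo n ps)) < e / 2"
		using LIMSEQ_D[OF l[OF ps], of "e / 2"] e by auto
	have "norm (ip M (f k) ps - ip M g ps) < e" if k: "k >= K" for k
	proof -
		have "abs (ip M (f k) (%x. mo n ps x - ps x)) <= n2 M (f k) * n2 M (%x. mo n ps x - ps x)" by (rule ip_Cauchy_Schwarz[OF f(1) sd])
		also have "... <= abs B * d" using f(2)[of k] n by (intro mult_mono) auto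
		finally have 1: "abs (ip M (f k) (mo n ps) - ip M (f k) ps) <= abs B * d" by (simp add: ip_diff_right[OF sm ps f(1)])
		have "abs (ip M g (%x. mo n ps x - ps x)) <= n2 M g * n2 M (%x. mo n ps x - ps x)" by (rule ip_Cauchy_Schwarz[OF g sd])
		also have "... <= n2 M g * d" using n by (intro mult_left_mono) auto
		finally have 2: "abs (ip M g (mo n ps) - ip M g ps) <= n2 M g * d" by (simp add: ip_diff_right[OF sm ps g])
		have "(abs B + n2 M g) * d <= C * d" using C d by (intro mult_right_mono) auto
		also have "... = e / 2" using C by (simp add: d_def)
		finally show ?thesis using 1 2 K[OF k] unfolding real_norm_def distrib_right by linarith
	qed
	thus "EX K. ALL k>=K. norm (ip M (f k) ps - ip M g ps) < e" by blast
qed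

text \<open>Symmetry of the solution operator gives weak convergence of the differences D. Their
  mollifications at fixed radius converge pointwise and boundedly, hence in L^1, and
  \<open>Z_mo_L1\<close> makes the mollification error uniformly small. Stampacchia's sup bound
  lifts L^1 to L^2 convergence, and the energy identity transfers it to the gradients.\<close>

lemma sol_compact:
	assumes f: "!!k. sqi M (f k)" "!!k. n2 M (f k) <= B" and g: "sqi M g"
		and l: "!!ps. sqi M ps ==> (%k. ip M (f k) ps) ----> ip M g ps"
		and s: "!!k. sol (f k) (V k) (GV k)" "sol g V' GV'"
	shows "(%k. n2 M (%x. V k x - V' x)) ----> 0" "(%k. n2 M (%x. GV k x - GV' x)) ----> 0"
proof -
	define D where "D k x = V k x - V' x" for k x
	define GD where "GD k x = GV k x - GV' x" for k x
	have so: "sol (%x. f k x - g x) (D k) (GD k)" for k unfolding D_def[abs_def] GD_def[abs_def] by (rule sol_diff[OF s(1) s(2) f(1) g])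
	have fg: "sqi M (%x. f k x - g x)" for k using f(1) g by auto
	define c where "c = B + n2 M g"
	have fgc: "n2 M (%x. f k x - g x) <= c" for k using n2_diff_le[OF f(1) g, of k] f(2)[of k] by (simp add: c_def)
	have c0: "c >= 0" using order_trans[OF n2_nonneg fgc[of 0]] .
	note sD = solD(3)[OF so] and sGD = solD(4)[OF so]
	have iD: "integrable M (D k)" for k by (rule sqi_imp_integrable[OF sD])
	have GDb: "n2 M (GD k) <= 2 * dsize * c" for k
		using sol_estimate(1)[OF so fg, of k] mult_left_mono[OF fgc[of k], of "2 * dsize"] by simp
	have wk: "(%k. ip M (D k) ps) ----> 0" if ps: "sqi M ps" for ps
	proof -
		\<comment> \<open>Solving with the test function as datum moves the solution operator onto the
		  test function.\<close>
		obtain W GW where W: "sol ps W GW" by (rule sol_exists[OF ps])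
		note sW = solD(3)[OF W]
		have "ip M (D k) ps = ip M (f k) W - ip M g W" for k
			using solD(5)[OF so[of k] solD(1)[OF W]] solD(5)[OF W solD(1)[OF so[of k]]] ip_commute[of M GW "GD k"] ip_commute[of M ps "D k"]
			by (simp add: ip_diff_left[OF f(1) g sW])
		thus ?thesis using tendsto_diff[OF l[OF sW] tendsto_const[of "ip M g W"]] by simp
	qed
	have L1: "(%k. \<integral>x. abs (D k x) \<partial>M) ----> 0"
	proof (rule LIMSEQ_I)
		fix e :: real assume e: "e > 0"
		define C where "C = dsize * (2 * dsize * c) + 1"
		have C: "C > 0" using c0 by (simp add: C_def add_nonneg_pos)
		obtain n where n: "1 / real (Suc n) < e / (2 * C)" using nat_approx_posE[of "e / (2 * C)"] e C by (metis divide_pos_pos mult_pos_pos zero_less_numeral)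
		define k where "k = kern (1 / real (Suc n))"
		obtain K where K: "K > 0" "!!x. abs (k x) <= K" using smooth_cs_bounded[OF kern_n(1)] unfolding k_def by blast
		have km: "sqi M (%y. k (x - y))" for x
		proof (rule bounded_sqi)
			show "norm (k (x - y)) <= K" for y using K(2) by simp
			have "(%y. k (x - y)) : bm borel" unfolding k_def by measurable
			thus "(%y. k (x - y)) : bm M" by (rule borel_M)
		qed
		have mk: "mo n (D j) x = ip M (D j) (%y. k (x - y))" for j x by (simp add: mo_def conv_def ip_def k_def)
		have mb: "abs (mo n (D j) x) <= ((2 * dsize)^2 * c) * (K * dsize)" for j x
		proof -
			have "abs (mo n (D j) x) <= n2 M (D j) * n2 M (%y. k (x - y))" unfolding mk by (rule ip_Cauchy_Schwarz[OF sD km])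
			also have "n2 M (%y. k (x - y)) <= n2 M (%y. K * 1)" using K by (intro n2_mono km sqi_const AE_I2) auto
			also have "... = K * dsize" unfolding dsize_def using K(1) by (subst n2_cmult) simp
			also have "n2 M (D j) <= (2 * dsize)^2 * c"
				using sol_estimate(2)[OF so fg, of j] mult_left_mono[OF fgc[of j], of "(2 * dsize)^2"] by simp
			finally show ?thesis using K(1) by (simp add: mult_left_mono mult_right_mono)
		qed
		have "(%j. \<integral>x. abs (mo n (D j) x) \<partial>M) ----> (LINT x|M. 0)"
		proof (rule integral_dominated_convergence[where w = "%x. ((2 * dsize)^2 * c) * (K * dsize)"])
			show "AE x in M. (%j. abs (mo n (D j) x)) ----> 0"
				unfolding mk using wk[OF km] by (intro AE_I2 tendsto_rabs_zero)
			show "AE x in M. norm (abs (mo n (D j) x)) <= ((2 * dsize)^2 * c) * (K * dsize)" for j using mb by simp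
			show "(%x. abs (mo n (D j) x)) : bm M" for j using mo_integrable[OF iD[of j], of n] by measurable
		qed auto
		then obtain J where J: "!!j. j >= J ==> (LINT x|M. abs (mo n (D j) x)) < e / 2"
			using LIMSEQ_D[of _ "0::real" "e / 2"] e by fastforce
		have "norm ((LINT x|M. abs (D j x)) - 0) < e" if "j >= J" for j
		proof -
			have "(LINT x|M. abs (D j x)) <= (LINT x|M. abs (D j x - mo n (D j) x) + abs (mo n (D j) x))"
				using iD[of j] mo_integrable[OF iD[of j], of n] by (intro integral_mono bi_i_add integrable_abs bi_i_diff) auto
			also have "... = (LINT x|M. abs (D j x - mo n (D j) x)) + (LINT x|M. abs (mo n (D j) x))"
				using iD[of j] mo_integrable[OF iD[of j], of n] by (intro bi_add integrable_abs bi_i_diff)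
			also have "... < 1 / Suc n * (dsize * n2 M (GD j)) + e / 2" using Z_mo_L1[OF solD(1)[OF so[of j]], of n] J[OF that] by linarith
			also have "1 / Suc n * (dsize * n2 M (GD j)) <= 1 / Suc n * C"
				using mult_left_mono[OF GDb[of j] dsize_nonneg] by (intro mult_left_mono) (auto simp: C_def)
			also have "1 / Suc n * C <= e / (2 * C) * C" using n C by (intro mult_right_mono) auto
			also have "e / (2 * C) * C = e / 2" using C by simp
			finally have "(LINT x|M. abs (D j x)) < e" by simp
			moreover have "0 <= (LINT x|M. abs (D j x))" by simp
			ultimately show ?thesis by simp
		qed
		thus "EX J. ALL j>=J. norm ((LINT x|M. abs (D j x)) - 0) < e" by blast
	qed
	have Dsq: "(n2 M (D k))^2 <= (16 * dsize * c) * (LINT x|M. abs (D k x))" for k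
	proof -
		have h: "16 * dsize * n2 M (%x. f k x - g x) <= 16 * dsize * c" using fgc[of k] by (intro mult_left_mono) auto
		have sm: "sol (%x. - (f k x - g x)) (%x. - D k x) (%x. - GD k x)" using sol_lin[OF so so fg fg, of 0 k "-1" k] by simp
		have b: "AE x in M. abs (D k x) <= 16 * dsize * c"
			using stampacchia_upper[OF so fg, of k] stampacchia_upper[OF sm sqi_uminus[OF fg], unfolded n2_uminus] by eventually_elim (use h in linarith)
		have "AE x in M. (norm (D k x))^2 <= (16 * dsize * c) * abs (D k x)"
			using b
		proof eventually_elim
			case (elim x)
			from mult_right_mono[OF elim abs_ge_zero[of "D k x"]] show ?case by (simp add: power2_eq_square)
		qed
		hence "(LINT x|M. (norm (D k x))^2) <= (LINT x|M. (16 * dsize * c) * abs (D k x))"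
			using iD[of k] by (intro integral_mono_AE sqi_integrable[OF sD]) auto
		thus ?thesis by (simp add: n2_sq ip_self)
	qed
	have sq: "a ----> 0" if "b ----> 0" "!!k. 0 <= a k" "!!k. (a k)^2 <= b k" for a b :: "nat => real"
	proof -
		have "(%k. sqrt (b k)) ----> sqrt 0" using that(1) by (rule tendsto_real_sqrt)
		thus ?thesis using that by (intro tendsto0_le[of "%k. sqrt (b k)" a]) (auto intro: real_le_rsqrt)
	qed
	show V: "(%k. n2 M (%x. V k x - V' x)) ----> 0"
		unfolding D_def[symmetric] by (rule sq[OF _ n2_nonneg Dsq]) (use tendsto_mult_left[OF L1, of "16 * dsize * c"] in simp)
	have GDsq: "(n2 M (GD k))^2 <= c * n2 M (D k)" for k
	proof -
		have "(n2 M (GD k))^2 <= n2 M (%x. f k x - g x) * n2 M (D k)"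
			using solD(5)[OF so solD(1)[OF so], of k] ip_Cauchy_Schwarz[OF fg sD, of k k] by (simp add: n2_sq)
		thus ?thesis using mult_right_mono[OF fgc[of k] n2_nonneg[of M "D k"]] by linarith
	qed
	show "(%k. n2 M (%x. GV k x - GV' x)) ----> 0"
		unfolding GD_def[symmetric] by (rule sq[OF _ n2_nonneg GDsq]) (use tendsto_mult_left[OF V, of c] in \<open>simp add: D_def[abs_def]\<close>)
qed

end

section \<open>Auxiliary facts for limits of convex combinations\<close>

lemma combo_Pair: "combo N c (%k z. (f k z, h k z)) z = (combo N c f z, combo N c h z)"
	by (simp add: combo_def sum_prod[symmetric])

lemma combo_Pair_tendsto:
	fixes f :: "nat => 'a => 'b::euclidean_space" and h :: "nat => 'a => 'c::euclidean_space"
	assumes f: "!!k. sqi M (f k)" and h: "!!k. sqi M (h k)" and G: "sqi M G"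
		and l: "(%n. n2 M (%x. combo (N n) (c n) (%k z. (f k z, h k z)) x - G x)) ----> 0"
	shows "sqi M (%x. fst (G x))" "sqi M (%x. snd (G x))"
		"(%n. n2 M (%x. combo (N n) (c n) f x - fst (G x))) ----> 0" "(%n. n2 M (%x. combo (N n) (c n) h x - snd (G x))) ----> 0"
proof -
	have "sqi M (%x. (fst (G x), snd (G x)))" using G by simp
	thus s: "sqi M (%x. fst (G x))" "sqi M (%x. snd (G x))" unfolding sqi_Pair_iff by auto
	have d: "sqi M (%x. combo (N n) (c n) f x - fst (G x))" "sqi M (%x. combo (N n) (c n) h x - snd (G x))" for n
		using s f h by (auto intro!: sqi_diff sqi_combo)
	have e: "combo (N n) (c n) (%k z. (f k z, h k z)) x - G x = (combo (N n) (c n) f x - fst (G x), combo (N n) (c n) h x - snd (G x))" for n x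
		by (simp add: combo_Pair prod_eq_iff)
	show "(%n. n2 M (%x. combo (N n) (c n) f x - fst (G x))) ----> 0" "(%n. n2 M (%x. combo (N n) (c n) h x - snd (G x))) ----> 0"
		using l n2_Pair_tendsto[OF d] unfolding e by auto
qed

lemma ip_combo: "(!!k. sqi M (f k)) ==> sqi M h ==> ip M (combo N c f) h = (\<Sum>k<N. c k * ip M (f k) h)"
	unfolding combo_def by (subst ip_sum_left) auto

lemma sqi_eq_weak:
	assumes s: "sqi M f" "sqi M g" and e: "!!ps. sqi M ps ==> ip M f ps = ip M g ps" shows "AE x in M. f x = g x"
proof -
	have d: "sqi M (%x. f x - g x)" using s by auto
	have "(n2 M (%x. f x - g x))^2 = 0" using e[OF d] ip_diff_left[OF s d] by (simp add: n2_sq)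
	hence "n2 M (%x. f x - g x) = 0" by simp
	from n2_eq_0[OF d this] show ?thesis by simp
qed

context bdom
begin

lemma Hg_sum:
	"(!!k. k < K ==> Hg (f k) (g k)) ==> Hg (%x. \<Sum>k<(K::nat). a k * f k x) (%x. \<Sum>k<K. a k *R g k x)"
proof (induction K)
	case 0
	show ?case using Hg_const[of 0] by simp
next
	case (Suc K)
	show ?case using Hg_add[OF Suc.IH Hg_cmult[OF Suc.prems[of K], of "a K"]] Suc.prems by simp
qed

lemma sol_AE_cong:
	assumes s: "sol f V GV" and m: "sqi M f" "sqi M f'" "sqi M V'" "sqi M GV'"
		and e: "AE x in M. f x = f' x" "AE x in M. V x = V' x" "AE x in M. GV x = GV' x"
	shows "sol f' V' GV'"
	unfolding sol_def
proof (intro conjI allI impI)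
	note m = m[THEN sqi_m]
	show "Z V' GV'" by (rule Z_cong[OF solD(1)[OF s] m(3,4) e(2,3)])
	fix W GW assume Z: "Z W GW"
	note zm = HgD(1,2)[OF Z_H1[OF Z], THEN sqi_m]
	show "ip M GV' GW = - ip M f' W"
		using solD(5)[OF s Z] ip_cong_AE[OF sqi_m[OF solD(4)[OF s]] m(4) zm(2) e(3)] ip_cong_AE[OF m(1,2) zm(1) e(1)] by simp
qed

end

section \<open>Existence of approximate solutions\<close>

context sbdom
begin

text \<open>B is fixed before the accuracy e. Mollifying the datum gives H^1 initial values whose
  mass and L^2 norm are controlled independently of e; their gradients are not, so the time step is
  adapted to them.\<close>

lemma appr_exists:
	obtains et where "et > 0" "!!T u0. 0 < T ==> sqi M u0 ==> AE x in M. 0 <= u0 x ==> (LINT x|M. abs (u0 x)) <= et ==>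
		EX B. ALL e>0. EX W GW F ub gb V GV. stdom.appr Om T B e u0 W GW F ub gb V GV"
proof -
	obtain et where et: "et > 0"
		and bd: "!!T R. EX B>=0. ALL N ta u g V GV. rothe ta u g V GV --> rothe_data et R T N ta (u 0) (g 0) --> rothe_bd B N ta u g V GV"
		by (rule rothe_bounds) blast
	show thesis
	proof (rule that[OF et])
		fix T :: real and u0 :: "real^2 => real"
		assume T: "0 < T" and u0: "sqi M u0" "AE x in M. 0 <= u0 x" and mass: "(LINT x|M. abs (u0 x)) <= et"
		interpret stdom Om T by unfold_locales (rule T)
		obtain B where B: "B >= 0" "!!N ta u g V GV. rothe ta u g V GV ==> rothe_data et (n2 M u0 + 1) T N ta (u 0) (g 0) ==> rothe_bd B N ta u g V GV"
			using bd[of "n2 M u0 + 1" T] by blast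
		\<comment> \<open>The datum is nonnegative only almost everywhere, while the scheme requires
		  nonnegativity at every point.\<close>
		define v where "v x = max 0 (u0 x)" for x
		have [measurable]: "u0 : bm M" using u0(1) by (rule sqi_m)
		have uv: "AE x in M. u0 x = v x" using u0(2) by eventually_elim (simp add: v_def)
		have v: "sqi M v" by (rule sqi_cong_AE[OF u0(1) _ uv]) (simp add: v_def[abs_def])
		note vi = sqi_imp_integrable[OF v]
		have mv: "(LINT x|M. abs (v x)) <= et"
		proof -
			have "(LINT x|M. abs (v x)) = (LINT x|M. abs (u0 x))"
				using uv by (intro integral_cong_AE) (auto simp: v_def[abs_def] elim: eventually_mono)
			thus ?thesis using mass by simp
		qed
		have "EX W GW F ub gb V GV. appr (B + 2 * sqrt B + sqrt T * (B + 2 * dsize * B + (2 * dsize)^2 * B)) e u0 W GW F ub gb V GV" if e: "e > 0" for e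
		proof -
			obtain n where n: "n2 M (%x. mo n v x - v x) < min e 1" using LIMSEQ_D[OF mo_tendsto_L2[OF v], of "min e 1"] e by auto
			define a where "a = mo n v"
			define ga where "ga = grad a"
			have aH: "Hg a ga" unfolding a_def ga_def by (rule smooth_cs_H1_conv[OF vi])
			note sa = HgD(1)[OF aH]
			have a0: "0 <= a x" for x
				using mo_mono[of "%x. 0" v n x] vi by (simp add: a_def v_def mo_def conv_def)
			obtain c where c: "!!x. abs (a x) <= c" using conv_bounded[OF vi kern_n(1)] unfolding a_def mo_def by blast
			have ac: "a x <= c" for x using c[of x] by simp
			have am: "(LINT x|M. a x) <= et" using mo_L1[OF vi, of n] mv a0 by (simp add: a_def)
			have an: "n2 M a <= n2 M u0 + 1"
				using n2_triangle[OF sqi_diff[OF sa v] v] n n2_cong_AE[of u0 M v] uv v[THEN sqi_m] by (simp add: a_def)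
			have ae: "n2 M (%x. a x - u0 x) <= e"
			proof -
				have "n2 M (%x. a x - u0 x) = n2 M (%x. a x - v x)"
					using uv sa v[THEN sqi_m] by (intro n2_cong_AE) (auto dest: sqi_m elim: eventually_mono)
				thus ?thesis using n by (simp add: a_def)
			qed
			\<comment> \<open>The three summands enforce ta <= 1, ta * |ga|^2 <= 1 and B * ta <= e^2.\<close>
			define S where "S = 1 + (n2 M ga)^2 + (B + 1) / e^2"
			have S: "S >= 1" "(n2 M ga)^2 <= S" "(B + 1) / e^2 <= S" using B(1) e by (auto simp: S_def)
			obtain N0 :: nat where N0: "T * S < N0" using reals_Archimedean2 by blast
			have "0 < T * S" using T S by simp
			hence Npos: "0 < real N0" using N0 by linarith
			define ta where "ta = T / N0"
			have ta: "ta > 0" "ta * N0 = T" using T Npos by (auto simp: ta_def)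
			have taS: "ta * S <= 1" using N0 Npos by (simp add: ta_def divide_le_eq)
			have ta1: "ta <= 1" using taS mult_left_mono[OF S(1), of ta] ta(1) by linarith
			have tag: "ta * (n2 M ga)^2 <= 1" using taS mult_left_mono[OF S(2), of ta] ta(1) by linarith
			have "ta * ((B + 1) / e^2) <= 1" using taS mult_left_mono[OF S(3), of ta] ta(1) by linarith
			hence "B * ta <= e^2" using e ta(1) by (simp add: field_simps)
			hence "sqrt (B * ta) <= sqrt (e^2)" by (rule real_sqrt_le_mono)
			hence tae: "sqrt B * sqrt ta <= e" using e by (simp add: real_sqrt_mult)
			obtain u g V GV where r: "rothe ta u g V GV" "u 0 = a" "g 0 = ga" by (rule rothe_exists[OF aH a0 ac ta(1)])
			interpret grid Om T ta N0 by unfold_locales (use ta in auto)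
			have b: "rothe_bd B N0 ta u g V GV"
				by (rule B(2)[OF r(1)]) (use am an ta ta1 tag in \<open>auto simp: r rothe_data_def\<close>)
			have "n2 M (%x. u 0 x - u0 x) <= e" using ae by (simp add: r(2))
			from rothe_appr[OF r(1) b tae this] show ?thesis by blast
		qed
		thus "EX B. ALL e>0. EX W GW F ub gb V GV. appr B e u0 W GW F ub gb V GV" by blast
	qed
qed

end

section \<open>Passage to the limit\<close>

locale appr_seq = stdom +
	fixes B :: real and e u0 W GW F ub gb V GV
	assumes ap: "!!k :: nat. appr B (e k) u0 (W k) (GW k) (F k) (ub k) (gb k) (V k) (GV k)"
		and e0: "e ----> 0" and u0: "sqi M u0" and Fw: "!!y. sqi ST y ==> convergent (%k. ip ST (F k) y)"
begin

lemma apD: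
	"sqi ST (GW k)" "sqi ST (F k)" "sqi ST (ub k)" "sqi ST (gb k)" "sqi ST (V k)" "sqi ST (GV k)"
	"n2 ST (GW k) <= B" "n2 ST (F k) <= B" "n2 ST (ub k) <= B" "n2 ST (gb k) <= B" "n2 ST (V k) <= B" "n2 ST (GV k) <= B"
	"n2 M (%x. W k (0, x) - u0 x) <= e k"
	using ap[of k] unfolding appr_def by auto

lemmas ap7 = ap[unfolded appr_def, THEN conjunct2, THEN conjunct2, THEN conjunct2, THEN conjunct2, THEN conjunct2, THEN conjunct2]

lemma apt:
	assumes "0 <= t" "t <= T"
	shows "Hg (%x. W k (t, x)) (%x. GW k (t, x))" "sqi M (%x. W k (t, x))" "n2 M (%x. W k (t, x)) <= B"
		"Hg ph gph ==> ip M (%x. W k (t, x)) ph = ip M (%x. W k (0, x)) ph - ip ST (F k) (tn (ind 0 t) gph)"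
proof -
	have "t : {0..T}" using assms by simp
	thus *: "Hg (%x. W k (t, x)) (%x. GW k (t, x))" "n2 M (%x. W k (t, x)) <= B"
		"Hg ph gph ==> ip M (%x. W k (t, x)) ph = ip M (%x. W k (0, x)) ph - ip ST (F k) (tn (ind 0 t) gph)"
		using ap7[THEN conjunct1, rule_format, of t k] by blast+
	show "sqi M (%x. W k (t, x))" by (rule HgD(1)[OF *(1)])
qed

lemma apo:
	assumes "0 < t" "t < T"
	shows "Hg (%x. ub k (t, x)) (%x. gb k (t, x))" "n2 M (%x. ub k (t, x)) <= B" "sqi M (%x. ub k (t, x) *R GV k (t, x))"
		"F k (t, x) = gb k (t, x) + ub k (t, x) *R GV k (t, x)"
		"Hg ph gph ==> abs (ip M (%x. ub k (t, x)) ph - ip M (%x. W k (t, x)) ph) <= e k * n2 M gph"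
		"EX f. sqi M f & n2 M f <= B & sol f (%x. V k (t, x)) (%x. GV k (t, x)) &
				(ALL ph gph. Hg ph gph --> abs (ip M f ph - ip M (%x. W k (t, x)) ph) <= e k * n2 M gph)"
proof -
	have "t : {0<..<T}" using assms by simp
	thus "Hg (%x. ub k (t, x)) (%x. gb k (t, x))" "n2 M (%x. ub k (t, x)) <= B" "sqi M (%x. ub k (t, x) *R GV k (t, x))"
		"F k (t, x) = gb k (t, x) + ub k (t, x) *R GV k (t, x)"
		"Hg ph gph ==> abs (ip M (%x. ub k (t, x)) ph - ip M (%x. W k (t, x)) ph) <= e k * n2 M gph"
		"EX f. sqi M f & n2 M f <= B & sol f (%x. V k (t, x)) (%x. GV k (t, x)) &
				(ALL ph gph. Hg ph gph --> abs (ip M f ph - ip M (%x. W k (t, x)) ph) <= e k * n2 M gph)"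
		using ap7[THEN conjunct2, THEN conjunct2, THEN conjunct2, rule_format, of t k] by blast+
qed

lemma lip_ex: "EX K. ALL s t. 0 <= s --> s <= t --> t <= T -->
		n2 M (%x. W k (t, x) - W k (s, x)) <= K * (t - s) & n2 M (%x. GW k (t, x) - GW k (s, x)) <= K * (t - s)"
	using ap7[THEN conjunct2, THEN conjunct1] .

lemma combo_lip:
	"EX C. ALL s t. 0 <= s --> s <= t --> t <= T -->
		n2 M (%x. combo K a W (t, x) - combo K a W (s, x)) <= C * (t - s) & n2 M (%x. combo K a GW (t, x) - combo K a GW (s, x)) <= C * (t - s)"
proof -
	have "ALL k. EX K. ALL s t. 0 <= s --> s <= t --> t <= T -->
		n2 M (%x. W k (t, x) - W k (s, x)) <= K * (t - s) & n2 M (%x. GW k (t, x) - GW k (s, x)) <= K * (t - s)" using lip_ex by blast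
	from choice[OF this] obtain C where C: "!!k s t. 0 <= s ==> s <= t ==> t <= T ==>
		n2 M (%x. W k (t, x) - W k (s, x)) <= C k * (t - s) & n2 M (%x. GW k (t, x) - GW k (s, x)) <= C k * (t - s)" by blast
	have g: "n2 M (%x. combo K a f (t, x) - combo K a f (s, x)) <= (\<Sum>k<K. abs (a k) * C k) * (t - s)"
		if s: "!!k. sqi M (%x. f k (t, x))" "!!k. sqi M (%x. f k (s, x))" and l: "!!k. n2 M (%x. f k (t, x) - f k (s, x)) <= C k * (t - s)"
		for s t and f :: "nat => real \<times> (real^2) => 'z::euclidean_space"
	proof -
		have e: "(%x. combo K a f (t, x) - combo K a f (s, x)) = (%x. \<Sum>k<K. a k *R (f k (t, x) - f k (s, x)))"
			by (simp add: combo_def sum_subtractf[symmetric] scaleR_diff_right)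
		have "n2 M (%x. combo K a f (t, x) - combo K a f (s, x)) <= (\<Sum>k<K. n2 M (%x. a k *R (f k (t, x) - f k (s, x))))"
			unfolding e using s by (intro n2_sum_le sqi_scaleR sqi_diff)
		also have "... <= (\<Sum>k<K. abs (a k) * (C k * (t - s)))"
		proof (intro sum_mono)
			show "n2 M (%x. a k *R (f k (t, x) - f k (s, x))) <= abs (a k) * (C k * (t - s))" for k
				using mult_left_mono[OF l abs_ge_zero[of "a k"]] by simp
		qed
		finally show ?thesis by (simp add: sum_distrib_right mult.assoc)
	qed
	have "n2 M (%x. combo K a W (t, x) - combo K a W (s, x)) <= (\<Sum>k<K. abs (a k) * C k) * (t - s)"
		"n2 M (%x. combo K a GW (t, x) - combo K a GW (s, x)) <= (\<Sum>k<K. abs (a k) * C k) * (t - s)" if "0 <= s" "s <= t" "t <= T" for s t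
		using C[OF that] apt(2)[of t] apt(2)[of s] HgD(2)[OF apt(1), of t] HgD(2)[OF apt(1), of s] that by (intro g; auto)+
	thus ?thesis by blast
qed

text \<open>The equation linking W and F is linear, whatever the nonlinear origin of F, so the
  energy inequality holds for combinations with arbitrary real weights, in particular for
  differences of two convex combinations.\<close>

lemma combo_energy:
	assumes t: "0 <= t" "t <= T"
	shows "(n2 M (%x. combo K a W (t, x)))^2 <= (n2 M (%x. combo K a W (0, x)))^2 + 2 * n2 ST (combo K a F) * n2 ST (combo K a GW)"
proof -
	obtain C where C: "!!s t. 0 <= s ==> s <= t ==> t <= T ==> n2 M (%x. combo K a GW (t, x) - combo K a GW (s, x)) <= C * (t - s)"
		using combo_lip[where K = K and a = a] by blast
	show ?thesis
	proof (rule energy_ineq[where v = "%t x. combo K a W (t, x)" and K = C])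
		show "Hg (%x. combo K a W (t, x)) (%x. combo K a GW (t, x))" if "0 <= t" "t <= T" for t
			using Hg_sum[OF apt(1)[OF that], where K = K and a = a] by (simp add: combo_def)
		show "sqi ST (combo K a GW)" "sqi ST (combo K a F)" using apD by (auto intro!: sqi_combo)
		show "ip M (%x. combo K a W (t, x)) ph = ip M (%x. combo K a W (0, x)) ph - ip ST (combo K a F) (tn (ind 0 t) gph)"
			if t: "0 <= t" "t <= T" and ph: "Hg ph gph" for t ph gph
		proof -
			have c: "ip M (%x. combo K a W (s, x)) ph = (\<Sum>k<K. a k * ip M (%x. W k (s, x)) ph)" if "0 <= s" "s <= T" for s
				using ip_combo[OF apt(2)[OF that] HgD(1)[OF ph], where N = K and c = a] by (simp add: combo_def)
			have "ip ST (combo K a F) (tn (ind 0 t) gph) = (\<Sum>k<K. a k * ip ST (F k) (tn (ind 0 t) gph))"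
				by (rule ip_combo[OF apD(2) tn_sqi(1)[OF indicator_L(1) HgD(2)[OF ph]]])
			thus ?thesis using c[OF t] c[of 0] T_pos apt(4)[OF t ph] by (simp add: right_diff_distrib sum_subtractf)
		qed
	qed (use C t in auto)
qed

end

text \<open>Mazur's lemma provides strongly convergent convex combinations of the approximate solutions.\<close>
locale mazur_seq = appr_seq +
	fixes N c G
	assumes tw: "!!n :: nat. tail_weights n (N n) (c n)" and G: "sqi ST G"
		and Gl: "(%n. n2 ST (%z. combo (N n) (c n) (%k z. (GW k z, F k z, ub k z, gb k z, V k z, GV k z)) z - G z)) ----> 0"
begin

definition Phi where "Phi z = fst (snd (G z))"
definition u where "u z = fst (snd (snd (G z)))"
definition g where "g z = fst (snd (snd (snd (G z))))"
definition V' where "V' z = fst (snd (snd (snd (snd (G z)))))"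
definition GV' where "GV' z = snd (snd (snd (snd (snd (G z)))))"

abbreviation cb where "cb n \<equiv> combo (N n) (c n)"

text \<open>The embedding \<open>io\<close> lets one statement serve space-time, with
  \<open>io\<close> the identity, and single time slices, with \<open>io\<close> sending x to (t,
  x).\<close>

lemma comps:
	fixes mu :: "'s measure"
	assumes "!!k. sqi mu (%x. GW k (io x))" "!!k. sqi mu (%x. F k (io x))" "!!k. sqi mu (%x. ub k (io x))"
		"!!k. sqi mu (%x. gb k (io x))" "!!k. sqi mu (%x. V k (io x))" "!!k. sqi mu (%x. GV k (io x))" "sqi mu (%x. G (io x))"
		and l: "(%n. n2 mu (%x. combo (N (r n)) (c (r n)) (%k z. (GW k z, F k z, ub k z, gb k z, V k z, GV k z)) (io x) - G (io x))) ----> 0"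
	shows "sqi mu (%x. fst (G (io x)))" "sqi mu (%x. Phi (io x))" "sqi mu (%x. u (io x))" "sqi mu (%x. g (io x))" "sqi mu (%x. V' (io x))" "sqi mu (%x. GV' (io x))"
		"(%n. n2 mu (%x. cb (r n) GW (io x) - fst (G (io x)))) ----> 0" "(%n. n2 mu (%x. cb (r n) F (io x) - Phi (io x))) ----> 0"
		"(%n. n2 mu (%x. cb (r n) ub (io x) - u (io x))) ----> 0" "(%n. n2 mu (%x. cb (r n) gb (io x) - g (io x))) ----> 0"
		"(%n. n2 mu (%x. cb (r n) V (io x) - V' (io x))) ----> 0" "(%n. n2 mu (%x. cb (r n) GV (io x) - GV' (io x))) ----> 0"
proof -
	have sh: "combo n d (%k x. f k (io x)) = (%x. combo n d f (io x))" for n d and f :: "nat => real \<times> (real^2) => 'z::real_vector"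
		by (simp add: combo_def)
	note P = sqi_Pair_iff[THEN iffD2, OF conjI]
	note s5 = P[OF assms(5,6)]
	note s4 = P[OF assms(4) s5]
	note s3 = P[OF assms(3) s4]
	note s2 = P[OF assms(2) s3]
	have l': "(%n. n2 mu (%x. combo (N (r n)) (c (r n)) (%k x. (GW k (io x), F k (io x), ub k (io x), gb k (io x), V k (io x), GV k (io x))) x - G (io x))) ----> 0"
		using l by (simp add: combo_def)
	note 1 = combo_Pair_tendsto[OF assms(1) s2 assms(7) l']
	note 2 = combo_Pair_tendsto[OF assms(2) s3 1(2,4)]
	note 3 = combo_Pair_tendsto[OF assms(3) s4 2(2,4)]
	note 4 = combo_Pair_tendsto[OF assms(4) s5 3(2,4)]
	note 5 = combo_Pair_tendsto[OF assms(5,6) 4(2,4)]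
	note d = Phi_def[symmetric] u_def[symmetric] g_def[symmetric] V'_def[symmetric] GV'_def[symmetric] sh
	show "sqi mu (%x. fst (G (io x)))" "(%n. n2 mu (%x. cb (r n) GW (io x) - fst (G (io x)))) ----> 0"
		using 1(1,3) unfolding d .
	show "sqi mu (%x. Phi (io x))" "(%n. n2 mu (%x. cb (r n) F (io x) - Phi (io x))) ----> 0"
		using 2(1,3) unfolding d .
	show "sqi mu (%x. u (io x))" "(%n. n2 mu (%x. cb (r n) ub (io x) - u (io x))) ----> 0"
		using 3(1,3) unfolding d .
	show "sqi mu (%x. g (io x))" "(%n. n2 mu (%x. cb (r n) gb (io x) - g (io x))) ----> 0"
		using 4(1,3) unfolding d .
	show "sqi mu (%x. V' (io x))" "(%n. n2 mu (%x. cb (r n) V (io x) - V' (io x))) ----> 0"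
		using 5(1,3) unfolding d .
	show "sqi mu (%x. GV' (io x))" "(%n. n2 mu (%x. cb (r n) GV (io x) - GV' (io x))) ----> 0"
		using 5(2,4) unfolding d .
qed

lemmas ST_comps = comps[where mu = ST and io = "%x. x" and r = "%n. n", OF apD(1-6) G Gl]

text \<open>The energy inequality for the difference of two combinations involves only initial
  values and space-time norms, which are Cauchy; the bound is therefore uniform in t.\<close>

lemma uniform_Cauchy:
	assumes ep: "ep > 0"
	shows "EX J. ALL i>=J. ALL j>=J. ALL t:{0..T}. n2 M (%x. cb i W (t, x) - cb j W (t, x)) <= ep"
proof -
	define a where "a n = n2 ST (%z. cb n F z - Phi z)" for n
	define b where "b n = n2 ST (%z. cb n GW z - fst (G z))" for n
	define d where "d n = n2 M (%x. cb n W (0, x) - u0 x)" for n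
	have s0: "sqi M (%x. W k (0, x))" for k using apt(2)[of 0] T_pos by simp
	have d0: "d ----> 0"
	proof -
		have "(%k. n2 M (%x. W k (0, x) - u0 x)) ----> 0" by (rule tendsto0_le[OF e0 n2_nonneg apD(13)])
		from combo_tendsto_n2[OF tw s0 u0 this] show ?thesis by (simp add: d_def[abs_def] combo_def)
	qed
	\<comment> \<open>The initial term and twice the product of the flux and gradient norms give (2q)^2
	  + 2 (2q)(2q) = 12 q^2, and q <= 1 turns this into 12 q <= ep^2.\<close>
	define q where "q = min 1 (ep^2 / 12)"
	have q: "q > 0" "q <= 1" "12 * q <= ep^2" using ep by (auto simp: q_def)
	have ex: "EX J. ALL i>=J. f i < q" if "f ----> 0" for f :: "nat => real" using order_tendstoD(2)[OF that q(1)] by (simp add: eventually_sequentially)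
	obtain J1 where J1: "!!i. i >= J1 ==> a i < q" using ex[OF ST_comps(8)] unfolding a_def by blast
	obtain J2 where J2: "!!i. i >= J2 ==> b i < q" using ex[OF ST_comps(7)] unfolding b_def by blast
	obtain J3 where J3: "!!i. i >= J3 ==> d i < q" using ex[OF d0] by blast
	note J = J1 J2 J3
	have "n2 M (%x. cb i W (t, x) - cb j W (t, x)) <= ep" if ij: "i >= max J1 (max J2 J3)" "j >= max J1 (max J2 J3)" and t: "t : {0..T}" for i j t
	proof -
		define K where "K = max (N i) (N j)"
		define w where "w k = c i k - c j k" for k
		have cw: "combo K w f z = cb i f z - cb j f z" for z and f :: "nat => real \<times> (real^2) => 'z::real_vector"
		proof -
			have K: "N i <= K" "N j <= K" by (auto simp: K_def)
			show ?thesis unfolding tail_weights_mono(2)[OF tw K(1), symmetric] tail_weights_mono(2)[OF tw K(2), symmetric]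
				by (simp add: combo_def w_def scaleR_diff_left sum_subtractf)
		qed
		have tri: "n2 mu (%x. f x - h x) <= n2 mu (%x. f x - y x) + n2 mu (%x. h x - y x)" if "sqi mu f" "sqi mu h" "sqi mu y"
			for mu :: "'s measure" and f h y :: "'s => 'z::euclidean_space"
			using n2_triangle3[OF that(1,3,2)] n2_minus_commute[of mu y h] by simp
		have sc: "sqi ST (cb n F)" "sqi ST (cb n GW)" for n using apD by (auto intro!: sqi_combo)
		have sw0: "sqi M (%x. cb n W (0, x))" for n using sqi_combo[of M "%k x. W k (0, x)", OF s0] by (simp add: combo_def)
		have 1: "n2 ST (combo K w F) <= 2 * q"
			using tri[OF sc(1)[of i] sc(1)[of j] ST_comps(2)] J(1)[of i] J(1)[of j] ij by (simp add: cw[abs_def] a_def)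
		have 2: "n2 ST (combo K w GW) <= 2 * q"
			using tri[OF sc(2)[of i] sc(2)[of j] ST_comps(1)] J(2)[of i] J(2)[of j] ij by (simp add: cw[abs_def] b_def)
		have 3: "n2 M (%x. combo K w W (0, x)) <= 2 * q"
			using tri[OF sw0[of i] sw0[of j] u0] J(3)[of i] J(3)[of j] ij by (simp add: cw d_def)
		have "(n2 M (%x. cb i W (t, x) - cb j W (t, x)))^2 <= (n2 M (%x. combo K w W (0, x)))^2 + 2 * (n2 ST (combo K w F) * n2 ST (combo K w GW))"
			using combo_energy[of t K w] t by (simp add: cw mult.assoc)
		also have "... <= (2 * q)^2 + 2 * ((2 * q) * (2 * q))"
			using 1 2 3 q by (intro add_mono power_mono mult_left_mono mult_mono) auto
		also have "... = 12 * (q * q)" by (simp add: power2_eq_square)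
		also have "... <= 12 * (q * 1)" using q by (intro mult_left_mono) auto
		also have "... <= ep^2" using q by simp
		finally show ?thesis by (rule power2_le_imp_le) (use ep in simp)
	qed
	thus ?thesis by blast
qed

lemma sW: "0 <= t ==> t <= T ==> sqi M (%x. cb n W (t, x))"
	using sqi_combo[of M "%k x. W k (t, x)", OF apt(2)] by (simp add: combo_def)

text \<open>A uniform limit of Lipschitz curves in L^2 is continuous, although the Lipschitz
  constants of the combinations may be unbounded.\<close>

lemma limit_curve:
	obtains U where "!!t. 0 <= t ==> t <= T ==> sqi M (U t)" "!!t. 0 <= t ==> t <= T ==> (%n. n2 M (%x. cb n W (t, x) - U t x)) ----> 0"
		"!!t. 0 <= t ==> t <= T ==> ((%s. n2 M (%x. U s x - U t x)) \<longlongrightarrow> 0) (at t within {0..T})"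
proof -
	have "EX U. sqi M U & (%n. n2 M (%x. cb n W (t, x) - U x)) ----> 0" if t: "0 <= t" "t <= T" for t
	proof (rule n2_complete[of M "%n x. cb n W (t, x)"])
		show "sqi M (%x. cb n W (t, x))" for n by (rule sW[OF t])
		show "n2_Cauchy M (%n x. cb n W (t, x))"
			unfolding n2_Cauchy_def
		proof (intro allI impI)
			fix ep :: real assume ep: "ep > 0"
			have "ep / 2 > 0" using ep by simp
			from uniform_Cauchy[OF this] obtain J where J: "!!i j t. i >= J ==> j >= J ==> t : {0..T} ==> n2 M (%x. cb i W (t, x) - cb j W (t, x)) <= ep / 2" by blast
			have "n2 M (%x. cb m W (t, x) - cb n W (t, x)) < ep" if "m >= J" "n >= J" for m n
				using J[OF that, of t] t ep by simp
			thus "EX N. ALL m>=N. ALL n>=N. n2 M (%x. cb m W (t, x) - cb n W (t, x)) < ep" by blast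
		qed
	qed blast
	hence "ALL t. EX U. 0 <= t --> t <= T --> sqi M U & (%n. n2 M (%x. cb n W (t, x) - U x)) ----> 0" by blast
	from choice[OF this] obtain U where U: "!!t. 0 <= t ==> t <= T ==> sqi M (U t)" "!!t. 0 <= t ==> t <= T ==> (%n. n2 M (%x. cb n W (t, x) - U t x)) ----> 0" by blast
	have "((%s. n2 M (%x. U s x - U t x)) \<longlongrightarrow> 0) (at t within {0..T})" if t: "0 <= t" "t <= T" for t
	proof (rule tendstoI)
		fix ep :: real assume ep: "ep > 0"
		have "ep / 4 > 0" using ep by simp
		from uniform_Cauchy[OF this] obtain J where J: "!!i j t. i >= J ==> j >= J ==> t : {0..T} ==> n2 M (%x. cb i W (t, x) - cb j W (t, x)) <= ep / 4" by blast
		have JU: "n2 M (%x. cb J W (s, x) - U s x) <= ep / 4" if s: "0 <= s" "s <= T" for s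
		proof (rule LIMSEQ_le_const)
			show "(%n. ep / 4 + n2 M (%x. cb n W (s, x) - U s x)) ----> ep / 4" using tendsto_add[OF tendsto_const U(2)[OF s]] by simp
			show "EX N. ALL n>=N. n2 M (%x. cb J W (s, x) - U s x) <= ep / 4 + n2 M (%x. cb n W (s, x) - U s x)"
			proof (intro exI[of _ J] allI impI)
				show "n2 M (%x. cb J W (s, x) - U s x) <= ep / 4 + n2 M (%x. cb n W (s, x) - U s x)" if "n >= J" for n
					using n2_triangle3[OF sW[OF s, of J] sW[OF s, of n] U(1)[OF s]] J[of J n s] that s by simp
			qed
		qed
		obtain C where C: "!!s t. 0 <= s ==> s <= t ==> t <= T ==> n2 M (%x. cb J W (t, x) - cb J W (s, x)) <= C * (t - s)"
			using combo_lip[where K = "N J" and a = "c J"] by blast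
		have est: "n2 M (%x. U s x - U t x) < ep" if s: "s : {0..T}" "dist s t < ep / (4 * (abs C + 1))" for s
		proof -
			have s': "0 <= s" "s <= T" using s by auto
			have "n2 M (%x. cb J W (s, x) - cb J W (t, x)) <= (abs C + 1) * abs (s - t)"
			proof (cases "s <= t")
				case True
				have "C * (t - s) <= (abs C + 1) * (t - s)" using True by (intro mult_right_mono) auto
				thus ?thesis using C[of s t] True s' t n2_minus_commute[of M "%x. cb J W (s, x)"] by simp
			next
				case False
				hence "C * (s - t) <= (abs C + 1) * (s - t)" by (intro mult_right_mono) auto
				moreover have "abs (s - t) = s - t" using False by simp
				moreover have ts: "t <= s" using False by simp
				ultimately show ?thesis using C[OF t(1) ts s'(2)] by linarith
			qed
			also have "... < ep / 4" using s(2) by (simp add: dist_real_def field_simps)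
			finally have m: "n2 M (%x. cb J W (s, x) - cb J W (t, x)) < ep / 4" .
			have "n2 M (%x. U s x - U t x) <= n2 M (%x. U s x - cb J W (s, x)) + (n2 M (%x. cb J W (s, x) - cb J W (t, x)) + n2 M (%x. cb J W (t, x) - U t x))"
				using n2_triangle3[OF U(1)[OF s'] sW[OF s', of J] U(1)[OF t]] n2_triangle3[OF sW[OF s', of J] sW[OF t, of J] U(1)[OF t]] by linarith
			thus ?thesis using m JU[OF s'] JU[OF t] n2_minus_commute[of M "U s" "%x. cb J W (s, x)"] ep by simp
		qed
		show "\<forall>\<^sub>F s in at t within {0..T}. dist (n2 M (%x. U s x - U t x)) 0 < ep"
			unfolding eventually_at
		proof (intro exI[of _ "ep / (4 * (abs C + 1))"] conjI ballI impI)
			show "0 < ep / (4 * (abs C + 1))" using ep by (simp add: add_nonneg_pos)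
		qed (use est in auto)
	qed
	with U show thesis by (rule that)
qed

end

locale lim_seq = mazur_seq + fixes U
	assumes sU: "!!t. 0 <= t ==> t <= T ==> sqi M (U t)"
		and Ul: "!!t. 0 <= t ==> t <= T ==> (%n. n2 M (%x. cb n W (t, x) - U t x)) ----> 0"
begin

lemma combo_weak:
	assumes f: "!!k. sqi mu (%x. f k (io x))" and ps: "sqi mu ps" and l: "(%k. ip mu (%x. f k (io x)) ps) ----> a"
	shows "(%n. ip mu (%x. cb n f (io x)) ps) ----> a"
proof -
	have "ip mu (%x. cb n f (io x)) ps = (\<Sum>k<N n. c n k * ip mu (%x. f k (io x)) ps)" for n
		using ip_combo[OF f ps, of "N n" "c n"] by (simp add: combo_def)
	thus ?thesis using combo_tendsto[OF tw l] by simp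
qed

lemma F_lim: assumes y: "sqi ST y" shows "(%k. ip ST (F k) y) ----> ip ST Phi y"
proof -
	obtain l where l: "(%k. ip ST (F k) y) ----> l" using Fw[OF y] by (auto simp: convergent_def)
	have "(%n. ip ST (cb n F) y) ----> l" using combo_weak[of ST F "%z. z", OF apD(2) y l] by simp
	moreover have "(%n. ip ST (cb n F) y) ----> ip ST Phi y"
		by (rule tendsto_ip_left[OF sqi_combo[OF apD(2)] ST_comps(2) y ST_comps(8)])
	ultimately show ?thesis using l LIMSEQ_unique by blast
qed

text \<open>Weak convergence of the flux, tested with \<open>tn (ind 0 t) gph\<close>, gives
  convergence of the solution at every t for the whole sequence; the convex combinations serve to
  identify the limit as U t.\<close>

lemma W_lim:
	assumes t: "0 <= t" "t <= T" and ph: "Hg ph gph"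
	shows "ip M (U t) ph = ip M u0 ph - ip ST Phi (tn (ind 0 t) gph)" "(%k. ip M (%x. W k (t, x)) ph) ----> ip M (U t) ph"
proof -
	note s = HgD(1,2)[OF ph]
	have T: "0 <= T" using T_pos by simp
	have "(%k. n2 M (%x. W k (0, x) - u0 x)) ----> 0" by (rule tendsto0_le[OF e0 n2_nonneg apD(13)])
	hence "(%k. ip M (%x. W k (0, x)) ph) ----> ip M u0 ph" by (rule tendsto_ip_left[OF apt(2)[OF order_refl T] u0 s(1)])
	from tendsto_diff[OF this F_lim[OF tn_sqi(1)[OF indicator_L(1) s(2)], of 0 t]]
	have l: "(%k. ip M (%x. W k (t, x)) ph) ----> ip M u0 ph - ip ST Phi (tn (ind 0 t) gph)" using apt(4)[OF t ph] by simp
	have "(%n. ip M (%x. cb n W (t, x)) ph) ----> ip M u0 ph - ip ST Phi (tn (ind 0 t) gph)"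
		by (rule combo_weak[where mu = M and io = "%x. (t, x)" and f = W, OF apt(2)[OF t] s(1) l])
	moreover have "(%n. ip M (%x. cb n W (t, x)) ph) ----> ip M (U t) ph"
		by (rule tendsto_ip_left[OF sW[OF t] sU[OF t] s(1) Ul[OF t]])
	ultimately show "ip M (U t) ph = ip M u0 ph - ip ST Phi (tn (ind 0 t) gph)" by (rule LIMSEQ_unique[rotated])
	with l show "(%k. ip M (%x. W k (t, x)) ph) ----> ip M (U t) ph" by simp
qed

text \<open>Closeness to W is known only against H^1 functions and with their gradient norm;
  boundedness in L^2 extends it to all L^2 test functions.\<close>

lemma near_weak:
	assumes t: "0 <= t" "t <= T" and f: "!!k. sqi M (f k)" "!!k. n2 M (f k) <= B"
		and c: "!!k ph gph. Hg ph gph ==> abs (ip M (f k) ph - ip M (%x. W k (t, x)) ph) <= e k * n2 M gph" and ps: "sqi M ps"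
	shows "(%k. ip M (f k) ps) ----> ip M (U t) ps"
proof (rule weak_limit_dense[OF f sU[OF t] _ ps])
	fix n and ps :: "real^2 => real" assume "sqi M ps"
	hence H: "Hg (mo n ps) (grad (mo n ps))" by (intro smooth_cs_H1_conv sqi_imp_integrable)
	have "(%k. e k * n2 M (grad (mo n ps))) ----> 0" using tendsto_mult_right[OF e0] by simp
	hence "(%k. abs (ip M (f k) (mo n ps) - ip M (%x. W k (t, x)) (mo n ps))) ----> 0"
		by (rule tendsto0_le[OF _ abs_ge_zero c[OF H]])
	from tendsto_add[OF W_lim(2)[OF t H] tendsto_rabs_zero_cancel[OF this]]
	show "(%k. ip M (f k) (mo n ps)) ----> ip M (U t) (mo n ps)" by simp
qed

text \<open>The weak limit U t of the data is already known, so the potentials converge strongly for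
  the full sequence and no subsequence depending on t is extracted.\<close>

lemma slice_limit:
	assumes t: "0 < t" "t < T"
	obtains Vt Gt where "sol (U t) Vt Gt" "!!k. sqi M (%x. V k (t, x))" "!!k. sqi M (%x. GV k (t, x))"
		"(%k. n2 M (%x. V k (t, x) - Vt x)) ----> 0" "(%k. n2 M (%x. GV k (t, x) - Gt x)) ----> 0"
proof -
	have t': "0 <= t" "t <= T" using t by auto
	have "ALL k. EX f. sqi M f & n2 M f <= B & sol f (%x. V k (t, x)) (%x. GV k (t, x)) &
				(ALL ph gph. Hg ph gph --> abs (ip M f ph - ip M (%x. W k (t, x)) ph) <= e k * n2 M gph)" using apo(6)[OF t] by blast
	from choice[OF this] obtain f where f: "!!k. sqi M (f k)" "!!k. n2 M (f k) <= B" "!!k. sol (f k) (%x. V k (t, x)) (%x. GV k (t, x))"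
		"!!k ph gph. Hg ph gph ==> abs (ip M (f k) ph - ip M (%x. W k (t, x)) ph) <= e k * n2 M gph" by blast
	obtain Vt Gt where s: "sol (U t) Vt Gt" by (rule sol_exists[OF sU[OF t']])
	note w = near_weak[where f = f, OF t' f(1,2,4)]
	show thesis
		by (rule that[OF s solD(3)[OF f(3)] solD(4)[OF f(3)] sol_compact[where f = f, OF f(1,2) sU[OF t'] w f(3) s]])
qed

text \<open>Linear relations survive convex combinations directly, and weak limits identify the
  strong limits of the combinations. The product ub GV does not commute with combinations, so its
  weak limit is found first, from weak convergence of ub and strong convergence of GV.\<close>

lemma good_slice:
	assumes t: "0 < t" "t < T" and r: "strict_mono r" and G: "sqi M (%x. G (t, x))"
		and l: "(%n. n2 M (%x. combo (N (r n)) (c (r n)) (%k z. (GW k z, F k z, ub k z, gb k z, V k z, GV k z)) (t, x) - G (t, x))) ----> 0"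
	shows "Hg (U t) (%x. g (t, x))" "AE x in M. u (t, x) = U t x" "sol (U t) (%x. V' (t, x)) (%x. GV' (t, x))"
		"AE x in M. Phi (t, x) = g (t, x) + u (t, x) *R GV' (t, x)"
proof -
	have t': "0 <= t" "t <= T" using t by auto
	obtain Vt Gt where s: "sol (U t) Vt Gt" and sV: "!!k. sqi M (%x. V k (t, x))" "!!k. sqi M (%x. GV k (t, x))"
		and Vl: "(%k. n2 M (%x. V k (t, x) - Vt x)) ----> 0" "(%k. n2 M (%x. GV k (t, x) - Gt x)) ----> 0"
		using slice_limit[OF t] by blast
	note sub = HgD(1)[OF apo(1)[OF t]] and sgb = HgD(2)[OF apo(1)[OF t]]
	have sF: "sqi M (%x. F k (t, x))" for k unfolding apo(4)[OF t] by (rule sqi_add[OF sgb apo(3)[OF t]])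
	note cs = comps[where mu = M and io = "%x. (t, x)" and r = r, OF HgD(2)[OF apt(1)[OF t']] sF sub sgb sV G l]
	have sc: "sqi M (%x. cb n f (t, x))" if "!!k. sqi M (%x. f k (t, x))" for n and f :: "nat => real \<times> (real^2) => 'z::euclidean_space"
		using sqi_combo[of M "%k x. f k (t, x)", OF that] by (simp add: combo_def)
	have sub_lim: "(%n. a (r n)) ----> b" if "a ----> b" for a and b :: real using LIMSEQ_subseq_LIMSEQ[OF that r] by (simp add: o_def)
	have ubw: "(%k. ip M (%x. ub k (t, x)) ps) ----> ip M (U t) ps" if "sqi M ps" for ps
		by (rule near_weak[OF t' sub apo(2)[OF t] apo(5)[OF t] that])
	have ubc: "(%n. ip M (%x. cb (r n) ub (t, x)) ps) ----> ip M (U t) ps" if "sqi M ps" for ps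
		by (rule sub_lim[OF combo_weak[where mu = M and io = "%x. (t, x)" and f = ub, OF sub that ubw[OF that]]])
	have dir: "sqi M (%x. ph x *R axis i (1::real))" "sqi M ph" if ph: "tf ph" for ph and i :: 2
		using sqi_mult_bounded[OF sqi_const[of "axis i 1"] sqi_m[OF test_fun_sqi[OF ph]]] test_fun_bounded[OF ph] test_fun_sqi[OF ph] by blast+
	have ipd: "ip M f (%x. ph x *R axis i 1) = (LINT x|M. f x $ i * ph x)" for f :: "real^2 => real^2" and ph and i :: 2
		unfolding ip_def by (intro bi_cong) (auto simp: inner_axis)
	show H: "Hg (U t) (%x. g (t, x))"
		unfolding Hg_iff
	proof (intro conjI weak_gradI)
		show "sqi M (U t)" by (rule sU[OF t'])
		show "sqi M (%x. g (t, x))" by (rule cs(4))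
		fix i :: 2 and ph assume ph: "tf ph"
		note sp = test_fun_sqi[OF test_fun_pd[OF ph], of i]
		have "ip M (%x. cb n ub (t, x)) (pd i ph) = - ip M (%x. cb n gb (t, x)) (%x. ph x *R axis i 1)" for n
			using HgD(6)[where i = i, OF Hg_sum[OF apo(1)[OF t], where K = "N n" and a = "c n"] ph] by (simp add: ipd combo_def ip_def[of M _ "pd i ph"])
		hence "(%n. - ip M (%x. cb (r n) gb (t, x)) (%x. ph x *R axis i 1)) ----> ip M (U t) (pd i ph)"
			using ubc[OF sp] by simp
		moreover have "(%n. - ip M (%x. cb (r n) gb (t, x)) (%x. ph x *R axis i 1)) ----> - ip M (%x. g (t, x)) (%x. ph x *R axis i 1)"
			by (intro tendsto_minus tendsto_ip_left[OF sc[OF sgb] cs(4) dir(1)[OF ph] cs(10)])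
		ultimately have "ip M (U t) (pd i ph) = - ip M (%x. g (t, x)) (%x. ph x *R axis i 1)" by (rule LIMSEQ_unique)
		thus "(LINT x|M. U t x * pd i ph x) = - (LINT x|M. g (t, x) $ i * ph x)" by (simp add: ipd ip_def[of M _ "pd i ph"])
	qed
	show uU: "AE x in M. u (t, x) = U t x"
	proof (rule sqi_eq_weak[OF cs(3) sU[OF t']])
		show "ip M (%x. u (t, x)) ps = ip M (U t) ps" if "sqi M ps" for ps
			by (rule LIMSEQ_unique[OF tendsto_ip_left[OF sc[OF sub] cs(3) that cs(9)] ubc[OF that]])
	qed
	have lim: "(%n. n2 M (%x. cb (r n) f (t, x) - h x)) ----> 0" if f: "!!k. sqi M (%x. f k (t, x))" and h: "sqi M h" and fl: "(%k. n2 M (%x. f k (t, x) - h x)) ----> 0"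
		for h and f :: "nat => real \<times> (real^2) => 'z::euclidean_space"
		using sub_lim[OF combo_tendsto_n2[OF tw f h fl]] by (simp add: combo_def)
	have VV: "AE x in M. Vt x = V' (t, x)"
		by (rule n2_lim_unique[OF sc[OF sV(1)] solD(3)[OF s] cs(5) lim[OF sV(1) solD(3)[OF s] Vl(1)] cs(11)])
	have GG: "AE x in M. Gt x = GV' (t, x)"
		by (rule n2_lim_unique[OF sc[OF sV(2)] solD(4)[OF s] cs(6) lim[OF sV(2) solD(4)[OF s] Vl(2)] cs(12)])
	show "sol (U t) (%x. V' (t, x)) (%x. GV' (t, x))"
		by (rule sol_AE_cong[OF s sU[OF t'] sU[OF t'] cs(5,6) _ VV GG]) simp
	have fl: "AE x in M. Phi (t, x) $ i - g (t, x) $ i - U t x * Gt x $ i = 0" for i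
	proof (rule fundamental_lemma)
		have Gi: "sqi M (%x. Gt x $ i)" using solD(4)[OF s] sqi_vec_iff by blast
		have Pi: "integrable M (%x. Phi (t, x) $ i)" "integrable M (%x. g (t, x) $ i)"
			using cs(2,4) sqi_vec_iff sqi_imp_integrable by blast+
		have UG: "integrable M (%x. U t x * Gt x $ i)" using integrable_ip[OF sU[OF t'] Gi] by simp
		show "integrable M (%x. Phi (t, x) $ i - g (t, x) $ i - U t x * Gt x $ i)" using Pi UG by simp
		fix ph assume ph: "tf ph"
		obtain C where C: "!!x. abs (ph x) <= C" using test_fun_bounded[OF ph] by blast
		note phm = sqi_m[OF test_fun_sqi[OF ph]]
		define ps where "ps x = ph x *R axis i (1::real)" for x
		have sps: "sqi M ps" unfolding ps_def[abs_def] by (rule dir(1)[OF ph])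
		\<comment> \<open>Moving the scalar test function onto the gradient makes the nonlinear term a
		  pairing of the weakly convergent ub with the strongly convergent \<open>a k\<close>.\<close>
		define a where "a k x = ph x *R (GV k (t, x) $ i)" for k x
		define a' where "a' x = ph x *R (Gt x $ i)" for x
		have sGi: "sqi M (%x. GV k (t, x) $ i)" for k using sqi_vec_iff[of "%x. GV k (t, x)"] sV(2) by blast
		have sa: "sqi M (a k)" for k unfolding a_def[abs_def] by (rule sqi_mult_bounded[OF sGi phm C])
		have sa': "sqi M a'" unfolding a'_def[abs_def] by (rule sqi_mult_bounded[OF Gi phm C])
		have sGd: "sqi M (%x. GV k (t, x) - Gt x)" for k by (rule sqi_diff[OF sV(2) solD(4)[OF s]])
		have da: "n2 M (%x. a k x - a' x) <= abs C * n2 M (%x. GV k (t, x) - Gt x)" for k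
		proof -
			have "n2 M (%x. a k x - a' x) <= n2 M (%x. abs C *R (GV k (t, x) - Gt x))"
			proof (intro n2_mono sqi_diff[OF sa sa'] sqi_scaleR[OF sGd] AE_I2)
				fix x
				have "a k x - a' x = ph x * (GV k (t, x) - Gt x) $ i" by (simp add: a_def a'_def right_diff_distrib)
				hence "norm (a k x - a' x) = abs (ph x) * abs ((GV k (t, x) - Gt x) $ i)" by (simp only: real_norm_def abs_mult)
				also have "... <= abs C * norm (GV k (t, x) - Gt x)" using C[of x] component_le_norm_cart[of "GV k (t, x) - Gt x" i] by (intro mult_mono) auto
				finally show "norm (a k x - a' x) <= norm (abs C *R (GV k (t, x) - Gt x))" by simp
			qed
			thus ?thesis by simp
		qed
		have "(%k. B * (abs C * n2 M (%x. GV k (t, x) - Gt x))) ----> B * (abs C * 0)" by (intro tendsto_mult_left Vl(2))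
		hence "(%k. B * (abs C * n2 M (%x. GV k (t, x) - Gt x))) ----> 0" by simp
		moreover have "abs (ip M (%x. ub k (t, x)) (%x. a k x - a' x)) <= B * (abs C * n2 M (%x. GV k (t, x) - Gt x))" for k
			using ip_Cauchy_Schwarz[OF sub sqi_diff[OF sa sa']] mult_mono[OF apo(2)[OF t] da, of k k] order_trans[OF n2_nonneg apo(2)[OF t]]
			by (meson n2_nonneg order_trans)
		ultimately have "(%k. abs (ip M (%x. ub k (t, x)) (%x. a k x - a' x))) ----> 0" by (rule tendsto0_le[OF _ abs_ge_zero])
		from tendsto_add[OF ubw[OF sa'] tendsto_rabs_zero_cancel[OF this]]
		have Ql: "(%k. ip M (%x. ub k (t, x)) (a k)) ----> ip M (U t) a'" by (simp add: ip_diff_right[OF sa sa' sub])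
		have FQ: "ip M (%x. F k (t, x) - gb k (t, x)) ps = ip M (%x. ub k (t, x)) (a k)" for k
			unfolding apo(4)[OF t] ip_def by (intro bi_cong) (auto simp: ps_def a_def inner_axis)
		have "(%k. ip M (%x. F k (t, x) - gb k (t, x)) ps) ----> ip M (U t) a'" using Ql by (simp add: FQ)
		from sub_lim[OF combo_weak[where mu = M and io = "%x. (t, x)" and f = "%k z. F k z - gb k z", OF sqi_diff[OF sF sgb] sps this]]
		have "(%n. ip M (%x. cb (r n) F (t, x) - cb (r n) gb (t, x)) ps) ----> ip M (U t) a'"
			by (simp add: combo_def scaleR_diff_right sum_subtractf)
		hence "(%n. ip M (%x. cb (r n) F (t, x)) ps - ip M (%x. cb (r n) gb (t, x)) ps) ----> ip M (U t) a'"
			by (simp add: ip_diff_left[OF sc[OF sF] sc[OF sgb] sps])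
		moreover have "(%n. ip M (%x. cb (r n) F (t, x)) ps - ip M (%x. cb (r n) gb (t, x)) ps) ----> ip M (%x. Phi (t, x)) ps - ip M (%x. g (t, x)) ps"
			by (intro tendsto_diff tendsto_ip_left[OF sc[OF sF] cs(2) sps cs(8)] tendsto_ip_left[OF sc[OF sgb] cs(4) sps cs(10)])
		ultimately have e: "ip M (%x. Phi (t, x)) ps - ip M (%x. g (t, x)) ps = ip M (U t) a'" by (rule LIMSEQ_unique[rotated])
		have "(LINT x|M. (Phi (t, x) $ i - g (t, x) $ i - U t x * Gt x $ i) * ph x)
			= (LINT x|M. Phi (t, x) \<bullet> ps x - g (t, x) \<bullet> ps x - U t x \<bullet> a' x)"
			by (intro bi_cong) (auto simp: ps_def a'_def inner_axis algebra_simps)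
		also have "... = ip M (%x. Phi (t, x)) ps - ip M (%x. g (t, x)) ps - ip M (U t) a'"
			unfolding ip_def using integrable_ip[OF cs(2) sps] integrable_ip[OF cs(4) sps] integrable_ip[OF sU[OF t'] sa']
			by (subst bi_diff; simp)+
		finally show "(LINT x|M. (Phi (t, x) $ i - g (t, x) $ i - U t x * Gt x $ i) * ph x) = 0" using e by simp
	qed
	show "AE x in M. Phi (t, x) = g (t, x) + u (t, x) *R GV' (t, x)"
		using fl[of 1] fl[of 2] uU GG by eventually_elim (simp add: vec_eq_iff forall_2 algebra_simps)
qed

text \<open>The subsequence is extracted once from convergence in space-time, and its slices then
  converge for almost every t.\<close>

lemma AE_good:
	"AE t in L. Hg (U t) (%x. g (t, x)) & (AE x in M. u (t, x) = U t x) & sol (U t) (%x. V' (t, x)) (%x. GV' (t, x)) &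
		(AE x in M. Phi (t, x) = g (t, x) + u (t, x) *R GV' (t, x))"
proof -
	have sX: "sqi ST (%z. (GW k z, F k z, ub k z, gb k z, V k z, GV k z))" for k using apD(1-6)[of k] by (simp add: sqi_Pair_iff)
	obtain r where r: "strict_mono r" "AE t in L. (%n. n2 M (%x. combo (N (r n)) (c (r n)) (%k z. (GW k z, F k z, ub k z, gb k z, V k z, GV k z)) (t, x) - G (t, x))) ----> 0"
		using ST_slices_tendsto[OF sqi_combo[OF sX] G Gl] by blast
	have "AE t in L. t : {0<..<T}" using AE_space[of L] by simp
	thus ?thesis using r(2) ST_ip(1)[OF G G]
	proof eventually_elim
		case (elim t)
		hence t: "0 < t" "t < T" by auto
		show ?case using good_slice[OF t r(1) elim(3) elim(2)] by blast
	qed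
qed

lemma U_0: "AE x in M. U 0 x = u0 x"
proof -
	have T: "0 <= T" using T_pos by simp
	have "(%k. n2 M (%x. W k (0, x) - u0 x)) ----> 0" by (rule tendsto0_le[OF e0 n2_nonneg apD(13)])
	from combo_tendsto_n2[OF tw apt(2)[OF order_refl T] u0 this] have "(%n. n2 M (%x. cb n W (0, x) - u0 x)) ----> 0" by (simp add: combo_def)
	from n2_lim_unique[OF sW[OF order_refl T] sU[OF order_refl T] u0 Ul[OF order_refl T] this] show ?thesis .
qed

end

context stdom
begin

definition limit_solution where
	"limit_solution u0 Phi u g V GV U \<longleftrightarrow> sqi ST Phi & sqi ST u & sqi ST g & sqi ST V & sqi ST GV &
		(ALL t:{0..T}. sqi M (U t) & ((%s. n2 M (%x. U s x - U t x)) \<longlongrightarrow> 0) (at t within {0..T}) &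
			(ALL ph gph. Hg ph gph --> ip M (U t) ph = ip M u0 ph - ip ST Phi (tn (ind 0 t) gph))) & (AE x in M. U 0 x = u0 x) &
		(AE t in L. Hg (U t) (%x. g (t, x)) & (AE x in M. u (t, x) = U t x) & sol (U t) (%x. V (t, x)) (%x. GV (t, x)) &
			(AE x in M. Phi (t, x) = g (t, x) + u (t, x) *R GV (t, x)))"

lemma limit_solution_exists:
	assumes u0: "sqi M u0" and B: "ALL e>0. EX W GW F ub gb V GV. appr B e u0 W GW F ub gb V GV"
	shows "EX Phi u g V GV U. limit_solution u0 Phi u g V GV U"
proof -
	have "ALL k. EX p. case p of (W, GW, F, ub, gb, V, GV) => appr B (1 / real (Suc k)) u0 W GW F ub gb V GV"
		using B by (simp add: split_paired_Ex)
	from choice[OF this] obtain p where p: "!!k. case p k of (W, GW, F, ub, gb, V, GV) => appr B (1 / real (Suc k)) u0 W GW F ub gb V GV" by blast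
	define F0 where "F0 k = fst (snd (snd (p k)))" for k
	have "sqi ST (F0 k)" "n2 ST (F0 k) <= B" for k using p[of k] unfolding F0_def by (auto simp: case_prod_unfold appr_def)
	then obtain s where s: "strict_mono s" "!!y. sqi ST y ==> convergent (%n. ip ST (F0 (s n)) y)"
		by (rule weakly_convergent_subseq[where f = F0]) blast
	define e :: "nat => real" where "e k = 1 / real (Suc (s k))" for k
	define W where "W k = fst (p (s k))" for k
	define GW where "GW k = fst (snd (p (s k)))" for k
	define F where "F k = fst (snd (snd (p (s k))))" for k
	define ub where "ub k = fst (snd (snd (snd (p (s k)))))" for k
	define gb where "gb k = fst (snd (snd (snd (snd (p (s k))))))" for k
	define V where "V k = fst (snd (snd (snd (snd (snd (p (s k)))))))" for k
	define GV where "GV k = snd (snd (snd (snd (snd (snd (p (s k)))))))" for k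
	note d = W_def GW_def F_def ub_def gb_def V_def GV_def
	have e: "e ----> 0"
		using LIMSEQ_subseq_LIMSEQ[OF LIMSEQ_Suc[OF lim_1_over_n] s(1)] by (simp add: e_def[abs_def] o_def)
	interpret appr_seq Om T B e u0 W GW F ub gb V GV
	proof
		show "appr B (e k) u0 (W k) (GW k) (F k) (ub k) (gb k) (V k) (GV k)" for k using p[of "s k"] by (simp add: d e_def case_prod_unfold)
		show "convergent (%k. ip ST (F k) y)" if "sqi ST y" for y using s(2)[OF that] by (simp add: F_def F0_def)
	qed (fact e u0)+
	have sX: "sqi ST (%z. (GW k z, F k z, ub k z, gb k z, V k z, GV k z))" "n2 ST (%z. (GW k z, F k z, ub k z, gb k z, V k z, GV k z)) <= 6 * B" for k
	proof -
		note P = sqi_Pair_iff[THEN iffD2, OF conjI]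
		note p5 = P[OF apD(5,6)[of k]] and b5 = n2_Pair_le[OF apD(5,6)[of k]]
		note p4 = P[OF apD(4)[of k] p5] and b4 = n2_Pair_le[OF apD(4)[of k] p5]
		note p3 = P[OF apD(3)[of k] p4] and b3 = n2_Pair_le[OF apD(3)[of k] p4]
		note p2 = P[OF apD(2)[of k] p3] and b2 = n2_Pair_le[OF apD(2)[of k] p3]
		show "sqi ST (%z. (GW k z, F k z, ub k z, gb k z, V k z, GV k z))" by (rule P[OF apD(1)[of k] p2])
		show "n2 ST (%z. (GW k z, F k z, ub k z, gb k z, V k z, GV k z)) <= 6 * B"
			using n2_Pair_le[OF apD(1)[of k] p2] b2 b3 b4 b5 apD(7-12)[of k] by linarith
	qed
	obtain N c G where m: "!!n. tail_weights n (N n) (c n)" "sqi ST G"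
		"(%n. n2 ST (%x. combo (N n) (c n) (%k z. (GW k z, F k z, ub k z, gb k z, V k z, GV k z)) x - G x)) ----> 0"
		by (rule mazur[where f = "%k z. (GW k z, F k z, ub k z, gb k z, V k z, GV k z)", OF sX]) blast
	interpret mazur_seq Om T B e u0 W GW F ub gb V GV N c G by unfold_locales (fact m)+
	obtain U where U: "!!t. 0 <= t ==> t <= T ==> sqi M (U t)" "!!t. 0 <= t ==> t <= T ==> (%n. n2 M (%x. cb n W (t, x) - U t x)) ----> 0"
		"!!t. 0 <= t ==> t <= T ==> ((%s. n2 M (%x. U s x - U t x)) \<longlongrightarrow> 0) (at t within {0..T})"
		by (rule limit_curve) blast
	interpret lim_seq Om T B e u0 W GW F ub gb V GV N c G U by unfold_locales (fact U(1,2))+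
	have "limit_solution u0 Phi u g V' GV' U"
		unfolding limit_solution_def using ST_comps(2-6) U(1,3) U_0 W_lim(1) AE_good by (intro conjI ballI allI impI) auto
	thus ?thesis by blast
qed

end

section \<open>The weak formulation\<close>

lemma borel_measurable_AE_on:
	fixes f g :: "'a::euclidean_space => 'b::euclidean_space"
	assumes f: "f : bm (lebesgue_on S)" and S: "S : sets lebesgue" and e: "AE x in lebesgue_on S. f x = g x"
	shows "g : bm (lebesgue_on S)"
proof -
	have "(%x. if x : S then f x else 0) : bm lebesgue" by (rule borel_measurable_if_I[OF f S])
	moreover have "AE x in lebesgue. (if x : S then f x else 0) = (if x : S then g x else 0)"
	proof -
		have "AE x in lebesgue. x : S --> f x = g x" using e S by (simp add: AE_restrict_space_iff)
		thus ?thesis by eventually_elim simp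
	qed
	ultimately have "(%x. if x : S then g x else 0) : bm lebesgue" by (rule borel_measurable_AE)
	thus ?thesis by (rule borel_measurable_if_D)
qed

context stdom
begin

lemma test_fun_R_props:
	assumes ph: "test_fun_R {0<..<T} ph"
	shows "(ph has_real_derivative deriv ph t) (at t)" "continuous_on UNIV (deriv ph)" "ph 0 = 0" "ph T = 0"
		"EX C. ALL t:{0<..<T}. abs (deriv ph t) <= C" "0 <= r ==> r < T ==> (LINT t|L. (if r < t then deriv ph t else 0)) = - ph r"
proof -
	have s: "((deriv ^^ n) ph) differentiable (at x)" for n x using ph by (simp add: test_fun_R_def smooth_R_def)
	show d: "(ph has_real_derivative deriv ph t) (at t)" for t using s[of 0 t] by (simp add: DERIV_deriv_iff_real_differentiable)
	have "isCont (deriv ph) t" for t using s[of 1 t] differentiable_imp_continuous_within by auto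
	thus c: "continuous_on UNIV (deriv ph)" by (simp add: continuous_at_imp_continuous_on)
	have z: "ph t = 0" if "t \<notin> {0<..<T}" for t
		using ph that closure_subset[of "{t. ph t ~= 0}"] unfolding test_fun_R_def by blast
	show "ph 0 = 0" "ph T = 0" using z by auto
	have "compact (deriv ph ` {0..T})" using c by (intro compact_continuous_image continuous_on_subset[OF c]) auto
	then obtain C where C: "!!t. t : {0..T} ==> abs (deriv ph t) <= C" using compact_imp_bounded bounded_iff by (metis imageI real_norm_def)
	thus "EX C. ALL t:{0<..<T}. abs (deriv ph t) <= C" by (intro exI[of _ C]) auto
	show "(LINT t|L. (if r < t then deriv ph t else 0)) = - ph r" if r: "0 <= r" "r < T"
	proof -
		have m: "deriv ph : bm (lebesgue_on {r<..<T})"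
			using borel_measurable_continuous_onI[OF c] by (intro measurable_restrict_space1 measurable_completion) simp
		interpret f: finite_measure "lebesgue_on {r<..<T}" by (rule finite_measure_lebesgue_on) simp
		have i: "integrable (lebesgue_on {r<..<T}) (deriv ph)"
			using C r m by (intro f.integrable_const_bound[where B = C]) (auto intro!: AE_I2)
		have "(LINT t|L. (if r < t then deriv ph t else 0)) = (LINT t|L. (if t : {r<..<T} then deriv ph t else 0))"
			by (intro bi_cong) auto
		also have "... = integral\<^sup>L (lebesgue_on {r<..<T}) (deriv ph)" using r by (intro integral_restrict) auto
		also have "... = integral {r<..<T} (deriv ph)" using i by (intro lebesgue_integral_eq_integral) auto
		also have "... = integral {r..T} (deriv ph)" by (rule integral_open_interval_real[symmetric])
		also have "... = ph T - ph r"
			using r d by (intro integral_unique fundamental_theorem_of_calculus)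
				(auto simp: has_real_derivative_iff_has_vector_derivative intro: has_vector_derivative_at_within)
		finally show ?thesis using z[of T] by simp
	qed
qed

lemma id_L [measurable]: "(%t. t) : bm L"
	by (intro measurable_restrict_space1 measurable_completion) simp

text \<open>Fubini on the triangle r < t: integrating the derivative of the test function over (r,
  T) gives -ph r, and the constant k integrates to zero.\<close>

lemma primitive_weak_deriv:
	assumes ph: "test_fun_R {0<..<T} ph" and a: "integrable L a"
	shows "(LINT t|L. deriv ph t * (k - (LINT r|L. ind 0 t r * a r))) = (LINT t|L. ph t * a t)"
proof -
	note p = test_fun_R_props[OF ph]
	obtain C where C: "!!t. t : {0<..<T} ==> abs (deriv ph t) <= C" using p(5) by blast
	interpret LL: pair_sigma_finite L L by unfold_locales
	have [measurable]: "a : bm L" using a by simp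
	have bm: "f : bm L" if "continuous_on UNIV f" for f :: "real => real"
		using borel_measurable_continuous_onI[OF that] by (intro measurable_restrict_space1 measurable_completion) simp
	have dm [measurable]: "deriv ph : bm L" by (rule bm[OF p(2)])
	define h where "h t r = (if r < t then deriv ph t else 0) * a r" for t r
	have hm [measurable]: "case_prod h : bm (L \<Otimes>\<^sub>M L)"
		unfolding h_def case_prod_beta by measurable
	have hb: "abs (h t r) <= abs C * abs (a r)" if "t : {0<..<T}" for t r
		using C[OF that] by (auto simp: h_def abs_mult intro!: mult_right_mono)
	have hi: "integrable L (h t)" if "t : {0<..<T}" for t
		by (rule bi_i_bound[OF integrable_mult_right[OF integrable_abs[OF a], of "abs C"]])
			(use hb[OF that] in \<open>auto simp: h_def[abs_def] intro!: AE_I2\<close>)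
	have "integrable (L \<Otimes>\<^sub>M L) (case_prod h)"
	proof (rule LL.Fubini_integrable[OF hm])
		show "AE t in L. integrable L (%r. case_prod h (t, r))" using hi by (intro AE_I2) simp
		show "integrable L (%t. \<integral>r. norm (case_prod h (t, r)) \<partial>L)"
		proof (rule lf.integrable_const_bound)
			show "AE t in L. norm (LINT r|L. norm (case_prod h (t, r))) <= (LINT r|L. abs C * abs (a r))"
			proof (rule AE_I2)
				fix t assume "t : space L"
				hence t: "t : {0<..<T}" by simp
				have "(LINT r|L. abs (h t r)) <= (LINT r|L. abs C * abs (a r))" using hi[OF t] a hb[OF t] by (intro integral_mono) auto
				thus "norm (LINT r|L. norm (case_prod h (t, r))) <= (LINT r|L. abs C * abs (a r))" by simp
			qed
		qed measurable
	qed
	note F = LL.Fubini_integral[OF this] and I = LL.integrable_fst[OF this]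
	have eq: "deriv ph t * (LINT r|L. ind 0 t r * a r) = (LINT r|L. h t r)" for t
	proof -
		have "(LINT r|L. h t r) = (LINT r|L. deriv ph t * (ind 0 t r * a r))"
			by (intro bi_cong) (auto simp: h_def)
		thus ?thesis by simp
	qed
	have di: "integrable L (deriv ph)"
		using C dm by (intro lf.integrable_const_bound[where B = C]) (auto intro!: AE_I2)
	have "(LINT t|L. deriv ph t) = (LINT t|L. (if 0 < t then deriv ph t else 0))" by (intro bi_cong) auto
	hence d0: "(LINT t|L. deriv ph t) = 0" using p(6)[of 0] p(3) T_pos by simp
	have "(LINT t|L. deriv ph t * (k - (LINT r|L. ind 0 t r * a r))) = (LINT t|L. deriv ph t * k - (LINT r|L. h t r))"
		by (simp only: right_diff_distrib eq)
	also have "... = - (LINT t|L. (LINT r|L. h t r))"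
		using di I d0 by (subst bi_diff) auto
	also have "(LINT t|L. (LINT r|L. h t r)) = (LINT r|L. (LINT t|L. h t r))" by (rule F[symmetric])
	also have "... = (LINT r|L. - (ph r * a r))"
		by (intro bi_cong refl) (simp add: h_def p(6))
	finally show ?thesis by simp
qed

lemma weak_form:
	assumes "limit_solution u0 Phi u g V GV U"
	shows "EX u Gu U xi V GV.
			 L2H1 Om T u Gu & C0L2 Om T U &
			 (AE t in L. AE x in M. u t x = U t x) & (AE x in M. U 0 x = u0 x) &
			 L2dual Om T xi & weak_time_deriv Om T u xi &
			 (%(t,x). V t x) : bm ST & (%(t,x). GV t x) : bm ST &
			 (AE t in L. dirichlet_inv Om (u t) (V t) (GV t)) &
			 (ALL w Gw. L2H1 Om T w Gw -->
					integrable L (%t. xi t (w t)) &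
					integrable ST (%(t,x). (Gu t x + u t x *R GV t x) \<bullet> Gw t x) &
					(LINT t|L. xi t (w t)) + (\<integral>(t,x). (Gu t x + u t x *R GV t x) \<bullet> Gw t x \<partial>ST) = 0)"
proof -
	have Phi: "sqi ST Phi" and u: "sqi ST u" and g: "sqi ST g" and V: "sqi ST V" "sqi ST GV"
		and U: "!!t. 0 <= t ==> t <= T ==> sqi M (U t)"
		and Uc: "!!t. 0 <= t ==> t <= T ==> ((%s. n2 M (%x. U s x - U t x)) \<longlongrightarrow> 0) (at t within {0..T})" and U0: "AE x in M. U 0 x = u0 x"
		and eq: "!!t ph gph. 0 <= t ==> t <= T ==> Hg ph gph ==> ip M (U t) ph = ip M u0 ph - ip ST Phi (tn (ind 0 t) gph)"
		and ae: "AE t in L. Hg (U t) (%x. g (t, x)) & (AE x in M. u (t, x) = U t x) & sol (U t) (%x. V (t, x)) (%x. GV (t, x)) &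
			(AE x in M. Phi (t, x) = g (t, x) + u (t, x) *R GV (t, x))"
		using assms unfolding limit_solution_def by auto
	note [measurable] = Phi[THEN sqi_m] u[THEN sqi_m] g[THEN sqi_m] V[THEN sqi_m]
	\<comment> \<open>The same choice of weak gradient as in \<open>H1norm\<close>. It makes xi a
	  functional of v alone; \<open>ipg\<close> returns to any other weak gradient.\<close>
	define gr where "gr v = (SOME h. Hg v h)" for v
	have gr: "Hg v (gr v)" if "Hg v h" for v h unfolding gr_def using that by (rule someI[of "%h. Hg v h"])
	have grH: "Hg v (gr v)" if "H1 Om v" for v using that gr by (auto simp: H1_def)
	define xi where "xi t v = - ip M (%x. Phi (t, x)) (gr v)" for t v
	have ipg: "ip M f (gr v) = ip M f h" if "Hg v h" "sqi M f" for f v h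
		unfolding ip_commute[of M f]
		by (rule ip_cong_AE[OF _ _ _ Hg_unique[OF gr[OF that(1)] that(1)]])
			(use HgD(2)[OF gr[OF that(1)]] HgD(2)[OF that(1)] that(2) sqi_m in blast)+
	have aeT: "AE t in L. t : {0<..<T}" using AE_space[of L] by simp
	have aeu: "AE t in L. sqi M (%x. u (t, x)) & (AE x in M. U t x = u (t, x)) & sqi M (U t)"
		using aeT ae ST_ip(1)[OF u u] by eventually_elim (use U in \<open>auto elim: eventually_mono\<close>)
	have c1: "L2H1 Om T (%t x. u (t, x)) (%t x. g (t, x))"
	proof -
		have "AE t in L. Hg (%x. u (t, x)) (%x. g (t, x))"
			using ae aeu ST_ip(1)[OF g g]
		proof eventually_elim
			case (elim t)
			thus ?case using Hg_cong[of "U t" "%x. g (t, x)" "%x. u (t, x)" "%x. g (t, x)"] by (auto dest: sqi_m)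
		qed
		thus ?thesis using u g by (simp add: L2H1_def sqi_def case_prod_unfold)
	qed
	have c2: "C0L2 Om T U"
		unfolding C0L2_def L2_iff
	proof (intro conjI ballI)
		fix t assume t: "t : {0..T}"
		thus "sqi M (U t)" using U by simp
		have "((%s. (n2 M (%x. U s x - U t x))^2) \<longlongrightarrow> 0^2) (at t within {0..T})" using Uc[of t] t by (intro tendsto_power) auto
		thus "((%s. \<integral>x. (U s x - U t x)^2 \<partial>M) \<longlongrightarrow> 0) (at t within {0..T})" by (simp add: n2_sq ip_self)
	qed
	have c3: "AE t in L. AE x in M. u (t, x) = U t x" using ae by eventually_elim simp
	have c4: "L2dual Om T xi"
		unfolding L2dual_def
	proof (intro conjI allI impI)
		have bd: "abs (xi t v) <= n2 M (%x. Phi (t, x)) * H1norm Om v" if P: "sqi M (%x. Phi (t, x))" and v: "H1 Om v" for t v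
		proof -
			note s = HgD(1,2)[OF grH[OF v]]
			have "(LINT x|M. (norm (gr v x))^2) <= (LINT x|M. (v x)^2) + (LINT x|M. (norm (gr v x))^2)" by simp
			hence "n2 M (gr v) <= H1norm Om v" unfolding H1norm_def n2_def ip_self gr_def by (rule real_sqrt_le_mono)
			hence "n2 M (%x. Phi (t, x)) * n2 M (gr v) <= n2 M (%x. Phi (t, x)) * H1norm Om v" by (intro mult_left_mono) auto
			thus ?thesis using ip_Cauchy_Schwarz[OF P s(2)] by (simp add: xi_def)
		qed
		show "AE t in L. H1_dual Om (xi t)"
			using ST_ip(1)[OF Phi Phi]
		proof eventually_elim
			case (elim t)
			\<comment> \<open>The choice \<open>gr\<close> need not be linear pointwise; linearity of xi
			  rests on almost everywhere uniqueness of weak gradients.\<close>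
			have "xi t (%x. a * v x + b * w x) = a * xi t v + b * xi t w" if "H1 Om v" "H1 Om w" for v w a b
			proof -
				note sv = HgD(2)[OF grH[OF that(1)]] HgD(2)[OF grH[OF that(2)]]
				show ?thesis unfolding xi_def ipg[OF Hg_lin[OF grH[OF that(1)] grH[OF that(2)]] elim]
					by (simp add: ip_add_right[OF sqi_scaleR[OF sv(1)] sqi_scaleR[OF sv(2)] elim])
			qed
			thus ?case using bd[OF elim] by (auto simp: H1_dual_def)
		qed
		show "(%t. xi t v) : bm L" if "H1 Om v" for v
			using ip_tn(2)[OF Phi n2_L_const(1)[of 1] HgD(2)[OF grH[OF that]]] by (simp add: xi_def)
		have "(nni L (%t. ennreal ((dual_norm Om (xi t))^2))) <= (nni L (%t. ennreal ((n2 M (%x. Phi (t, x)))^2)))"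
		proof (rule nn_integral_mono_AE)
			show "AE t in L. ennreal ((dual_norm Om (xi t))^2) <= ennreal ((n2 M (%x. Phi (t, x)))^2)"
				using ST_ip(1)[OF Phi Phi]
			proof eventually_elim
				case (elim t)
				define S where "S = {\<bar>xi t v\<bar> | v. H1 Om v & H1norm Om v <= 1}"
				have b: "y <= n2 M (%x. Phi (t, x))" if "y : S" for y
				proof -
					obtain v where v: "y = abs (xi t v)" "H1 Om v" "H1norm Om v <= 1" using \<open>y : S\<close> by (auto simp: S_def)
					thus ?thesis using bd[OF elim v(2)] mult_left_mono[OF v(3) n2_nonneg[of M "%x. Phi (t, x)"]] by simp
				qed
				\<comment> \<open>The zero function makes the set in \<open>dual_norm\<close> nonempty, so its
				  supremum is controlled; its chosen gradient vanishes only almost everywhere, hence the detour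
				  through the integral.\<close>
				have z: "Hg (%x. 0) (%x. 0)" by (rule Hg_const)
				have "gr (%x. 0) : bm M" using HgD(2)[OF gr[OF z]] by (rule sqi_m)
				hence "(LINT x|M. (norm (gr (%x. 0) x))^2) = (LINT x|M. 0)"
					using Hg_unique[OF gr[OF z] z] by (intro integral_cong_AE) (auto elim: eventually_mono)
				hence "H1norm Om (%x. 0) = 0" by (simp add: H1norm_def gr_def)
				hence ne: "abs (xi t (%x. 0)) : S" using z by (auto simp: S_def H1_def)
				have "0 <= Sup S" by (rule order_trans[OF abs_ge_zero cSup_upper[OF ne]]) (use b in \<open>auto simp: bdd_above_def\<close>)
				moreover have "Sup S <= n2 M (%x. Phi (t, x))" using ne b by (intro cSup_least) auto
				ultimately show ?case by (simp add: dual_norm_def S_def[symmetric] power_mono ennreal_leI)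
			qed
		qed
		also have "... < \<infinity>" using sqi_integrable[OF ST_n2(1)[OF Phi]] by (simp add: integrable_iff_bounded)
		finally show "(nni L (%t. ennreal ((dual_norm Om (xi t))^2))) < \<infinity>" .
	qed
	have c5: "weak_time_deriv Om T (%t x. u (t, x)) xi"
		unfolding weak_time_deriv_def
	proof (intro allI impI)
		fix ph v assume A: "test_fun_R {0<..<T} ph & H1 Om v"
		note v = grH[OF conjunct2[OF A]]
		note s = HgD(1,2)[OF v]
		define a where "a t = ip M (%x. Phi (t, x)) (gr v)" for t
		have ai: "integrable L a" using ip_tn(2)[OF Phi n2_L_const(1)[of 1] s(2)] by (simp add: a_def[abs_def])
		have um: "(%t. \<integral>x. u (t, x) * v x \<partial>M) : bm L"
			using ip_tn(2)[OF u n2_L_const(1)[of 1] s(1)] by (simp add: ip_def)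
		have dm: "deriv ph : bm L"
			using borel_measurable_continuous_onI[OF test_fun_R_props(2)] A by (intro measurable_restrict_space1 measurable_completion) simp
		have e: "AE t in L. (LINT x|M. u (t, x) * v x) = ip M u0 v - (LINT r|L. ind 0 t r * a r)"
			using aeT aeu
		proof eventually_elim
			case (elim t)
			have "(LINT x|M. u (t, x) * v x) = ip M (U t) v"
				using ip_cong_AE[of "U t" M "%x. u (t, x)" v] elim s(1) by (auto simp: ip_def[of M "%x. u (t, x)"] dest: sqi_m)
			also have "... = ip M u0 v - (LINT r|L. ind 0 t r * a r)"
				using eq[OF _ _ v, of t] elim ip_tn(1)[OF Phi indicator_L(1) s(2)] by (simp add: a_def)
			finally show ?case .
		qed
		have Am: "(%t. ip M u0 v - (LINT r|L. ind 0 t r * a r)) : bm L"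
			by (rule borel_measurable_AE_on[OF um _ e]) simp
		have "(LINT t|L. deriv ph t * (LINT x|M. u (t, x) * v x)) = (LINT t|L. deriv ph t * (ip M u0 v - (LINT r|L. ind 0 t r * a r)))"
			by (intro integral_cong_AE borel_measurable_times dm um Am) (use e in \<open>auto elim: eventually_mono\<close>)
		also have "... = (LINT t|L. ph t * a t)" by (rule primitive_weak_deriv[OF conjunct1[OF A] ai])
		finally show "(LINT t|L. deriv ph t * (LINT x|M. u (t, x) * v x)) = - (LINT t|L. ph t * xi t v)" by (simp add: xi_def a_def)
	qed
	have c6: "AE t in L. dirichlet_inv Om (%x. u (t, x)) (%x. V (t, x)) (%x. GV (t, x))"
		using ae aeu ST_ip(1)[OF V(1) V(1)] ST_ip(1)[OF V(2) V(2)]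
	proof eventually_elim
		case (elim t)
		hence "sol (U t) (%x. V (t, x)) (%x. GV (t, x))" "sqi M (U t)" "sqi M (%x. u (t, x))" "AE x in M. U t x = u (t, x)" by blast+
		from sol_AE_cong[OF this(1-3) elim(3,4) this(4)] show ?case by (intro sol_dirichlet_inv) simp
	qed
	\<comment> \<open>The flux identity holds on almost every slice; measurability of both sides lifts
	  it to the product measure.\<close>
	have flux: "AE z in ST. Phi z = g z + u z *R GV z"
	proof (rule st.AE_pair_measure)
		show "{z : space ST. Phi z = g z + u z *R GV z} : sets ST" by measurable
		show "AE t in L. AE x in M. Phi (t, x) = g (t, x) + u (t, x) *R GV (t, x)" using ae by eventually_elim simp
	qed
	have sfl: "sqi ST (%z. g z + u z *R GV z)" by (rule sqi_cong_AE[OF Phi _ flux]) measurable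
	have c7: "integrable L (%t. xi t (w t)) & integrable ST (%(t,x). (g (t, x) + u (t, x) *R GV (t, x)) \<bullet> Gw t x) &
					(LINT t|L. xi t (w t)) + (\<integral>(t,x). (g (t, x) + u (t, x) *R GV (t, x)) \<bullet> Gw t x \<partial>ST) = 0"
		if w: "L2H1 Om T w Gw" for w Gw
	proof -
		have Gw: "sqi ST (%(t, x). Gw t x)" using w by (simp add: L2H1_def sqi_def case_prod_unfold)
		have e: "AE t in L. - ip M (%x. Phi (t, x)) (%x. Gw t x) = xi t (w t)"
			using ST_ip(1)[OF Phi Phi] w[unfolded L2H1_def, THEN conjunct2, THEN conjunct2, THEN conjunct2, THEN conjunct2]
			by eventually_elim (simp add: xi_def ipg)
		have i: "integrable L (%t. - ip M (%x. Phi (t, x)) (%x. Gw t x))" using ST_ip(2)[OF Phi Gw] by simp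
		\<comment> \<open>The functional agrees only almost everywhere with a measurable function of t;
		  completeness of Lebesgue measure supplies measurability.\<close>
		have m: "(%t. xi t (w t)) : bm L" by (rule borel_measurable_AE_on[OF borel_measurable_integrable[OF i] _ e]) simp
		have 1: "integrable L (%t. xi t (w t))" using integrable_cong_AE[THEN iffD1, OF borel_measurable_integrable[OF i] m e i] .
		have 2: "integrable ST (%(t,x). (g (t, x) + u (t, x) *R GV (t, x)) \<bullet> Gw t x)"
			using integrable_ip[OF sfl Gw] by (simp add: case_prod_unfold)
		have "(LINT t|L. xi t (w t)) = (LINT t|L. - ip M (%x. Phi (t, x)) (%x. Gw t x))"
			by (rule integral_cong_AE[OF m borel_measurable_integrable[OF i]]) (use e in \<open>auto elim: eventually_mono\<close>)
		also have "... = - ip ST Phi (%(t, x). Gw t x)" using ST_ip(3)[OF Phi Gw] by simp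
		also have "ip ST Phi (%(t, x). Gw t x) = ip ST (%z. g z + u z *R GV z) (%(t, x). Gw t x)"
			by (rule ip_cong_AE[OF sqi_m[OF Phi] sqi_m[OF sfl] sqi_m[OF Gw] flux])
		finally show ?thesis using 1 2 by (simp add: ip_def case_prod_unfold)
	qed
	show ?thesis
		by (rule exI[of _ "%t x. u (t, x)"], rule exI[of _ "%t x. g (t, x)"], rule exI[of _ U], rule exI[of _ xi], rule exI[of _ "%t x. V (t, x)"], rule exI[of _ "%t x. GV (t, x)"])
			(use c1 c2 c3 U0 c4 c5 c6 c7 in simp)
qed

end

theorem theorem5p1:
	fixes \<Omega> :: "(real^2) set"
	assumes "smooth_bounded_domain \<Omega>"
	shows "\<exists>\<eta>>0. \<forall>T>0. \<forall>u0.
		L2 \<Omega> u0 \<and> (AE x in lebesgue_on \<Omega>. u0 x \<ge> 0) \<and> (\<integral>x. \<bar>u0 x\<bar> \<partial>lebesgue_on \<Omega>) \<le> \<eta> \<longrightarrow>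
		(\<exists>u Gu U \<xi> V GV.
			 L2H1 \<Omega> T u Gu \<and>
			 C0L2 \<Omega> T U \<and>
			 (AE t in lebesgue_on {0<..<T}. AE x in lebesgue_on \<Omega>. u t x = U t x) \<and>
			 (AE x in lebesgue_on \<Omega>. U 0 x = u0 x) \<and>
			 L2dual \<Omega> T \<xi> \<and> weak_time_deriv \<Omega> T u \<xi> \<and>
			 (\<lambda>(t,x). V t x) \<in> borel_measurable (spacetime T \<Omega>) \<and>
			 (\<lambda>(t,x). GV t x) \<in> borel_measurable (spacetime T \<Omega>) \<and>
			 (AE t in lebesgue_on {0<..<T}. dirichlet_inv \<Omega> (u t) (V t) (GV t)) \<and>
			 (\<forall>w Gw. L2H1 \<Omega> T w Gw \<longrightarrow>
					integrable (lebesgue_on {0<..<T}) (\<lambda>t. \<xi> t (w t)) \<and>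
					integrable (spacetime T \<Omega>) (\<lambda>(t,x). (Gu t x + u t x *\<^sub>R GV t x) \<bullet> Gw t x) \<and>
					(\<integral>t. \<xi> t (w t) \<partial>lebesgue_on {0<..<T})
						+ (\<integral>(t,x). (Gu t x + u t x *\<^sub>R GV t x) \<bullet> Gw t x \<partial>spacetime T \<Omega>) = 0))"
		(is "\<exists>\<eta>>0. \<forall>T>0. \<forall>u0. ?P \<eta> u0 \<longrightarrow> ?Q T u0")
proof -
	interpret sbdom \<Omega> by unfold_locales (rule assms)
	obtain \<eta> where \<eta>: "\<eta> > 0" "\<And>T u0. 0 < T \<Longrightarrow> sqi M u0 \<Longrightarrow> AE x in M. 0 \<le> u0 x \<Longrightarrow> (\<integral>x. \<bar>u0 x\<bar> \<partial>M) \<le> \<eta> \<Longrightarrow>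
		\<exists>B. \<forall>e>0. \<exists>W GW F ub gb V GV. stdom.appr \<Omega> T B e u0 W GW F ub gb V GV"
		by (rule appr_exists) blast
	show ?thesis
	proof (rule exI[of _ \<eta>], rule conjI[OF \<eta>(1)], intro allI impI, elim conjE)
		fix T :: real and u0 :: "real^2 \<Rightarrow> real"
		assume T: "T > 0" and u0: "L2 \<Omega> u0" "AE x in M. u0 x \<ge> 0" "(\<integral>x. \<bar>u0 x\<bar> \<partial>M) \<le> \<eta>"
		interpret stdom \<Omega> T by unfold_locales (rule T)
		note s0 = u0(1)[unfolded L2_iff]
		from \<eta>(2)[OF T s0 u0(2,3)] obtain B where B: "\<forall>e>0. \<exists>W GW F ub gb V GV. appr B e u0 W GW F ub gb V GV" by blast
		show "?Q T u0" using limit_solution_exists[OF s0 B] weak_form by blast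
	qed
qed

end
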